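(* Let $(A,X,\rho)$ be a C*-probability space $(A,\rho)$ endowed with a generating set $X\subseteq A$, i.e. $A=C^*(X,1)$. Suppose that there exist unitaries $a\in\mathcal{P}_{X^*}A$ and $b,c\in\mathcal{P}_XA$ in the centralizer of $\rho$ such that $\rho(a)=\rho(b)=\rho(c)=\rho(c^{-1}a)=\rho(c^{-1}b)=0$. Then the inclusion $\widetilde{A}\subset A*C(\mathbb{T})$ is selfless. In particular, the free complexification $\widetilde{A}$ is selfless.
   Context: **C*-probability spaces.** A C*-probability space $(A,\rho)$ is a unital C*-algebra $A$ with a state $\rho$ whose GNS representation is faithful (standing assumption on all states, except ultrapower states). Morphisms are unital state-preserving *-homomorphisms. An inclusion $B\subset(A,\rho)$ consists of a C*-probability space $(A,\rho)$ and a unital C*-subalgebra $B$ of $A$ with the restricted state $\rho|_B$. For an ultrafilter $\omega$ on a set $I$, $A^\omega=\ell^\infty(I,A)/\{(a_i):\lim_{i\to\omega}\|a_i\|=0\}$, with state $\rho^\omega((a_i)_i)=\lim_{i\to\omega}\rho(a_i)$; $B^\omega\subseteq A^\omega$ naturally. The symbol $*$ denotes the reduced free product of C*-probability spaces, with the free product state. The centralizer of a state $\rho$ on $A$ is $\{x\in A:\rho(xy)=\rho(yx)\ \forall y\in A\}$. **Selfless inclusions.** $B\subset(A,\rho)$ is selfless if there exist a free ultrafilter $\omega$, a C*-probability space $(C,\kappa)$ with $C\ne\mathbb{C}$, and a state-preserving unital embedding of C*-algebras $\sigma\colon A*C\to A^\omega$ such that the restriction of $\sigma$ to the first factor $A$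 is the diagonal inclusion $A\to A^\omega$ and $\sigma(B*C)\subseteq B^\omega$ (equivalently $\sigma(C)\subseteq B^\omega$). A C*-probability space $(A,\rho)$ is selfless if the inclusion $A\subset(A,\rho)$ is selfless. **Free complexification and projective versions.** Form the reduced free product $(A,\rho)*(C(\mathbb{T}),\lambda)$, where $\lambda$ is the state induced by normalized Lebesgue measure on the circle $\mathbb{T}$, and let $z$ be the canonical unitary generator of $C(\mathbb{T})$. The free complexification of $(A,\rho,X)$ is $\widetilde{A}=C^*(1,Xz)\subseteq A*C(\mathbb{T})$, where $Xz=\{xz:x\in X\}$, endowed with the state $(\rho*\lambda)|_{\widetilde{A}}$. $\mathcal{P}_XA\subseteq A$ is the C*-subalgebra generated by $1$ and $XX^*=\{xy^*:x,y\in X\}$; $\mathcal{P}_{X^*}A\subseteq A$ is the C*-subalgebra generated by $1$ and $X^*X=\{x^*y:x,y\in X\}$.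
   Formalization: The final claim that the free complexification is selfless is proved under the explicit assumption that its restricted state has a faithful GNS representation; this standing assumption on states can fail for the free complexification, which is then not a C*-probability space. *)

theory Defs
  imports "HOL-Analysis.Analysis" "HOL-Algebra.Subrings"
begin

section \<open>C*-algebras and C*-probability spaces\<close>

text \<open>Structures are carrier-based, as in \<^theory>\<open>HOL-Algebra.Ring\<close>, because ultrapowers
  and generated subalgebras are not types.\<close>

record 'a cstar = "'a ring" +
  cscale :: "complex \<Rightarrow> 'a \<Rightarrow> 'a"
  adj :: "'a \<Rightarrow> 'a"
  nrm :: "'a \<Rightarrow> real"

record 'a cstar_prob = "'a cstar" +
  state :: "'a \<Rightarrow> complex"

text \<open>\<^locale>\<open>Metric_space\<close> requires its distance to be nonnegative and symmetric everywhere,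
  hence the dummy value \<open>0\<close> outside the carrier.\<close>

definition cdist :: "('a, 'm) cstar_scheme \<Rightarrow> 'a \<Rightarrow> 'a \<Rightarrow> real" where
  "cdist A x y = (if x \<in> carrier A \<and> y \<in> carrier A then nrm A (x \<ominus>\<^bsub>A\<^esub> y) else 0)"

locale cstar_algebra = ring A for A :: "('a, 'm) cstar_scheme" (structure) +
  assumes cscale_closed: "x \<in> carrier A \<Longrightarrow> cscale A c x \<in> carrier A"
    and cscale_one: "x \<in> carrier A \<Longrightarrow> cscale A 1 x = x"
    and cscale_cscale: "x \<in> carrier A \<Longrightarrow> cscale A c (cscale A d x) = cscale A (c * d) x"
    and cscale_add_left: "x \<in> carrier A \<Longrightarrow> cscale A (c + d) x = cscale A c x \<oplus> cscale A d x"
    and cscale_add_right: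
      "\<lbrakk>x \<in> carrier A; y \<in> carrier A\<rbrakk> \<Longrightarrow> cscale A c (x \<oplus> y) = cscale A c x \<oplus> cscale A c y"
    and cscale_mult_left:
      "\<lbrakk>x \<in> carrier A; y \<in> carrier A\<rbrakk> \<Longrightarrow> cscale A c x \<otimes> y = cscale A c (x \<otimes> y)"
    and cscale_mult_right:
      "\<lbrakk>x \<in> carrier A; y \<in> carrier A\<rbrakk> \<Longrightarrow> x \<otimes> cscale A c y = cscale A c (x \<otimes> y)"
    and adj_closed: "x \<in> carrier A \<Longrightarrow> adj A x \<in> carrier A"
    and adj_adj: "x \<in> carrier A \<Longrightarrow> adj A (adj A x) = x"
    and adj_add: "\<lbrakk>x \<in> carrier A; y \<in> carrier A\<rbrakk> \<Longrightarrow> adj A (x \<oplus> y) = adj A x \<oplus> adj A y"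
    and adj_cscale: "x \<in> carrier A \<Longrightarrow> adj A (cscale A c x) = cscale A (cnj c) (adj A x)"
    and adj_mult: "\<lbrakk>x \<in> carrier A; y \<in> carrier A\<rbrakk> \<Longrightarrow> adj A (x \<otimes> y) = adj A y \<otimes> adj A x"
    and nrm_nonneg: "x \<in> carrier A \<Longrightarrow> 0 \<le> nrm A x"
    and nrm_eq_0_iff: "x \<in> carrier A \<Longrightarrow> nrm A x = 0 \<longleftrightarrow> x = \<zero>"
    and nrm_triangle:
      "\<lbrakk>x \<in> carrier A; y \<in> carrier A\<rbrakk> \<Longrightarrow> nrm A (x \<oplus> y) \<le> nrm A x + nrm A y"
    and nrm_cscale: "x \<in> carrier A \<Longrightarrow> nrm A (cscale A c x) = cmod c * nrm A x"
    and nrm_mult: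
      "\<lbrakk>x \<in> carrier A; y \<in> carrier A\<rbrakk> \<Longrightarrow> nrm A (x \<otimes> y) \<le> nrm A x * nrm A y"
    and nrm_adj_mult: "x \<in> carrier A \<Longrightarrow> nrm A (adj A x \<otimes> x) = (nrm A x)\<^sup>2"
    and complete: "Metric_space.mcomplete (carrier A) (cdist A)"

definition cstar_subalgebra :: "('a, 'm) cstar_scheme \<Rightarrow> 'a set \<Rightarrow> bool" where
  "cstar_subalgebra A B \<longleftrightarrow>
     subring B A \<and>
     (\<forall>c. \<forall>x\<in>B. cscale A c x \<in> B) \<and>
     (\<forall>x\<in>B. adj A x \<in> B) \<and>
     closedin (Metric_space.mtopology (carrier A) (cdist A)) B"

text \<open>The unital C*-subalgebra \<open>C*(1, S)\<close>.\<close>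

definition cstar_generated :: "('a, 'm) cstar_scheme \<Rightarrow> 'a set \<Rightarrow> 'a set" where
  "cstar_generated A S = cstar_subalgebra A hull S"

definition is_state :: "'a cstar_prob \<Rightarrow> bool" where
  "is_state A \<longleftrightarrow>
     (\<forall>x\<in>carrier A. \<forall>y\<in>carrier A. state A (x \<oplus>\<^bsub>A\<^esub> y) = state A x + state A y) \<and>
     (\<forall>c. \<forall>x\<in>carrier A. state A (cscale A c x) = c * state A x) \<and>
     (\<forall>x\<in>carrier A. state A (adj A x \<otimes>\<^bsub>A\<^esub> x) \<in> \<real>\<^sub>\<ge>\<^sub>0) \<and>
     state A \<one>\<^bsub>A\<^esub> = 1"

text \<open>The GNS representation of \<open>A\<close> acts on the completion of \<open>A / N\<close>, where
  \<open>N = {x. \<rho>(x* x) = 0}\<close>, by extending \<open>x \<cdot> (y + N) = x y + N\<close>.  Since \<open>A / N\<close> is dense in the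
  completion, a bounded operator on it is determined by its restriction to \<open>A / N\<close>, and
  faithfulness can be tested on that restriction; the completion is therefore not formed.\<close>

definition gns_null :: "'a cstar_prob \<Rightarrow> 'a set" where
  "gns_null A = {x \<in> carrier A. state A (adj A x \<otimes>\<^bsub>A\<^esub> x) = 0}"

definition gns_rep :: "'a cstar_prob \<Rightarrow> 'a \<Rightarrow> 'a set \<Rightarrow> 'a set" where
  "gns_rep A x = (\<lambda>V \<in> a_rcosets\<^bsub>A\<^esub> (gns_null A). \<Union>y\<in>V. gns_null A +>\<^bsub>A\<^esub> (x \<otimes>\<^bsub>A\<^esub> y))"

definition gns_faithful :: "'a cstar_prob \<Rightarrow> bool" where
  "gns_faithful A \<longleftrightarrow> inj_on (gns_rep A) (carrier A)"

definition cstar_prob_space :: "'a cstar_prob \<Rightarrow> bool" where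
  "cstar_prob_space A \<longleftrightarrow> cstar_algebra A \<and> is_state A \<and> gns_faithful A"

definition cps_hom :: "'a cstar_prob \<Rightarrow> 'b cstar_prob \<Rightarrow> ('a \<Rightarrow> 'b) set" where
  "cps_hom A B = {f \<in> ring_hom A B.
     (\<forall>c. \<forall>x\<in>carrier A. f (cscale A c x) = cscale B c (f x)) \<and>
     (\<forall>x\<in>carrier A. f (adj A x) = adj B (f x)) \<and>
     (\<forall>x\<in>carrier A. state B (f x) = state A x)}"

definition cps_embedding :: "'a cstar_prob \<Rightarrow> 'b cstar_prob \<Rightarrow> ('a \<Rightarrow> 'b) set" where
  "cps_embedding A B = {f \<in> cps_hom A B. inj_on f (carrier A)}"

definition centralizer :: "'a cstar_prob \<Rightarrow> 'a set" where
  "centralizer A =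
     {x \<in> carrier A. \<forall>y\<in>carrier A. state A (x \<otimes>\<^bsub>A\<^esub> y) = state A (y \<otimes>\<^bsub>A\<^esub> x)}"

definition unitaries :: "('a, 'm) cstar_scheme \<Rightarrow> 'a set" where
  "unitaries A =
     {u \<in> carrier A. adj A u \<otimes>\<^bsub>A\<^esub> u = \<one>\<^bsub>A\<^esub> \<and> u \<otimes>\<^bsub>A\<^esub> adj A u = \<one>\<^bsub>A\<^esub>}"


section \<open>Reduced free products\<close>

text \<open>Freeness of a family \<open>B\<close> of subalgebras: products of centered elements whose indices are
  alternating (neighbours distinct) are centered.  A word is a list of index-element pairs.\<close>

definition free_family :: "'a cstar_prob \<Rightarrow> ('i \<Rightarrow> 'a set) \<Rightarrow> bool" where
  "free_family D B \<longleftrightarrow>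
     (\<forall>w. w \<noteq> [] \<and> distinct_adj (map fst w) \<and> (\<forall>(i, x)\<in>set w. x \<in> B i \<and> state D x = 0)
        \<longrightarrow> state D (foldr (\<otimes>\<^bsub>D\<^esub>) (map snd w) \<one>\<^bsub>D\<^esub>) = 0)"

text \<open>Voiculescu's definition: \<open>D\<close> with \<open>\<iota>\<close> and \<open>\<kappa>\<close> is the reduced free product of \<open>A\<close> and
  \<open>C\<close>.  These data exist for all C*-probability spaces \<open>A\<close>, \<open>C\<close> and are unique up to a
  state-preserving isomorphism compatible with \<open>\<iota>\<close> and \<open>\<kappa>\<close>.\<close>

definition reduced_free_product ::
    "'d cstar_prob \<Rightarrow> 'a cstar_prob \<Rightarrow> 'c cstar_prob \<Rightarrow> ('a \<Rightarrow> 'd) \<Rightarrow> ('c \<Rightarrow> 'd) \<Rightarrow> bool" where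
  "reduced_free_product D A C \<iota> \<kappa> \<longleftrightarrow>
     cstar_prob_space A \<and> cstar_prob_space C \<and> cstar_prob_space D \<and>
     \<iota> \<in> cps_hom A D \<and> \<kappa> \<in> cps_hom C D \<and>
     free_family D (\<lambda>second. if second then \<kappa> ` carrier C else \<iota> ` carrier A) \<and>
     cstar_generated D (\<iota> ` carrier A \<union> \<kappa> ` carrier C) = carrier D"


section \<open>Ultrapowers\<close>

text \<open>An ultrafilter on an index set is represented as a filter on an index type.\<close>

definition free_ultrafilter :: "'i filter \<Rightarrow> bool" where
  "free_ultrafilter \<omega> \<longleftrightarrow>
     \<omega> \<noteq> bot \<and>
     (\<forall>P. eventually P \<omega> \<or> eventually (\<lambda>i. \<not> P i) \<omega>) \<and>
     (\<forall>j. eventually (\<lambda>i. i \<noteq> j) \<omega>)"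

definition linf :: "('a, 'm) cstar_scheme \<Rightarrow> ('i \<Rightarrow> 'a) ring" where
  "linf A = \<lparr>
     carrier = {a. (\<forall>i. a i \<in> carrier A) \<and> bdd_above (range (\<lambda>i. nrm A (a i)))},
     mult = (\<lambda>a b i. a i \<otimes>\<^bsub>A\<^esub> b i),
     one = (\<lambda>i. \<one>\<^bsub>A\<^esub>),
     ring.zero = (\<lambda>i. \<zero>\<^bsub>A\<^esub>),
     add = (\<lambda>a b i. a i \<oplus>\<^bsub>A\<^esub> b i)\<rparr>"

definition ultra_null :: "('a, 'm) cstar_scheme \<Rightarrow> 'i filter \<Rightarrow> ('i \<Rightarrow> 'a) set" where
  "ultra_null A \<omega> = {a \<in> carrier (linf A). ((\<lambda>i. nrm A (a i)) \<longlongrightarrow> 0) \<omega>}"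

definition ultra_class :: "('a, 'm) cstar_scheme \<Rightarrow> 'i filter \<Rightarrow> ('i \<Rightarrow> 'a) \<Rightarrow> ('i \<Rightarrow> 'a) set" where
  "ultra_class A \<omega> a = ultra_null A \<omega> +>\<^bsub>linf A\<^esub> a"

text \<open>\<open>FactRing\<close> supplies the ring structure of the quotient; scalar multiplication,
  adjoint, quotient norm and limit state are induced from representing families.\<close>

definition ultrapower :: "'a cstar_prob \<Rightarrow> 'i filter \<Rightarrow> ('i \<Rightarrow> 'a) set cstar_prob" where
  "ultrapower A \<omega> = (let Q = linf A Quot ultra_null A \<omega> in \<lparr>
     carrier = carrier Q,
     mult = mult Q,
     one = one Q,
     ring.zero = ring.zero Q,
     add = add Q,
     cscale = (\<lambda>c U. \<Union>a\<in>U. ultra_class A \<omega> (\<lambda>i. cscale A c (a i))),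
     adj = (\<lambda>U. \<Union>a\<in>U. ultra_class A \<omega> (\<lambda>i. adj A (a i))),
     nrm = (\<lambda>U. THE r. \<forall>a\<in>U. ((\<lambda>i. nrm A (a i)) \<longlongrightarrow> r) \<omega>),
     state = (\<lambda>U. THE s. \<forall>a\<in>U. ((\<lambda>i. state A (a i)) \<longlongrightarrow> s) \<omega>)\<rparr>)"

definition ultra_diag :: "'a cstar_prob \<Rightarrow> 'i filter \<Rightarrow> 'a \<Rightarrow> ('i \<Rightarrow> 'a) set" where
  "ultra_diag A \<omega> x = ultra_class A \<omega> (\<lambda>i. x)"

text \<open>The image of \<open>B\<^sup>\<omega>\<close> in \<open>A\<^sup>\<omega>\<close>.\<close>

definition ultra_sub :: "'a cstar_prob \<Rightarrow> 'i filter \<Rightarrow> 'a set \<Rightarrow> ('i \<Rightarrow> 'a) set set" where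
  "ultra_sub A \<omega> B = ultra_class A \<omega> ` {b \<in> carrier (linf A). \<forall>i. b i \<in> B}"


section \<open>Selfless inclusions\<close>

text \<open>The definition quantifies existentially over the index set of the ultrafilter and over
  \<open>C\<close>.  HOL cannot quantify over types, so these range over fixed types, chosen large enough
  to lose nothing.  The index type \<open>'a set \<times> nat\<close> contains a copy of every set of cardinality at
  most that of \<open>'a\<close>.  Given a witness over any index set, \<open>C\<close> can be cut down to a separable
  nontrivial C*-subalgebra with GNS-faithful restricted state, and existence of \<open>\<sigma>\<close> then amounts to
  finitely satisfiable approximate conditions indexed by finite subsets of a set of cardinality
  at most that of \<open>'a\<close>.  Finally \<open>C\<close> and \<open>A * C\<close> can be replaced by their images
  under \<open>\<sigma>\<close>, which are C*-subalgebras of the ultrapower.\<close>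

type_synonym 'a ultra_index = "'a set \<times> nat"
type_synonym 'a ultra_elem = "('a ultra_index \<Rightarrow> 'a) set"

text \<open>\<open>P = A * C\<close> with canonical embeddings \<open>\<iota>\<close>, \<open>\<kappa>\<close>, and \<open>B * C\<close> is the
  C*-subalgebra of \<open>A * C\<close> generated by \<open>B\<close> and \<open>C\<close>.\<close>

definition selfless_inclusion :: "'a cstar_prob \<Rightarrow> 'a set \<Rightarrow> bool" where
  "selfless_inclusion A B \<longleftrightarrow>
     cstar_prob_space A \<and> cstar_subalgebra A B \<and>
     (\<exists>(\<omega> :: 'a ultra_index filter) (C :: 'a ultra_elem cstar_prob)
        (P :: 'a ultra_elem cstar_prob) \<iota> \<kappa> \<sigma>.
        free_ultrafilter \<omega> \<and>
        cstar_prob_space C \<and>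
        carrier C \<noteq> range (\<lambda>c. cscale C c \<one>\<^bsub>C\<^esub>) \<and>
        reduced_free_product P A C \<iota> \<kappa> \<and>
        \<sigma> \<in> cps_embedding P (ultrapower A \<omega>) \<and>
        (\<forall>x\<in>carrier A. \<sigma> (\<iota> x) = ultra_diag A \<omega> x) \<and>
        \<sigma> ` cstar_generated P (\<iota> ` B \<union> \<kappa> ` carrier C) \<subseteq> ultra_sub A \<omega> B)"

text \<open>\<^const>\<open>selfless_inclusion\<close> asks for GNS-faithfulness of the state on the large algebra only;
  for \<open>selfless\<close> this is the algebra itself.\<close>

definition selfless :: "'a cstar_prob \<Rightarrow> bool" where
  "selfless A \<longleftrightarrow> selfless_inclusion A (carrier A)"


section \<open>Free complexification\<close>

text \<open>\<open>C(\<T>)\<close> with normalized Lebesgue measure.  Functions are restricted to the circle, so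
  that equality is pointwise equality on the circle.\<close>

abbreviation circle :: "complex set" where
  "circle \<equiv> sphere 0 1"

definition circle_space :: "(complex \<Rightarrow> complex) cstar_prob" where
  "circle_space = \<lparr>
     carrier = {f. continuous_on circle f \<and> f \<in> extensional circle},
     mult = (\<lambda>f g. \<lambda>x\<in>circle. f x * g x),
     one = (\<lambda>x\<in>circle. 1),
     ring.zero = (\<lambda>x\<in>circle. 0),
     add = (\<lambda>f g. \<lambda>x\<in>circle. f x + g x),
     cscale = (\<lambda>c f. \<lambda>x\<in>circle. c * f x),
     adj = (\<lambda>f. \<lambda>x\<in>circle. cnj (f x)),
     nrm = (\<lambda>f. SUP x\<in>circle. cmod (f x)),
     state = (\<lambda>f. integral {0..2 * pi} (\<lambda>t. f (cis t)) / (2 * pi))\<rparr>"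

definition circle_gen :: "complex \<Rightarrow> complex" where
  "circle_gen = (\<lambda>x\<in>circle. x)"

text \<open>\<open>D = A * C(\<T>)\<close> with canonical embeddings \<open>\<iota>\<close>, \<open>\<kappa>\<close>.\<close>

definition free_complexification ::
    "'d cstar_prob \<Rightarrow> ('a \<Rightarrow> 'd) \<Rightarrow> ((complex \<Rightarrow> complex) \<Rightarrow> 'd) \<Rightarrow> 'a set \<Rightarrow> 'd set" where
  "free_complexification D \<iota> \<kappa> S = cstar_generated D {\<iota> x \<otimes>\<^bsub>D\<^esub> \<kappa> circle_gen | x. x \<in> S}"

text \<open>For a generating set \<open>S\<close>: \<open>\<P>\<^sub>S A\<close> and \<open>\<P>\<^bsub>S*\<^esub> A\<close>.\<close>

definition proj_left :: "'a cstar_prob \<Rightarrow> 'a set \<Rightarrow> 'a set" where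
  "proj_left A S = cstar_generated A {x \<otimes>\<^bsub>A\<^esub> adj A y | x y. x \<in> S \<and> y \<in> S}"

definition proj_right :: "'a cstar_prob \<Rightarrow> 'a set \<Rightarrow> 'a set" where
  "proj_right A S = cstar_generated A {adj A x \<otimes>\<^bsub>A\<^esub> y | x y. x \<in> S \<and> y \<in> S}"

end

(*
The algebra C is generated by a semicircular element of the ultrapower,
s = lim n^(-1/2) sum r_i h r_i* over i < n, where h is self-adjoint of mean zero and
variance one in the algebra generated by b, and the unitaries r_i lie in the free complexification.
They are r_i = P_m t_i with P_m an initial segment of the sequence of letters (b or c), z*, a, z, of
period four, in which c is chosen exactly at the powers of two.  This sequence is preserved by no
shift, so conjugation by P_m carries every reduced word into the scalars plus words that start and
end with a circle letter, and the t_i separate different indices.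

On L^2, let q be the projection onto the words starting with a letter from A.  Then
(1 - q) h (1 - q) = 0 and (1 - q) h^2 (1 - q) = 1 - q, so s = l + l* for the limit l of
n^(-1/2) sum r_i q h (1 - q) r_i*, with l* x l = rho(x) and l* x = 0 on the vacuum for all x in A * C(T).
These Fock relations give the vacuum moments, hence freeness.  Comparing the components of fixed
creation and annihilation degree also bounds the norm of a polynomial in s by its norm in the vacuum
representation, with a constant that powers remove; this is the faithfulness of the state on C*(A, s).
*)

theory Submission
  imports Defs "HOL-Library.Function_Algebras" "HOL-Algebra.QuotRing"
begin

section \<open>Star algebras with a norm\<close>

text \<open>The ultrapower state is not faithful, so two facts must be secured separately: freeness
  of \<open>s\<close> from the algebra, and equality of the norm of \<open>C*(A, s)\<close> with its
  GNS norm. Both become visible only once \<open>s\<close> is split into creation and annihilation.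
  The creation part need not belong to the ultrapower, so a dense algebra of reduced words is
  represented isometrically on its GNS space, and the split takes place in an ultrapower of
  operators. That space is never completed, which is why the norm axioms are separated here from
  completeness.

  The hypotheses on the letters act at distinct places. The centralizer lets conjugation by
  \<open>P_m\<close> keep the state, so the scalar left by the conjugation of \<open>x\<close> is
  exactly \<open>rho(x)\<close>. The condition \<open>rho(c^-1 b) = 0\<close> stops cancellation
  wherever a \<open>c\<close> faces a \<open>b\<close>, both between different \<open>t_i\<close>
  and between \<open>P_m\<close> and a shift of itself. Only products \<open>x y*\<close> and
  \<open>z* x* y z\<close> of elements \<open>x\<close>, \<open>y\<close> of \<open>X\<close> are
  available in the complexification; hence \<open>b\<close> and \<open>c\<close> enter as they are,
  \<open>a\<close> only as \<open>z* a z\<close>, and the words are built from blocks of four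
  letters.\<close>

locale pre_cstar = ring A for A :: "('a, 'm) cstar_scheme" (structure) +
  assumes cscale_closed [simp]: "x \<in> carrier A \<Longrightarrow> cscale A c x \<in> carrier A"
    and cscale_one [simp]: "x \<in> carrier A \<Longrightarrow> cscale A 1 x = x"
    and cscale_cscale [simp]: "x \<in> carrier A \<Longrightarrow> cscale A c (cscale A d x) = cscale A (c * d) x"
    and cscale_add_left: "x \<in> carrier A \<Longrightarrow> cscale A (c + d) x = cscale A c x \<oplus> cscale A d x"
    and cscale_add_right:
      "\<lbrakk>x \<in> carrier A; y \<in> carrier A\<rbrakk> \<Longrightarrow> cscale A c (x \<oplus> y) = cscale A c x \<oplus> cscale A c y"
    and cscale_mult_left:
      "\<lbrakk>x \<in> carrier A; y \<in> carrier A\<rbrakk> \<Longrightarrow> cscale A c x \<otimes> y = cscale A c (x \<otimes> y)"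
    and cscale_mult_right:
      "\<lbrakk>x \<in> carrier A; y \<in> carrier A\<rbrakk> \<Longrightarrow> x \<otimes> cscale A c y = cscale A c (x \<otimes> y)"
    and adj_closed [simp]: "x \<in> carrier A \<Longrightarrow> adj A x \<in> carrier A"
    and adj_adj [simp]: "x \<in> carrier A \<Longrightarrow> adj A (adj A x) = x"
    and adj_add: "\<lbrakk>x \<in> carrier A; y \<in> carrier A\<rbrakk> \<Longrightarrow> adj A (x \<oplus> y) = adj A x \<oplus> adj A y"
    and adj_cscale: "x \<in> carrier A \<Longrightarrow> adj A (cscale A c x) = cscale A (cnj c) (adj A x)"
    and adj_mult: "\<lbrakk>x \<in> carrier A; y \<in> carrier A\<rbrakk> \<Longrightarrow> adj A (x \<otimes> y) = adj A y \<otimes> adj A x"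
    and nrm_nonneg [simp]: "x \<in> carrier A \<Longrightarrow> 0 \<le> nrm A x"
    and nrm_eq_0_iff: "x \<in> carrier A \<Longrightarrow> nrm A x = 0 \<longleftrightarrow> x = \<zero>"
    and nrm_triangle:
      "\<lbrakk>x \<in> carrier A; y \<in> carrier A\<rbrakk> \<Longrightarrow> nrm A (x \<oplus> y) \<le> nrm A x + nrm A y"
    and nrm_cscale: "x \<in> carrier A \<Longrightarrow> nrm A (cscale A c x) = cmod c * nrm A x"
    and nrm_mult:
      "\<lbrakk>x \<in> carrier A; y \<in> carrier A\<rbrakk> \<Longrightarrow> nrm A (x \<otimes> y) \<le> nrm A x * nrm A y"
    and nrm_adj_mult: "x \<in> carrier A \<Longrightarrow> nrm A (adj A x \<otimes> x) = (nrm A x)\<^sup>2"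

sublocale cstar_algebra \<subseteq> pre_cstar
  by unfold_locales
    (simp_all add: cscale_closed cscale_one cscale_cscale cscale_add_left cscale_add_right
      cscale_mult_left cscale_mult_right adj_closed adj_adj adj_add adj_cscale adj_mult
      nrm_nonneg nrm_eq_0_iff nrm_triangle nrm_cscale nrm_mult nrm_adj_mult)

context pre_cstar
begin

abbreviation sc where "sc \<equiv> cscale A"
abbreviation star where "star \<equiv> adj A"
abbreviation nn where "nn \<equiv> nrm A"
abbreviation alg where "alg \<equiv> carrier A"

lemma nrm_zero [simp]: "nn \<zero> = 0"
  by (simp add: nrm_eq_0_iff)

lemma cscale_0 [simp]: "x \<in> alg \<Longrightarrow> sc 0 x = \<zero>"
  using nrm_cscale[of x 0] nrm_eq_0_iff[of "sc 0 x"] by simp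

lemma cscale_zero [simp]: "sc c \<zero> = \<zero>"
  using nrm_cscale[of \<zero> c] nrm_eq_0_iff[of "sc c \<zero>"] by simp

lemma cscale_m1: "x \<in> alg \<Longrightarrow> sc (-1) x = \<ominus> x"
proof -
  assume x: "x \<in> alg"
  have "sc (-1) x \<oplus> x = sc (-1 + 1) x" using x by (simp only: cscale_add_left cscale_one)
  hence "sc (-1) x \<oplus> x = \<zero>" using x by simp
  thus ?thesis using x by (metis cscale_closed minus_equality)
qed

lemma cscale_minus_left: "x \<in> alg \<Longrightarrow> sc (- c) x = \<ominus> sc c x"
  using cscale_m1[of "sc c x"] by simp

lemma cscale_minus_right: "x \<in> alg \<Longrightarrow> sc c (\<ominus> x) = \<ominus> sc c x"
  using cscale_m1[of x] cscale_m1[of "sc c x"] by (metis cscale_cscale cscale_closed mult.commute)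

lemma cscale_diff_right:
  "\<lbrakk>x \<in> alg; y \<in> carrier A\<rbrakk> \<Longrightarrow> sc c (x \<ominus> y) = sc c x \<ominus> sc c y"
  by (simp add: minus_eq cscale_add_right cscale_minus_right)

lemma cscale_diff_left:
  "x \<in> alg \<Longrightarrow> sc (c - d) x = sc c x \<ominus> sc d x"
  using cscale_add_left[of x c "-d"] by (simp add: minus_eq cscale_minus_left)

lemma adj_zero [simp]: "star \<zero> = \<zero>"
  using adj_cscale[of \<zero> 0] by simp

lemma adj_uminus: "x \<in> alg \<Longrightarrow> star (\<ominus> x) = \<ominus> star x"
  using adj_cscale[of x "-1"] by (simp add: cscale_m1)

lemma adj_diff: "\<lbrakk>x \<in> alg; y \<in> carrier A\<rbrakk> \<Longrightarrow> star (x \<ominus> y) = star x \<ominus> star y"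
  by (simp add: minus_eq adj_add adj_uminus)

lemma adj_one [simp]: "star \<one> = \<one>"
  by (metis adj_adj adj_closed adj_mult l_one one_closed r_one)

lemma nrm_uminus [simp]: "x \<in> alg \<Longrightarrow> nn (\<ominus> x) = nn x"
  using nrm_cscale[of x "-1"] by (simp add: cscale_m1)

lemma nrm_adj [simp]: assumes "x \<in> alg" shows "nn (star x) = nn x"
proof -
  have *: "nn y \<le> nn (star y)" if y: "y \<in> alg" for y
  proof (cases "nn y = 0")
    case False
    have "(nn y)\<^sup>2 \<le> nn (star y) * nn y"
      using nrm_adj_mult[OF y] nrm_mult[of "star y" y] y by simp
    thus ?thesis using False nrm_nonneg[OF y] by (simp add: power2_eq_square)
  qed (use y in simp)
  show ?thesis using *[OF assms] *[of "star x"] assms by simp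
qed

lemma nrm_minus_triangle: "\<lbrakk>x \<in> alg; y \<in> carrier A\<rbrakk> \<Longrightarrow> nn (x \<ominus> y) \<le> nn x + nn y"
  using nrm_triangle[of x "\<ominus> y"] by (simp add: minus_eq)

lemma nrm_minus_commute: "\<lbrakk>x \<in> alg; y \<in> carrier A\<rbrakk> \<Longrightarrow> nn (x \<ominus> y) = nn (y \<ominus> x)"
proof -
  assume "x \<in> alg" "y \<in> alg"
  hence "x \<ominus> y = \<ominus> (y \<ominus> x)" by algebra
  thus ?thesis using \<open>x \<in> carrier A\<close> \<open>y \<in> carrier A\<close> by simp
qed

lemma nrm_diff_triangle:
  assumes "x \<in> alg" "y \<in> alg" "z \<in> alg"
  shows "nn (x \<ominus> z) \<le> nn (x \<ominus> y) + nn (y \<ominus> z)"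
proof -
  have "x \<ominus> z = (x \<ominus> y) \<oplus> (y \<ominus> z)" using assms by algebra
  thus ?thesis using assms nrm_triangle[of "x \<ominus> y" "y \<ominus> z"] by simp
qed

lemma nrm_diff_ge:
  assumes "x \<in> alg" "y \<in> alg" shows "\<bar>nn x - nn y\<bar> \<le> nn (x \<ominus> y)"
proof -
  have "(x \<ominus> y) \<oplus> y = x" "(y \<ominus> x) \<oplus> x = y" using assms by algebra+
  thus ?thesis
    using nrm_triangle[of "x \<ominus> y" y] nrm_triangle[of "y \<ominus> x" x] assms nrm_minus_commute[of x y]
    by simp
qed

lemma nrm_diff_eq_0: "\<lbrakk>x \<in> alg; y \<in> carrier A\<rbrakk> \<Longrightarrow> nn (x \<ominus> y) = 0 \<longleftrightarrow> x = y"
  by (simp add: nrm_eq_0_iff r_right_minus_eq)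

lemma nrm_one_le: "nn \<one> \<le> 1"
  using nrm_adj_mult[of \<one>] nrm_nonneg[of \<one>] by (auto simp: power2_eq_square)

lemma nrm_self_adj_sq:
  assumes "h \<in> alg" "star h = h" shows "nn (h \<otimes> h) = (nn h)\<^sup>2"
  using nrm_adj_mult[of h] assms by simp

lemma star_pow: "x \<in> alg \<Longrightarrow> star (x [^] (n::nat)) = star x [^] n"
proof (induction n)
  case (Suc n)
  have "star (x [^] Suc n) = star x \<otimes> star x [^] n" using Suc by (simp add: adj_mult)
  also have "\<dots> = star x [^] Suc n" using Suc.prems by (subst nat_pow_Suc2) auto
  finally show ?case .
qed simp

text \<open>Iterating the C*-identity gives exact norms along powers of two. Estimates known only up
  to a constant are later sharpened by applying them to such powers and taking roots.\<close>

lemma nrm_pow_self_adj: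
  assumes "h \<in> alg" "star h = h" shows "nn (h [^] (2 ^ k :: nat)) = nn h ^ (2 ^ k)"
proof (induction k)
  case (Suc k)
  have "h [^] (2 ^ Suc k :: nat) = h [^] (2 ^ k :: nat) \<otimes> h [^] (2 ^ k :: nat)"
    using assms by (simp add: nat_pow_mult mult_2)
  also have "nn \<dots> = (nn (h [^] (2 ^ k :: nat)))\<^sup>2"
    using assms by (intro nrm_self_adj_sq) (auto simp: star_pow)
  finally show ?case using Suc by (simp add: power_mult [symmetric] mult.commute)
qed (use assms in simp)

lemma Metric_cdist: "Metric_space (alg) (cdist A)"
proof
  show "0 \<le> cdist A x y" for x y by (simp add: cdist_def)
  show "cdist A x y = cdist A y x" for x y by (simp add: cdist_def nrm_minus_commute)
  show "cdist A x y = 0 \<longleftrightarrow> x = y" if "x \<in> alg" "y \<in> alg" for x y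
    using that by (simp add: cdist_def nrm_diff_eq_0)
  show "cdist A x z \<le> cdist A x y + cdist A y z"
    if "x \<in> alg" "y \<in> alg" "z \<in> alg" for x y z
    using that nrm_diff_triangle by (simp add: cdist_def)
qed

lemma limitin_cdist:
  assumes "\<And>n. x n \<in> alg"
  shows "limitin (Metric_space.mtopology (alg) (cdist A)) x l F \<longleftrightarrow>
    l \<in> alg \<and> ((\<lambda>n. nn (x n \<ominus> l)) \<longlongrightarrow> 0) F"
  using assms by (auto simp: Metric_space.limitin_metric_dist_null[OF Metric_cdist] cdist_def)

text \<open>Closedness as approximability in norm; the metric topology occurring in
  \<open>cstar_subalgebra\<close> is then handled once, in \<open>closedin_cdist\<close>.\<close>

definition nclosed :: "'a set \<Rightarrow> bool" where
  "nclosed B \<longleftrightarrow> (\<forall>x\<in>alg. (\<forall>e>0. \<exists>y\<in>B. nn (x \<ominus> y) < e) \<longrightarrow> x \<in> B)"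

lemma closedin_cdist:
  assumes "B \<subseteq> alg"
  shows "closedin (Metric_space.mtopology (alg) (cdist A)) B \<longleftrightarrow> nclosed B"
proof
  assume cl: "closedin (Metric_space.mtopology (alg) (cdist A)) B"
  show "nclosed B" unfolding nclosed_def
  proof (intro ballI impI)
    fix x assume x: "x \<in> alg" and ap: "\<forall>e>0. \<exists>y\<in>B. nn (x \<ominus> y) < e"
    have "\<forall>n. \<exists>y\<in>B. nn (x \<ominus> y) < 1 / real (Suc n)" using ap by simp
    then obtain y where y: "\<And>n. y n \<in> B" "\<And>n. nn (x \<ominus> y n) < 1 / real (Suc n)" by metis
    have "(\<lambda>n. nn (y n \<ominus> x)) \<longlonglongrightarrow> 0"
    proof (rule real_tendsto_sandwich[OF _ _ tendsto_const LIMSEQ_inverse_real_of_nat])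
      show "\<forall>\<^sub>F n in sequentially. 0 \<le> nn (y n \<ominus> x)" using assms y x by (intro always_eventually allI nrm_nonneg minus_closed) auto
      have "nn (y n \<ominus> x) \<le> inverse (real (Suc n))" for n
        using y[of n] nrm_minus_commute[of x "y n"] x assms by (simp add: inverse_eq_divide subset_iff)
      thus "\<forall>\<^sub>F n in sequentially. nn (y n \<ominus> x) \<le> inverse (real (Suc n))" by simp
    qed
    hence "limitin (Metric_space.mtopology (alg) (cdist A)) y x sequentially"
      using y assms x by (subst limitin_cdist) auto
    thus "x \<in> B"
      using cl y(1) unfolding Metric_space.metric_closedin_iff_sequentially_closed[OF Metric_cdist]
      by (metis image_subsetI)
  qed
next
  assume cl: "nclosed B"
  show "closedin (Metric_space.mtopology (alg) (cdist A)) B"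
    unfolding Metric_space.metric_closedin_iff_sequentially_closed[OF Metric_cdist]
  proof (intro conjI allI impI)
    fix \<sigma> l assume *: "range \<sigma> \<subseteq> B \<and> limitin (Metric_space.mtopology (alg) (cdist A)) \<sigma> l sequentially"
    hence l: "l \<in> alg" and lim: "(\<lambda>n. nn (\<sigma> n \<ominus> l)) \<longlonglongrightarrow> 0"
      using limitin_cdist[of \<sigma> l sequentially] assms by auto
    have "\<exists>y\<in>B. nn (l \<ominus> y) < e" if "e > 0" for e
    proof -
      from lim that have "\<forall>\<^sub>F n in sequentially. nn (\<sigma> n \<ominus> l) < e" by (rule order_tendstoD)
      then obtain n where "nn (\<sigma> n \<ominus> l) < e" by (auto simp: eventually_sequentially)
      moreover have "\<sigma> n \<in> B" using * by auto
      moreover have "\<sigma> n \<in> alg" using * assms by auto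
      ultimately show ?thesis using nrm_minus_commute[of "\<sigma> n" l] l by auto
    qed
    with cl l show "l \<in> B" unfolding nclosed_def by blast
  qed (rule assms)
qed

lemma mcomplete_iff:
  "Metric_space.mcomplete (alg) (cdist A) \<longleftrightarrow>
    (\<forall>x::nat \<Rightarrow> 'a. (\<forall>n. x n \<in> alg) \<longrightarrow> (\<forall>e>0. \<exists>N. \<forall>m\<ge>N. \<forall>n\<ge>N. nn (x m \<ominus> x n) < e) \<longrightarrow>
      (\<exists>l\<in>alg. (\<lambda>n. nn (x n \<ominus> l)) \<longlonglongrightarrow> 0))"
proof -
  have 1: "Metric_space.MCauchy (alg) (cdist A) x \<longleftrightarrow> (\<forall>n. x n \<in> alg) \<and>
     (\<forall>e>0. \<exists>N. \<forall>m\<ge>N. \<forall>n\<ge>N. nn (x m \<ominus> x n) < e)" for x :: "nat \<Rightarrow> 'a"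
  proof (cases "\<forall>n. x n \<in> alg")
    case True
    hence "cdist A (x m) (x n) = nn (x m \<ominus> x n)" for m n by (simp add: cdist_def)
    with True show ?thesis
      unfolding Metric_space.MCauchy_def[OF Metric_cdist] image_subset_iff by auto
  qed (auto simp: Metric_space.MCauchy_def[OF Metric_cdist])
  have 2: "(\<exists>l. limitin (Metric_space.mtopology (alg) (cdist A)) x l sequentially) \<longleftrightarrow>
      (\<exists>l\<in>alg. (\<lambda>n. nn (x n \<ominus> l)) \<longlonglongrightarrow> 0)" if "\<forall>n. x n \<in> alg" for x
    using limitin_cdist[of x _ sequentially] that by blast
  show ?thesis
    unfolding Metric_space.mcomplete_def[OF Metric_cdist] 1
    by (intro iff_allI) (simp add: 2 imp_conjL cong: conj_cong imp_cong)
qed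

section \<open>Subalgebras, closures and generated subalgebras\<close>

definition star_subalg :: "'a set \<Rightarrow> bool" where
  "star_subalg B \<longleftrightarrow> B \<subseteq> alg \<and> \<one> \<in> B \<and> (\<forall>x\<in>B. \<forall>y\<in>B. x \<oplus> y \<in> B \<and> x \<otimes> y \<in> B) \<and>
     (\<forall>c. \<forall>x\<in>B. sc c x \<in> B) \<and> (\<forall>x\<in>B. star x \<in> B)"

lemma star_subalgD:
  assumes "star_subalg B"
  shows "x \<in> B \<Longrightarrow> x \<in> alg" "\<one> \<in> B" "x \<in> B \<Longrightarrow> y \<in> B \<Longrightarrow> x \<oplus> y \<in> B"
    "x \<in> B \<Longrightarrow> y \<in> B \<Longrightarrow> x \<otimes> y \<in> B" "x \<in> B \<Longrightarrow> sc c x \<in> B" "x \<in> B \<Longrightarrow> star x \<in> B"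
    "\<zero> \<in> B" "x \<in> B \<Longrightarrow> \<ominus> x \<in> B" "x \<in> B \<Longrightarrow> y \<in> B \<Longrightarrow> x \<ominus> y \<in> B"
proof -
  note a = assms[unfolded star_subalg_def]
  show "x \<in> B \<Longrightarrow> x \<in> alg" "\<one> \<in> B" "x \<in> B \<Longrightarrow> y \<in> B \<Longrightarrow> x \<oplus> y \<in> B"
    "x \<in> B \<Longrightarrow> y \<in> B \<Longrightarrow> x \<otimes> y \<in> B" "x \<in> B \<Longrightarrow> sc c x \<in> B" "x \<in> B \<Longrightarrow> star x \<in> B"
    using a by blast+
  have "sc 0 \<one> \<in> B" using a by blast
  thus "\<zero> \<in> B" by simp
  have m: "\<ominus> x \<in> B" if "x \<in> B" for x
    using a that cscale_m1[of x] by (metis subsetD)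
  show "x \<in> B \<Longrightarrow> \<ominus> x \<in> B" by (rule m)
  show "x \<in> B \<Longrightarrow> y \<in> B \<Longrightarrow> x \<ominus> y \<in> B"
    unfolding minus_eq using a m by blast
qed

lemma star_subalg_subring: "star_subalg B \<Longrightarrow> subring B A"
  by (intro subringI subsetI) (blast dest: star_subalgD)+

lemma cstar_subalgebra_iff: "cstar_subalgebra A B \<longleftrightarrow> star_subalg B \<and> nclosed B"
proof
  assume B: "star_subalg B \<and> nclosed B"
  thus "cstar_subalgebra A B"
    unfolding cstar_subalgebra_def
    using star_subalg_subring[of B] closedin_cdist[of B] by (simp add: star_subalg_def)
next
  assume B: "cstar_subalgebra A B"
  have sr: "subring B A" using B by (simp add: cstar_subalgebra_def)
  note s = subringE[OF sr]
  show "star_subalg B \<and> nclosed B"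
    using B closedin_cdist[OF s(1)] s(1,3,6,7)
    unfolding star_subalg_def cstar_subalgebra_def by blast
qed

lemma star_subalg_carrier: "star_subalg (alg)"
  by (auto simp: star_subalg_def)

lemma cstar_subalgebra_carrier: "cstar_subalgebra A (alg)"
  by (auto simp: cstar_subalgebra_iff star_subalg_carrier nclosed_def)

lemma cstar_subalgebra_Inter:
  assumes "\<And>B. B \<in> \<B> \<Longrightarrow> cstar_subalgebra A B" "\<B> \<noteq> {}"
  shows "cstar_subalgebra A (\<Inter>\<B>)"
proof -
  have 1: "star_subalg B" "nclosed B" if "B \<in> \<B>" for B using assms(1)[OF that] by (auto simp: cstar_subalgebra_iff)
  have "star_subalg (\<Inter>\<B>)"
    using 1(1) assms(2) unfolding star_subalg_def by blast
  moreover have "nclosed (\<Inter>\<B>)" unfolding nclosed_def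
    using 1(2) unfolding nclosed_def by (metis Inter_iff)
  ultimately show ?thesis by (simp add: cstar_subalgebra_iff)
qed

lemma cstar_generated_subalgebra:
  assumes "S \<subseteq> alg" shows "cstar_subalgebra A (cstar_generated A S)"
  unfolding cstar_generated_def hull_def
  by (rule cstar_subalgebra_Inter) (use assms cstar_subalgebra_carrier in auto)

lemma cstar_generated_inc: "S \<subseteq> cstar_generated A S"
  unfolding cstar_generated_def by (rule hull_subset)

lemma cstar_generated_minimal:
  "\<lbrakk>S \<subseteq> B; cstar_subalgebra A B\<rbrakk> \<Longrightarrow> cstar_generated A S \<subseteq> B"
  unfolding cstar_generated_def by (rule hull_minimal)

definition nclosure :: "'a set \<Rightarrow> 'a set" where
  "nclosure B = {x \<in> alg. \<forall>e>0. \<exists>y\<in>B. nn (x \<ominus> y) < e}"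

lemma nclosure_inc: "B \<subseteq> alg \<Longrightarrow> B \<subseteq> nclosure B"
proof
  fix x assume "B \<subseteq> alg" "x \<in> B"
  thus "x \<in> nclosure B" unfolding nclosure_def
    by (auto intro!: bexI[of _ x] simp: nrm_diff_eq_0[THEN iffD2])
qed

lemma nclosure_closed:
  assumes "B \<subseteq> alg" shows "nclosed (nclosure B)"
  unfolding nclosed_def
proof (intro ballI impI)
  fix x assume x: "x \<in> alg" and ap: "\<forall>e>0. \<exists>y\<in>nclosure B. nn (x \<ominus> y) < e"
  have "\<exists>y\<in>B. nn (x \<ominus> y) < e" if "e > 0" for e
  proof -
    have e: "e / 2 > 0" using that by simp
    obtain y where y: "y \<in> nclosure B" "nn (x \<ominus> y) < e / 2" using ap e by blast
    then obtain z where z: "z \<in> B" "nn (y \<ominus> z) < e / 2" using e unfolding nclosure_def by blast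
    have "y \<in> alg" "z \<in> alg" using y z assms by (auto simp: nclosure_def)
    thus ?thesis using nrm_diff_triangle[of x y z] x y z by (intro bexI[of _ z]) auto
  qed
  thus "x \<in> nclosure B" using x by (simp add: nclosure_def)
qed

lemma nrm_mult_diff:
  assumes "x \<in> alg" "y \<in> alg" "x' \<in> alg" "y' \<in> alg"
  shows "nn (x \<otimes> y \<ominus> x' \<otimes> y') \<le> nn (x \<ominus> x') * nn y + nn x' * nn (y \<ominus> y')"
proof -
  have "x \<otimes> y \<ominus> x' \<otimes> y' = (x \<ominus> x') \<otimes> y \<oplus> x' \<otimes> (y \<ominus> y')" using assms by algebra
  thus ?thesis
    using nrm_triangle[of "(x \<ominus> x') \<otimes> y" "x' \<otimes> (y \<ominus> y')"] nrm_mult[of "x \<ominus> x'" y]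
      nrm_mult[of x' "y \<ominus> y'"] assms by simp
qed

lemma nclosure_star_subalg:
  assumes B: "star_subalg B" shows "star_subalg (nclosure B)"
proof -
  note s = star_subalgD[OF B]
  have c: "B \<subseteq> alg" using s by auto
  have add: "x \<oplus> y \<in> nclosure B" if xy: "x \<in> nclosure B" "y \<in> nclosure B" for x y
  proof -
    have x: "x \<in> alg" and y: "y \<in> alg" using xy by (auto simp: nclosure_def)
    { fix e :: real assume "e > 0"
      hence "e / 2 > 0" by simp
      then obtain x' y' where *: "x' \<in> B" "nn (x \<ominus> x') < e / 2" "y' \<in> B" "nn (y \<ominus> y') < e / 2"
        using xy unfolding nclosure_def by blast
      have c': "x' \<in> alg" "y' \<in> alg" using s(1) *(1,3) by blast+
      have "(x \<oplus> y) \<ominus> (x' \<oplus> y') = (x \<ominus> x') \<oplus> (y \<ominus> y')" using x y c' by algebra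
      hence "nn ((x \<oplus> y) \<ominus> (x' \<oplus> y')) < e"
        using * nrm_triangle[of "x \<ominus> x'" "y \<ominus> y'"] x y c' by simp
      hence "\<exists>z\<in>B. nn ((x \<oplus> y) \<ominus> z) < e" using s(3)[OF *(1) *(3)] by blast }
    thus ?thesis using x y by (simp add: nclosure_def)
  qed
  have mult: "x \<otimes> y \<in> nclosure B" if xy: "x \<in> nclosure B" "y \<in> nclosure B" for x y
  proof -
    have x: "x \<in> alg" and y: "y \<in> alg" using xy by (auto simp: nclosure_def)
    { fix e :: real assume e: "e > 0"
      \<comment> \<open>The cap at one keeps \<open>nn x'\<close> below \<open>nn x + 1\<close>, and
        the quotient makes the resulting error \<open>d * (nn x + nn y + 2)\<close> at most
        \<open>e / 2\<close>.\<close>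
      define d where "d = min 1 (e / (2 * (nn x + nn y + 2)))"
      have pos: "nn x + nn y + 2 > 0" using nrm_nonneg[OF x] nrm_nonneg[OF y] by linarith
      have d: "d > 0" "d \<le> 1" using e pos by (auto simp: d_def)
      obtain x' y' where *: "x' \<in> B" "nn (x \<ominus> x') < d" "y' \<in> B" "nn (y \<ominus> y') < d"
        using xy d(1) unfolding nclosure_def by blast
      have c': "x' \<in> alg" "y' \<in> alg" using s(1) *(1,3) by blast+
      have nx': "nn x' \<le> nn x + 1" using nrm_diff_ge[OF x c'(1)] * d by linarith
      have "nn (x \<otimes> y \<ominus> x' \<otimes> y') \<le> nn (x \<ominus> x') * nn y + nn x' * nn (y \<ominus> y')"
        using nrm_mult_diff x y c' by simp
      also have "\<dots> \<le> d * nn y + (nn x + 1) * d"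
        using * nx' d x y c' by (intro add_mono mult_mono) auto
      also have "\<dots> \<le> d * (nn x + nn y + 2)" using d by (simp add: algebra_simps)
      also have "\<dots> \<le> e / (2 * (nn x + nn y + 2)) * (nn x + nn y + 2)"
        using pos by (intro mult_right_mono) (auto simp: d_def)
      also have "\<dots> = e / 2"
      proof -
        have "e / (2 * K) * K = e / 2" if "K > 0" for K :: real using that by simp
        thus ?thesis using pos .
      qed
      finally have "nn (x \<otimes> y \<ominus> x' \<otimes> y') < e" using e by simp
      hence "\<exists>z\<in>B. nn ((x \<otimes> y) \<ominus> z) < e" using s(4)[OF *(1) *(3)] by blast }
    thus ?thesis using x y by (simp add: nclosure_def)
  qed
  have scl: "sc c x \<in> nclosure B" if xc: "x \<in> nclosure B" for c x
  proof -
    have x: "x \<in> alg" using xc by (auto simp: nclosure_def)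
    { fix e :: real assume e: "e > 0"
      hence "e / (cmod c + 1) > 0" by (simp add: add_nonneg_pos)
      then obtain x' where *: "x' \<in> B" "nn (x \<ominus> x') < e / (cmod c + 1)"
        using xc unfolding nclosure_def by blast
      have c': "x' \<in> alg" using s(1) *(1) by blast
      have "nn (sc c x \<ominus> sc c x') = cmod c * nn (x \<ominus> x')"
        using x c' by (simp add: nrm_cscale flip: cscale_diff_right)
      also have "\<dots> \<le> cmod c * (e / (cmod c + 1))" using * by (intro mult_left_mono) auto
      also have "\<dots> < e"
      proof -
        have "t * (e / (t + 1)) < e" if "t \<ge> 0" for t :: real
          using e that by (simp add: pos_divide_less_eq distrib_left mult.commute)
        thus ?thesis by simp
      qed
      finally have "\<exists>z\<in>B. nn (sc c x \<ominus> z) < e" using s(5)[OF *(1)] by blast }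
    thus ?thesis using x by (simp add: nclosure_def)
  qed
  have st: "star x \<in> nclosure B" if xc: "x \<in> nclosure B" for x
  proof -
    have x: "x \<in> alg" using xc by (auto simp: nclosure_def)
    { fix e :: real assume e: "e > 0"
      then obtain x' where *: "x' \<in> B" "nn (x \<ominus> x') < e" using xc unfolding nclosure_def by blast
      have c': "x' \<in> alg" using s(1) *(1) by blast
      have "nn (star x \<ominus> star x') = nn (x \<ominus> x')"
        using x c' nrm_adj[of "x \<ominus> x'"] by (simp add: adj_diff)
      hence "\<exists>z\<in>B. nn (star x \<ominus> z) < e" using *(2) s(6)[OF *(1)] by (intro bexI[of _ "star x'"]) simp_all }
    thus ?thesis using x by (simp add: nclosure_def)
  qed
  show ?thesis unfolding star_subalg_def
    using add mult scl st subsetD[OF nclosure_inc[OF c] s(2)] by (simp add: nclosure_def subset_iff)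
qed

lemma nclosure_cstar_subalgebra: "star_subalg B \<Longrightarrow> cstar_subalgebra A (nclosure B)"
  by (simp add: cstar_subalgebra_iff nclosure_star_subalg nclosure_closed[of B] star_subalgD(1) subset_iff)

lemma subalg_pre_cstar:
  assumes B: "star_subalg B" shows "pre_cstar (A\<lparr>carrier := B\<rparr>)"
proof -
  note s = star_subalgD[OF B]
  interpret R: ring "A\<lparr>carrier := B\<rparr>"
    using subring_is_ring[OF star_subalg_subring[OF B]] .
  show ?thesis
    by unfold_locales
      (use s in \<open>simp_all add: cscale_add_left cscale_add_right cscale_mult_left cscale_mult_right
        adj_add adj_cscale adj_mult nrm_eq_0_iff nrm_triangle nrm_cscale nrm_mult nrm_adj_mult\<close>)
qed

text \<open>Negation is a definite description over the carrier, so a smaller carrier could change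
  it. It does not, because in both rings it is multiplication by the scalar \<open>-1\<close>, which
  ignores the carrier.\<close>

lemma subalg_minus:
  assumes B: "star_subalg B" and x: "x \<in> B" "y \<in> B"
  shows "x \<ominus>\<^bsub>A\<lparr>carrier := B\<rparr>\<^esub> y = x \<ominus> y"
proof -
  interpret R: pre_cstar "A\<lparr>carrier := B\<rparr>" by (rule subalg_pre_cstar[OF B])
  note s = star_subalgD[OF B]
  have "\<ominus>\<^bsub>A\<lparr>carrier := B\<rparr>\<^esub> y = \<ominus> y"
    using R.cscale_m1[of y] cscale_m1[of y] x s by simp
  thus ?thesis by (simp add: a_minus_def)
qed

text \<open>A limit of points of \<open>C\<close> that exists in the large algebra already lies in
  the closed set \<open>B\<close>, so closedness relative to \<open>B\<close> and in the large
  algebra agree.\<close>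

lemma subalg_subalgebra_iff:
  assumes B: "star_subalg B" and "nclosed B"
  shows "cstar_subalgebra (A\<lparr>carrier := B\<rparr>) C \<longleftrightarrow> C \<subseteq> B \<and> cstar_subalgebra A C"
proof -
  interpret R: pre_cstar "A\<lparr>carrier := B\<rparr>" by (rule subalg_pre_cstar[OF B])
  note s = star_subalgD[OF B]
  have 1: "R.star_subalg C \<longleftrightarrow> C \<subseteq> B \<and> star_subalg C"
    unfolding R.star_subalg_def star_subalg_def using s by auto
  have 2: "R.nclosed C \<longleftrightarrow> nclosed C" if C: "C \<subseteq> B"
  proof -
    have "R.nclosed C \<longleftrightarrow> (\<forall>x\<in>B. (\<forall>e>0. \<exists>y\<in>C. nn (x \<ominus> y) < e) \<longrightarrow> x \<in> C)"
    proof -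
      have "(\<exists>y\<in>C. nn (x \<ominus>\<^bsub>A\<lparr>carrier := B\<rparr>\<^esub> y) < e) \<longleftrightarrow> (\<exists>y\<in>C. nn (x \<ominus> y) < e)" if "x \<in> B" for x e
        using subalg_minus[OF B that] C by (metis subsetD)
      thus ?thesis unfolding R.nclosed_def by simp
    qed
    also have "\<dots> \<longleftrightarrow> nclosed C"
    proof -
      have "x \<in> B" if "x \<in> alg" "\<forall>e>0. \<exists>y\<in>C. nn (x \<ominus> y) < e" for x
        using assms(2) that C unfolding nclosed_def by (meson subsetD)
      thus ?thesis unfolding nclosed_def using s(1) by blast
    qed
    finally show ?thesis .
  qed
  show ?thesis unfolding R.cstar_subalgebra_iff cstar_subalgebra_iff using 1 2 by blast
qed

text \<open>A reduced free product has to be generated inside its own carrier, whereas the generated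
  algebras are formed in the ultrapower; this identifies the two.\<close>

lemma subalg_generated:
  assumes B: "cstar_subalgebra A B" and S: "S \<subseteq> B"
  shows "cstar_generated (A\<lparr>carrier := B\<rparr>) S = cstar_generated A S"
proof -
  have "star_subalg B" "nclosed B" using B by (auto simp: cstar_subalgebra_iff)
  note i = subalg_subalgebra_iff[OF this]
  interpret R: pre_cstar "A\<lparr>carrier := B\<rparr>" by (rule subalg_pre_cstar) fact
  have c: "S \<subseteq> alg" using S B by (auto simp: cstar_subalgebra_iff star_subalg_def)
  show ?thesis
  proof
    have "cstar_generated A S \<subseteq> B" using cstar_generated_minimal[OF S B] .
    thus "cstar_generated (A\<lparr>carrier := B\<rparr>) S \<subseteq> cstar_generated A S"
      using R.cstar_generated_minimal[OF cstar_generated_inc] i cstar_generated_subalgebra[OF c] by blast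
    show "cstar_generated A S \<subseteq> cstar_generated (A\<lparr>carrier := B\<rparr>) S"
      using cstar_generated_minimal[OF R.cstar_generated_inc] i R.cstar_generated_subalgebra[of S] S by simp
  qed
qed

end

lemma cstar_algebra_iff:
  "cstar_algebra A \<longleftrightarrow> pre_cstar A \<and> Metric_space.mcomplete (carrier A) (cdist A)"
  unfolding cstar_algebra_def cstar_algebra_axioms_def pre_cstar_def pre_cstar_axioms_def by auto

lemma (in pre_cstar) subalg_cstar_algebra:
  assumes "cstar_algebra A" and B: "cstar_subalgebra A B"
  shows "cstar_algebra (A\<lparr>carrier := B\<rparr>)"
proof -
  interpret cstar_algebra A by fact
  have sb: "star_subalg B" and cl: "nclosed B" using B by (auto simp: cstar_subalgebra_iff)
  interpret R: pre_cstar "A\<lparr>carrier := B\<rparr>" by (rule subalg_pre_cstar[OF sb])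
  note s = star_subalgD[OF sb]
  have "\<exists>l\<in>B. (\<lambda>n. nn (x n \<ominus>\<^bsub>A\<lparr>carrier := B\<rparr>\<^esub> l)) \<longlonglongrightarrow> 0"
    if x: "\<And>n. x n \<in> B" and "\<forall>e>0. \<exists>N. \<forall>m\<ge>N. \<forall>n\<ge>N. nn (x m \<ominus>\<^bsub>A\<lparr>carrier := B\<rparr>\<^esub> x n) < e" for x
  proof -
    have "\<forall>e>0. \<exists>N. \<forall>m\<ge>N. \<forall>n\<ge>N. nn (x m \<ominus> x n) < e"
      using that subalg_minus[OF sb] by simp
    then obtain l where l: "l \<in> carrier A" "(\<lambda>n. nn (x n \<ominus> l)) \<longlonglongrightarrow> 0"
      using complete[unfolded mcomplete_iff, THEN spec, THEN mp, of x] x s(1) by blast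
    have "\<exists>y\<in>B. nn (l \<ominus> y) < e" if "e > 0" for e
    proof -
      from l(2) that have "\<forall>\<^sub>F n in sequentially. nn (x n \<ominus> l) < e" by (rule order_tendstoD)
      then obtain n where "nn (x n \<ominus> l) < e" by (auto simp: eventually_sequentially)
      thus ?thesis using nrm_minus_commute[of "x n" l] l(1) x[of n] s(1) by (intro bexI[of _ "x n"]) auto
    qed
    hence "l \<in> B" using cl l unfolding nclosed_def by blast
    thus ?thesis using l(2) subalg_minus[OF sb] x by auto
  qed
  hence "Metric_space.mcomplete B (cdist (A\<lparr>carrier := B\<rparr>))"
    using R.mcomplete_iff by simp
  thus ?thesis by (simp add: cstar_algebra_iff R.pre_cstar_axioms)
qed

section \<open>Square roots and faithful states\<close>

text \<open>Sorting summands can separate an element from its negative. These rules cancel across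
  one intermediate summand and complete the rewriting set \<open>ring_exp\<close> for noncommutative
  rings.\<close>

lemma (in ring) r_neg3: "\<lbrakk>x \<in> carrier R; y \<in> carrier R\<rbrakk> \<Longrightarrow> x \<oplus> (y \<oplus> \<ominus> x) = y"
  by (subst a_lcomm) (simp_all add: r_neg)

lemma (in ring) r_neg4: "\<lbrakk>x \<in> carrier R; y \<in> carrier R; z \<in> carrier R\<rbrakk> \<Longrightarrow> x \<oplus> (y \<oplus> (\<ominus> x \<oplus> z)) = y \<oplus> z"
  by (subst a_lcomm) (simp_all add: r_neg2)

lemmas (in ring) ring_exp = minus_eq l_distr r_distr l_minus r_minus minus_add a_ac m_assoc
  r_neg r_neg1 r_neg2 r_neg3 r_neg4

section \<open>States and their GNS seminorm\<close>

locale pre_state = pre_cstar A for A :: "'a cstar_prob" (structure) +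
  assumes state_is_state: "is_state A"
begin

abbreviation st where "st \<equiv> state A"

lemma st_add: "\<lbrakk>x \<in> alg; y \<in> alg\<rbrakk> \<Longrightarrow> st (x \<oplus> y) = st x + st y"
  and st_cscale: "x \<in> alg \<Longrightarrow> st (sc c x) = c * st x"
  and st_pos: "x \<in> alg \<Longrightarrow> st (star x \<otimes> x) \<in> \<real>\<^sub>\<ge>\<^sub>0"
  and st_one [simp]: "st \<one> = 1"
  using state_is_state by (auto simp: is_state_def)

lemma st_zero [simp]: "st \<zero> = 0"
  using st_cscale[of \<zero> 0] by simp

lemma st_uminus: "x \<in> alg \<Longrightarrow> st (\<ominus> x) = - st x"
  using st_cscale[of x "-1"] by (simp add: cscale_m1)

lemma st_diff: "\<lbrakk>x \<in> alg; y \<in> alg\<rbrakk> \<Longrightarrow> st (x \<ominus> y) = st x - st y"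
  by (simp add: minus_eq st_add st_uminus)

text \<open>The GNS seminorm, read on the algebra itself: \<open>N2 (x \<otimes> y)\<close> is the
  length of the vector obtained by applying \<open>x\<close> to the class of \<open>y\<close>, so no
  quotient has to be formed.\<close>

definition N2 :: "'a \<Rightarrow> real" where "N2 x = sqrt (Re (st (star x \<otimes> x)))"

lemma st_sq: "x \<in> alg \<Longrightarrow> st (star x \<otimes> x) = of_real ((N2 x)\<^sup>2)"
  using st_pos[of x] by (auto simp: N2_def complex_nonneg_Reals_iff complex_eq_iff)

lemma N2_nonneg [simp]: "x \<in> alg \<Longrightarrow> 0 \<le> N2 x"
  using st_pos[of x] by (simp add: N2_def complex_nonneg_Reals_iff)

lemma N2_one [simp]: "N2 \<one> = 1" by (simp add: N2_def)

text \<open>Positivity alone makes a state Hermitian: the values at \<open>1 + x\<close> and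
  \<open>1 + i x\<close> are real, which compares the imaginary and then the real parts.\<close>

lemma st_adj: assumes x: "x \<in> alg" shows "st (star x) = cnj (st x)"
proof -
  have 1: "star (\<one> \<oplus> x) \<otimes> (\<one> \<oplus> x) = (\<one> \<oplus> x) \<oplus> (star x \<oplus> star x \<otimes> x)"
    using x by (simp add: adj_add l_distr r_distr a_ac)
  have 2: "star (\<one> \<oplus> sc \<i> x) \<otimes> (\<one> \<oplus> sc \<i> x) = (\<one> \<oplus> sc \<i> x) \<oplus> (sc (-\<i>) (star x) \<oplus> star x \<otimes> x)"
    using x by (simp add: adj_add adj_cscale l_distr r_distr cscale_mult_left cscale_mult_right
        cscale_add_right a_ac)
  have "Im (st (star (\<one> \<oplus> x) \<otimes> (\<one> \<oplus> x))) = 0" using x by (subst st_sq) auto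
  hence 3: "Im (st x) + Im (st (star x)) = 0"
    using x unfolding 1 by (simp add: st_add st_sq)
  have "Im (st (star (\<one> \<oplus> sc \<i> x) \<otimes> (\<one> \<oplus> sc \<i> x))) = 0" using x by (subst st_sq) auto
  hence 4: "Re (st x) - Re (st (star x)) = 0"
    using x unfolding 2 by (simp add: st_add st_sq st_cscale)
  show ?thesis using 3 4 by (simp add: complex_eq_iff)
qed

lemma CS: assumes x: "x \<in> alg" and y: "y \<in> alg"
  shows "cmod (st (star x \<otimes> y)) \<le> N2 x * N2 y"
proof -
  define s where "s = st (star x \<otimes> y)"
  have cs: "st (star y \<otimes> x) = cnj s" using st_adj[of "star x \<otimes> y"] x y by (simp add: s_def adj_mult)
  have *: "0 \<le> r\<^sup>2 * (cmod s)\<^sup>2 * (N2 x)\<^sup>2 - 2 * r * (cmod s)\<^sup>2 + (N2 y)\<^sup>2" for r :: real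
  proof -
    \<comment> \<open>A real multiple of \<open>s\<close> makes the mixed terms real and leaves a
      real quadratic in \<open>r\<close>.\<close>
    define c where "c = - (of_real r * s)"
    have "star (sc c x \<oplus> y) \<otimes> (sc c x \<oplus> y) =
      sc (cnj c * c) (star x \<otimes> x) \<oplus> (sc (cnj c) (star x \<otimes> y) \<oplus> (sc c (star y \<otimes> x) \<oplus> star y \<otimes> y))"
      using x y by (simp add: adj_add adj_cscale l_distr r_distr cscale_mult_left cscale_mult_right
        cscale_add_right a_ac mult.commute)
    hence "st (star (sc c x \<oplus> y) \<otimes> (sc c x \<oplus> y)) =
      cnj c * c * st (star x \<otimes> x) + (cnj c * s + (c * cnj s + st (star y \<otimes> y)))"
      using x y cs by (simp add: st_add st_cscale s_def)
    hence "of_real ((N2 (sc c x \<oplus> y))\<^sup>2) =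
       cnj c * c * of_real ((N2 x)\<^sup>2) + (cnj c * s + (c * cnj s + of_real ((N2 y)\<^sup>2)))"
      using st_sq[of "sc c x \<oplus> y"] st_sq[OF x] st_sq[OF y] x y by simp
    moreover have "cnj c * c = of_real (r\<^sup>2 * (cmod s)\<^sup>2)" "cnj c * s = - of_real (r * (cmod s)\<^sup>2)"
      "c * cnj s = - of_real (r * (cmod s)\<^sup>2)"
      unfolding c_def using complex_norm_square[of s] by (auto simp: power2_eq_square algebra_simps)
    ultimately have "of_real ((N2 (sc c x \<oplus> y))\<^sup>2) =
       (of_real (r\<^sup>2 * (cmod s)\<^sup>2 * (N2 x)\<^sup>2 - 2 * r * (cmod s)\<^sup>2 + (N2 y)\<^sup>2) :: complex)"
      by simp
    hence "(N2 (sc c x \<oplus> y))\<^sup>2 = r\<^sup>2 * (cmod s)\<^sup>2 * (N2 x)\<^sup>2 - 2 * r * (cmod s)\<^sup>2 + (N2 y)\<^sup>2"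
      by (simp only: of_real_eq_iff)
    thus ?thesis by (metis zero_le_power2)
  qed
  have "(cmod s)\<^sup>2 \<le> (N2 x)\<^sup>2 * (N2 y)\<^sup>2"
  proof (cases "N2 x = 0")
    case True
    have "s = 0"
    proof (rule ccontr)
      assume "s \<noteq> 0"
      hence "(cmod s)\<^sup>2 > 0" by simp
      \<comment> \<open>With \<open>N2 x = 0\<close> the quadratic takes the value \<open>-1\<close>
        at this \<open>r\<close>.\<close>
      thus False using *[of "((N2 y)\<^sup>2 + 1) / (2 * (cmod s)\<^sup>2)"] True by (simp add: field_simps)
    qed
    thus ?thesis by simp
  next
    case False
    hence "(N2 x)\<^sup>2 > 0" by simp
    moreover have "S \<le> X * Y" if "0 \<le> (1 / X)\<^sup>2 * S * X - 2 * (1 / X) * S + Y" "X > 0" for S X Y :: real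
    proof -
      have "(1 / X)\<^sup>2 * S * X = S / X" using that by (simp add: power2_eq_square)
      hence "S / X \<le> Y" using that by simp
      thus ?thesis using that by (simp add: field_simps)
    qed
    ultimately show ?thesis using *[of "1 / (N2 x)\<^sup>2"] by blast
  qed
  hence "(cmod s)\<^sup>2 \<le> (N2 x * N2 y)\<^sup>2" by (simp add: power_mult_distrib)
  thus ?thesis unfolding s_def[symmetric]
    using power2_le_imp_le[of "cmod s" "N2 x * N2 y"] x y by simp
qed

lemma N2_triangle: assumes x: "x \<in> alg" and y: "y \<in> alg"
  shows "N2 (x \<oplus> y) \<le> N2 x + N2 y"
proof -
  have "star (x \<oplus> y) \<otimes> (x \<oplus> y) = star x \<otimes> x \<oplus> (star x \<otimes> y \<oplus> (star y \<otimes> x \<oplus> star y \<otimes> y))"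
    using x y by (simp add: adj_add l_distr r_distr a_ac)
  hence "of_real ((N2 (x \<oplus> y))\<^sup>2) = of_real ((N2 x)\<^sup>2) + (st (star x \<otimes> y) + (st (star y \<otimes> x) + of_real ((N2 y)\<^sup>2)))"
    using x y st_sq[of x] st_sq[of y] st_sq[of "x \<oplus> y"] by (simp add: st_add)
  hence "(N2 (x \<oplus> y))\<^sup>2 = (N2 x)\<^sup>2 + (Re (st (star x \<otimes> y)) + (Re (st (star y \<otimes> x)) + (N2 y)\<^sup>2))"
    by (metis Re_complex_of_real plus_complex.sel(1))
  also have "\<dots> \<le> (N2 x)\<^sup>2 + (N2 x * N2 y + (N2 y * N2 x + (N2 y)\<^sup>2))"
    using CS[OF x y] CS[OF y x] complex_Re_le_cmod order_trans
    by (intro add_mono order_refl) blast+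
  also have "\<dots> = (N2 x + N2 y)\<^sup>2" by (simp add: power2_sum)
  finally show ?thesis by (rule power2_le_imp_le) (use x y in simp)
qed

lemma N2_cscale: "x \<in> alg \<Longrightarrow> N2 (sc c x) = cmod c * N2 x"
proof -
  assume x: "x \<in> alg"
  have "st (star (sc c x) \<otimes> sc c x) = cnj c * c * of_real ((N2 x)\<^sup>2)"
    using x by (simp add: adj_cscale cscale_mult_left cscale_mult_right st_cscale st_sq)
  also have "cnj c * c = of_real ((cmod c)\<^sup>2)" using complex_norm_square[of c] by (simp add: mult.commute)
  finally have "of_real ((N2 (sc c x))\<^sup>2) = (of_real ((cmod c * N2 x)\<^sup>2) :: complex)"
    using st_sq[of "sc c x"] x by (simp add: power_mult_distrib)
  hence "(N2 (sc c x))\<^sup>2 = (cmod c * N2 x)\<^sup>2" by (simp only: of_real_eq_iff)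
  thus ?thesis using x by (simp add: power2_eq_iff_nonneg)
qed

lemma N2_zero [simp]: "N2 \<zero> = 0" by (simp add: N2_def)

lemma N2_uminus [simp]: "x \<in> alg \<Longrightarrow> N2 (\<ominus> x) = N2 x"
  using N2_cscale[of x "-1"] by (simp add: cscale_m1)

lemma N2_minus_triangle: "\<lbrakk>x \<in> alg; y \<in> alg\<rbrakk> \<Longrightarrow> N2 (x \<ominus> y) \<le> N2 x + N2 y"
  using N2_triangle[of x "\<ominus> y"] by (simp add: minus_eq)

end

text \<open>Boundedness of left multiplication on the GNS space. In a complete algebra it follows
  from square roots (\<open>cstar_state_pre_prob\<close>); ultrapowers inherit it in the limit, and
  operator algebras have it from the definition of their norm.\<close>

locale pre_prob = pre_state +
  assumes N2_mult: "\<lbrakk>t \<in> alg; x \<in> alg\<rbrakk> \<Longrightarrow> N2 (t \<otimes> x) \<le> nn t * N2 x"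
begin

lemma st_N2: "x \<in> alg \<Longrightarrow> cmod (st (star x \<otimes> x)) = (N2 x)\<^sup>2"
  by (simp add: st_sq norm_power)

lemma le_cancel_sq: fixes a b :: real assumes "0 \<le> a" "0 \<le> b" "a\<^sup>2 \<le> a * b" shows "a \<le> b"
  using assms by (cases "a = 0") (auto simp: power2_eq_square)

text \<open>The square of \<open>N2 (star T \<otimes> d)\<close> is the inner product of
  \<open>d\<close> with \<open>T \<otimes> (star T \<otimes> d)\<close>. A bound for
  \<open>T\<close> at this one vector suffices, which matters where \<open>T\<close> is controlled
  only on vectors of fixed particle number.\<close>

lemma adj_N2_bound:
  assumes T: "T \<in> alg" and d: "d \<in> alg" and K: "K \<ge> 0"
    and b: "N2 (T \<otimes> (star T \<otimes> d)) \<le> K * N2 (star T \<otimes> d)"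
  shows "N2 (star T \<otimes> d) \<le> K * N2 d"
proof -
  have "(N2 (star T \<otimes> d))\<^sup>2 = cmod (st (star d \<otimes> (T \<otimes> (star T \<otimes> d))))"
    using T d st_N2[of "star T \<otimes> d"] by (simp add: adj_mult m_assoc)
  also have "\<dots> \<le> N2 d * N2 (T \<otimes> (star T \<otimes> d))" using T d by (intro CS) auto
  also have "\<dots> \<le> N2 d * (K * N2 (star T \<otimes> d))" using b d by (intro mult_left_mono) auto
  finally show ?thesis using le_cancel_sq[of "N2 (star T \<otimes> d)" "K * N2 d"] T d K by (simp add: mult.assoc mult.left_commute mult.commute)
qed

lemma N2_null_mult: "\<lbrakk>t \<in> alg; x \<in> alg; N2 x = 0\<rbrakk> \<Longrightarrow> N2 (t \<otimes> x) = 0"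
  using N2_mult[of t x] by (intro antisym) auto

lemma N2_null_add: "\<lbrakk>x \<in> alg; y \<in> alg; N2 x = 0; N2 y = 0\<rbrakk> \<Longrightarrow> N2 (x \<oplus> y) = 0"
  using N2_triangle[of x y] by (intro antisym) auto

lemma N2_le: "x \<in> alg \<Longrightarrow> N2 x \<le> nn x"
  using N2_mult[of x \<one>] by simp

lemma st_bound: "x \<in> alg \<Longrightarrow> cmod (st x) \<le> nn x"
  using CS[of \<one> x] N2_le[of x] by simp

lemma nrm_one [simp]: "nn \<one> = 1"
  using st_bound[of \<one>] nrm_one_le by simp

end

context cstar_algebra
begin

lemma limit_unique:
  assumes x: "\<And>n. x n \<in> alg" and l: "l \<in> alg" "l' \<in> alg"
    and "(\<lambda>n. nn (x n \<ominus> l)) \<longlonglongrightarrow> 0" "(\<lambda>n. nn (x n \<ominus> l')) \<longlonglongrightarrow> 0"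
  shows "l = l'"
proof -
  have "(\<lambda>n. nn (x n \<ominus> l) + nn (x n \<ominus> l')) \<longlonglongrightarrow> 0 + 0" using assms by (intro tendsto_add)
  moreover have "nn (l \<ominus> l') \<le> nn (x n \<ominus> l) + nn (x n \<ominus> l')" for n
    using nrm_diff_triangle[of l "x n" l'] nrm_minus_commute[of l "x n"] l x by simp
  ultimately have "nn (l \<ominus> l') \<le> 0"
    by (intro tendsto_lowerbound[of _ _ sequentially]) auto
  hence "nn (l \<ominus> l') = 0" using nrm_nonneg[of "l \<ominus> l'"] l by (intro antisym) auto
  thus ?thesis using nrm_diff_eq_0[of l l'] l by simp
qed

text \<open>The root \<open>1 - y\<close> of \<open>1 - g\<close> comes from iterating \<open>y \<mapsto> (g + y\<^sup>2) / 2\<close>; the iterates are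
  dominated by the numbers obtained for \<open>g = 1\<close>, which increase to \<open>1\<close>.\<close>

lemma sqrt_one_minus:
  assumes g: "g \<in> alg" "star g = g" "nn g \<le> 1"
  obtains y where "y \<in> alg" "star y = y" "nn y \<le> 1" "(\<one> \<ominus> y) \<otimes> (\<one> \<ominus> y) = \<one> \<ominus> g"
    "\<forall>x\<in>alg. x \<otimes> g = g \<otimes> x \<longrightarrow> x \<otimes> y = y \<otimes> x"
proof -
  define Y where "Y = rec_nat \<zero> (\<lambda>_ y. sc (1/2) (g \<oplus> y \<otimes> y))"
  define t :: "nat \<Rightarrow> real" where "t = rec_nat 0 (\<lambda>_ s. (1 + s * s) / 2)"
  have Y0: "Y 0 = \<zero>" and YS: "Y (Suc n) = sc (1/2) (g \<oplus> Y n \<otimes> Y n)" for n by (simp_all add: Y_def)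
  have t0: "t 0 = 0" and tS: "t (Suc n) = (1 + t n * t n) / 2" for n by (simp_all add: t_def)
  have gd: "sc (1/2) (g \<oplus> a \<otimes> a) \<ominus> sc (1/2) (g \<oplus> b \<otimes> b) = sc (1/2) (a \<otimes> a \<ominus> b \<otimes> b)"
    if ab: "a \<in> alg" "b \<in> alg" for a b
  proof -
    have "(g \<oplus> a \<otimes> a) \<ominus> (g \<oplus> b \<otimes> b) = a \<otimes> a \<ominus> b \<otimes> b" using g ab by algebra
    thus ?thesis using ab g by (simp flip: cscale_diff_right)
  qed
  have Yc [simp]: "Y n \<in> alg" for n by (induction n) (use g in \<open>simp_all add: Y0 YS\<close>)
  have Ys: "star (Y n) = Y n" for n
    by (induction n) (use g in \<open>simp_all add: Y0 YS adj_cscale adj_add adj_mult\<close>)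
  have Ycomm: "x \<otimes> Y n = Y n \<otimes> x" if x: "x \<in> alg" "x \<otimes> g = g \<otimes> x" for x n
  proof (induction n)
    case (Suc n)
    have "x \<otimes> (Y n \<otimes> Y n) = (Y n \<otimes> Y n) \<otimes> x"
      using Suc x by (metis Yc m_assoc)
    thus ?case using x g by (simp add: YS cscale_mult_left cscale_mult_right r_distr l_distr)
  qed (use x in \<open>simp add: Y0\<close>)
  have tb: "0 \<le> t n \<and> t n \<le> 1" for n
  proof (induction n)
    case (Suc n)
    hence "t n * t n \<le> 1 * 1" by (intro mult_mono) auto
    thus ?case using Suc by (simp add: tS)
  qed (simp add: t0)
  have tm: "t n \<le> t (Suc n)" for n
  proof -
    have "0 \<le> (1 - t n)\<^sup>2" by simp
    thus ?thesis by (simp add: tS power2_eq_square algebra_simps)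
  qed
  have inc: "incseq t" using tm by (intro incseq_SucI)
  have Yb: "nn (Y n) \<le> t n" for n
  proof (induction n)
    case (Suc n)
    have "nn (Y (Suc n)) = nn (g \<oplus> Y n \<otimes> Y n) / 2" using g by (simp add: YS nrm_cscale)
    also have "\<dots> \<le> (nn g + nn (Y n) * nn (Y n)) / 2"
      using nrm_triangle[of g "Y n \<otimes> Y n"] nrm_mult[of "Y n" "Y n"] g by simp
    also have "\<dots> \<le> (1 + t n * t n) / 2"
      using g Suc tb[of n] mult_mono[OF Suc Suc] by simp
    finally show ?case by (simp add: tS)
  qed (simp add: Y0 t0)
  have Yd: "nn (Y (Suc n) \<ominus> Y n) \<le> t (Suc n) - t n" for n
  proof (induction n)
    case 0
    show ?case using g by (simp add: YS Y0 t0 tS nrm_cscale minus_eq)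
  next
    case (Suc n)
    have "Y (Suc (Suc n)) \<ominus> Y (Suc n) = sc (1/2) (Y (Suc n) \<otimes> Y (Suc n) \<ominus> Y n \<otimes> Y n)"
      using gd[of "Y (Suc n)" "Y n"] unfolding YS[symmetric] by simp
    hence "nn (Y (Suc (Suc n)) \<ominus> Y (Suc n)) = nn (Y (Suc n) \<otimes> Y (Suc n) \<ominus> Y n \<otimes> Y n) / 2"
      by (simp add: nrm_cscale)
    also have "\<dots> \<le> (nn (Y (Suc n) \<ominus> Y n) * nn (Y (Suc n)) + nn (Y n) * nn (Y (Suc n) \<ominus> Y n)) / 2"
      using nrm_mult_diff[of "Y (Suc n)" "Y (Suc n)" "Y n" "Y n"] by simp
    also have "\<dots> \<le> ((t (Suc n) - t n) * t (Suc n) + t n * (t (Suc n) - t n)) / 2"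
      using Suc Yb tb tm by (intro divide_right_mono add_mono mult_mono) auto
    also have "\<dots> = t (Suc (Suc n)) - t (Suc n)" by (simp add: tS[of "Suc n"] tS[of n] field_simps)
    finally show ?case .
  qed
  have Ydd: "nn (Y (n + k) \<ominus> Y n) \<le> t (n + k) - t n" for n k
  proof (induction k)
    case 0 show ?case using nrm_diff_eq_0[of "Y n" "Y n"] by simp
  next
    case (Suc k)
    have "nn (Y (Suc (n + k)) \<ominus> Y n) \<le> nn (Y (Suc (n + k)) \<ominus> Y (n + k)) + nn (Y (n + k) \<ominus> Y n)"
      by (intro nrm_diff_triangle) auto
    thus ?case using Suc Yd[of "n + k"] by simp
  qed
  have "convergent t" using inc tb by (intro Bseq_mono_convergent[OF BseqI'[of _ 1]]) (auto simp: incseq_def)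
  hence "Cauchy t" by (rule convergent_Cauchy)
  have "\<forall>e>0. \<exists>N. \<forall>m\<ge>N. \<forall>n\<ge>N. nn (Y m \<ominus> Y n) < e"
  proof (intro allI impI)
    fix e :: real assume "e > 0"
    then obtain N where N: "\<And>m n. m \<ge> N \<Longrightarrow> n \<ge> N \<Longrightarrow> \<bar>t m - t n\<bar> < e"
      using metric_CauchyD[OF \<open>Cauchy t\<close>, of e] unfolding dist_real_def by blast
    have "nn (Y m \<ominus> Y n) < e" if "m \<ge> N" "n \<ge> N" for m n
    proof (cases "n \<le> m")
      case True
      thus ?thesis using Ydd[of n "m - n"] N[of m n] that by simp
    next
      case False
      thus ?thesis using Ydd[of m "n - m"] N[of n m] that nrm_minus_commute[of "Y m" "Y n"] by simp
    qed
    thus "\<exists>N. \<forall>m\<ge>N. \<forall>n\<ge>N. nn (Y m \<ominus> Y n) < e" by blast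
  qed
  then obtain y where y: "y \<in> alg" and lim: "(\<lambda>n. nn (Y n \<ominus> y)) \<longlonglongrightarrow> 0"
    using complete[unfolded mcomplete_iff, THEN spec, THEN mp, of Y] by auto
  have 1: "nn y \<le> 1"
  proof -
    have "(\<lambda>n. nn (Y n \<ominus> y) + 1) \<longlonglongrightarrow> 0 + 1" using lim by (intro tendsto_add) auto
    moreover have "nn y \<le> nn (Y n \<ominus> y) + 1" for n
      using nrm_diff_ge[of "Y n" y] Yb[of n] tb[of n] y by (auto simp: abs_le_iff)
    ultimately show ?thesis using tendsto_lowerbound[of _ "0 + 1" sequentially "nn y"] by simp
  qed
  have 2: "star y = y"
  proof (rule limit_unique[of Y])
    have "nn (Y n \<ominus> star y) = nn (Y n \<ominus> y)" for n
      using nrm_adj[of "Y n \<ominus> y"] y by (simp add: adj_diff Ys del: nrm_adj)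
    thus "(\<lambda>n. nn (Y n \<ominus> star y)) \<longlonglongrightarrow> 0" using lim by simp
  qed (use y lim in auto)
  have 3: "x \<otimes> y = y \<otimes> x" if x: "x \<in> alg" "x \<otimes> g = g \<otimes> x" for x
  proof (rule limit_unique[of "\<lambda>n. x \<otimes> Y n"])
    have b: "(\<lambda>n. nn x * nn (Y n \<ominus> y)) \<longlonglongrightarrow> 0" using tendsto_mult_left[OF lim, of "nn x"] by simp
    have "nn (x \<otimes> Y n \<ominus> x \<otimes> y) \<le> nn x * nn (Y n \<ominus> y)" for n
    proof -
      have "x \<otimes> Y n \<ominus> x \<otimes> y = x \<otimes> (Y n \<ominus> y)" using x y Yc[of n] by algebra
      thus ?thesis using nrm_mult[of x "Y n \<ominus> y"] x y by simp
    qed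
    thus "(\<lambda>n. nn (x \<otimes> Y n \<ominus> x \<otimes> y)) \<longlonglongrightarrow> 0"
      using x y by (intro real_tendsto_sandwich[OF _ _ tendsto_const b]) auto
    have "nn (x \<otimes> Y n \<ominus> y \<otimes> x) \<le> nn x * nn (Y n \<ominus> y)" for n
    proof -
      have "x \<otimes> Y n \<ominus> y \<otimes> x = (Y n \<ominus> y) \<otimes> x" unfolding Ycomm[OF x] using x(1) y Yc[of n] by algebra
      thus ?thesis using nrm_mult[of "Y n \<ominus> y" x] x y by (simp add: mult.commute)
    qed
    thus "(\<lambda>n. nn (x \<otimes> Y n \<ominus> y \<otimes> x)) \<longlonglongrightarrow> 0"
      using x y by (intro real_tendsto_sandwich[OF _ _ tendsto_const b]) auto
  qed (use x y in auto)
  have 4: "y = sc (1/2) (g \<oplus> y \<otimes> y)"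
  proof (rule limit_unique[of "\<lambda>n. Y (Suc n)"])
    show "(\<lambda>n. nn (Y (Suc n) \<ominus> y)) \<longlonglongrightarrow> 0" using lim by (rule LIMSEQ_Suc)
    have "nn (Y (Suc n) \<ominus> sc (1/2) (g \<oplus> y \<otimes> y)) \<le> nn (Y n \<ominus> y)" for n
    proof -
      have "Y (Suc n) \<ominus> sc (1/2) (g \<oplus> y \<otimes> y) = sc (1/2) (Y n \<otimes> Y n \<ominus> y \<otimes> y)"
        using gd[of "Y n" y] y unfolding YS[symmetric] by simp
      hence "nn (Y (Suc n) \<ominus> sc (1/2) (g \<oplus> y \<otimes> y)) = nn (Y n \<otimes> Y n \<ominus> y \<otimes> y) / 2"
        using y by (simp add: nrm_cscale)
      also have "\<dots> \<le> (nn (Y n \<ominus> y) * nn (Y n) + nn y * nn (Y n \<ominus> y)) / 2"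
        using nrm_mult_diff[of "Y n" "Y n" y y] y by simp
      also have "\<dots> \<le> (nn (Y n \<ominus> y) * 1 + 1 * nn (Y n \<ominus> y)) / 2"
        using Yb[of n] tb[of n] 1 y by (intro divide_right_mono add_mono mult_mono) auto
      finally show ?thesis by simp
    qed
    thus "(\<lambda>n. nn (Y (Suc n) \<ominus> sc (1/2) (g \<oplus> y \<otimes> y))) \<longlonglongrightarrow> 0"
      using g y by (intro real_tendsto_sandwich[OF _ _ tendsto_const lim]) auto
  qed (use g y in auto)
  have "y \<oplus> y = sc 2 y" using cscale_add_left[of y 1 1] y by simp
  also have "\<dots> = g \<oplus> y \<otimes> y" using y g by (subst 4) simp
  finally have 5: "y \<oplus> y = g \<oplus> y \<otimes> y" .
  have "(\<one> \<ominus> y) \<otimes> (\<one> \<ominus> y) = \<one> \<ominus> (y \<oplus> y) \<oplus> y \<otimes> y" using y by (simp add: ring_exp)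
  also have "\<dots> = \<one> \<ominus> (g \<oplus> y \<otimes> y) \<oplus> y \<otimes> y" by (simp only: 5)
  also have "\<dots> = \<one> \<ominus> g" using y g(1) by (simp add: ring_exp)
  finally show ?thesis by (intro that[OF y 2 1]) (simp_all add: 3)
qed

lemma one_minus_commute:
  assumes "x \<in> alg" "y \<in> alg" "x \<otimes> y = y \<otimes> x"
  shows "x \<otimes> (\<one> \<ominus> y) = (\<one> \<ominus> y) \<otimes> x"
proof -
  have "x \<otimes> (\<one> \<ominus> y) = x \<ominus> x \<otimes> y" "(\<one> \<ominus> y) \<otimes> x = x \<ominus> y \<otimes> x"
    using assms(1,2) by (simp_all add: minus_eq l_distr r_distr l_minus r_minus)
  thus ?thesis by (simp only: assms(3))
qed

text \<open>With \<open>k\<close> the root of \<open>1 - h^2\<close>, the element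
  \<open>u = h + i k\<close> is unitary, as \<open>cos + i sin\<close> is; its imaginary part
  \<open>k\<close> therefore has norm at most one. This replaces an appeal to spectral
  theory.\<close>

lemma one_minus_sq_nrm:
  assumes h: "h \<in> alg" "star h = h" "nn h \<le> 1"
  shows "nn (\<one> \<ominus> h \<otimes> h) \<le> 1"
proof -
  have hh: "h \<otimes> h \<in> alg" "star (h \<otimes> h) = h \<otimes> h" using h by (simp_all add: adj_mult)
  have "nn (h \<otimes> h) \<le> 1"
    using h nrm_self_adj_sq[OF h(1,2)] power_le_one[of "nn h" 2] by simp
  with hh obtain y where y: "y \<in> alg" "star y = y"
      and "nn y \<le> 1" and y3: "(\<one> \<ominus> y) \<otimes> (\<one> \<ominus> y) = \<one> \<ominus> h \<otimes> h"
      and y4: "\<forall>x\<in>alg. x \<otimes> (h \<otimes> h) = (h \<otimes> h) \<otimes> x \<longrightarrow> x \<otimes> y = y \<otimes> x"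
    by (rule sqrt_one_minus)
  define k where "k = \<one> \<ominus> y"
  have k: "k \<in> alg" "star k = k" using y(1,2) by (simp_all add: k_def adj_diff)
  have kk: "k \<otimes> k = \<one> \<ominus> h \<otimes> h" using y3 by (simp add: k_def)
  have "h \<otimes> y = y \<otimes> h" using y4 h(1) by (metis m_assoc)
  hence hk: "h \<otimes> k = k \<otimes> h" unfolding k_def by (rule one_minus_commute[OF h(1) y(1)])
  define u where "u = h \<oplus> sc \<i> k"
  have u: "u \<in> alg" using h k by (simp add: u_def)
  have us: "star u = h \<oplus> sc (-\<i>) k" using h k by (simp add: u_def adj_add adj_cscale)
  have "star u \<otimes> u = (h \<otimes> h \<oplus> sc \<i> (k \<otimes> h)) \<oplus> (sc (-\<i>) (k \<otimes> h) \<oplus> k \<otimes> k)"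
    using h(1) k(1) hk unfolding us
    by (simp add: u_def l_distr r_distr cscale_mult_left cscale_mult_right cscale_add_right a_ac)
  also have "\<dots> = \<one>"
    unfolding kk using h(1) k(1) by (simp add: cscale_minus_left ring_exp)
  finally have "star u \<otimes> u = \<one>" .
  hence "(nn u)\<^sup>2 \<le> 1" using nrm_adj_mult[OF u] nrm_one_le by simp
  hence nu: "nn u \<le> 1" using power2_le_imp_le[of "nn u" 1] by simp
  have "u \<ominus> star u = sc (2 * \<i>) k"
  proof -
    have "u \<ominus> star u = sc \<i> k \<ominus> sc (-\<i>) k" unfolding us
      using h(1) k(1) by (simp add: u_def ring_exp)
    thus ?thesis using k cscale_diff_left[of k \<i> "-\<i>"] by simp
  qed
  hence "2 * nn k \<le> nn u + nn (star u)"
    using nrm_minus_triangle[of u "star u"] u k by (simp add: nrm_cscale norm_mult)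
  hence "nn k \<le> 1" using nu u by simp
  hence "nn (k \<otimes> k) \<le> 1" using nrm_self_adj_sq[OF k] power_le_one[of "nn k" 2] k by simp
  thus ?thesis by (simp add: kk)
qed

text \<open>Here \<open>p\<close> is the absolute value of \<open>k\<close> and \<open>v\<close> its
  square root. The square \<open>k^2\<close> is written as \<open>1 - (1 - k^2)\<close>, whose
  subtrahend has norm at most one by \<open>one_minus_sq_nrm\<close>; since the root produced has
  the form \<open>1 - y\<close> with \<open>nn y \<le> 1\<close>, the same construction applies a
  second time.\<close>

lemma abs_sqrt:
  assumes k: "k \<in> alg" "star k = k" "nn k \<le> 1"
  obtains p v where "p \<in> alg" "star p = p" "p \<otimes> p = k \<otimes> k"
    "v \<in> alg" "star v = v" "v \<otimes> v = p"
    "\<forall>x\<in>alg. x \<otimes> k = k \<otimes> x \<longrightarrow> x \<otimes> p = p \<otimes> x"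
    "\<forall>x\<in>alg. x \<otimes> k = k \<otimes> x \<longrightarrow> x \<otimes> v = v \<otimes> x"
proof -
  have g: "\<one> \<ominus> k \<otimes> k \<in> alg" "star (\<one> \<ominus> k \<otimes> k) = \<one> \<ominus> k \<otimes> k"
    using k by (simp_all add: adj_diff adj_mult)
  note com = one_minus_commute
  obtain y where y: "y \<in> alg" "star y = y" "nn y \<le> 1"
      and yy: "(\<one> \<ominus> y) \<otimes> (\<one> \<ominus> y) = \<one> \<ominus> (\<one> \<ominus> k \<otimes> k)"
      and yc: "\<forall>x\<in>alg. x \<otimes> (\<one> \<ominus> k \<otimes> k) = (\<one> \<ominus> k \<otimes> k) \<otimes> x \<longrightarrow> x \<otimes> y = y \<otimes> x"
    by (rule sqrt_one_minus[OF g one_minus_sq_nrm[OF k]])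
  obtain z where z: "z \<in> alg" "star z = z" and "nn z \<le> 1" and zz: "(\<one> \<ominus> z) \<otimes> (\<one> \<ominus> z) = \<one> \<ominus> y"
      and zc: "\<forall>x\<in>alg. x \<otimes> y = y \<otimes> x \<longrightarrow> x \<otimes> z = z \<otimes> x"
    by (rule sqrt_one_minus[OF y])
  have kkc: "x \<otimes> (k \<otimes> k) = (k \<otimes> k) \<otimes> x" if "x \<in> alg" "x \<otimes> k = k \<otimes> x" for x
    using that k by (metis m_assoc)
  show ?thesis
  proof (rule that[of "\<one> \<ominus> y" "\<one> \<ominus> z"])
    show "(\<one> \<ominus> y) \<otimes> (\<one> \<ominus> y) = k \<otimes> k"
    proof -
      have "\<one> \<ominus> (\<one> \<ominus> k \<otimes> k) = k \<otimes> k" using k(1) by (simp add: ring_exp)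
      thus ?thesis by (simp only: yy)
    qed
    have xy: "x \<otimes> y = y \<otimes> x" if x: "x \<in> alg" "x \<otimes> k = k \<otimes> x" for x
      using yc com[OF x(1) _ kkc[OF x]] k(1) x(1) by simp
    show "\<forall>x\<in>alg. x \<otimes> k = k \<otimes> x \<longrightarrow> x \<otimes> (\<one> \<ominus> y) = (\<one> \<ominus> y) \<otimes> x"
      using com[OF _ y(1) xy] by blast
    show "\<forall>x\<in>alg. x \<otimes> k = k \<otimes> x \<longrightarrow> x \<otimes> (\<one> \<ominus> z) = (\<one> \<ominus> z) \<otimes> x"
      using com[OF _ z(1)] zc xy by blast
  qed (simp_all add: y(1,2) z(1,2) zz adj_diff)
qed

end

section \<open>Homomorphisms and the boundedness of left multiplication\<close>

definition star_hom :: "('a, 'm) cstar_scheme \<Rightarrow> ('b, 'n) cstar_scheme \<Rightarrow> ('a \<Rightarrow> 'b) \<Rightarrow> bool" where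
  "star_hom A D f \<longleftrightarrow> f \<in> ring_hom A D \<and> (\<forall>c. \<forall>x\<in>carrier A. f (cscale A c x) = cscale D c (f x)) \<and>
     (\<forall>x\<in>carrier A. f (adj A x) = adj D (f x))"

lemma star_homD:
  assumes "star_hom A D f"
  shows "x \<in> carrier A \<Longrightarrow> f x \<in> carrier D"
    "\<lbrakk>x \<in> carrier A; y \<in> carrier A\<rbrakk> \<Longrightarrow> f (x \<otimes>\<^bsub>A\<^esub> y) = f x \<otimes>\<^bsub>D\<^esub> f y"
    "\<lbrakk>x \<in> carrier A; y \<in> carrier A\<rbrakk> \<Longrightarrow> f (x \<oplus>\<^bsub>A\<^esub> y) = f x \<oplus>\<^bsub>D\<^esub> f y"
    "f \<one>\<^bsub>A\<^esub> = \<one>\<^bsub>D\<^esub>" "x \<in> carrier A \<Longrightarrow> f (cscale A c x) = cscale D c (f x)"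
    "x \<in> carrier A \<Longrightarrow> f (adj A x) = adj D (f x)"
  using assms by (auto simp: star_hom_def ring_hom_closed ring_hom_mult ring_hom_add ring_hom_one)

text \<open>If \<open>nn x \<le> 1\<close>, the square root \<open>v\<close> of
  \<open>1 - x* x\<close> turns one into \<open>x* x + v* v\<close>. The homomorphism preserves this
  identity, so the squared length of \<open>u\<close> is the sum of the squared lengths of
  \<open>f x \<otimes> u\<close> and \<open>f v \<otimes> u\<close>. Completeness is used only in
  the source.\<close>

lemma star_hom_N2_le:
  fixes D :: "'d cstar_prob" (structure)
  assumes A: "cstar_algebra A" and D: "pre_state D" and f: "star_hom A D f"
    and x: "x \<in> carrier A" and u: "u \<in> carrier D"
  shows "pre_state.N2 D (f x \<otimes> u) \<le> nrm A x * pre_state.N2 D u"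
proof -
  interpret A: cstar_algebra A by (rule A)
  interpret D: pre_state D by (rule D)
  note h = star_homD[OF f]
  have 1: "D.N2 (f x \<otimes> u) \<le> D.N2 u" if x: "x \<in> carrier A" and n: "A.nn x \<le> 1" for x
  proof -
    define g where "g = A.star x \<otimes>\<^bsub>A\<^esub> x"
    have g: "g \<in> carrier A" "A.star g = g" using x by (simp_all add: g_def A.adj_mult)
    have "A.nn g \<le> 1" unfolding g_def A.nrm_adj_mult[OF x] using n x by (simp add: power_le_one)
    obtain y where y: "y \<in> carrier A" "A.star y = y" "A.nn y \<le> 1"
      "(\<one>\<^bsub>A\<^esub> \<ominus>\<^bsub>A\<^esub> y) \<otimes>\<^bsub>A\<^esub> (\<one>\<^bsub>A\<^esub> \<ominus>\<^bsub>A\<^esub> y) = \<one>\<^bsub>A\<^esub> \<ominus>\<^bsub>A\<^esub> g"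
      "\<forall>x\<in>carrier A. x \<otimes>\<^bsub>A\<^esub> g = g \<otimes>\<^bsub>A\<^esub> x \<longrightarrow> x \<otimes>\<^bsub>A\<^esub> y = y \<otimes>\<^bsub>A\<^esub> x"
      by (rule A.sqrt_one_minus[OF g \<open>A.nn g \<le> 1\<close>])
    define v where "v = \<one>\<^bsub>A\<^esub> \<ominus>\<^bsub>A\<^esub> y"
    have v: "v \<in> carrier A" "A.star v = v" using y(1,2) by (simp_all add: v_def A.adj_diff)
    have "\<one>\<^bsub>A\<^esub> = A.star x \<otimes>\<^bsub>A\<^esub> x \<oplus>\<^bsub>A\<^esub> A.star v \<otimes>\<^bsub>A\<^esub> v"
      unfolding v(2) using y(4) g(1) by (simp add: v_def g_def[symmetric] A.minus_eq A.a_lcomm[of g] A.r_neg)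
    hence "f \<one>\<^bsub>A\<^esub> = f (A.star x \<otimes>\<^bsub>A\<^esub> x \<oplus>\<^bsub>A\<^esub> A.star v \<otimes>\<^bsub>A\<^esub> v)" by (rule arg_cong)
    hence one: "\<one> = D.star (f x) \<otimes> f x \<oplus> D.star (f v) \<otimes> f v"
      using x v(1) by (simp only: h A.adj_closed A.m_closed)
    note fc = h(1)[OF x] h(1)[OF v(1)]
    have "D.star u \<otimes> u = D.star u \<otimes> (\<one> \<otimes> u)" using u by simp
    also have "\<dots> = D.star (f x \<otimes> u) \<otimes> (f x \<otimes> u) \<oplus> D.star (f v \<otimes> u) \<otimes> (f v \<otimes> u)"
      unfolding one using u fc by (simp add: D.l_distr D.r_distr D.adj_mult D.m_assoc)
    finally have "D.st (D.star u \<otimes> u) = D.st (D.star (f x \<otimes> u) \<otimes> (f x \<otimes> u)) + D.st (D.star (f v \<otimes> u) \<otimes> (f v \<otimes> u))"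
      using u fc by (simp add: D.st_add)
    hence "complex_of_real ((D.N2 u)\<^sup>2) = complex_of_real ((D.N2 (f x \<otimes> u))\<^sup>2 + (D.N2 (f v \<otimes> u))\<^sup>2)"
      using u fc by (simp only: D.st_sq D.m_closed of_real_add)
    hence "(D.N2 u)\<^sup>2 = (D.N2 (f x \<otimes> u))\<^sup>2 + (D.N2 (f v \<otimes> u))\<^sup>2" by (simp only: of_real_eq_iff)
    hence "(D.N2 (f x \<otimes> u))\<^sup>2 \<le> (D.N2 u)\<^sup>2" by simp
    thus ?thesis by (rule power2_le_imp_le[OF _ D.N2_nonneg[OF u]])
  qed
  show ?thesis
  proof (cases "A.nn x = 0")
    case True
    hence "x = A.sc 0 \<one>\<^bsub>A\<^esub>" using A.nrm_eq_0_iff[OF x] by simp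
    hence "f x = D.sc 0 (f \<one>\<^bsub>A\<^esub>)" using h(5)[OF A.one_closed] by metis
    thus ?thesis using True u by (simp add: h(4))
  next
    case False
    hence p: "A.nn x > 0" using A.nrm_nonneg[OF x] by simp
    let ?t = "complex_of_real (1 / A.nn x)"
    have "D.N2 (f (A.sc ?t x) \<otimes> u) \<le> D.N2 u"
      by (rule 1) (use x p in \<open>simp_all add: A.nrm_cscale norm_divide\<close>)
    thus ?thesis using p x u h(1)[OF x]
      by (simp add: h(5) D.cscale_mult_left D.N2_cscale norm_divide field_simps)
  qed
qed

lemma cstar_state_pre_prob:
  assumes "cstar_algebra A" "is_state A" shows "pre_prob A"
proof -
  interpret cstar_algebra A by fact
  interpret pre_state A using assms(2) by unfold_locales
  have "star_hom A A (\<lambda>x. x)" by (simp add: star_hom_def ring_hom_def)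
  thus ?thesis by unfold_locales (rule star_hom_N2_le[OF assms(1) pre_state_axioms])
qed

text \<open>Injectivity of the GNS representation in terms of \<open>N2\<close>; the agreement with
  the formulation by cosets is \<open>cstar_prob_space_iff\<close>.\<close>

locale faithful_prob = cstar_algebra A + pre_prob A for A :: "'a cstar_prob" (structure) +
  assumes gns_inj: "\<lbrakk>x \<in> alg; \<And>y. y \<in> alg \<Longrightarrow> N2 (x \<otimes> y) = 0\<rbrakk> \<Longrightarrow> x = \<zero>"
begin

text \<open>Faithful representations are isometric.  Otherwise rescale to \<open>\<parallel>w\<parallel> = 1\<close> for \<open>w = x\<^sup>* x\<close>, where
  \<open>w\<^sup>2\<close> is at most \<open>r < 1\<close> in the representation; the positive part of \<open>w\<^sup>2 - (1 + r) / 2\<close>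
  is then killed by the representation, hence zero, which bounds \<open>\<parallel>w\<parallel>\<close> below \<open>1\<close>.\<close>

lemma gns_isometric:
  assumes x: "x \<in> alg" and M: "M \<ge> 0" and b: "\<And>y. y \<in> alg \<Longrightarrow> N2 (x \<otimes> y) \<le> M * N2 y"
  shows "nn x \<le> M"
proof (rule ccontr)
  assume "\<not> nn x \<le> M"
  hence xM: "nn x > M" by simp
  define c where "c = 1 / (nn x)\<^sup>2"
  have c: "c > 0" using xM M by (simp add: c_def)
  define w where "w = sc (of_real c) (star x \<otimes> x)"
  have w: "w \<in> alg" "star w = w" using x by (simp_all add: w_def adj_cscale adj_mult)
  have nw: "nn w = 1" using x xM M c by (simp add: w_def nrm_cscale nrm_adj_mult) (simp add: c_def)
  have bs: "N2 (star x \<otimes> y) \<le> M * N2 y" if "y \<in> alg" for y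
    using adj_N2_bound[OF x that M] b x that by simp
  define r where "r = (c * M\<^sup>2)\<^sup>2"
  have "M\<^sup>2 < (nn x)\<^sup>2" using xM M by (intro power_strict_mono) auto
  hence cM: "c * M\<^sup>2 < 1" "0 \<le> c * M\<^sup>2" using c xM M by (auto simp: c_def field_simps)
  hence r: "0 \<le> r" "r < 1" unfolding r_def
    using power_strict_mono[of "c * M\<^sup>2" 1 2] by auto
  have wb: "(N2 (w \<otimes> y))\<^sup>2 \<le> r * (N2 y)\<^sup>2" if y: "y \<in> alg" for y
  proof -
    have "N2 (w \<otimes> y) = c * N2 (star x \<otimes> (x \<otimes> y))"
      using x y c by (simp add: w_def cscale_mult_left N2_cscale m_assoc)
    also have "\<dots> \<le> c * (M * (M * N2 y))"
      using bs[of "x \<otimes> y"] b[OF y] x y c M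
      by (intro mult_left_mono order_trans[OF bs] order_refl) auto
    finally have "N2 (w \<otimes> y) \<le> c * M\<^sup>2 * N2 y" by (simp add: power2_eq_square mult.assoc)
    hence "(N2 (w \<otimes> y))\<^sup>2 \<le> (c * M\<^sup>2 * N2 y)\<^sup>2" using w y by (intro power_mono) auto
    thus ?thesis by (simp add: r_def power_mult_distrib)
  qed
  define r' where "r' = (1 + r) / 2"
  have r': "r < r'" "0 < r'" "r' < 1" using r by (auto simp: r'_def)
  \<comment> \<open>The threshold lies strictly between the bound \<open>r\<close> in the
    representation and the norm one of \<open>w^2\<close>; halving brings \<open>k\<close> into the
    unit ball, as \<open>abs_sqrt\<close> requires.\<close>
  define k where "k = sc (1/2) (w \<otimes> w \<ominus> sc (of_real r') \<one>)"
  have k: "k \<in> alg" "star k = k" using w by (simp_all add: k_def adj_cscale adj_diff adj_mult)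
  have "nn (w \<otimes> w \<ominus> sc (of_real r') \<one>) \<le> 1 + r' * 1"
    using nrm_minus_triangle[of "w \<otimes> w" "sc (of_real r') \<one>"] nrm_self_adj_sq[OF w] nw w r' nrm_one_le
    by (simp add: nrm_cscale)
  hence "nn k \<le> 1" using w r' by (simp add: k_def nrm_cscale)
  then obtain p v where p: "p \<in> alg" "star p = p" and pp: "p \<otimes> p = k \<otimes> k"
    and v: "v \<in> alg" "star v = v" and vv: "v \<otimes> v = p"
    and pc: "\<forall>x\<in>alg. x \<otimes> k = k \<otimes> x \<longrightarrow> x \<otimes> p = p \<otimes> x"
    and vc: "\<forall>x\<in>alg. x \<otimes> k = k \<otimes> x \<longrightarrow> x \<otimes> v = v \<otimes> x"
    by (rule abs_sqrt[OF k])
  have kp: "k \<otimes> p = p \<otimes> k" using pc k(1) by simp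
  \<comment> \<open>Twice the positive part of \<open>k\<close>. On its range \<open>k\<close>
    agrees with \<open>p = v v\<close> and is thus nonnegative, whereas \<open>wb\<close> makes the
    form of \<open>k\<close> strictly negative on every vector that is not null.\<close>
  define m where "m = p \<oplus> k"
  have m: "m \<in> alg" using p k by (simp add: m_def)
  have km: "k \<otimes> m = p \<otimes> m" using p k kp pp by (simp add: m_def r_distr a_comm)
  have "m = \<zero>"
  proof (rule gns_inj[OF m])
    fix y assume y: "y \<in> alg"
    define z where "z = m \<otimes> y"
    have z: "z \<in> alg" using m y by (simp add: z_def)
    have "star z \<otimes> (k \<otimes> z) = star (v \<otimes> z) \<otimes> (v \<otimes> z)"
    proof -
      have "k \<otimes> z = p \<otimes> z" using km k p m y by (simp add: z_def flip: m_assoc)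
      also have "\<dots> = v \<otimes> (v \<otimes> z)" using vv v z by (simp flip: m_assoc)
      finally show ?thesis using v z by (simp add: adj_mult m_assoc)
    qed
    hence e1: "st (star z \<otimes> (k \<otimes> z)) = of_real ((N2 (v \<otimes> z))\<^sup>2)"
      using st_sq[of "v \<otimes> z"] v z by simp
    have "star z \<otimes> (k \<otimes> z) = sc (1/2) (star (w \<otimes> z) \<otimes> (w \<otimes> z) \<ominus> sc (of_real r') (star z \<otimes> z))"
      using w z by (simp add: k_def cscale_mult_left cscale_mult_right adj_mult m_assoc minus_eq
         l_distr r_distr l_minus r_minus)
    hence "st (star z \<otimes> (k \<otimes> z)) = of_real (((N2 (w \<otimes> z))\<^sup>2 - r' * (N2 z)\<^sup>2) / 2)"
      using w z st_sq[of z] st_sq[of "w \<otimes> z"] by (simp add: st_cscale st_diff)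
    with e1 have "(N2 (v \<otimes> z))\<^sup>2 = ((N2 (w \<otimes> z))\<^sup>2 - r' * (N2 z)\<^sup>2) / 2" by (simp only: of_real_eq_iff)
    hence "0 \<le> (N2 (w \<otimes> z))\<^sup>2 - r' * (N2 z)\<^sup>2"
      by (metis zero_le_power2 zero_le_divide_iff not_numeral_le_zero)
    hence "(r' - r) * (N2 z)\<^sup>2 \<le> 0" using wb[OF z] by (simp add: algebra_simps)
    hence "(N2 z)\<^sup>2 \<le> 0" using r'(1) by (simp add: mult_le_0_iff)
    thus "N2 (m \<otimes> y) = 0" by (simp add: z_def)
  qed
  hence pk: "p = \<ominus> k" using p k by (metis m_def minus_equality)
  have wk: "w \<otimes> k = k \<otimes> w"
    using w by (simp add: k_def cscale_mult_left cscale_mult_right minus_eq l_distr r_distr l_minus r_minus m_assoc)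
  have wv: "w \<otimes> v = v \<otimes> w" using vc w(1) wk by blast
  \<comment> \<open>Vanishing of the positive part means \<open>w^2 + 2 p = r'\<close>. The factor
    \<open>sqrt 2\<close> makes \<open>star u \<otimes> u\<close> equal to this scalar, and
    \<open>u\<close> plus its adjoint is \<open>2 w\<close>.\<close>
  define s2 :: complex where "s2 = of_real (sqrt 2)"
  have s2: "s2 * s2 = 2" "cnj s2 = s2" by (simp_all add: s2_def flip: of_real_mult)
  define u where "u = w \<oplus> sc (\<i> * s2) v"
  have u: "u \<in> alg" using w v by (simp add: u_def)
  have us: "star u = w \<oplus> sc (- (\<i> * s2)) v" using w v s2 by (simp add: u_def adj_add adj_cscale)
  have i2: "- (\<i> * s2) * (\<i> * s2) = 2" using s2(1) by (simp add: algebra_simps)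
  have "star u \<otimes> u = (w \<otimes> w \<oplus> sc (\<i> * s2) (v \<otimes> w)) \<oplus> (sc (- (\<i> * s2)) (v \<otimes> w) \<oplus> sc (- (\<i> * s2) * (\<i> * s2)) (v \<otimes> v))"
    using w(1) v(1) wv unfolding us
    by (simp add: u_def l_distr r_distr cscale_mult_left cscale_mult_right cscale_add_right a_ac)
  also have "\<dots> = w \<otimes> w \<oplus> sc 2 p"
    unfolding i2 vv using w(1) v(1) p(1) by (simp add: cscale_minus_left ring_exp)
  also have "sc 2 p = sc (of_real r') \<one> \<ominus> w \<otimes> w"
  proof -
    have "sc 2 p = \<ominus> sc 2 k" using pk k by (simp add: cscale_minus_right)
    also have "sc 2 k = w \<otimes> w \<ominus> sc (of_real r') \<one>" using w by (simp add: k_def)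
    finally show ?thesis using w(1) by (simp add: ring_exp)
  qed
  also have "w \<otimes> w \<oplus> (sc (of_real r') \<one> \<ominus> w \<otimes> w) = sc (of_real r') \<one>"
    using w(1) by (simp add: ring_exp)
  finally have "star u \<otimes> u = sc (of_real r') \<one>" .
  hence "(nn u)\<^sup>2 \<le> r'" using nrm_adj_mult[OF u] r' by (simp add: nrm_cscale)
  hence "(nn u)\<^sup>2 < 1\<^sup>2" using r' by simp
  hence nu: "nn u < 1" by (rule power2_less_imp_less) simp
  have "u \<oplus> star u = sc 2 w"
  proof -
    have "u \<oplus> star u = w \<oplus> w" unfolding us
      using w(1) v(1) by (simp add: u_def cscale_minus_left ring_exp)
    thus ?thesis using cscale_add_left[of w 1 1] w by simp
  qed
  hence "2 * nn w \<le> nn u + nn (star u)" using nrm_triangle[of u "star u"] u w by (simp add: nrm_cscale)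
  thus False using nu nw u by simp
qed

lemma gns_isometric_dense:
  assumes e: "e \<in> alg" and M: "M \<ge> 0" and W: "W \<subseteq> alg"
    and d: "\<And>y \<delta>. y \<in> alg \<Longrightarrow> \<delta> > 0 \<Longrightarrow> \<exists>x\<in>W. nn (y \<ominus> x) < \<delta>"
    and b: "\<And>x. x \<in> W \<Longrightarrow> N2 (e \<otimes> x) \<le> M * N2 x"
  shows "nn e \<le> M"
proof (rule gns_isometric[OF e M], rule field_le_epsilon)
  fix y and \<epsilon> :: real assume y: "y \<in> alg" and \<epsilon>: "\<epsilon> > 0"
  define \<delta> where "\<delta> = \<epsilon> / (nn e + M + 1)"
  have p: "nn e + M + 1 > 0" using M nrm_nonneg[OF e] by simp
  have \<delta>: "\<delta> > 0" "\<delta> * (nn e + M + 1) = \<epsilon>" using \<epsilon> p by (auto simp: \<delta>_def)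
  obtain x where xW: "x \<in> W" and x: "x \<in> alg" "nn (y \<ominus> x) < \<delta>" using d[OF y \<delta>(1)] W by blast
  have d2: "N2 (y \<ominus> x) \<le> \<delta>" using N2_le[of "y \<ominus> x"] x y by simp
  have "e \<otimes> y = e \<otimes> (y \<ominus> x) \<oplus> e \<otimes> x" using x y e by (simp add: minus_eq r_distr r_minus a_assoc l_neg)
  hence "N2 (e \<otimes> y) \<le> N2 (e \<otimes> (y \<ominus> x)) + N2 (e \<otimes> x)" using N2_triangle[of "e \<otimes> (y \<ominus> x)" "e \<otimes> x"] x y e by simp
  also have "N2 (e \<otimes> (y \<ominus> x)) \<le> nn e * N2 (y \<ominus> x)" using N2_mult x y e by simp
  also have "\<dots> \<le> nn e * \<delta>" using d2 e by (simp add: mult_left_mono)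
  also have "N2 (e \<otimes> x) \<le> M * N2 x" by (rule b[OF xW])
  also have "N2 x \<le> N2 y + \<delta>"
  proof -
    have "x = y \<ominus> (y \<ominus> x)" using x y by (simp add: minus_eq minus_add a_ac r_neg r_neg1 r_neg2 r_neg3 r_neg4)
    hence "N2 x \<le> N2 y + N2 (y \<ominus> x)" using N2_minus_triangle[of y "y \<ominus> x"] x y by simp
    thus ?thesis using d2 by simp
  qed
  hence "M * N2 x \<le> M * (N2 y + \<delta>)" using M by (rule mult_left_mono)
  finally have "N2 (e \<otimes> y) \<le> nn e * \<delta> + M * (N2 y + \<delta>)" by simp
  also have "\<dots> \<le> M * N2 y + \<delta> * (nn e + M + 1)" using \<delta> by (simp add: algebra_simps)
  finally show "N2 (e \<otimes> y) \<le> M * N2 y + \<epsilon>" using \<delta> by simp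
qed

end

section \<open>Ultrapowers\<close>

text \<open>Compactness of a ball supplies a cluster point, and an ultrafilter converges to each of
  its cluster points.\<close>

lemma ultrafilter_bounded_limit:
  fixes f :: "'i \<Rightarrow> 'b :: euclidean_space"
  assumes ne: "\<omega> \<noteq> bot" and ultra: "\<And>P. eventually P \<omega> \<or> eventually (\<lambda>i. \<not> P i) \<omega>"
    and b: "\<And>i. norm (f i) \<le> B"
  obtains l where "(f \<longlongrightarrow> l) \<omega>"
proof -
  have "filtermap f \<omega> \<noteq> bot" using ne by (simp add: filtermap_bot_iff)
  moreover have "eventually (\<lambda>x. x \<in> cball 0 B) (filtermap f \<omega>)"
    using b by (simp add: eventually_filtermap)
  ultimately obtain l where l: "inf (nhds l) (filtermap f \<omega>) \<noteq> bot"
    using compact_cball[of 0 B] unfolding compact_filter by blast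
  have "(f \<longlongrightarrow> l) \<omega>"
  proof (rule topological_tendstoI)
    fix S assume S: "open S" "l \<in> S"
    show "\<forall>\<^sub>F x in \<omega>. f x \<in> S"
    proof (rule ccontr)
      assume "\<not> (\<forall>\<^sub>F x in \<omega>. f x \<in> S)"
      hence 1: "eventually (\<lambda>x. x \<notin> S) (filtermap f \<omega>)" using ultra[of "\<lambda>x. f x \<in> S"]
        by (simp add: eventually_filtermap)
      have 2: "eventually (\<lambda>x. x \<in> S) (nhds l)" using S by (rule eventually_nhds_in_open)
      have "eventually (\<lambda>x. False) (inf (nhds l) (filtermap f \<omega>))"
        unfolding eventually_inf using 1 2 by (intro exI[of _ "\<lambda>x. x \<in> S"] exI[of _ "\<lambda>x. x \<notin> S"]) auto
      thus False using l by (simp add: eventually_False)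
    qed
  qed
  thus ?thesis using that by blast
qed

text \<open>Stated without completeness because it is instantiated twice: for the given algebra and
  for the operators on the uncompleted GNS space.\<close>

locale ultra_prob = pre_prob A for A :: "'a cstar_prob" (structure) +
  fixes \<omega> :: "'i filter"
  assumes free: "free_ultrafilter \<omega>"
begin

lemma ne: "\<omega> \<noteq> bot" and ultra: "eventually P \<omega> \<or> eventually (\<lambda>i. \<not> P i) \<omega>"
  using free by (auto simp: free_ultrafilter_def)

abbreviation "LL \<equiv> linf A"
abbreviation "NN \<equiv> ultra_null A \<omega>"
abbreviation "cls \<equiv> ultra_class A \<omega>"
abbreviation "U \<equiv> ultrapower A \<omega>"

lemma linf_iff: "a \<in> carrier LL \<longleftrightarrow> (\<forall>i. a i \<in> alg) \<and> (\<exists>B. \<forall>i. nn (a i) \<le> B)"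
  by (auto simp: linf_def bdd_above_def)

lemma linfI: "\<lbrakk>\<And>i. a i \<in> alg; \<And>i. nn (a i) \<le> B\<rbrakk> \<Longrightarrow> a \<in> carrier LL"
  by (auto simp: linf_iff)

lemma linfD: "a \<in> carrier LL \<Longrightarrow> a i \<in> alg" by (auto simp: linf_iff)

lemma linfE: assumes "a \<in> carrier LL" obtains B where "B \<ge> 0" "\<And>i. nn (a i) \<le> B"
  using assms unfolding linf_iff by (metis nrm_nonneg order_trans)

lemma linf_simps [simp]: "\<zero>\<^bsub>LL\<^esub> = (\<lambda>i. \<zero>)" "\<one>\<^bsub>LL\<^esub> = (\<lambda>i. \<one>)"
  "a \<oplus>\<^bsub>LL\<^esub> b = (\<lambda>i. a i \<oplus> b i)" "a \<otimes>\<^bsub>LL\<^esub> b = (\<lambda>i. a i \<otimes> b i)"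
  by (simp_all add: linf_def)

lemma linf_add: assumes "a \<in> carrier LL" "b \<in> carrier LL" shows "(\<lambda>i. a i \<oplus> b i) \<in> carrier LL"
proof -
  note [simp] = linfD[OF assms(1)] linfD[OF assms(2)]
  obtain B C where "\<And>i. nn (a i) \<le> B" "\<And>i. nn (b i) \<le> C" using assms linfE by metis
  hence "nn (a i \<oplus> b i) \<le> B + C" for i
    using nrm_triangle[of "a i" "b i"] assms by (simp add: add_mono order_trans)
  thus ?thesis using assms by (intro linfI) auto
qed

lemma linf_mult: assumes "a \<in> carrier LL" "b \<in> carrier LL" shows "(\<lambda>i. a i \<otimes> b i) \<in> carrier LL"
proof -
  note [simp] = linfD[OF assms(1)] linfD[OF assms(2)]
  obtain B C where B: "\<And>i. nn (a i) \<le> B" "\<And>i. nn (b i) \<le> C" "B \<ge> 0" using assms linfE by metis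
  have "nn (a i \<otimes> b i) \<le> B * C" for i
    using order_trans[OF nrm_mult mult_mono[OF B(1) B(2)], of i i] assms B(3) by simp
  thus ?thesis using assms by (intro linfI) auto
qed

lemma linf_sc: assumes "a \<in> carrier LL" shows "(\<lambda>i. sc c (a i)) \<in> carrier LL"
proof -
  note [simp] = linfD[OF assms]
  obtain B where "\<And>i. nn (a i) \<le> B" using assms linfE by metis
  hence "nn (sc c (a i)) \<le> cmod c * B" for i using assms by (simp add: nrm_cscale mult_left_mono)
  thus ?thesis using assms by (intro linfI) auto
qed

lemma linf_star: assumes "a \<in> carrier LL" shows "(\<lambda>i. star (a i)) \<in> carrier LL"
proof -
  note [simp] = linfD[OF assms]
  obtain B where "\<And>i. nn (a i) \<le> B" using assms linfE by metis
  thus ?thesis using assms by (intro linfI[of _ B]) auto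
qed

lemma linf_const: "x \<in> alg \<Longrightarrow> (\<lambda>i. x) \<in> carrier LL"
  by (rule linfI) auto

lemma linf_minus: "a \<in> carrier LL \<Longrightarrow> b \<in> carrier LL \<Longrightarrow> (\<lambda>i. a i \<ominus> b i) \<in> carrier LL"
  using linf_add[of a "\<lambda>i. sc (-1) (b i)"] linf_sc[of b "-1"] linfD[of b] by (simp add: cscale_m1 minus_eq)

lemma ring_linf: "ring LL"
proof (rule ringI)
  show "abelian_group LL"
  proof (rule abelian_groupI)
    fix x assume x: "x \<in> carrier LL"
    show "\<exists>y\<in>carrier LL. y \<oplus>\<^bsub>LL\<^esub> x = \<zero>\<^bsub>LL\<^esub>"
      using linf_sc[OF x, of "-1"] linfD[OF x] by (intro bexI[of _ "\<lambda>i. sc (-1) (x i)"]) (auto simp: cscale_m1 l_neg)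
  qed (simp_all add: linf_add linf_const linfD a_ac)
  show "monoid LL"
    by (rule monoidI) (simp_all add: linf_mult linf_const linfD m_assoc)
qed (simp_all add: linfD l_distr r_distr)

lemma linf_uminus: "a \<in> carrier LL \<Longrightarrow> \<ominus>\<^bsub>LL\<^esub> a = (\<lambda>i. \<ominus> (a i))"
proof -
  assume a: "a \<in> carrier LL"
  interpret L: ring LL by (rule ring_linf)
  note [simp] = linfD[OF a]
  have "(\<lambda>i. \<ominus> (a i)) \<in> carrier LL" using linf_sc[OF a, of "-1"] by (simp add: cscale_m1)
  thus ?thesis using a by (intro L.minus_equality) (auto simp: l_neg)
qed

lemma null_iff: "a \<in> NN \<longleftrightarrow> a \<in> carrier LL \<and> ((\<lambda>i. nn (a i)) \<longlongrightarrow> 0) \<omega>"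
  by (auto simp: ultra_null_def)

lemma nullD: "a \<in> NN \<Longrightarrow> a \<in> carrier LL" "a \<in> NN \<Longrightarrow> a i \<in> alg"
  by (auto simp: null_iff linfD)

lemma null_bound:
  assumes "a \<in> carrier LL" "((\<lambda>i. g i) \<longlongrightarrow> 0) \<omega>" "\<And>i. nn (a i) \<le> g i"
  shows "a \<in> NN"
  unfolding null_iff using assms linfD[OF assms(1)]
  by (auto intro!: tendsto_sandwich[of "\<lambda>i. 0" "\<lambda>i. nn (a i)" \<omega> g] always_eventually)

lemma null_add: assumes "a \<in> NN" "b \<in> NN" shows "(\<lambda>i. a i \<oplus> b i) \<in> NN"
  by (rule null_bound[where g="\<lambda>i. nn (a i) + nn (b i)"])
     (use assms tendsto_add[of "\<lambda>i. nn (a i)" 0 \<omega> "\<lambda>i. nn (b i)" 0] nullD(2)[OF assms(1)] nullD(2)[OF assms(2)]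
       in \<open>auto simp: null_iff linf_add nrm_triangle\<close>)

lemma null_mult_left: assumes "a \<in> carrier LL" "b \<in> NN" shows "(\<lambda>i. a i \<otimes> b i) \<in> NN"
proof -
  note [simp] = linfD[OF assms(1)] nullD(2)[OF assms(2)]
  obtain B where B: "\<And>i. nn (a i) \<le> B" using assms linfE by metis
  show ?thesis
  proof (rule null_bound[where g="\<lambda>i. B * nn (b i)"])
    show "((\<lambda>i. B * nn (b i)) \<longlongrightarrow> 0) \<omega>"
      using assms tendsto_mult_left[of "\<lambda>i. nn (b i)" 0 \<omega> B] by (simp add: null_iff)
    show "nn (a i \<otimes> b i) \<le> B * nn (b i)" for i
      using assms B by (intro order_trans[OF nrm_mult] mult_right_mono) (auto simp: null_iff)
  qed (use assms in \<open>auto simp: null_iff linf_mult\<close>)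
qed

lemma null_mult_right: assumes "a \<in> carrier LL" "b \<in> NN" shows "(\<lambda>i. b i \<otimes> a i) \<in> NN"
proof -
  note [simp] = linfD[OF assms(1)] nullD(2)[OF assms(2)]
  obtain B where B: "\<And>i. nn (a i) \<le> B" using assms linfE by metis
  show ?thesis
  proof (rule null_bound[where g="\<lambda>i. B * nn (b i)"])
    show "((\<lambda>i. B * nn (b i)) \<longlongrightarrow> 0) \<omega>"
      using assms tendsto_mult_left[of "\<lambda>i. nn (b i)" 0 \<omega> B] by (simp add: null_iff)
    have "nn (b i \<otimes> a i) \<le> nn (b i) * B" for i
      using assms B by (intro order_trans[OF nrm_mult] mult_left_mono) (auto simp: null_iff)
    thus "nn (b i \<otimes> a i) \<le> B * nn (b i)" for i by (simp add: mult.commute)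
  qed (use assms in \<open>auto simp: null_iff linf_mult\<close>)
qed

lemma ideal_null: "ideal NN LL"
proof (rule idealI[OF ring_linf])
  interpret L: ring LL by (rule ring_linf)
  show "subgroup NN (add_monoid LL)"
  proof (rule L.add.subgroupI)
    show "NN \<subseteq> carrier LL" by (auto simp: null_iff)
    have "(\<lambda>i. \<zero>) \<in> NN" using linf_const[OF zero_closed] by (simp add: null_iff)
    thus "NN \<noteq> {}" by blast
    show "\<ominus>\<^bsub>LL\<^esub> a \<in> NN" if "a \<in> NN" for a
      using that L.a_inv_closed[of a] nullD(2)[OF that] by (simp add: null_iff linf_uminus)
    show "a \<oplus>\<^bsub>LL\<^esub> b \<in> NN" if "a \<in> NN" "b \<in> NN" for a b using that by (simp add: null_add)
  qed
qed (simp_all add: null_mult_left null_mult_right)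

lemma cls_mem: assumes "a \<in> carrier LL"
  shows "b \<in> cls a \<longleftrightarrow> b \<in> carrier LL \<and> ((\<lambda>i. nn (b i \<ominus> a i)) \<longlongrightarrow> 0) \<omega>"
proof -
  note [simp] = linfD[OF assms]
  have "b \<in> cls a \<longleftrightarrow> (\<exists>h\<in>NN. b = (\<lambda>i. h i \<oplus> a i))"
    by (auto simp: ultra_class_def a_r_coset_def')
  also have "\<dots> \<longleftrightarrow> b \<in> carrier LL \<and> (\<lambda>i. b i \<ominus> a i) \<in> NN"
  proof
    assume "\<exists>h\<in>NN. b = (\<lambda>i. h i \<oplus> a i)"
    then obtain h where h: "h \<in> NN" and b: "b = (\<lambda>i. h i \<oplus> a i)" by blast
    have "h i \<oplus> a i \<ominus> a i = h i" for i
      using nullD(2)[OF h] by (simp add: minus_eq a_assoc r_neg)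
    thus "b \<in> carrier LL \<and> (\<lambda>i. b i \<ominus> a i) \<in> NN"
      using h assms by (simp add: b linf_add null_iff)
  next
    assume *: "b \<in> carrier LL \<and> (\<lambda>i. b i \<ominus> a i) \<in> NN"
    hence "b i \<ominus> a i \<oplus> a i = b i" for i using linfD[of b i] by (simp add: minus_eq a_assoc l_neg)
    thus "\<exists>h\<in>NN. b = (\<lambda>i. h i \<oplus> a i)" using * by (intro bexI[of _ "\<lambda>i. b i \<ominus> a i"]) auto
  qed
  also have "\<dots> \<longleftrightarrow> b \<in> carrier LL \<and> ((\<lambda>i. nn (b i \<ominus> a i)) \<longlongrightarrow> 0) \<omega>"
    using assms linf_minus by (auto simp: null_iff)
  finally show ?thesis .
qed

lemma cls_self: "a \<in> carrier LL \<Longrightarrow> a \<in> cls a"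
proof -
  assume a: "a \<in> carrier LL"
  have "nn (a i \<ominus> a i) = 0" for i using nrm_diff_eq_0[of "a i" "a i"] linfD[OF a] by simp
  thus ?thesis using a by (simp add: cls_mem)
qed

lemma cls_eq: assumes "a \<in> carrier LL" "b \<in> carrier LL"
  shows "cls a = cls b \<longleftrightarrow> ((\<lambda>i. nn (a i \<ominus> b i)) \<longlongrightarrow> 0) \<omega>"
proof
  have "a \<in> cls a" using cls_self[OF assms(1)] .
  thus "cls a = cls b \<Longrightarrow> ((\<lambda>i. nn (a i \<ominus> b i)) \<longlongrightarrow> 0) \<omega>"
    using assms cls_mem[of b a] by simp
next
  assume *: "((\<lambda>i. nn (a i \<ominus> b i)) \<longlongrightarrow> 0) \<omega>"
  have tr: "((\<lambda>i. nn (x i \<ominus> z i)) \<longlongrightarrow> 0) \<omega>"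
    if "x \<in> carrier LL" "y \<in> carrier LL" "z \<in> carrier LL"
      "((\<lambda>i. nn (x i \<ominus> y i)) \<longlongrightarrow> 0) \<omega>" "((\<lambda>i. nn (y i \<ominus> z i)) \<longlongrightarrow> 0) \<omega>" for x y z
    using null_bound[OF linf_minus[OF that(1,3)] _ nrm_diff_triangle, of "y"]
      tendsto_add[OF that(4,5)] linfD[OF that(1)] linfD[OF that(2)] linfD[OF that(3)] by (simp add: null_iff)
  have sy: "((\<lambda>i. nn (b i \<ominus> a i)) \<longlongrightarrow> 0) \<omega>" using * linfD[OF assms(1)] linfD[OF assms(2)] by (simp add: nrm_minus_commute)
  show "cls a = cls b"
    using tr[OF _ assms(1,2) _ *] tr[OF _ assms(2,1) _ sy] assms by (auto simp: cls_mem set_eq_iff)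
qed

lemma cls_eqI: assumes "a \<in> carrier LL" "b \<in> carrier LL" "((\<lambda>i. g i) \<longlongrightarrow> 0) \<omega>" "\<And>i. nn (a i \<ominus> b i) \<le> g i"
  shows "cls a = cls b"
  using null_bound[OF linf_minus[OF assms(1,2)] assms(3,4)] assms(1,2) by (simp add: cls_eq null_iff)

lemma cls_eq_eventually: assumes "a \<in> carrier LL" "b \<in> carrier LL" "\<forall>\<^sub>F i in \<omega>. a i = b i"
  shows "cls a = cls b"
proof -
  have "\<forall>\<^sub>F i in \<omega>. nn (a i \<ominus> b i) = 0" using assms(3)
    by eventually_elim (simp add: nrm_diff_eq_0 linfD[OF assms(2)])
  thus ?thesis using assms by (simp add: cls_eq tendsto_eventually)
qed

lemma U_ring_simps [simp]: "carrier U = carrier (LL Quot NN)" "mult U = mult (LL Quot NN)"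
  "one U = one (LL Quot NN)" "ring.zero U = ring.zero (LL Quot NN)" "add U = add (LL Quot NN)"
  by (simp_all add: ultrapower_def Let_def)

lemma U_carrier: "carrier U = cls ` carrier LL"
  by (auto simp: FactRing_def A_RCOSETS_def' ultra_class_def)

lemma cls_closed [simp]: "a \<in> carrier LL \<Longrightarrow> cls a \<in> carrier U"
  unfolding U_carrier by blast

lemma cls_E: assumes "x \<in> carrier U" obtains a where "a \<in> carrier LL" "x = cls a"
  using assms unfolding U_carrier by blast

lemma cls_mult: "\<lbrakk>a \<in> carrier LL; b \<in> carrier LL\<rbrakk> \<Longrightarrow> cls a \<otimes>\<^bsub>U\<^esub> cls b = cls (\<lambda>i. a i \<otimes> b i)"
  using ideal.rcoset_mult_add[OF ideal_null, of a b] by (simp add: FactRing_def ultra_class_def)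

lemma cls_add: "\<lbrakk>a \<in> carrier LL; b \<in> carrier LL\<rbrakk> \<Longrightarrow> cls a \<oplus>\<^bsub>U\<^esub> cls b = cls (\<lambda>i. a i \<oplus> b i)"
proof -
  assume a: "a \<in> carrier LL" "b \<in> carrier LL"
  interpret I: ideal NN LL by (rule ideal_null)
  show ?thesis using I.a_rcos_sum[OF a] by (simp add: FactRing_def ultra_class_def)
qed

lemma cls_one: "\<one>\<^bsub>U\<^esub> = cls (\<lambda>i. \<one>)"
  by (simp add: FactRing_def ultra_class_def)

lemma cls_zero: "\<zero>\<^bsub>U\<^esub> = cls (\<lambda>i. \<zero>)"
proof -
  interpret L: ring LL by (rule ring_linf)
  have "NN = NN +>\<^bsub>LL\<^esub> \<zero>\<^bsub>LL\<^esub>"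
    using abelian_subgroup.a_coset_eq additive_subgroup.a_subset ideal.axioms(1)[OF ideal_null]
    by (metis L.a_coset_add_zero)
  thus ?thesis by (simp add: FactRing_def ultra_class_def)
qed

text \<open>The operations of \<open>ultrapower\<close> are unions over all representatives; they
  have the intended value as soon as each representative yields the same class.\<close>

lemma U_Union:
  assumes a: "a \<in> carrier LL" and f: "\<And>b. b \<in> cls a \<Longrightarrow> f b = f a"
  shows "(\<Union>b\<in>cls a. f b) = f a"
proof -
  have "a \<in> cls a" using cls_self[OF a] .
  thus ?thesis using f by blast
qed

lemma cls_sc: assumes a: "a \<in> carrier LL" shows "cscale U c (cls a) = cls (\<lambda>i. sc c (a i))"
proof -
  have "cls (\<lambda>i. sc c (b i)) = cls (\<lambda>i. sc c (a i))" if b: "b \<in> cls a" for b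
  proof (rule cls_eqI[where g="\<lambda>i. cmod c * nn (b i \<ominus> a i)"])
    have b': "b \<in> carrier LL" "((\<lambda>i. nn (b i \<ominus> a i)) \<longlongrightarrow> 0) \<omega>" using b cls_mem[OF a] by auto
    note [simp] = linfD[OF a] linfD[OF b'(1)]
    show "((\<lambda>i. cmod c * nn (b i \<ominus> a i)) \<longlongrightarrow> 0) \<omega>" using tendsto_mult_left[OF b'(2), of "cmod c"] by simp
    show "nn (sc c (b i) \<ominus> sc c (a i)) \<le> cmod c * nn (b i \<ominus> a i)" for i
      using a b' by (simp add: nrm_cscale flip: cscale_diff_right)
  qed (use a b cls_mem[OF a] linf_sc in auto)
  thus ?thesis using U_Union[OF a, of "\<lambda>b. cls (\<lambda>i. sc c (b i))"]
    by (simp add: ultrapower_def Let_def)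
qed

lemma cls_star: assumes a: "a \<in> carrier LL" shows "adj U (cls a) = cls (\<lambda>i. star (a i))"
proof -
  have "cls (\<lambda>i. star (b i)) = cls (\<lambda>i. star (a i))" if b: "b \<in> cls a" for b
  proof (rule cls_eqI[where g="\<lambda>i. nn (b i \<ominus> a i)"])
    have b': "b \<in> carrier LL" "((\<lambda>i. nn (b i \<ominus> a i)) \<longlongrightarrow> 0) \<omega>" using b cls_mem[OF a] by auto
    note [simp] = linfD[OF a] linfD[OF b'(1)]
    show "((\<lambda>i. nn (b i \<ominus> a i)) \<longlongrightarrow> 0) \<omega>" by fact
    show "nn (star (b i) \<ominus> star (a i)) \<le> nn (b i \<ominus> a i)" for i
      using a b' nrm_adj[of "b i \<ominus> a i"] by (simp add: adj_diff del: nrm_adj)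
  qed (use a b cls_mem[OF a] linf_star in auto)
  thus ?thesis using U_Union[OF a, of "\<lambda>b. cls (\<lambda>i. star (b i))"]
    by (simp add: ultrapower_def Let_def)
qed

lemma cls_nrm: assumes a: "a \<in> carrier LL" shows "((\<lambda>i. nn (a i)) \<longlongrightarrow> nrm U (cls a)) \<omega>"
proof -
  obtain B where B: "\<And>i. nn (a i) \<le> B" using a linfE by metis
  hence "norm (nn (a i)) \<le> B" for i using linfD[OF a] by simp
  then obtain l where l: "((\<lambda>i. nn (a i)) \<longlongrightarrow> l) \<omega>" using ultrafilter_bounded_limit[OF ne ultra] by metis
  have all: "((\<lambda>i. nn (b i)) \<longlongrightarrow> l) \<omega>" if b: "b \<in> cls a" for b
  proof -
    have b': "b \<in> carrier LL" "((\<lambda>i. nn (b i \<ominus> a i)) \<longlongrightarrow> 0) \<omega>" using b cls_mem[OF a] by auto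
    note [simp] = linfD[OF a] linfD[OF b'(1)]
    have "((\<lambda>i. nn (b i) - nn (a i)) \<longlongrightarrow> 0) \<omega>"
      by (rule Lim_null_comparison[OF _ b'(2)]) (use nrm_diff_ge a b' in \<open>auto intro!: always_eventually\<close>)
    from tendsto_add[OF this l] show ?thesis by simp
  qed
  have a': "a \<in> cls a" using cls_self[OF a] .
  have "nrm U (cls a) = (THE r. \<forall>b\<in>cls a. ((\<lambda>i. nn (b i)) \<longlongrightarrow> r) \<omega>)"
    by (simp add: ultrapower_def Let_def)
  also have "\<dots> = l" using all a' ne by (intro the_equality) (auto intro: tendsto_unique)
  finally show ?thesis using l by simp
qed

lemma cls_st: assumes a: "a \<in> carrier LL" shows "((\<lambda>i. st (a i)) \<longlongrightarrow> state U (cls a)) \<omega>"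
proof -
  obtain B where B: "\<And>i. nn (a i) \<le> B" using a linfE by metis
  have "norm (st (a i)) \<le> B" for i using a B st_bound[of "a i"] by (meson linfD order_trans)
  then obtain l where l: "((\<lambda>i. st (a i)) \<longlongrightarrow> l) \<omega>" using ultrafilter_bounded_limit[OF ne ultra] by metis
  have all: "((\<lambda>i. st (b i)) \<longlongrightarrow> l) \<omega>" if b: "b \<in> cls a" for b
  proof -
    have b': "b \<in> carrier LL" "((\<lambda>i. nn (b i \<ominus> a i)) \<longlongrightarrow> 0) \<omega>" using b cls_mem[OF a] by auto
    note [simp] = linfD[OF a] linfD[OF b'(1)]
    have "cmod (st (b i) - st (a i)) \<le> nn (b i \<ominus> a i)" for i
      using st_bound[of "b i \<ominus> a i"] a b' by (simp add: st_diff)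
    hence "((\<lambda>i. st (b i) - st (a i)) \<longlongrightarrow> 0) \<omega>"
      by (intro Lim_null_comparison[OF _ b'(2)] always_eventually) auto
    from tendsto_add[OF this l] show ?thesis by simp
  qed
  have a': "a \<in> cls a" using cls_self[OF a] .
  have "state U (cls a) = (THE r. \<forall>b\<in>cls a. ((\<lambda>i. st (b i)) \<longlongrightarrow> r) \<omega>)"
    by (simp add: ultrapower_def Let_def)
  also have "\<dots> = l" using all a' ne by (intro the_equality) (auto intro: tendsto_unique)
  finally show ?thesis using l by simp
qed

lemma nrm_cls_eqI: "\<lbrakk>a \<in> carrier LL; ((\<lambda>i. nn (a i)) \<longlongrightarrow> r) \<omega>\<rbrakk> \<Longrightarrow> nrm U (cls a) = r"
  using tendsto_unique[OF ne cls_nrm] by blast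

lemma st_cls_eqI: "\<lbrakk>a \<in> carrier LL; ((\<lambda>i. st (a i)) \<longlongrightarrow> r) \<omega>\<rbrakk> \<Longrightarrow> state U (cls a) = r"
  using tendsto_unique[OF ne cls_st] by blast

lemma U_ring: "ring U"
proof -
  interpret Q: ring "LL Quot NN" by (rule ideal.quotient_is_ring[OF ideal_null])
  show ?thesis
  proof (rule ringI)
    show "abelian_group U"
      by (rule abelian_groupI) (simp_all add: Q.a_ac Q.add.l_inv_ex)
    show "monoid U" by (rule monoidI) (simp_all add: Q.m_assoc)
  qed (simp_all add: Q.l_distr Q.r_distr)
qed

lemmas cls_simps = cls_mult cls_add cls_one cls_zero cls_sc cls_star
  linf_mult linf_add linf_sc linf_star linf_const

lemma U_pre_cstar: "pre_cstar U"
proof -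
  interpret UR: ring U by (rule U_ring)
  note [simp del] = U_ring_simps
  show ?thesis
  proof
    fix x c d assume x: "x \<in> carrier U"
    then obtain a where a: "a \<in> carrier LL" "x = cls a" by (rule cls_E)
    note [simp] = linfD[OF a(1)]
    show "cscale U c x \<in> carrier U" "cscale U 1 x = x" "cscale U c (cscale U d x) = cscale U (c * d) x"
      "cscale U (c + d) x = cscale U c x \<oplus>\<^bsub>U\<^esub> cscale U d x" "adj U x \<in> carrier U" "adj U (adj U x) = x"
      "adj U (cscale U c x) = cscale U (cnj c) (adj U x)"
      using a by (simp_all add: cls_simps cscale_add_left adj_cscale)
    show "0 \<le> nrm U x" unfolding a
      using cls_nrm[OF a(1)] a by (intro tendsto_lowerbound[OF _ _ ne] always_eventually) auto
    show "nrm U x = 0 \<longleftrightarrow> x = \<zero>\<^bsub>U\<^esub>"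
      using cls_nrm[OF a(1)] nrm_cls_eqI[OF a(1), of 0] a cls_eq[OF a(1) linf_const[OF zero_closed]]
      by (auto simp: cls_zero minus_eq)
    show "nrm U (cscale U c x) = cmod c * nrm U x"
      unfolding a cls_sc[OF a(1)] using tendsto_mult_left[OF cls_nrm[OF a(1)], of "cmod c"] a
      by (intro nrm_cls_eqI) (auto simp: linf_sc nrm_cscale)
    have "((\<lambda>i. nn (star (a i) \<otimes> a i)) \<longlongrightarrow> (nrm U x)\<^sup>2) \<omega>"
      using tendsto_power[OF cls_nrm[OF a(1)], of 2] a by (simp add: nrm_adj_mult)
    thus "nrm U (adj U x \<otimes>\<^bsub>U\<^esub> x) = (nrm U x)\<^sup>2"
      using a by (simp add: cls_simps) (intro nrm_cls_eqI, auto simp: cls_simps)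
  next
    fix x y c assume x: "x \<in> carrier U" and y: "y \<in> carrier U"
    obtain a b where a: "a \<in> carrier LL" "x = cls a" and b: "b \<in> carrier LL" "y = cls b"
      using cls_E[OF x] cls_E[OF y] by metis
    note [simp] = linfD[OF a(1)] linfD[OF b(1)]
    show "cscale U c (x \<oplus>\<^bsub>U\<^esub> y) = cscale U c x \<oplus>\<^bsub>U\<^esub> cscale U c y"
      "cscale U c x \<otimes>\<^bsub>U\<^esub> y = cscale U c (x \<otimes>\<^bsub>U\<^esub> y)"
      "x \<otimes>\<^bsub>U\<^esub> cscale U c y = cscale U c (x \<otimes>\<^bsub>U\<^esub> y)"
      "adj U (x \<oplus>\<^bsub>U\<^esub> y) = adj U x \<oplus>\<^bsub>U\<^esub> adj U y"
      "adj U (x \<otimes>\<^bsub>U\<^esub> y) = adj U y \<otimes>\<^bsub>U\<^esub> adj U x"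
      using a b by (simp_all add: cls_simps cscale_add_right cscale_mult_left cscale_mult_right adj_add adj_mult)
    have "nrm U (cls (\<lambda>i. a i \<oplus> b i)) \<le> nrm U (cls a) + nrm U (cls b)"
      using a b by (intro tendsto_le[OF ne tendsto_add[OF cls_nrm cls_nrm] cls_nrm] always_eventually)
        (auto simp: linf_add nrm_triangle)
    thus "nrm U (x \<oplus>\<^bsub>U\<^esub> y) \<le> nrm U x + nrm U y" using a b by (simp add: cls_add)
    have "nrm U (cls (\<lambda>i. a i \<otimes> b i)) \<le> nrm U (cls a) * nrm U (cls b)"
      using a b by (intro tendsto_le[OF ne tendsto_mult[OF cls_nrm cls_nrm] cls_nrm] always_eventually)
        (auto simp: linf_mult nrm_mult)
    thus "nrm U (x \<otimes>\<^bsub>U\<^esub> y) \<le> nrm U x * nrm U y" using a b by (simp add: cls_mult)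
  qed
qed

lemma U_is_state: "is_state U"
  unfolding is_state_def
proof (intro conjI ballI allI)
  note [simp del] = U_ring_simps
  fix x c assume x: "x \<in> carrier U"
  then obtain a where a: "a \<in> carrier LL" "x = cls a" by (rule cls_E)
  note [simp] = linfD[OF a(1)]
  show "state U (cscale U c x) = c * state U x"
    unfolding a cls_sc[OF a(1)] using tendsto_mult_left[OF cls_st[OF a(1)], of c] a
    by (intro st_cls_eqI) (auto simp: linf_sc st_cscale)
  have *: "((\<lambda>i. st (star (a i) \<otimes> a i)) \<longlongrightarrow> state U (adj U x \<otimes>\<^bsub>U\<^esub> x)) \<omega>"
    using a cls_st[of "\<lambda>i. star (a i) \<otimes> a i"] by (simp add: cls_simps)
  show "state U (adj U x \<otimes>\<^bsub>U\<^esub> x) \<in> \<real>\<^sub>\<ge>\<^sub>0"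
    by (rule Lim_in_closed_set[OF closed_nonneg_Reals_complex _ ne *]) (use a st_pos in \<open>auto intro!: always_eventually\<close>)
  fix y assume y: "y \<in> carrier U"
  then obtain b where b: "b \<in> carrier LL" "y = cls b" by (rule cls_E)
  note [simp] = linfD[OF b(1)]
  show "state U (x \<oplus>\<^bsub>U\<^esub> y) = state U x + state U y"
    unfolding a b cls_add[OF a(1) b(1)] using tendsto_add[OF cls_st[OF a(1)] cls_st[OF b(1)]] a b
    by (intro st_cls_eqI) (auto simp: linf_add st_add)
next
  show "state U \<one>\<^bsub>U\<^esub> = 1" unfolding cls_one by (rule st_cls_eqI) (auto simp: linf_const)
qed

sublocale UP: pre_state U
  by (intro pre_state.intro U_pre_cstar) (unfold_locales, rule U_is_state)

lemma N2_cls: assumes a: "a \<in> carrier LL" shows "((\<lambda>i. N2 (a i)) \<longlongrightarrow> UP.N2 (cls a)) \<omega>"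
proof -
  have "((\<lambda>i. st (star (a i) \<otimes> a i)) \<longlongrightarrow> state U (adj U (cls a) \<otimes>\<^bsub>U\<^esub> cls a)) \<omega>"
    using a cls_st[of "\<lambda>i. star (a i) \<otimes> a i"] by (simp add: cls_simps del: U_ring_simps)
  thus ?thesis unfolding N2_def UP.N2_def by (intro tendsto_intros)
qed

sublocale UP: pre_prob U
proof
  note [simp del] = U_ring_simps
  fix t x assume "t \<in> carrier U" "x \<in> carrier U"
  then obtain a b where a: "a \<in> carrier LL" "t = cls a" and b: "b \<in> carrier LL" "x = cls b"
    using cls_E by metis
  note [simp] = linfD[OF a(1)] linfD[OF b(1)]
  have "UP.N2 (cls (\<lambda>i. a i \<otimes> b i)) \<le> nrm U (cls a) * UP.N2 (cls b)"
    using a b by (intro tendsto_le[OF ne tendsto_mult[OF cls_nrm N2_cls] N2_cls] always_eventually)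
      (auto simp: linf_mult N2_mult)
  thus "UP.N2 (t \<otimes>\<^bsub>U\<^esub> x) \<le> nrm U t * UP.N2 x" using a b by (simp add: cls_mult)
qed

lemma cls_minus: "\<lbrakk>a \<in> carrier LL; b \<in> carrier LL\<rbrakk> \<Longrightarrow> cls a \<ominus>\<^bsub>U\<^esub> cls b = cls (\<lambda>i. a i \<ominus> b i)"
proof -
  assume a: "a \<in> carrier LL" "b \<in> carrier LL"
  note [simp] = linfD[OF a(1)] linfD[OF a(2)]
  have "cls a \<ominus>\<^bsub>U\<^esub> cls b = cls a \<oplus>\<^bsub>U\<^esub> cscale U (-1) (cls b)"
    using a by (simp add: a_minus_def UP.cscale_m1 del: U_ring_simps)
  moreover have "(\<lambda>i. \<ominus> b i) \<in> carrier LL" using linf_sc[OF a(2), of "-1"] by (simp add: cscale_m1)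
  ultimately show ?thesis using a by (simp add: cls_simps cscale_m1 minus_eq del: U_ring_simps)
qed

lemma U_minus_const_nrm:
  assumes "a \<in> carrier LL" "b \<in> carrier LL" "\<And>i. nn (a i \<ominus> b i) \<le> r"
  shows "nrm U (cls a \<ominus>\<^bsub>U\<^esub> cls b) \<le> r"
  unfolding cls_minus[OF assms(1,2)]
  by (rule tendsto_upperbound[OF cls_nrm[OF linf_minus[OF assms(1,2)]] _ ne]) (simp add: assms(3))

text \<open>A Cauchy sequence of classes is thinned out until its increments are dominated by a
  geometric series. The classes are then lifted one after the other so that the increments obey the
  bound at every index, and the limit is taken index by index.\<close>

lemma U_cstar_algebra:
  assumes "cstar_algebra A" shows "cstar_algebra U"
proof -
  note [simp del] = U_ring_simps
  interpret A: cstar_algebra A by fact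
  have "\<exists>l\<in>carrier U. (\<lambda>n. nrm U (x n \<ominus>\<^bsub>U\<^esub> l)) \<longlonglongrightarrow> 0"
    if x: "\<And>n. x n \<in> carrier U"
      and cau: "\<forall>e>0. \<exists>N. \<forall>m\<ge>N. \<forall>n\<ge>N. nrm U (x m \<ominus>\<^bsub>U\<^esub> x n) < e" for x :: "nat \<Rightarrow> ('i \<Rightarrow> 'a) set"
  proof -
    define e :: "nat \<Rightarrow> real" where "e k = (1/2) ^ k" for k
    have e: "e k > 0" "e (Suc k) = e k / 2" for k by (simp_all add: e_def)
    have "\<forall>k. \<exists>N. \<forall>m\<ge>N. \<forall>n\<ge>N. nrm U (x m \<ominus>\<^bsub>U\<^esub> x n) < e k" using cau e by simp
    then obtain N where N: "\<And>k m n. m \<ge> N k \<Longrightarrow> n \<ge> N k \<Longrightarrow> nrm U (x m \<ominus>\<^bsub>U\<^esub> x n) < e k" by metis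
    \<comment> \<open>Running sums make \<open>r\<close> monotone while keeping it above
      \<open>N\<close>.\<close>
    define r where "r k = (\<Sum>j\<le>k. N j)" for k
    have r: "N k \<le> r k" "r k \<le> r (Suc k)" for k
      by (auto simp: r_def intro: member_le_sum)
    have "\<exists>a. \<forall>k. (a k \<in> carrier LL \<and> cls (a k) = x (r k)) \<and> (\<forall>i. nn (a (Suc k) i \<ominus> a k i) \<le> e k)"
    proof (rule dependent_nat_choice)
      show "\<exists>a. a \<in> carrier LL \<and> cls a = x (r 0)" using x cls_E by metis
    next
      fix a k assume a: "a \<in> carrier LL \<and> cls a = x (r k)"
      obtain b where b: "b \<in> carrier LL" "x (r (Suc k)) = cls b" using x cls_E by metis
      note [simp] = linfD[OF a[THEN conjunct1]] linfD[OF b(1)]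
      \<comment> \<open>Where the increment is too large the previous entry is repeated. Such
        indices are negligible for the ultrafilter, so the class stays that of \<open>b\<close>, but
        now the bound holds everywhere.\<close>
      define c where "c i = (if nn (b i \<ominus> a i) \<le> e k then b i else a i)" for i
      obtain B C where B: "\<And>i. nn (a i) \<le> B" "\<And>i. nn (b i) \<le> C" using a b linfE by metis
      have c: "c \<in> carrier LL"
        by (rule linfI[of _ "max B C"]) (use B in \<open>auto simp: c_def le_max_iff_disj\<close>)
      have "nrm U (cls b \<ominus>\<^bsub>U\<^esub> cls a) < e k"
        using N[of k "r (Suc k)" "r k"] r[of k] a b by simp
      hence "nrm U (cls (\<lambda>i. b i \<ominus> a i)) < e k"
        using cls_minus[OF b(1) a[THEN conjunct1]] by simp
      hence "\<forall>\<^sub>F i in \<omega>. nn (b i \<ominus> a i) < e k"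
        by (rule order_tendstoD(2)[OF cls_nrm[OF linf_minus[OF b(1) a[THEN conjunct1]]]])
      hence "\<forall>\<^sub>F i in \<omega>. c i = b i" by eventually_elim (simp add: c_def)
      hence "cls c = cls b" using c b by (intro cls_eq_eventually) auto
      moreover have "nn (c i \<ominus> a i) \<le> e k" for i
        using nrm_diff_eq_0[of "a i" "a i"] e(1)[of k] by (simp add: c_def)
      ultimately show "\<exists>c. (c \<in> carrier LL \<and> cls c = x (r (Suc k))) \<and> (\<forall>i. nn (c i \<ominus> a i) \<le> e k)"
        using b c by (intro exI[of _ c]) auto
    qed
    then obtain a where a: "\<And>k. a k \<in> carrier LL" "\<And>k. cls (a k) = x (r k)"
      and ad: "\<And>k i. nn (a (Suc k) i \<ominus> a k i) \<le> e k" by metis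
    have ac [simp]: "a k i \<in> alg" for k i using linfD[OF a(1)] .
    have add: "nn (a (k + j) i \<ominus> a k i) \<le> 2 * e k - 2 * e (k + j)" for k j i
    proof (induction j)
      case 0 show ?case using nrm_diff_eq_0[of "a k i" "a k i"] by simp
    next
      case (Suc j)
      have "nn (a (Suc (k + j)) i \<ominus> a k i) \<le> nn (a (Suc (k + j)) i \<ominus> a (k + j) i) + nn (a (k + j) i \<ominus> a k i)"
        by (intro nrm_diff_triangle) auto
      also have "\<dots> \<le> e (k + j) + (2 * e k - 2 * e (k + j))" using ad Suc by (intro add_mono) auto
      finally show ?case using e(2)[of "k + j"] by simp
    qed
    have add2: "nn (a m i \<ominus> a k i) \<le> 2 * e k" if "k \<le> m" for k m i
      using add[of k "m - k" i] that e(1)[of m] by simp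
    have e0: "e \<longlonglongrightarrow> 0" unfolding e_def by (rule LIMSEQ_power_zero) simp
    have small: "\<exists>k. 4 * e k < d" if "d > 0" for d
    proof -
      have "(\<lambda>k. 4 * e k) \<longlonglongrightarrow> 0" using tendsto_mult_left[OF e0, of 4] by simp
      from order_tendstoD(2)[OF this that] show ?thesis by (auto simp: eventually_sequentially)
    qed
    have "\<exists>l\<in>alg. (\<lambda>k. nn (a k i \<ominus> l)) \<longlonglongrightarrow> 0" for i
    proof -
      have "\<exists>N. \<forall>m\<ge>N. \<forall>n\<ge>N. nn (a m i \<ominus> a n i) < d" if d: "d > 0" for d
      proof -
        obtain k where k: "4 * e k < d" using small[OF d] by blast
        have "nn (a m i \<ominus> a n i) < d" if "m \<ge> k" "n \<ge> k" for m n
          using nrm_diff_triangle[of "a m i" "a k i" "a n i"] add2[OF that(1), of i] add2[OF that(2), of i]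
            nrm_minus_commute[of "a k i" "a n i"] k by simp
        thus ?thesis by blast
      qed
      thus ?thesis
        using A.complete[unfolded mcomplete_iff, THEN spec, THEN mp, of "\<lambda>k. a k i"] by simp
    qed
    then obtain l where l: "\<And>i. l i \<in> alg" "\<And>i. (\<lambda>k. nn (a k i \<ominus> l i)) \<longlonglongrightarrow> 0" by metis
    note [simp] = l(1)
    have al: "nn (a k i \<ominus> l i) \<le> 2 * e k" for k i
    proof -
      have "(\<lambda>m. 2 * e k + nn (a m i \<ominus> l i)) \<longlonglongrightarrow> 2 * e k + 0" using l(2) by (intro tendsto_add) auto
      moreover have "\<forall>\<^sub>F m in sequentially. nn (a k i \<ominus> l i) \<le> 2 * e k + nn (a m i \<ominus> l i)"
        unfolding eventually_sequentially
      proof (intro exI[of _ k] allI impI)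
        fix m assume "k \<le> m"
        thus "nn (a k i \<ominus> l i) \<le> 2 * e k + nn (a m i \<ominus> l i)"
          using nrm_diff_triangle[of "a k i" "a m i" "l i"] add2[of k m i] nrm_minus_commute[of "a k i" "a m i"] by simp
      qed
      ultimately show ?thesis using tendsto_lowerbound[of _ "2 * e k + 0" sequentially] by force
    qed
    have lL: "l \<in> carrier LL"
    proof -
      obtain B where B: "\<And>i. nn (a 0 i) \<le> B" using a linfE by metis
      have "nn (l i) \<le> B + 2" for i
      proof -
        have "\<bar>nn (a 0 i) - nn (l i)\<bar> \<le> nn (a 0 i \<ominus> l i)" by (rule nrm_diff_ge) simp_all
        moreover have "e 0 = 1" by (simp add: e_def)
        ultimately show ?thesis using al[of 0 i] B[of i] by linarith
      qed
      thus ?thesis by (intro linfI) auto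
    qed
    have "(\<lambda>n. nrm U (x n \<ominus>\<^bsub>U\<^esub> cls l)) \<longlonglongrightarrow> 0"
    proof (rule LIMSEQ_I)
      fix d :: real assume "d > 0"
      then obtain k where k: "4 * e k < d" using small by blast
      have "norm (nrm U (x n \<ominus>\<^bsub>U\<^esub> cls l) - 0) < d" if "n \<ge> N k" for n
      proof -
        have "nrm U (x n \<ominus>\<^bsub>U\<^esub> cls l) \<le> nrm U (x n \<ominus>\<^bsub>U\<^esub> x (r k)) + nrm U (x (r k) \<ominus>\<^bsub>U\<^esub> cls l)"
          using x lL by (intro UP.nrm_diff_triangle) auto
        also have "\<dots> \<le> e k + 2 * e k"
          using N[OF that r(1)] U_minus_const_nrm[OF a(1) lL al[of k]] by (simp add: a(2))
        finally show ?thesis using k e(1)[of k] x lL by simp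
      qed
      thus "\<exists>N. \<forall>n\<ge>N. norm (nrm U (x n \<ominus>\<^bsub>U\<^esub> cls l) - 0) < d" by blast
    qed
    thus ?thesis using lL cls_closed by blast
  qed
  thus ?thesis unfolding cstar_algebra_iff UP.mcomplete_iff using U_pre_cstar by blast
qed

lemma ultra_sub_iff: "x \<in> ultra_sub A \<omega> B \<longleftrightarrow> (\<exists>b\<in>carrier LL. (\<forall>i. b i \<in> B) \<and> x = cls b)"
  by (auto simp: ultra_sub_def)

lemma ultra_subI: "\<lbrakk>b \<in> carrier LL; \<And>i. b i \<in> B\<rbrakk> \<Longrightarrow> cls b \<in> ultra_sub A \<omega> B"
  by (auto simp: ultra_sub_def)

lemma ultra_sub_star_subalg:
  assumes B: "star_subalg B" shows "UP.star_subalg (ultra_sub A \<omega> B)"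
proof -
  note [simp del] = U_ring_simps
  note s = star_subalgD[OF B]
  have 1: "\<one>\<^bsub>U\<^esub> \<in> ultra_sub A \<omega> B" unfolding ultra_sub_iff cls_one
    using s(2) linf_const by (intro bexI[of _ "\<lambda>i. \<one>"]) auto
  have 2: "x \<oplus>\<^bsub>U\<^esub> y \<in> ultra_sub A \<omega> B \<and> x \<otimes>\<^bsub>U\<^esub> y \<in> ultra_sub A \<omega> B"
    if "x \<in> ultra_sub A \<omega> B" "y \<in> ultra_sub A \<omega> B" for x y
  proof -
    obtain a b where a: "a \<in> carrier LL" "\<And>i. a i \<in> B" "x = cls a" and b: "b \<in> carrier LL" "\<And>i. b i \<in> B" "y = cls b"
      using \<open>x \<in> _\<close> \<open>y \<in> _\<close> unfolding ultra_sub_iff by blast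
    show ?thesis
      using ultra_subI[OF linf_add[OF a(1) b(1)]] ultra_subI[OF linf_mult[OF a(1) b(1)]] s(3,4)[OF a(2) b(2)]
      by (simp add: a(3) b(3) cls_add[OF a(1) b(1)] cls_mult[OF a(1) b(1)])
  qed
  have 3: "cscale U c x \<in> ultra_sub A \<omega> B \<and> adj U x \<in> ultra_sub A \<omega> B"
    if "x \<in> ultra_sub A \<omega> B" for x c
  proof -
    obtain a where a: "a \<in> carrier LL" "\<And>i. a i \<in> B" "x = cls a"
      using \<open>x \<in> _\<close> unfolding ultra_sub_iff by blast
    show ?thesis
      using ultra_subI[OF linf_sc[OF a(1)]] ultra_subI[OF linf_star[OF a(1)]] s(5)[OF a(2), where c = c] s(6)[OF a(2)]
      by (simp add: a(3) cls_sc[OF a(1)] cls_star[OF a(1)])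
  qed
  show ?thesis unfolding UP.star_subalg_def using 1 2 3 by (auto simp: ultra_sub_iff)
qed

text \<open>A diagonal argument: at index \<open>i\<close> an approximant of the best available
  accuracy is taken from \<open>B\<close>. The function \<open>n\<close>, unbounded along the
  ultrafilter, caps the accuracy at each index and still lets it improve without end.\<close>

lemma ultra_sub_nclosed:
  assumes B: "star_subalg B" and n: "filterlim (n :: 'i \<Rightarrow> nat) at_top \<omega>"
  shows "UP.nclosed (ultra_sub A \<omega> B)"
  unfolding UP.nclosed_def
proof (intro ballI impI)
  note [simp del] = U_ring_simps
  note s = star_subalgD[OF B]
  fix x assume "x \<in> carrier U" and ap: "\<forall>e>0. \<exists>y\<in>ultra_sub A \<omega> B. nrm U (x \<ominus>\<^bsub>U\<^esub> y) < e"
  then obtain a where a: "a \<in> carrier LL" "x = cls a" using cls_E by blast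
  note [simp] = linfD[OF a(1)]
  define P where "P i k \<longleftrightarrow> k \<le> n i \<and> (\<exists>b\<in>B. nn (a i \<ominus> b) < 1 / real (Suc k))" for i k
  have Pk: "\<forall>\<^sub>F i in \<omega>. P i k" for k
  proof -
    have "(1::real) / real (Suc k) > 0" by simp
    then obtain y where "y \<in> ultra_sub A \<omega> B" and y2: "nrm U (x \<ominus>\<^bsub>U\<^esub> y) < 1 / real (Suc k)" using ap by blast
    then obtain b where b: "b \<in> carrier LL" "\<And>i. b i \<in> B" "y = cls b" unfolding ultra_sub_iff by blast
    have "\<forall>\<^sub>F i in \<omega>. nn (a i \<ominus> b i) < 1 / real (Suc k)"
      using order_tendstoD(2)[OF cls_nrm[OF linf_minus[OF a(1) b(1)]]] y2 by (simp add: a b cls_minus)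
    moreover have "\<forall>\<^sub>F i in \<omega>. k \<le> n i" using n by (simp add: filterlim_at_top)
    ultimately show ?thesis by eventually_elim (use b(2) in \<open>auto simp: P_def\<close>)
  qed
  \<comment> \<open>The greatest such \<open>k\<close> exists because \<open>P i k\<close> includes
    \<open>k \<le> n i\<close>; along the ultrafilter \<open>K\<close> exceeds every number, since
    each \<open>P i k\<close> holds eventually.\<close>
  define K where "K i = (GREATEST k. P i k)" for i
  have K: "P i (K i)" "k \<le> K i" if "P i k" for i k
    using GreatestI_nat[of "P i" k "n i"] Greatest_le_nat[of "P i" k "n i"] that unfolding K_def by (auto simp: P_def)
  have "\<exists>b\<in>B. (\<exists>k. P i k) \<longrightarrow> nn (a i \<ominus> b) < 1 / real (Suc (K i))" for i
    using K(1)[of i] s(2) by (auto simp: P_def)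
  then obtain b0 where b0: "\<And>i. b0 i \<in> B" "\<And>i k. P i k \<Longrightarrow> nn (a i \<ominus> b0 i) < 1 / real (Suc (K i))" by metis
  \<comment> \<open>Zero is only a default: already \<open>P i 0\<close> holds for almost every
    \<open>i\<close>. It keeps the family inside \<open>B\<close> and bounded.\<close>
  define b where "b i = (if \<exists>k. P i k then b0 i else \<zero>)" for i
  have bB: "b i \<in> B" for i using b0 s(7) by (simp add: b_def)
  have bc [simp]: "b i \<in> alg" for i using s(1)[OF bB] .
  have bb: "nn (a i \<ominus> b i) < 1 / real (Suc (K i))" if "P i k" for i k using b0(2)[OF that] that by (auto simp: b_def)
  have bL: "b \<in> carrier LL"
  proof -
    obtain C where C: "C \<ge> 0" "\<And>i. nn (a i) \<le> C" using a linfE by metis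
    have "nn (b i) \<le> C + 1" for i
    proof (cases "\<exists>k. P i k")
      case True
      hence "nn (a i \<ominus> b i) < 1 / real (Suc (K i))" using bb by blast
      moreover have "1 / real (Suc (K i)) \<le> 1" by simp
      moreover have "\<bar>nn (a i) - nn (b i)\<bar> \<le> nn (a i \<ominus> b i)" by (rule nrm_diff_ge) simp_all
      ultimately show ?thesis using C(2)[of i] by linarith
    qed (use C in \<open>simp add: b_def\<close>)
    thus ?thesis by (intro linfI) auto
  qed
  have "((\<lambda>i. nn (a i \<ominus> b i)) \<longlongrightarrow> 0) \<omega>"
  proof (rule order_tendstoI)
    fix d :: real assume "0 < d"
    then obtain k where k: "1 / real (Suc k) < d" using nat_approx_posE by blast
    show "\<forall>\<^sub>F i in \<omega>. nn (a i \<ominus> b i) < d" using Pk[of k]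
    proof eventually_elim
      case (elim i)
      have "1 / real (Suc (K i)) \<le> 1 / real (Suc k)" using K(2)[OF elim] by (simp add: frac_le)
      thus ?case using bb[OF elim] k by linarith
    qed
  next
    fix d :: real assume "d < 0"
    thus "\<forall>\<^sub>F i in \<omega>. d < nn (a i \<ominus> b i)"
      by (intro always_eventually allI) (meson a bc less_le_trans linfD minus_closed nrm_nonneg)
  qed
  hence "x = cls b" using a bL by (simp add: cls_eq)
  thus "x \<in> ultra_sub A \<omega> B" unfolding ultra_sub_iff using bL bB by blast
qed

lemma ultra_sub_subalgebra:
  assumes B: "cstar_subalgebra A B" and n: "filterlim (n :: 'i \<Rightarrow> nat) at_top \<omega>"
  shows "cstar_subalgebra U (ultra_sub A \<omega> B)"
  using B ultra_sub_star_subalg ultra_sub_nclosed[OF _ n]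
  unfolding cstar_subalgebra_iff UP.cstar_subalgebra_iff by blast

abbreviation "diag \<equiv> ultra_diag A \<omega>"

lemma diag_cls: "diag x = cls (\<lambda>i. x)" by (simp add: ultra_diag_def)

lemma diag_closed [simp]: "x \<in> alg \<Longrightarrow> diag x \<in> carrier U"
  unfolding diag_cls by (intro cls_closed linf_const)

lemma diag_nrm: "x \<in> alg \<Longrightarrow> nrm U (diag x) = nn x"
  unfolding diag_cls by (intro nrm_cls_eqI linf_const) auto

lemma diag_st: "x \<in> alg \<Longrightarrow> state U (diag x) = st x"
  unfolding diag_cls by (intro st_cls_eqI linf_const) auto

lemma diag_simps:
  "x \<in> alg \<Longrightarrow> y \<in> alg \<Longrightarrow> diag (x \<oplus> y) = diag x \<oplus>\<^bsub>U\<^esub> diag y"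
  "x \<in> alg \<Longrightarrow> y \<in> alg \<Longrightarrow> diag (x \<otimes> y) = diag x \<otimes>\<^bsub>U\<^esub> diag y"
  "x \<in> alg \<Longrightarrow> diag (sc c x) = cscale U c (diag x)"
  "x \<in> alg \<Longrightarrow> diag (star x) = adj U (diag x)"
  "x \<in> alg \<Longrightarrow> y \<in> alg \<Longrightarrow> diag (x \<ominus> y) = diag x \<ominus>\<^bsub>U\<^esub> diag y"
  "diag \<one> = \<one>\<^bsub>U\<^esub>"
  unfolding diag_cls by (simp_all add: cls_simps cls_minus del: U_ring_simps)

end

section \<open>Fock relations over a subalgebra\<close>

text \<open>Exponential growth beats any polynomial factor. The shape of the factor comes from its
  use: the \<open>n\<close>-th power of an operator of degree \<open>D\<close> has degree
  \<open>n D\<close>, hence at most \<open>(n D + 1)^2\<close> components.\<close>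

lemma le_of_powers_le:
  fixes a b C D :: real
  assumes b: "b > 0" and le: "\<And>i. a ^ (2 ^ i) \<le> C * (2 ^ i * D + 1)\<^sup>2 * b ^ (2 ^ i)"
  shows "a \<le> b"
proof (rule ccontr)
  assume "\<not> a \<le> b"
  hence r: "a / b > 1" using b by (simp add: field_simps)
  define r where "r = a / b"
  have "r > 1" using r by (simp add: r_def)
  have "((\<lambda>n::nat. C * (real n * D + 1)\<^sup>2 / r ^ n) \<longlongrightarrow> 0) sequentially"
  proof -
    \<comment> \<open>The square root distributes the decay of \<open>1 / r ^ n\<close> evenly over
      the two factors of the square, so that each tends to zero by itself.\<close>
    define x where "x = sqrt (1 / r)"
    have x: "0 \<le> x" "x < 1" "x\<^sup>2 = 1 / r" using \<open>r > 1\<close> by (auto simp: x_def)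
    have "(\<lambda>n::nat. C * ((real n * x ^ n) * D + x ^ n)\<^sup>2) \<longlonglongrightarrow> C * (0 * D + 0)\<^sup>2"
      using x by (intro tendsto_intros powser_times_n_limit_0 LIMSEQ_power_zero) auto
    moreover have "C * ((real n * x ^ n) * D + x ^ n)\<^sup>2 = C * (real n * D + 1)\<^sup>2 / r ^ n" for n
    proof -
      have "((real n * x ^ n) * D + x ^ n)\<^sup>2 = (real n * D + 1)\<^sup>2 * (x\<^sup>2) ^ n"
        by (simp add: power2_eq_square algebra_simps power_mult_distrib)
      thus ?thesis using x by (simp add: power_one_over)
    qed
    ultimately show ?thesis by simp
  qed
  hence "((\<lambda>i::nat. C * (real (2 ^ i) * D + 1)\<^sup>2 / r ^ (2 ^ i)) \<longlongrightarrow> 0) sequentially"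
    by (rule filterlim_compose) (rule filterlim_subseq, simp add: strict_mono_def)
  hence "\<forall>\<^sub>F i in sequentially. C * (real (2 ^ i) * D + 1)\<^sup>2 / r ^ (2 ^ i) < 1"
    by (rule order_tendstoD) simp
  then obtain i where i: "C * (real (2 ^ i) * D + 1)\<^sup>2 / r ^ (2 ^ i) < 1"
    by (auto simp: eventually_sequentially)
  have "r ^ (2 ^ i) > 0" using \<open>r > 1\<close> by simp
  hence "C * (2 ^ i * D + 1)\<^sup>2 < r ^ (2 ^ i)" using i by (simp add: pos_divide_less_eq)
  hence "C * (2 ^ i * D + 1)\<^sup>2 * b ^ (2 ^ i) < r ^ (2 ^ i) * b ^ (2 ^ i)"
    using b by (intro mult_strict_right_mono) auto
  also have "r ^ (2 ^ i) * b ^ (2 ^ i) = a ^ (2 ^ i)"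
    using b by (simp add: r_def flip: power_mult_distrib)
  finally show False using le[of i] by simp
qed

lemma le_of_powers_le_const:
  fixes a b C :: real
  assumes "b > 0" "\<And>i. a ^ (2 ^ i) \<le> C * b ^ (2 ^ i)" shows "a \<le> b"
  using le_of_powers_le[of b a C 0] assms by simp

text \<open>Relations of the creation operator on the full Fock space over \<open>E\<close>: by
  \<open>ll\<close> an annihilation cancels a creation and leaves the state of what stands between,
  by \<open>lE\<close> annihilation kills the zero-particle vectors, and by \<open>iso\<close> the
  norm on \<open>E\<close> is its norm on those vectors.\<close>

locale fock = pre_prob +
  fixes E :: "'a set" and l :: 'a
  assumes E: "star_subalg E" and l [simp]: "l \<in> alg"
    and ll: "e \<in> E \<Longrightarrow> star l \<otimes> (e \<otimes> l) = sc (st e) \<one>"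
    and lE: "e \<in> E \<Longrightarrow> N2 (star l \<otimes> e) = 0"
    and iso: "\<lbrakk>e \<in> E; M \<ge> 0; \<And>x. x \<in> E \<Longrightarrow> N2 (e \<otimes> x) \<le> M * N2 x\<rbrakk> \<Longrightarrow> nn e \<le> M"
begin

lemmas Es = star_subalgD[OF E]

lemma Ec: "e \<in> E \<Longrightarrow> e \<in> alg" by (rule Es)

lemma st_null: "\<lbrakk>x \<in> alg; N2 x = 0\<rbrakk> \<Longrightarrow> st x = 0"
  using CS[of \<one> x] by simp

text \<open>Applied to the vacuum, the elements of \<open>CC k\<close> are the \<open>k\<close>-particle vectors.\<close>

inductive CC :: "nat \<Rightarrow> 'a \<Rightarrow> bool" where
  CC_0: "e \<in> E \<Longrightarrow> CC 0 e"
| CC_Suc: "e \<in> E \<Longrightarrow> CC k c \<Longrightarrow> CC (Suc k) (e \<otimes> (l \<otimes> c))"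
| CC_add: "CC k c \<Longrightarrow> CC k d \<Longrightarrow> CC k (c \<oplus> d)"

lemma CC_carrier: "CC k c \<Longrightarrow> c \<in> alg"
  by (induction rule: CC.induct) (auto simp: Ec)

lemma CC_0D: "CC k c \<Longrightarrow> k = 0 \<Longrightarrow> c \<in> E"
  by (induction rule: CC.induct) (auto simp: Es)

lemma CC_left: "CC k c \<Longrightarrow> e \<in> E \<Longrightarrow> CC k (e \<otimes> c)"
proof (induction rule: CC.induct)
  case (CC_0 e') thus ?case using Es by (auto intro: CC.CC_0)
next
  case (CC_Suc e' k c)
  have "e \<otimes> (e' \<otimes> (l \<otimes> c)) = (e \<otimes> e') \<otimes> (l \<otimes> c)"
    using CC_Suc CC_carrier[OF CC_Suc(2)] by (simp add: m_assoc Ec)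
  moreover have "e \<otimes> e' \<in> E" using CC_Suc Es by auto
  ultimately show ?case using CC.CC_Suc CC_Suc by metis
next
  case (CC_add k c d) thus ?case
    using CC_carrier Ec by (simp add: r_distr CC.CC_add)
qed

lemma CC_mult: "CC k c \<Longrightarrow> CC m d \<Longrightarrow> CC (k + m) (c \<otimes> d)"
proof (induction rule: CC.induct)
  case (CC_0 e) thus ?case by (simp add: CC_left)
next
  case (CC_Suc e k c)
  have "e \<otimes> (l \<otimes> c) \<otimes> d = e \<otimes> (l \<otimes> (c \<otimes> d))"
    using CC_Suc CC_carrier by (simp add: m_assoc Ec)
  thus ?case using CC.CC_Suc[OF CC_Suc(1) CC_Suc.IH[OF CC_Suc.prems]] by simp
next
  case (CC_add k c d') thus ?case
    using CC_carrier by (simp add: l_distr CC.CC_add)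
qed

lemma CC_one: "CC 0 \<one>" using CC_0 Es by blast

lemma CC_l: "CC k c \<Longrightarrow> CC (Suc k) (l \<otimes> c)"
  using CC_Suc[of \<one> k c] Es CC_carrier by simp

lemma CC_l1: "CC 1 l" using CC_l[OF CC_one] by simp

lemma CC_ex: "\<exists>c. CC k c" by (induction k) (use CC_one CC_l in blast)+

lemma CC_zero: "CC k \<zero>"
proof -
  obtain c where c: "CC k c" using CC_ex by blast
  show ?thesis using CC_left[OF c, of \<zero>] Es CC_carrier[OF c] by simp
qed

lemma CC_sc: assumes "CC k c" shows "CC k (sc z c)"
proof -
  have "sc z \<one> \<otimes> c = sc z c" using CC_carrier[OF assms] by (simp add: cscale_mult_left)
  thus ?thesis using CC_left[OF assms, of "sc z \<one>"] Es by simp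
qed

lemma CC_annihilate: "CC n d \<Longrightarrow> n = Suc m \<Longrightarrow> e \<in> E \<Longrightarrow> CC m (star l \<otimes> (e \<otimes> d))"
proof (induction rule: CC.induct)
  case (CC_Suc e' k c)
  have c: "c \<in> alg" "e \<in> alg" "e' \<in> alg" using CC_Suc CC_carrier Ec by auto
  have "star l \<otimes> (e \<otimes> (e' \<otimes> (l \<otimes> c))) = star l \<otimes> ((e \<otimes> e') \<otimes> l) \<otimes> c"
    using c by (simp add: m_assoc)
  also have "\<dots> = sc (st (e \<otimes> e')) c" using CC_Suc Es c by (simp add: ll cscale_mult_left)
  finally show ?case using CC_sc CC_Suc by simp
next
  case (CC_add k c d)
  have "star l \<otimes> (e \<otimes> (c \<oplus> d)) = star l \<otimes> (e \<otimes> c) \<oplus> star l \<otimes> (e \<otimes> d)"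
    using CC_add CC_carrier Ec by (simp add: r_distr)
  thus ?case using CC_add by (simp add: CC.CC_add)
qed simp

text \<open>Each annihilation in \<open>star c\<close> meets a creation in \<open>d\<close> and is
  turned into a scalar by \<open>ll\<close>. The product is thus again a pure creation term as an
  element of the algebra, not merely on the vacuum.\<close>

lemma CC_star: "CC k c \<Longrightarrow> CC (k + m) d \<Longrightarrow> CC m (star c \<otimes> d)"
proof (induction arbitrary: d rule: CC.induct)
  case (CC_0 e) thus ?case using Es by (simp add: CC_left)
next
  case (CC_Suc e k c)
  have c: "c \<in> alg" "e \<in> alg" "d \<in> alg" using CC_Suc CC_carrier Ec by auto
  have "star (e \<otimes> (l \<otimes> c)) \<otimes> d = star c \<otimes> (star l \<otimes> (star e \<otimes> d))"
    using c by (simp add: adj_mult m_assoc)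
  moreover have "CC (k + m) (star l \<otimes> (star e \<otimes> d))"
    using CC_annihilate[OF CC_Suc.prems, of "k + m" "star e"] CC_Suc Es by simp
  ultimately show ?case using CC_Suc.IH by simp
next
  case (CC_add k c c')
  hence "star (c \<oplus> c') \<otimes> d = star c \<otimes> d \<oplus> star c' \<otimes> d"
    using CC_carrier by (simp add: adj_add l_distr)
  thus ?case using CC_add by (simp add: CC.CC_add)
qed

lemma CC_star_null0: "CC n d \<Longrightarrow> n > 0 \<Longrightarrow> N2 (star d) = 0"
proof (induction rule: CC.induct)
  case (CC_Suc e k c)
  have c: "c \<in> alg" "e \<in> alg" using CC_Suc CC_carrier Ec by auto
  have "star (e \<otimes> (l \<otimes> c)) = star c \<otimes> (star l \<otimes> star e)" using c by (simp add: adj_mult m_assoc)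
  thus ?case using c lE[of "star e"] Es(6)[OF CC_Suc(1)] by (simp add: N2_null_mult)
next
  case (CC_add k c d)
  thus ?case using CC_carrier by (simp add: adj_add N2_null_add)
qed simp

lemma CC_star_null: assumes "CC k c" "CC i d" "i < k" shows "N2 (star c \<otimes> d) = 0"
proof -
  have "CC (k - i) (star d \<otimes> c)" using CC_star[OF assms(2), of "k - i" c] assms by simp
  hence "N2 (star (star d \<otimes> c)) = 0" using CC_star_null0 assms by simp
  thus ?thesis using assms CC_carrier by (simp add: adj_mult)
qed

lemma CC_orth: assumes "CC i c" "CC j d" "i \<noteq> j" shows "st (star c \<otimes> d) = 0"
proof -
  have c: "c \<in> alg" "d \<in> alg" using assms CC_carrier by auto
  show ?thesis
  proof (cases "j < i")
    case True thus ?thesis using st_null[OF _ CC_star_null[OF assms(1,2)]] c by simp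
  next
    case False
    hence "st (star d \<otimes> c) = 0" using st_null[OF _ CC_star_null[OF assms(2,1)]] c assms by simp
    thus ?thesis using st_adj[of "star d \<otimes> c"] c by (simp add: adj_mult)
  qed
qed

text \<open>The tensor product structure of Fock space: \<open>star c \<otimes> c\<close> lies in
  \<open>E\<close>, so between \<open>star l\<close> and \<open>l\<close> it becomes the scalar
  \<open>rho(c* c)\<close> and decouples from \<open>x\<close>.\<close>

lemma N2_CC_l: assumes c: "CC k c" and x: "x \<in> alg"
  shows "N2 (c \<otimes> (l \<otimes> x)) = N2 c * N2 x"
proof -
  have cc: "c \<in> alg" using CC_carrier[OF c] .
  have cE: "star c \<otimes> c \<in> E" using CC_star[OF c, of 0 c] c CC_0D by auto
  have "star (c \<otimes> (l \<otimes> x)) \<otimes> (c \<otimes> (l \<otimes> x)) = star x \<otimes> ((star l \<otimes> ((star c \<otimes> c) \<otimes> l)) \<otimes> x)"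
    using cc x by (simp add: adj_mult m_assoc)
  also have "\<dots> = sc (st (star c \<otimes> c)) (star x \<otimes> x)"
    using cc x ll[OF cE] by (simp add: cscale_mult_left cscale_mult_right)
  finally have "st (star (c \<otimes> (l \<otimes> x)) \<otimes> (c \<otimes> (l \<otimes> x))) = of_real ((N2 c)\<^sup>2) * of_real ((N2 x)\<^sup>2)"
    using cc x by (simp add: st_cscale st_sq)
  hence "of_real ((N2 (c \<otimes> (l \<otimes> x)))\<^sup>2) = (of_real ((N2 c * N2 x)\<^sup>2) :: complex)"
    using cc x st_sq[of "c \<otimes> (l \<otimes> x)"] by (simp add: power_mult_distrib)
  hence "(N2 (c \<otimes> (l \<otimes> x)))\<^sup>2 = (N2 c * N2 x)\<^sup>2" by (simp only: of_real_eq_iff)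
  thus ?thesis using cc x by (simp add: power2_eq_iff_nonneg)
qed

text \<open>Terms with \<open>k + 1\<close> creations, split at the rightmost \<open>l\<close>
  instead of the leftmost one; this is the form to which \<open>N2_CC_l\<close> applies.\<close>

inductive RC :: "nat \<Rightarrow> 'a \<Rightarrow> bool" where
  RC_base: "CC k c \<Longrightarrow> e \<in> E \<Longrightarrow> RC k (c \<otimes> (l \<otimes> e))"
| RC_add: "RC k c \<Longrightarrow> RC k d \<Longrightarrow> RC k (c \<oplus> d)"

lemma RC_carrier: "RC k c \<Longrightarrow> c \<in> alg"
  by (induction rule: RC.induct) (auto simp: Ec CC_carrier)

lemma RC_left: "RC k c \<Longrightarrow> e \<in> E \<Longrightarrow> RC (Suc k) (e \<otimes> (l \<otimes> c))"
proof (induction rule: RC.induct)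
  case (RC_base k c e')
  have "e \<otimes> (l \<otimes> (c \<otimes> (l \<otimes> e'))) = (e \<otimes> (l \<otimes> c)) \<otimes> (l \<otimes> e')"
    using RC_base CC_carrier Ec by (simp add: m_assoc)
  thus ?case using RC.RC_base[OF CC_Suc[OF RC_base(3,1)] RC_base(2)] by simp
next
  case (RC_add k c d)
  hence "e \<otimes> (l \<otimes> (c \<oplus> d)) = e \<otimes> (l \<otimes> c) \<oplus> e \<otimes> (l \<otimes> d)"
    using RC_carrier Ec by (simp add: r_distr)
  thus ?case using RC_add by (simp add: RC.RC_add)
qed

lemma CC_RC: "CC n c \<Longrightarrow> n = Suc k \<Longrightarrow> RC k c"
proof (induction arbitrary: k rule: CC.induct)
  case (CC_Suc e m c)
  show ?case
  proof (cases m)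
    case 0
    hence "c \<in> E" using CC_0D CC_Suc by blast
    thus ?thesis using RC_base[OF CC_0[OF CC_Suc(1)]] 0 CC_Suc by simp
  next
    case (Suc m')
    thus ?thesis using RC_left[OF CC_Suc.IH[OF Suc] CC_Suc(1)] CC_Suc by simp
  qed
qed (auto intro: RC_add)

section \<open>Operators in normal order\<close>

text \<open>Normally ordered operators that first annihilate \<open>k\<close> particles and then
  create \<open>j\<close>. The finite sums of bounded degree in \<open>DD\<close> contain every
  polynomial in \<open>E\<close> and \<open>l + l*\<close>.\<close>

inductive WW :: "nat \<Rightarrow> nat \<Rightarrow> 'a \<Rightarrow> bool" where
  WW_base: "CC j a \<Longrightarrow> CC k b \<Longrightarrow> WW j k (a \<otimes> star b)"
| WW_add: "WW j k x \<Longrightarrow> WW j k y \<Longrightarrow> WW j k (x \<oplus> y)"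

lemma WW_carrier: "WW j k x \<Longrightarrow> x \<in> alg"
  by (induction rule: WW.induct) (auto simp: CC_carrier)

lemma WW_star: "WW j k x \<Longrightarrow> WW k j (star x)"
proof (induction rule: WW.induct)
  case (WW_base j a k b)
  hence "star (a \<otimes> star b) = b \<otimes> star a" using CC_carrier by (simp add: adj_mult)
  thus ?case using WW.WW_base WW_base by simp
next
  case (WW_add j k x y)
  thus ?case using WW_carrier by (simp add: adj_add WW.WW_add)
qed

lemma WW_zero: "WW j k \<zero>"
  using WW_base[OF CC_zero CC_zero, of j k] by simp

lemma WW_CC: "WW j k x \<Longrightarrow> CC (k + m) c \<Longrightarrow> CC (j + m) (x \<otimes> c)"
proof (induction rule: WW.induct)
  case (WW_base j a k b)
  hence "a \<otimes> star b \<otimes> c = a \<otimes> (star b \<otimes> c)" using CC_carrier by (simp add: m_assoc)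
  thus ?case using CC_mult[OF WW_base(1) CC_star[OF WW_base(2,3)]] by simp
next
  case (WW_add j k x y)
  thus ?case using WW_carrier CC_carrier by (simp add: l_distr CC_add)
qed

lemma WW_CC_null: "WW j k x \<Longrightarrow> CC i c \<Longrightarrow> i < k \<Longrightarrow> N2 (x \<otimes> c) = 0"
proof (induction rule: WW.induct)
  case (WW_base j a k b)
  hence "a \<otimes> star b \<otimes> c = a \<otimes> (star b \<otimes> c)" using CC_carrier by (simp add: m_assoc)
  thus ?case using WW_base CC_carrier by (simp add: N2_null_mult CC_star_null)
next
  case (WW_add j k x y)
  thus ?case using WW_carrier CC_carrier by (simp add: l_distr N2_null_add)
qed

inductive DD :: "nat \<Rightarrow> 'a \<Rightarrow> bool" where
  DD_base: "WW j k x \<Longrightarrow> j \<le> D \<Longrightarrow> k \<le> D \<Longrightarrow> DD D x"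
| DD_add: "DD D x \<Longrightarrow> DD D y \<Longrightarrow> DD D (x \<oplus> y)"

lemma DD_carrier: "DD D x \<Longrightarrow> x \<in> alg"
  by (induction rule: DD.induct) (auto simp: WW_carrier)

lemma DD_mono: "DD D x \<Longrightarrow> D \<le> D' \<Longrightarrow> DD D' x"
  by (induction rule: DD.induct) (auto intro: DD.intros order_trans)

lemma DD_star: "DD D x \<Longrightarrow> DD D (star x)"
proof (induction rule: DD.induct)
  case (DD_base j k x D) thus ?case using DD.DD_base[OF WW_star] by blast
next
  case (DD_add D x y) thus ?case using DD_carrier by (simp add: adj_add DD.DD_add)
qed

text \<open>The contraction of \<open>star b\<close> with \<open>a'\<close> is resolved completely
  by \<open>CC_star\<close>. If \<open>k \<le> j'\<close> some creations survive, otherwise some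
  annihilations; either way the product is again normally ordered and neither degree exceeds the
  sum.\<close>

lemma DD_WW_WW:
  assumes "WW j k x" "j \<le> D" "k \<le> D" "WW j' k' y" "j' \<le> D'" "k' \<le> D'"
  shows "DD (D + D') (x \<otimes> y)"
  using assms(1,2,3)
proof (induction rule: WW.induct)
  case (WW_base j a k b)
  note ab = WW_base
  show ?case using assms(4,5,6)
  proof (induction rule: WW.induct)
    case (WW_base j' a' k' b')
    have c: "a \<in> alg" "b \<in> alg" "a' \<in> alg" "b' \<in> alg"
      using ab WW_base CC_carrier by auto
    show ?case
    proof (cases "k \<le> j'")
      case True
      hence "CC (j' - k) (star b \<otimes> a')" using CC_star[OF ab(2), of "j' - k" a'] WW_base by simp
      from WW.WW_base[OF CC_mult[OF ab(1) this] WW_base(2)]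
      have "WW (j + (j' - k)) k' (a \<otimes> star b \<otimes> (a' \<otimes> star b'))" using c by (simp add: m_assoc)
      thus ?thesis by (rule DD.DD_base) (use ab WW_base True in auto)
    next
      case False
      hence "CC (k - j') (star a' \<otimes> b)" using CC_star[OF WW_base(1), of "k - j'" b] ab by simp
      from WW.WW_base[OF ab(1) CC_mult[OF WW_base(2) this]]
      have "WW j (k' + (k - j')) (a \<otimes> star b \<otimes> (a' \<otimes> star b'))" using c by (simp add: m_assoc adj_mult)
      thus ?thesis by (rule DD.DD_base) (use ab WW_base False in auto)
    qed
  next
    case (WW_add j k x y)
    thus ?case using ab CC_carrier WW_carrier by (simp add: r_distr DD_add)
  qed
next
  case (WW_add j k x x')
  thus ?case using WW_carrier[OF assms(4)] WW_carrier by (simp add: l_distr DD_add)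
qed

lemma DD_mult: assumes "DD D x" "DD D' y" shows "DD (D + D') (x \<otimes> y)"
  using assms
proof (induction rule: DD.induct)
  case (DD_base j k x D)
  note x = DD_base
  show ?case using x(4)
  proof (induction rule: DD.induct)
    case (DD_base j' k' y D') thus ?case using DD_WW_WW x by blast
  next
    case (DD_add D' y y') thus ?case using DD_carrier WW_carrier[OF x(1)] by (simp add: r_distr DD.DD_add)
  qed
next
  case (DD_add D x x') thus ?case using DD_carrier by (simp add: l_distr DD.DD_add)
qed

lemma DD_E: "e \<in> E \<Longrightarrow> DD 0 e"
  using DD_base[OF WW_base[OF CC_0 CC_one], of e 0] Ec by simp

lemma DD_l: "DD 1 l" using DD_base[OF WW_base[OF CC_l1 CC_one], of 1] by simp

lemma DD_s: "DD 1 (l \<oplus> star l)" using DD_add[OF DD_l DD_star[OF DD_l]] .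

lemma DD_pow: "DD D x \<Longrightarrow> DD (n * D) (x [^] n)"
proof (induction n)
  case 0 thus ?case using DD_E[OF Es(2)] by simp
next
  case (Suc n) thus ?case using DD_mult[of "n * D" "x [^] n" D x] by (simp add: add.commute)
qed

section \<open>Blocks between particle numbers\<close>

text \<open>\<open>Y j k\<close> is the normally ordered component of \<open>x\<close>, while
  \<open>B j k\<close> is its sum along the diagonal ending at \<open>(j, k)\<close>. By the last
  clause \<open>B j k\<close> has the same matrix coefficients as \<open>x\<close> from
  \<open>k\<close>-particle to \<open>j\<close>-particle vectors, so a component is a difference of
  two consecutive blocks.\<close>

definition adapted :: "nat \<Rightarrow> 'a \<Rightarrow> (nat \<Rightarrow> nat \<Rightarrow> 'a) \<Rightarrow> (nat \<Rightarrow> nat \<Rightarrow> 'a) \<Rightarrow> bool" where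
  "adapted D x Y B \<longleftrightarrow>
    (\<forall>j k. WW j k (Y j k)) \<and> x = (\<Oplus>j\<in>{..D}. \<Oplus>k\<in>{..D}. Y j k) \<and> (\<forall>j k. B j k \<in> alg) \<and>
    (\<forall>j. B 0 j = Y 0 j \<and> B j 0 = Y j 0) \<and> (\<forall>j k. B (Suc j) (Suc k) = Y (Suc j) (Suc k) \<oplus> B j k) \<and>
    (\<forall>j k c. CC k c \<longrightarrow> CC j (B j k \<otimes> c)) \<and> (\<forall>j k c. CC j c \<longrightarrow> CC k (star (B j k) \<otimes> c)) \<and>
    (\<forall>j k c u. CC k c \<longrightarrow> CC j u \<longrightarrow> st (star u \<otimes> (x \<otimes> c)) = st (star u \<otimes> (B j k \<otimes> c)))"

lemma adaptedD:
  assumes "adapted D x Y B"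
  shows "WW j k (Y j k)" "x = (\<Oplus>j\<in>{..D}. \<Oplus>k\<in>{..D}. Y j k)" "B j k \<in> alg"
    "B 0 j = Y 0 j" "B j 0 = Y j 0" "B (Suc j) (Suc k) = Y (Suc j) (Suc k) \<oplus> B j k"
    "CC k c \<Longrightarrow> CC j (B j k \<otimes> c)" "CC j c \<Longrightarrow> CC k (star (B j k) \<otimes> c)"
    "CC k c \<Longrightarrow> CC j u \<Longrightarrow> st (star u \<otimes> (x \<otimes> c)) = st (star u \<otimes> (B j k \<otimes> c))"
  using assms unfolding adapted_def by blast+

text \<open>A component with \<open>k0\<close> annihilations and \<open>j0\<close> creations
  contributes to the blocks on its diagonal from \<open>(j0, k0)\<close> onwards. The diagonal is
  written as \<open>j + k0 = k + j0\<close> to avoid truncated subtraction; on other blocks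
  orthogonality of particle numbers makes the coefficients vanish.\<close>

lemma adapted_single:
  assumes x: "WW j0 k0 x" and le: "j0 \<le> D" "k0 \<le> D"
  shows "adapted D x (\<lambda>j k. if j = j0 \<and> k = k0 then x else \<zero>)
     (\<lambda>j k. if j0 \<le> j \<and> j + k0 = k + j0 then x else \<zero>)"
proof -
  have c: "x \<in> alg" using WW_carrier[OF x] .
  have e: "(\<Oplus>k\<in>{..D}. if j = j0 \<and> k = k0 then x else \<zero>) = (if j0 = j then x else \<zero>)" for j
  proof (cases "j = j0")
    case True
    have "(\<Oplus>k\<in>{..D}. if k0 = k then x else \<zero>) = x"
      using add.finprod_singleton[of k0 "{..D}" "\<lambda>_. x"] c le by simp
    thus ?thesis using True by (simp add: eq_commute[of k0])
  qed simp
  have s: "x = (\<Oplus>j\<in>{..D}. \<Oplus>k\<in>{..D}. if j = j0 \<and> k = k0 then x else \<zero>)"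
    unfolding e using add.finprod_singleton[of j0 "{..D}" "\<lambda>_. x"] c le by simp
  have up: "CC j (x \<otimes> d)" if "CC k d" "j0 \<le> j" "j + k0 = k + j0" for j k d
    using WW_CC[OF x, of "j - j0" d] that by (simp add: add.commute)
  have dn: "CC k (star x \<otimes> d)" if "CC j d" "j0 \<le> j" "j + k0 = k + j0" for j k d
  proof -
    have "k0 + (j - j0) = k" using that by linarith
    thus ?thesis using WW_CC[OF WW_star[OF x], of "j - j0" d] that by simp
  qed
  have o: "st (star u \<otimes> (x \<otimes> d)) = 0" if "CC k d" "CC j u" "\<not> (j0 \<le> j \<and> j + k0 = k + j0)" for j k d u
  proof (cases "k < k0")
    case True
    have "N2 (star u \<otimes> (x \<otimes> d)) = 0"
      using WW_CC_null[OF x that(1) True] c CC_carrier that by (simp add: N2_null_mult)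
    thus ?thesis using st_null c CC_carrier that by simp
  next
    case False
    hence "CC (j0 + (k - k0)) (x \<otimes> d)" using WW_CC[OF x, of "k - k0" d] that by simp
    moreover have "j \<noteq> j0 + (k - k0)" using that False by auto
    ultimately show ?thesis using CC_orth[OF that(2)] by blast
  qed
  show ?thesis unfolding adapted_def
  proof (intro conjI allI impI)
    fix j k d u assume d: "CC k d"
    show "CC j ((if j0 \<le> j \<and> j + k0 = k + j0 then x else \<zero>) \<otimes> d)"
      using up[OF d] CC_zero CC_carrier[OF d] by simp
    assume "CC j u"
    thus "st (star u \<otimes> (x \<otimes> d)) = st (star u \<otimes> ((if j0 \<le> j \<and> j + k0 = k + j0 then x else \<zero>) \<otimes> d))"
      using o[OF d] CC_carrier[OF d] CC_carrier[of j u] by simp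
  next
    fix j k d assume d: "CC j d"
    show "CC k (star (if j0 \<le> j \<and> j + k0 = k + j0 then x else \<zero>) \<otimes> d)"
      using dn[OF d] CC_zero CC_carrier[OF d] by simp
  next
    fix j k
    show "WW j k (if j = j0 \<and> k = k0 then x else \<zero>)" using x WW_zero by simp
    show "(if j0 \<le> Suc j \<and> Suc j + k0 = Suc k + j0 then x else \<zero>) =
      (if Suc j = j0 \<and> Suc k = k0 then x else \<zero>) \<oplus> (if j0 \<le> j \<and> j + k0 = k + j0 then x else \<zero>)"
    proof (cases "Suc j = j0 \<and> Suc k = k0")
      case False
      hence "(j0 \<le> Suc j \<and> Suc j + k0 = Suc k + j0) = (j0 \<le> j \<and> j + k0 = k + j0)" by auto
      thus ?thesis using False c by auto
    qed (use c in simp)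
  qed (use s c in auto)
qed

lemma adapted_add:
  assumes 1: "adapted D x Y B" and 2: "adapted D x' Y' B'"
  shows "adapted D (x \<oplus> x') (\<lambda>j k. Y j k \<oplus> Y' j k) (\<lambda>j k. B j k \<oplus> B' j k)"
proof -
  note d1 = adaptedD[OF 1] and d2 = adaptedD[OF 2]
  have Yc [simp]: "Y j k \<in> alg" "Y' j k \<in> alg" for j k using d1(1) d2(1) WW_carrier by blast+
  note [simp] = d1(3) d2(3)
  have s: "x \<oplus> x' = (\<Oplus>j\<in>{..D}. \<Oplus>k\<in>{..D}. Y j k \<oplus> Y' j k)"
    by (subst d1(2), subst d2(2)) (simp add: finsum_addf Pi_def)
  have xc: "x \<in> alg" "x' \<in> alg" by (subst d1(2) d2(2), simp)+
  have st_eq: "st (star u \<otimes> ((x \<oplus> x') \<otimes> c)) = st (star u \<otimes> ((B j k \<oplus> B' j k) \<otimes> c))"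
    if "CC k c" "CC j u" for j k c u
    using d1(9)[OF that] d2(9)[OF that] xc CC_carrier[OF that(1)] CC_carrier[OF that(2)]
    by (simp add: l_distr r_distr st_add)
  have m1: "CC j ((B j k \<oplus> B' j k) \<otimes> c)" if "CC k c" for j k c
    using CC_add[OF d1(7)[OF that] d2(7)[OF that]] CC_carrier[OF that] by (simp add: l_distr)
  have m2: "CC k (star (B j k \<oplus> B' j k) \<otimes> c)" if "CC j c" for j k c
    using CC_add[OF d1(8)[OF that] d2(8)[OF that]] CC_carrier[OF that] by (simp add: l_distr adj_add)
  show ?thesis unfolding adapted_def
  proof (intro conjI allI impI s st_eq m1 m2)
    show "B (Suc j) (Suc k) \<oplus> B' (Suc j) (Suc k) = (Y (Suc j) (Suc k) \<oplus> Y' (Suc j) (Suc k)) \<oplus> (B j k \<oplus> B' j k)" for j k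
      by (simp add: d1(6) d2(6) a_ac)
  qed (auto simp: d1(4,5) d2(4,5) intro: WW_add d1(1) d2(1))
qed

lemma DD_adapted: "DD D x \<Longrightarrow> \<exists>Y B. adapted D x Y B"
  by (induction rule: DD.induct) (blast intro: adapted_single adapted_add)+

text \<open>Testing \<open>x\<close> against the vector \<open>u = B j k c\<close> itself shows that
  passing to a block does not increase the bound.\<close>

lemma adapted_bound:
  assumes ad: "adapted D x Y B" and x: "x \<in> alg" and M: "M \<ge> 0"
    and G: "\<forall>k c. CC k c \<longrightarrow> N2 (x \<otimes> c) \<le> M * N2 c" and c: "CC k c"
  shows "N2 (B j k \<otimes> c) \<le> M * N2 c"
proof -
  define u where "u = B j k \<otimes> c"
  have u: "CC j u" using adaptedD(7)[OF ad c] by (simp add: u_def)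
  have cc: "u \<in> alg" "c \<in> alg" using CC_carrier[OF u] CC_carrier[OF c] .
  have "(N2 u)\<^sup>2 = cmod (st (star u \<otimes> (x \<otimes> c)))"
    using adaptedD(9)[OF ad c u] st_N2[OF cc(1)] by (simp add: u_def)
  also have "\<dots> \<le> N2 u * N2 (x \<otimes> c)" using CS[of u "x \<otimes> c"] cc x by simp
  also have "\<dots> \<le> N2 u * (M * N2 c)" using G c cc by (intro mult_left_mono) auto
  finally show ?thesis unfolding u_def[symmetric] using le_cancel_sq[of "N2 u" "M * N2 c"] cc M by simp
qed

section \<open>Norm estimates from particle vectors\<close>

text \<open>For self-adjoint \<open>R\<close> the moments at a vector are log-convex: the ratio
  \<open>N2 (R c) / N2 c\<close>, raised to \<open>2 ^ i\<close>, is at most the ratio for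
  \<open>R ^ (2 ^ i)\<close>. The growth rate of powers at one vector therefore bounds
  \<open>R\<close> at this vector without any constant.\<close>

lemma N2_power_bound:
  assumes R: "R \<in> alg" "star R = R" and c: "c \<in> alg" and K: "K \<ge> 0"
    and b: "\<And>n. N2 (R [^] n \<otimes> c) \<le> C * K ^ (n::nat)"
  shows "N2 (R \<otimes> c) \<le> K * N2 c"
proof (cases "N2 c = 0")
  case True thus ?thesis using N2_null_mult[OF R(1) c] by simp
next
  case False
  hence a: "N2 c > 0" using c by (simp add: less_le)
  show ?thesis
  proof (cases "K = 0")
    case True thus ?thesis using b[of 1] R by simp
  next
    case False
    have *: "(N2 (R \<otimes> c) / N2 c) ^ (2 ^ i) \<le> N2 (R [^] (2 ^ i :: nat) \<otimes> c) / N2 c" for i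
    proof (induction i)
      case 0 thus ?case using R by simp
    next
      case (Suc i)
      define m :: nat where "m = 2 ^ i"
      have Rm: "R [^] m \<in> alg" "star (R [^] m) = R [^] m" using R by (simp_all add: star_pow)
      have "R [^] m \<otimes> (R [^] m \<otimes> c) = R [^] (m + m) \<otimes> c"
        using R c by (simp add: m_assoc[symmetric] nat_pow_mult)
      hence "(N2 (R [^] m \<otimes> c))\<^sup>2 = cmod (st (star c \<otimes> (R [^] (m + m) \<otimes> c)))"
        using Rm c st_N2[of "R [^] m \<otimes> c"] by (simp add: adj_mult m_assoc)
      also have "\<dots> \<le> N2 c * N2 (R [^] (m + m) \<otimes> c)" using R c by (intro CS) auto
      finally have le: "(N2 (R [^] m \<otimes> c))\<^sup>2 \<le> N2 c * N2 (R [^] (m + m) \<otimes> c)" .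
      have "(N2 (R \<otimes> c) / N2 c) ^ (2 ^ Suc i) = ((N2 (R \<otimes> c) / N2 c) ^ m)\<^sup>2"
        by (simp add: m_def mult.commute flip: power_mult)
      also have "\<dots> \<le> (N2 (R [^] m \<otimes> c) / N2 c)\<^sup>2"
        using Suc R c unfolding m_def by (intro power_mono) auto
      also have "\<dots> = (N2 (R [^] m \<otimes> c))\<^sup>2 / (N2 c * N2 c)" by (simp add: power_divide power2_eq_square)
      also have "\<dots> \<le> (N2 c * N2 (R [^] (m + m) \<otimes> c)) / (N2 c * N2 c)"
        using le by (intro divide_right_mono) auto
      also have "\<dots> = N2 (R [^] (2 ^ Suc i :: nat) \<otimes> c) / N2 c" using a by (simp add: m_def mult_2)
      finally show ?case .
    qed
    have "N2 (R \<otimes> c) / N2 c \<le> K"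
    proof (rule le_of_powers_le_const[where C = "C / N2 c"])
      show "K > 0" using K False by simp
      show "(N2 (R \<otimes> c) / N2 c) ^ (2 ^ i) \<le> C / N2 c * K ^ (2 ^ i)" for i
        using order_trans[OF *[of i] divide_right_mono[OF b[of "2 ^ i"]]] a by simp
    qed
    thus ?thesis using a by (simp add: field_simps)
  qed
qed

lemma N2_sq_bound:
  assumes x: "x \<in> alg" and c: "c \<in> alg" and K: "K \<ge> 0"
    and b: "\<And>n. N2 ((star x \<otimes> x) [^] n \<otimes> c) \<le> C * (K\<^sup>2) ^ (n::nat)"
  shows "N2 (x \<otimes> c) \<le> K * N2 c"
proof -
  have "N2 ((star x \<otimes> x) \<otimes> c) \<le> K\<^sup>2 * N2 c"
    by (rule N2_power_bound[OF _ _ c _ b]) (use x in \<open>auto simp: adj_mult\<close>)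
  moreover have "(N2 (x \<otimes> c))\<^sup>2 = cmod (st (star c \<otimes> ((star x \<otimes> x) \<otimes> c)))"
    using x c st_N2[of "x \<otimes> c"] by (simp add: adj_mult m_assoc)
  moreover have "\<dots> \<le> N2 c * N2 ((star x \<otimes> x) \<otimes> c)" using x c by (intro CS) auto
  ultimately have "(N2 (x \<otimes> c))\<^sup>2 \<le> N2 c * (K\<^sup>2 * N2 c)"
    using mult_left_mono[of "N2 ((star x \<otimes> x) \<otimes> c)" "K\<^sup>2 * N2 c" "N2 c"] N2_nonneg[OF c] by linarith
  hence "(N2 (x \<otimes> c))\<^sup>2 \<le> (K * N2 c)\<^sup>2" by (simp add: power2_eq_square mult_ac)
  thus ?thesis by (rule power2_le_imp_le) (use K c in simp)
qed

lemma iterate_bound: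
  assumes T: "T \<in> alg" and M: "M \<ge> 0"
    and up': "\<forall>c. CC k c \<longrightarrow> CC j (T \<otimes> c)" and dn': "\<forall>d. CC j d \<longrightarrow> CC k (star T \<otimes> d)"
    and b': "\<forall>c. CC k c \<longrightarrow> N2 (T \<otimes> c) \<le> M * N2 c" and c: "CC k c"
  shows "CC k ((star T \<otimes> T) [^] n \<otimes> c) \<and> N2 ((star T \<otimes> T) [^] n \<otimes> c) \<le> (M\<^sup>2) ^ n * N2 c"
  using c
proof (induction n arbitrary: c)
  case 0 thus ?case using CC_carrier[OF 0] by simp
next
  case (Suc n)
  note up = up'[rule_format] and dn = dn'[rule_format] and b = b'[rule_format]
  have cc: "c \<in> alg" using CC_carrier[OF Suc.prems] .
  have 1: "CC k ((star T \<otimes> T) \<otimes> c)" using dn[OF up[OF Suc.prems]] T cc by (simp add: m_assoc)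
  have "N2 (star T \<otimes> (T \<otimes> c)) \<le> M * N2 (T \<otimes> c)"
    using adj_N2_bound[OF T _ M b[OF dn[OF up[OF Suc.prems]]]] T cc by simp
  also have "\<dots> \<le> M * (M * N2 c)" using b[OF Suc.prems] M by (intro mult_left_mono)
  finally have 2: "N2 ((star T \<otimes> T) \<otimes> c) \<le> M\<^sup>2 * N2 c" using T cc by (simp add: m_assoc power2_eq_square mult.assoc)
  have 3: "(star T \<otimes> T) [^] Suc n \<otimes> c = (star T \<otimes> T) [^] n \<otimes> ((star T \<otimes> T) \<otimes> c)"
    using T cc by (simp add: m_assoc)
  have "N2 ((star T \<otimes> T) [^] n \<otimes> ((star T \<otimes> T) \<otimes> c)) \<le> (M\<^sup>2) ^ n * N2 ((star T \<otimes> T) \<otimes> c)"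
    using Suc.IH[OF 1] by simp
  also have "\<dots> \<le> (M\<^sup>2) ^ n * (M\<^sup>2 * N2 c)" using 2 by (intro mult_left_mono) auto
  finally show ?case unfolding 3 using Suc.IH[OF 1] by (simp add: mult_ac)
qed

text \<open>\<open>T\<close> acts on the leading tensor factors, so one further particle on the
  right cannot enlarge its norm. For a single term \<open>c l e\<close> this is
  \<open>N2_CC_l\<close>; for a sum the triangle inequality costs a constant, which
  \<open>N2_sq_bound\<close> removes through powers.\<close>

lemma amplify:
  assumes T: "T \<in> alg" and M: "M \<ge> 0"
    and up': "\<forall>c. CC k c \<longrightarrow> CC j (T \<otimes> c)" and dn': "\<forall>d. CC j d \<longrightarrow> CC k (star T \<otimes> d)"
    and b': "\<forall>c. CC k c \<longrightarrow> N2 (T \<otimes> c) \<le> M * N2 c" and c: "CC (Suc k) c"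
  shows "N2 (T \<otimes> c) \<le> M * N2 c"
proof -
  note it = iterate_bound[OF T M up' dn' b']
  define R where "R = star T \<otimes> T"
  have R: "R \<in> alg" using T by (simp add: R_def)
  have "\<exists>C. \<forall>n::nat. N2 (R [^] n \<otimes> c) \<le> C * (M\<^sup>2) ^ n" if "RC k' c" "k' = k" for k' c
    using that
  proof (induction rule: RC.induct)
    case (RC_base k' c e)
    have c: "CC k c" "c \<in> alg" using RC_base CC_carrier by auto
    have "N2 (R [^] n \<otimes> (c \<otimes> (l \<otimes> e))) \<le> N2 c * N2 e * (M\<^sup>2) ^ n" for n :: nat
    proof -
      have "N2 (R [^] n \<otimes> (c \<otimes> (l \<otimes> e))) = N2 ((R [^] n \<otimes> c) \<otimes> (l \<otimes> e))"
        using R c Ec[OF RC_base(2)] by (simp add: m_assoc)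
      also have "\<dots> = N2 (R [^] n \<otimes> c) * N2 e"
        using N2_CC_l[of k "R [^] n \<otimes> c" e] it[OF c(1), of n] Ec[OF RC_base(2)] by (simp add: R_def)
      also have "\<dots> \<le> (M\<^sup>2) ^ n * N2 c * N2 e"
        using it[OF c(1), of n] Ec[OF RC_base(2)] by (intro mult_right_mono) (auto simp: R_def)
      finally show ?thesis by (simp add: mult_ac)
    qed
    thus ?case by blast
  next
    case (RC_add k' c d)
    then obtain C C' where C: "\<And>n::nat. N2 (R [^] n \<otimes> c) \<le> C * (M\<^sup>2) ^ n" "\<And>n::nat. N2 (R [^] n \<otimes> d) \<le> C' * (M\<^sup>2) ^ n"
      by blast
    have cd: "c \<in> alg" "d \<in> alg" using RC_add RC_carrier by auto
    have "N2 (R [^] n \<otimes> (c \<oplus> d)) \<le> (C + C') * (M\<^sup>2) ^ n" for n :: nat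
      using N2_triangle[of "R [^] n \<otimes> c" "R [^] n \<otimes> d"] C(1)[of n] C(2)[of n] R cd
      by (simp add: r_distr distrib_right)
    thus ?case by blast
  qed
  then obtain C where "\<And>n::nat. N2 (R [^] n \<otimes> c) \<le> C * (M\<^sup>2) ^ n" using CC_RC[OF c] by blast
  thus ?thesis using N2_sq_bound[OF T CC_carrier[OF c] M] unfolding R_def by blast
qed

text \<open>The passage from vectors to the operator norm. Powers of
  \<open>star T \<otimes> T\<close> expand into finitely many entries of the form
  \<open>star a \<otimes> (R [^] n \<otimes> a')\<close>, which lie in \<open>E\<close> and are
  controlled by \<open>iso\<close>. The number and size of the outer factors do not depend on the
  power.\<close>

lemma WW_nrm_bound:
  assumes T: "WW j k T" and K: "K \<ge> 0"
    and b: "\<forall>c. CC k c \<longrightarrow> N2 (T \<otimes> c) \<le> K * N2 c"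
  shows "nn T \<le> K"
proof -
  note b = b[rule_format]
  have Tc: "T \<in> alg" using WW_carrier[OF T] .
  have up: "CC j (T \<otimes> c)" if "CC k c" for c using WW_CC[OF T, of 0 c] that by simp
  have dn: "CC k (star T \<otimes> c)" if "CC j c" for c using WW_CC[OF WW_star[OF T], of 0 c] that by simp
  have b': "N2 (star T \<otimes> d) \<le> K * N2 d" if "CC j d" for d
    using adj_N2_bound[OF Tc CC_carrier[OF that] K b[OF dn[OF that]]] .
  define R where "R = T \<otimes> star T"
  have R: "R \<in> alg" using Tc by (simp add: R_def)
  have it: "CC j (R [^] n \<otimes> c) \<and> N2 (R [^] n \<otimes> c) \<le> (K\<^sup>2) ^ n * N2 c" if "CC j c" for c and n :: nat
    using iterate_bound[of "star T" K j k c n] K dn b' that Tc up by (simp add: R_def)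
  \<comment> \<open>The creations in \<open>a'\<close> and the annihilations in
    \<open>star a\<close> are equally many and \<open>R\<close> preserves the particle number, so
    the entry lies in \<open>E\<close>.\<close>
  have entry: "nn (star a \<otimes> (R [^] n \<otimes> a')) \<le> nn a * nn a' * (K\<^sup>2) ^ n" if a: "CC j a" "CC j a'" for a a' and n :: nat
  proof (rule iso)
    have c: "a \<in> alg" "a' \<in> alg" using a CC_carrier by auto
    show "star a \<otimes> (R [^] n \<otimes> a') \<in> E"
      using CC_star[OF a(1), of 0 "R [^] n \<otimes> a'"] it[OF a(2)] CC_0D by simp
    show "0 \<le> nn a * nn a' * (K\<^sup>2) ^ n" using c by simp
    fix x assume x: "x \<in> E"
    have xc: "x \<in> alg" using Ec[OF x] .
    have ax: "CC j (a' \<otimes> x)" using CC_mult[OF a(2) CC_0[OF x]] by simp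
    have "N2 (star a \<otimes> (R [^] n \<otimes> a') \<otimes> x) = N2 (star a \<otimes> (R [^] n \<otimes> (a' \<otimes> x)))"
      using c xc R by (simp add: m_assoc)
    also have "\<dots> \<le> nn a * N2 (R [^] n \<otimes> (a' \<otimes> x))" using N2_mult[of "star a" "R [^] n \<otimes> (a' \<otimes> x)"] c xc R by simp
    also have "\<dots> \<le> nn a * ((K\<^sup>2) ^ n * (nn a' * N2 x))"
      using it[OF ax, of n] N2_mult[OF c(2) xc] c
      by (intro mult_left_mono order_trans[OF conjunct2[OF it[OF ax]]]) auto
    finally show "N2 (star a \<otimes> (R [^] n \<otimes> a') \<otimes> x) \<le> nn a * nn a' * (K\<^sup>2) ^ n * N2 x"
      by (simp add: mult_ac)
  qed
  have right: "\<exists>C. \<forall>n::nat. nn (star a \<otimes> (R [^] n \<otimes> S)) \<le> C * (K\<^sup>2) ^ n"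
    if a: "CC j a" and S: "WW j' k' S" "j' = j" for a j' k' S
    using S
  proof (induction rule: WW.induct)
    case (WW_base j' a' k' b')
    have c: "a \<in> alg" "a' \<in> alg" "b' \<in> alg" using a WW_base CC_carrier by auto
    have "nn (star a \<otimes> (R [^] n \<otimes> (a' \<otimes> star b'))) \<le> nn a * nn a' * nn b' * (K\<^sup>2) ^ n" for n :: nat
    proof -
      have "star a \<otimes> (R [^] n \<otimes> (a' \<otimes> star b')) = star a \<otimes> (R [^] n \<otimes> a') \<otimes> star b'"
        using c R by (simp add: m_assoc)
      hence "nn (star a \<otimes> (R [^] n \<otimes> (a' \<otimes> star b'))) \<le> nn (star a \<otimes> (R [^] n \<otimes> a')) * nn b'"
        using nrm_mult[of "star a \<otimes> (R [^] n \<otimes> a')" "star b'"] c R by simp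
      also have "\<dots> \<le> nn a * nn a' * (K\<^sup>2) ^ n * nn b'"
        using entry[OF a, of a' n] WW_base c by (intro mult_right_mono) auto
      finally show ?thesis by (simp add: mult_ac)
    qed
    thus ?case by blast
  next
    case (WW_add j' k' x y)
    then obtain C C' where C: "\<And>n::nat. nn (star a \<otimes> (R [^] n \<otimes> x)) \<le> C * (K\<^sup>2) ^ n"
      "\<And>n::nat. nn (star a \<otimes> (R [^] n \<otimes> y)) \<le> C' * (K\<^sup>2) ^ n" by blast
    have c: "a \<in> alg" "x \<in> alg" "y \<in> alg" using a WW_add CC_carrier WW_carrier by auto
    have "nn (star a \<otimes> (R [^] n \<otimes> (x \<oplus> y))) \<le> (C + C') * (K\<^sup>2) ^ n" for n :: nat
      using nrm_triangle[of "star a \<otimes> (R [^] n \<otimes> x)" "star a \<otimes> (R [^] n \<otimes> y)"] C(1)[of n] C(2)[of n] R c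
      by (simp add: r_distr distrib_right)
    thus ?case by blast
  qed
  have left: "\<exists>C. \<forall>n::nat. nn (star S \<otimes> (R [^] n \<otimes> T)) \<le> C * (K\<^sup>2) ^ n"
    if S: "WW j' k' S" "j' = j" for j' k' S
    using S
  proof (induction rule: WW.induct)
    case (WW_base j' a k' b)
    obtain C where C: "\<And>n::nat. nn (star a \<otimes> (R [^] n \<otimes> T)) \<le> C * (K\<^sup>2) ^ n"
      using right[OF _ T] WW_base by blast
    have c: "a \<in> alg" "b \<in> alg" using WW_base CC_carrier by auto
    have "nn (star (a \<otimes> star b) \<otimes> (R [^] n \<otimes> T)) \<le> nn b * C * (K\<^sup>2) ^ n" for n :: nat
    proof -
      have "star (a \<otimes> star b) \<otimes> (R [^] n \<otimes> T) = b \<otimes> (star a \<otimes> (R [^] n \<otimes> T))"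
        using c R Tc by (simp add: m_assoc adj_mult)
      hence "nn (star (a \<otimes> star b) \<otimes> (R [^] n \<otimes> T)) \<le> nn b * nn (star a \<otimes> (R [^] n \<otimes> T))"
        using nrm_mult[of b "star a \<otimes> (R [^] n \<otimes> T)"] c R Tc by simp
      also have "\<dots> \<le> nn b * (C * (K\<^sup>2) ^ n)" using C c by (intro mult_left_mono) auto
      finally show ?thesis by (simp add: mult_ac)
    qed
    thus ?case by blast
  next
    case (WW_add j' k' x y)
    then obtain C C' where C: "\<And>n::nat. nn (star x \<otimes> (R [^] n \<otimes> T)) \<le> C * (K\<^sup>2) ^ n"
      "\<And>n::nat. nn (star y \<otimes> (R [^] n \<otimes> T)) \<le> C' * (K\<^sup>2) ^ n" by blast
    have c: "x \<in> alg" "y \<in> alg" using WW_add WW_carrier by auto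
    have "nn (star (x \<oplus> y) \<otimes> (R [^] n \<otimes> T)) \<le> (C + C') * (K\<^sup>2) ^ n" for n :: nat
      using nrm_triangle[of "star x \<otimes> (R [^] n \<otimes> T)" "star y \<otimes> (R [^] n \<otimes> T)"] C(1)[of n] C(2)[of n] R Tc c
      by (simp add: l_distr adj_add distrib_right)
    thus ?case by blast
  qed
  obtain C where C: "\<And>n::nat. nn (star T \<otimes> (R [^] n \<otimes> T)) \<le> C * (K\<^sup>2) ^ n" using left[OF T] by blast
  note [simp del] = nat_pow_Suc
  \<comment> \<open>Splitting off the outer \<open>star T\<close> and \<open>T\<close> leaves powers
    of \<open>R\<close>, which preserve \<open>j\<close>-particle vectors, at the price of lowering
    the exponent by one.\<close>
  have pw: "(star T \<otimes> T) [^] Suc n = star T \<otimes> (R [^] n \<otimes> T)" for n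
  proof (induction n)
    case 0 thus ?case using Tc by (simp add: nat_pow_Suc)
  next
    case (Suc n)
    have "(star T \<otimes> T) [^] Suc (Suc n) = (star T \<otimes> T) [^] Suc n \<otimes> (star T \<otimes> T)" by (rule nat_pow_Suc)
    also have "\<dots> = star T \<otimes> (R [^] n \<otimes> T) \<otimes> (star T \<otimes> T)" using Suc by (simp only:)
    also have "\<dots> = star T \<otimes> (R [^] n \<otimes> R \<otimes> T)" using Tc R by (simp add: m_assoc R_def)
    finally show ?case by (simp add: nat_pow_Suc)
  qed
  have sq: "((nn T)\<^sup>2) ^ (2 ^ i) = nn ((star T \<otimes> T) [^] (2 ^ i :: nat))" for i
    using nrm_pow_self_adj[of "star T \<otimes> T" i] Tc by (simp add: adj_mult nrm_adj_mult)
  have bd: "((nn T)\<^sup>2) ^ (2 ^ i) \<le> C * (K\<^sup>2) ^ (2 ^ i - 1)" for i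
  proof -
    obtain n where n: "(2::nat) ^ i = Suc n" by (metis not0_implies_Suc power_not_zero zero_neq_numeral)
    hence "((nn T)\<^sup>2) ^ (2 ^ i) = nn (star T \<otimes> (R [^] n \<otimes> T))" by (metis sq pw)
    thus ?thesis using C[of n] n by simp
  qed
  show ?thesis
  \<comment> \<open>The missing factor \<open>K^2\<close> is moved into the constant
    \<open>C / K^2\<close>, which needs \<open>K\<close> nonzero. For \<open>K = 0\<close> the index
    \<open>i = 1\<close> is taken, since at \<open>i = 0\<close> the exponent is zero and the bound
    says nothing.\<close>
  proof (cases "K = 0")
    case True
    hence "((nn T)\<^sup>2) ^ 2 \<le> 0" using bd[of 1] by simp
    hence "nn T = 0" by (simp add: power_le_zero_eq flip: power_mult)
    thus ?thesis using K by simp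
  next
    case False
    hence Kp: "K\<^sup>2 > 0" by simp
    have "(nn T)\<^sup>2 \<le> K\<^sup>2"
    proof (rule le_of_powers_le_const[OF Kp, of _ "C / K\<^sup>2"])
      fix i :: nat
      have "(K\<^sup>2) ^ (2 ^ i) = K\<^sup>2 * (K\<^sup>2) ^ (2 ^ i - 1)" by (rule power_eq_if[THEN trans]) simp
      thus "((nn T)\<^sup>2) ^ (2 ^ i) \<le> C / K\<^sup>2 * (K\<^sup>2) ^ (2 ^ i)" using bd[of i] False by simp
    qed
    thus ?thesis using K by (rule power2_le_imp_le)
  qed
qed

lemma nrm_finsum_le:
  assumes "\<And>i. f i \<in> alg" "\<And>i. nn (f i) \<le> b"
  shows "nn (\<Oplus>i\<in>{..D::nat}. f i) \<le> (real D + 1) * b"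
proof (induction D)
  case 0 thus ?case using assms by simp
next
  case (Suc D)
  have "nn (\<Oplus>i\<in>{..Suc D}. f i) \<le> nn (f (Suc D)) + nn (\<Oplus>i\<in>{..D}. f i)"
    using assms by (simp add: Pi_def nrm_triangle)
  thus ?case using Suc assms(2)[of "Suc D"] by (simp add: algebra_simps)
qed

text \<open>Each component is a difference of two consecutive blocks, whence \<open>2 * M\<close>,
  and there are \<open>(D + 1)^2\<close> components. The smaller block acts on one particle more
  than it was bounded for, which is where \<open>amplify\<close> enters.\<close>

lemma DD_nrm_bound:
  assumes x: "DD D x" and M: "M \<ge> 0" and G: "\<forall>k c. CC k c \<longrightarrow> N2 (x \<otimes> c) \<le> M * N2 c"
  shows "nn x \<le> 2 * M * (real D + 1)\<^sup>2"
proof -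
  obtain Y B where ad: "adapted D x Y B" using DD_adapted[OF x] by blast
  note d = adaptedD[OF ad]
  have Yc [simp]: "Y j k \<in> alg" for j k using WW_carrier[OF d(1)] .
  note Bb = adapted_bound[OF ad DD_carrier[OF x] M G]
  have Y2: "N2 (Y j k \<otimes> c) \<le> (2 * M) * N2 c" if c: "CC k c" for j k c
  proof (cases "j = 0 \<or> k = 0")
    case True
    hence "Y j k = B j k" using d(4,5) by metis
    moreover have "0 \<le> M * N2 c" using M CC_carrier[OF c] by simp
    ultimately show ?thesis using Bb[OF c, of j] by simp
  next
    case False
    then obtain j' k' where jk: "j = Suc j'" "k = Suc k'" by (metis not0_implies_Suc)
    have cc: "c \<in> alg" using CC_carrier[OF c] .
    have "Y j k = B j k \<ominus> B j' k'"
      unfolding jk d(6) using d(3) by (simp add: minus_eq a_assoc r_neg)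
    hence "Y j k \<otimes> c = B j k \<otimes> c \<ominus> B j' k' \<otimes> c" using d(3) cc by (simp add: minus_eq l_distr l_minus)
    hence "N2 (Y j k \<otimes> c) \<le> N2 (B j k \<otimes> c) + N2 (B j' k' \<otimes> c)"
      using N2_minus_triangle[of "B j k \<otimes> c" "B j' k' \<otimes> c"] d(3) cc by simp
    also have "\<dots> \<le> M * N2 c + M * N2 c"
      using Bb[OF c] amplify[OF d(3) M, of k' j' j' k' c] d(7,8) Bb c jk by (intro add_mono) auto
    finally show ?thesis by simp
  qed
  have nY: "nn (Y j k) \<le> 2 * M" for j k using WW_nrm_bound[OF d(1)[of j k], of "2 * M"] M Y2 by simp
  have "nn x \<le> (real D + 1) * ((real D + 1) * (2 * M))"
    unfolding d(2) by (intro nrm_finsum_le nY) simp_all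
  thus ?thesis by (simp add: power2_eq_square mult_ac)
qed

lemma CC_approx:
  assumes P: "star_subalg P" and PE: "E \<subseteq> P" and s: "l \<oplus> star l \<in> P"
  shows "CC k c \<Longrightarrow> \<exists>y\<in>P. N2 (c \<ominus> y) = 0"
proof (induction k arbitrary: c rule: less_induct)
  case (less k)
  note p = star_subalgD[OF P]
  from less.prems less.IH show ?case
  proof (induction rule: CC.induct)
    case (CC_0 e) thus ?case using PE Ec by (intro bexI[of _ e]) (auto simp: minus_eq r_neg)
  next
    case (CC_Suc e k c)
    have c: "c \<in> alg" "e \<in> alg" using CC_Suc CC_carrier Ec by auto
    obtain y where y: "y \<in> P" "N2 (c \<ominus> y) = 0" using CC_Suc.prems[of k c] CC_Suc by auto
    obtain z where z: "z \<in> P" "N2 (star l \<otimes> c \<ominus> z) = 0"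
    proof (cases k)
      case 0
      hence "c \<in> E" using CC_0D CC_Suc by blast
      thus ?thesis using that[of \<zero>] p(7) lE c by (simp add: minus_eq)
    next
      case (Suc k')
      hence "CC k' (star l \<otimes> c)" using CC_annihilate[of k c k' \<one>] CC_Suc Es c by simp
      thus ?thesis using CC_Suc.prems[of k' "star l \<otimes> c"] Suc that by auto
    qed
    have yz: "y \<in> alg" "z \<in> alg" using y z p by auto
    have "e \<otimes> (l \<otimes> c) \<ominus> e \<otimes> ((l \<oplus> star l) \<otimes> y \<ominus> z)
        = e \<otimes> (((l \<oplus> star l) \<otimes> (c \<ominus> y)) \<ominus> (star l \<otimes> c \<ominus> z))"
    proof -
      have "l \<otimes> c \<ominus> ((l \<oplus> star l) \<otimes> y \<ominus> z) = ((l \<oplus> star l) \<otimes> (c \<ominus> y)) \<ominus> (star l \<otimes> c \<ominus> z)"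
        using c yz by (simp add: ring_exp)
      moreover have "e \<otimes> (l \<otimes> c) \<ominus> e \<otimes> ((l \<oplus> star l) \<otimes> y \<ominus> z) = e \<otimes> (l \<otimes> c \<ominus> ((l \<oplus> star l) \<otimes> y \<ominus> z))"
        using c yz by (simp only: minus_eq r_distr r_minus m_closed a_closed a_inv_closed adj_closed l)
      ultimately show ?thesis by simp
    qed
    moreover have "N2 (e \<otimes> (((l \<oplus> star l) \<otimes> (c \<ominus> y)) \<ominus> (star l \<otimes> c \<ominus> z))) = 0"
    proof (rule N2_null_mult)
      have "N2 ((l \<oplus> star l) \<otimes> (c \<ominus> y)) = 0" using y c yz by (intro N2_null_mult) auto
      thus "N2 (((l \<oplus> star l) \<otimes> (c \<ominus> y)) \<ominus> (star l \<otimes> c \<ominus> z)) = 0"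
        unfolding minus_eq[of "(l \<oplus> star l) \<otimes> (c \<ominus> y)"] using z c yz by (intro N2_null_add) auto
    qed (use c yz in auto)
    moreover have "e \<otimes> ((l \<oplus> star l) \<otimes> y \<ominus> z) \<in> P"
      using p(4,9) PE CC_Suc(1) s y(1) z(1) by blast
    ultimately show ?case by metis
  next
    case (CC_add k c d)
    obtain y z where y: "y \<in> P" "N2 (c \<ominus> y) = 0" and z: "z \<in> P" "N2 (d \<ominus> z) = 0" using CC_add by blast
    have cc: "c \<in> alg" "d \<in> alg" "y \<in> alg" "z \<in> alg"
      using CC_add CC_carrier y z p by auto
    have "(c \<oplus> d) \<ominus> (y \<oplus> z) = (c \<ominus> y) \<oplus> (d \<ominus> z)" using cc by algebra
    hence "N2 ((c \<oplus> d) \<ominus> (y \<oplus> z)) = 0" using y z cc by (simp add: N2_null_add)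
    thus ?case using p(3)[OF y(1) z(1)] by blast
  qed
qed

text \<open>\<open>DD_nrm_bound\<close> is applied to powers of \<open>R = y* y\<close>, whose
  degree grows linearly with the exponent, and \<open>le_of_powers_le\<close> absorbs the quadratic
  factor. By \<open>CC_approx\<close> the hypothesis on vectors from \<open>P\<close> covers all
  particle vectors.\<close>

theorem nrm_le_GNS:
  assumes P: "star_subalg P" and PE: "E \<subseteq> P" and s: "l \<oplus> star l \<in> P"
    and PD: "\<And>x. x \<in> P \<Longrightarrow> \<exists>D. DD D x"
    and y: "y \<in> P" and M: "M \<ge> 0" and G: "\<And>x. x \<in> P \<Longrightarrow> N2 (y \<otimes> x) \<le> M * N2 x"
  shows "nn y \<le> M"
proof -
  note p = star_subalgD[OF P]
  have yc: "y \<in> alg" using p(1)[OF y] .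
  obtain D where D: "DD D y" using PD[OF y] by blast
  define R where "R = star y \<otimes> y"
  have R: "R \<in> alg" "star R = R" "R \<in> P" using yc p y by (auto simp: R_def adj_mult)
  have DR: "DD (n * (2 * D)) (R [^] n)" for n :: nat
    using DD_pow[OF DD_mult[OF DD_star[OF D] D], of n] by (simp add: R_def mult_2)
  have Rp: "R [^] n \<otimes> x \<in> P" if "x \<in> P" for x and n :: nat
  proof -
    have "R [^] n \<in> P" by (induction n) (use p R in auto)
    thus ?thesis using p(4) that by blast
  qed
  have GR: "N2 (R [^] n \<otimes> x) \<le> (M\<^sup>2) ^ n * N2 x" if x: "x \<in> P" for x and n :: nat
  proof (induction n)
    case 0 thus ?case using p(1)[OF x] by simp
  next
    case (Suc n)
    define z where "z = R [^] n \<otimes> x"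
    have z: "z \<in> P" "z \<in> alg" using Rp[OF x] p by (auto simp: z_def)
    have "R [^] Suc n \<otimes> x = star y \<otimes> (y \<otimes> z)"
      using R p(1)[OF x] yc nat_pow_Suc2[of R n] by (simp add: z_def R_def m_assoc del: nat_pow_Suc)
    moreover have "N2 (star y \<otimes> (y \<otimes> z)) \<le> M * N2 (y \<otimes> z)"
    proof (rule adj_N2_bound[OF yc _ M])
      show "N2 (y \<otimes> (star y \<otimes> (y \<otimes> z))) \<le> M * N2 (star y \<otimes> (y \<otimes> z))"
        by (rule G[OF p(4)[OF p(6)[OF y] p(4)[OF y z(1)]]])
    qed (use yc z in simp)
    moreover have "M * N2 (y \<otimes> z) \<le> M * (M * ((M\<^sup>2) ^ n * N2 x))"
      using Suc M unfolding z_def[symmetric] by (intro mult_left_mono order_trans[OF G[OF z(1)]])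
    ultimately show ?case by (simp add: power2_eq_square mult_ac)
  qed
  have bd: "((nn y)\<^sup>2) ^ (2 ^ i) \<le> 2 * (2 ^ i * (2 * real D) + 1)\<^sup>2 * (M\<^sup>2) ^ (2 ^ i)" for i
  proof -
    define n :: nat where "n = 2 ^ i"
    have "N2 (R [^] n \<otimes> c) \<le> (M\<^sup>2) ^ n * N2 c" if c: "CC k c" for k c
    proof -
      obtain x where x: "x \<in> P" "N2 (c \<ominus> x) = 0" using CC_approx[OF P PE s c] by blast
      have cc: "c \<in> alg" "x \<in> alg" using CC_carrier[OF c] p x by auto
      have e: "c = x \<oplus> (c \<ominus> x)" "x = c \<oplus> \<ominus> (c \<ominus> x)" using cc by (simp_all add: ring_exp)
      have "N2 (R [^] n \<otimes> c) = N2 (R [^] n \<otimes> x \<oplus> R [^] n \<otimes> (c \<ominus> x))"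
        using cc R by (subst e(1)) (simp add: r_distr)
      also have "\<dots> \<le> N2 (R [^] n \<otimes> x) + N2 (R [^] n \<otimes> (c \<ominus> x))" using cc R by (intro N2_triangle) auto
      also have "N2 (R [^] n \<otimes> (c \<ominus> x)) = 0" using cc R x by (intro N2_null_mult) auto
      also have "N2 (R [^] n \<otimes> x) + 0 \<le> (M\<^sup>2) ^ n * N2 x" using GR[OF x(1)] by simp
      also have "N2 x \<le> N2 c + 0"
        using N2_triangle[of c "\<ominus> (c \<ominus> x)"] x(2) cc unfolding e(2)[symmetric] by simp
      finally show ?thesis by (simp add: mult_left_mono)
    qed
    hence "\<forall>k c. CC k c \<longrightarrow> N2 (R [^] n \<otimes> c) \<le> (M\<^sup>2) ^ n * N2 c" by blast
    from DD_nrm_bound[OF DR[of n] _ this]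
    have "nn (R [^] n) \<le> 2 * (M\<^sup>2) ^ n * (real (n * (2 * D)) + 1)\<^sup>2" by simp
    moreover have "((nn y)\<^sup>2) ^ (2 ^ i) = nn (R [^] n)"
      using nrm_pow_self_adj[OF R(1,2), of i] yc by (simp add: n_def R_def nrm_adj_mult)
    ultimately show ?thesis by (simp add: n_def mult_ac)
  qed
  show ?thesis
  proof (cases "M = 0")
    case True
    hence "(nn y)\<^sup>2 \<le> 0" using bd[of 0] by simp
    thus ?thesis using True by simp
  next
    case False
    hence "M\<^sup>2 > 0" by simp
    from le_of_powers_le[OF this bd] have "(nn y)\<^sup>2 \<le> M\<^sup>2" .
    thus ?thesis using M by (rule power2_le_imp_le)
  qed
qed

section \<open>Alternating words on the vacuum\<close>

lemma N2_star_l: "N2 (star l) = 0" using lE[OF Es(2)] by simp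

lemma st_l_left: "a \<in> alg \<Longrightarrow> st (l \<otimes> a) = 0"
  using CS[of "star l" a] N2_star_l by simp

lemma st_l_right: "b \<in> alg \<Longrightarrow> st (b \<otimes> star l) = 0"
  using N2_null_mult[of b "star l"] N2_star_l st_null by simp

text \<open>Over the scalars every pure creation term of positive degree starts with
  \<open>l\<close>, so a normally ordered sum is a scalar plus a part beginning with
  \<open>l\<close> plus a part ending with \<open>star l\<close>. The last two have state zero,
  which makes the scalar the mean.\<close>

lemma scalar_DD_form:
  assumes sc: "\<And>e. e \<in> E \<Longrightarrow> \<exists>z. e = sc z \<one>" and x: "DD D x"
  shows "\<exists>z a b. a \<in> alg \<and> b \<in> alg \<and> x = sc z \<one> \<oplus> (l \<otimes> a \<oplus> b \<otimes> star l)"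
proof -
  have Cl: "\<exists>a'\<in>alg. a = l \<otimes> a'" if "CC j a" "j > 0" for j a
    using that
  proof (induction rule: CC.induct)
    case (CC_Suc e k c)
    obtain z where "e = sc z \<one>" using sc CC_Suc by blast
    hence "e \<otimes> (l \<otimes> c) = l \<otimes> sc z c" using CC_carrier[OF CC_Suc(2)] by (simp add: cscale_mult_left cscale_mult_right)
    thus ?case using CC_carrier[OF CC_Suc(2)] by (intro bexI[of _ "sc z c"]) auto
  next
    case (CC_add k c d)
    then obtain c' d' where "c' \<in> alg" "d' \<in> alg" "c = l \<otimes> c'" "d = l \<otimes> d'" by blast
    thus ?case by (intro bexI[of _ "c' \<oplus> d'"]) (auto simp: r_distr)
  qed simp
  have W: "\<exists>z a b. a \<in> alg \<and> b \<in> alg \<and> x = sc z \<one> \<oplus> (l \<otimes> a \<oplus> b \<otimes> star l)" if "WW j k x" for j k x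
    using that
  proof (induction rule: WW.induct)
    case (WW_base j a k b)
    have c: "a \<in> alg" "b \<in> alg" using WW_base CC_carrier by auto
    show ?case
    proof (cases "j > 0")
      case True
      then obtain a' where "a' \<in> alg" "a = l \<otimes> a'" using Cl WW_base by blast
      thus ?thesis using c
        by (intro exI[of _ 0] exI[of _ "a' \<otimes> star b"] exI[of _ \<zero>]) (simp add: m_assoc)
    next
      case j: False
      show ?thesis
      proof (cases "k > 0")
        case True
        then obtain b' where "b' \<in> alg" "b = l \<otimes> b'" using Cl WW_base by blast
        thus ?thesis using c
          by (intro exI[of _ 0] exI[of _ \<zero>] exI[of _ "a \<otimes> star b'"]) (simp add: m_assoc adj_mult)
      next
        case False
        obtain z z' where "a = sc z \<one>" "b = sc z' \<one>" using CC_0D j False WW_base sc by (metis neq0_conv)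
        thus ?thesis
          by (intro exI[of _ "cnj z' * z"] exI[of _ \<zero>]) (simp add: adj_cscale cscale_mult_left cscale_mult_right)
      qed
    qed
  next
    case (WW_add j k x y)
    then obtain z a b z' a' b' where *: "a \<in> alg" "b \<in> alg" "x = sc z \<one> \<oplus> (l \<otimes> a \<oplus> b \<otimes> star l)"
      "a' \<in> alg" "b' \<in> alg" "y = sc z' \<one> \<oplus> (l \<otimes> a' \<oplus> b' \<otimes> star l)" by blast
    hence "x \<oplus> y = sc (z + z') \<one> \<oplus> (l \<otimes> (a \<oplus> a') \<oplus> (b \<oplus> b') \<otimes> star l)"
      by (simp add: cscale_add_left l_distr r_distr a_ac)
    thus ?case using * by blast
  qed
  show ?thesis using x
  proof (induction rule: DD.induct)
    case (DD_base j k x D) thus ?case using W by blast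
  next
    case (DD_add D x y)
    then obtain z a b z' a' b' where *: "a \<in> alg" "b \<in> alg" "x = sc z \<one> \<oplus> (l \<otimes> a \<oplus> b \<otimes> star l)"
      "a' \<in> alg" "b' \<in> alg" "y = sc z' \<one> \<oplus> (l \<otimes> a' \<oplus> b' \<otimes> star l)" by blast
    hence "x \<oplus> y = sc (z + z') \<one> \<oplus> (l \<otimes> (a \<oplus> a') \<oplus> (b \<oplus> b') \<otimes> star l)"
      by (simp add: cscale_add_left l_distr r_distr a_ac)
    thus ?case using * by blast
  qed
qed

abbreviation wprod :: "(bool \<times> 'a) list \<Rightarrow> 'a" where
  "wprod w \<equiv> foldr (\<otimes>) (map snd w) \<one>"

definition lform :: "'a \<Rightarrow> bool" where
  "lform c \<longleftrightarrow> (\<exists>a\<in>alg. \<exists>b\<in>alg. c = l \<otimes> a \<oplus> b \<otimes> star l)"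

text \<open>The centred letters of the two free factors. On the side of \<open>C\<close> the form
  \<open>lform\<close> is used instead of centredness, because it displays creation and
  annihilation; for the dense algebra generated by \<open>s\<close> centredness yields it.\<close>

definition letter :: "bool \<times> 'a \<Rightarrow> bool" where
  "letter p \<longleftrightarrow> (if fst p then lform (snd p) else snd p \<in> E \<and> st (snd p) = 0)"

lemma letter_carrier: "letter p \<Longrightarrow> snd p \<in> alg"
  by (auto simp: letter_def lform_def Ec split: if_splits)

lemma wprod_carrier: "\<forall>p\<in>set w. letter p \<Longrightarrow> wprod w \<in> alg"
  by (induction w) (auto simp: letter_carrier)

lemma N2_null_minus: "\<lbrakk>x \<in> alg; y \<in> alg; z \<in> alg; N2 (x \<ominus> y) = 0\<rbrakk> \<Longrightarrow> N2 (z \<otimes> x \<ominus> z \<otimes> y) = 0"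
  using N2_null_mult[of z "x \<ominus> y"] by (simp add: minus_eq r_distr r_minus)

text \<open>The annihilating half of a letter never contributes: what follows it begins with a
  centred \<open>e\<close> of \<open>E\<close>, and \<open>star l\<close> then produces either a
  null vector by \<open>lE\<close> or the scalar \<open>rho(e) = 0\<close> by \<open>ll\<close>.
  Hence the leading creation survives through the whole word.\<close>

lemma free_words_vacuum:
  assumes "w \<noteq> []" "distinct_adj (map fst w)" "\<forall>p\<in>set w. letter p"
  shows "(fst (hd w) \<longrightarrow> (\<exists>y\<in>alg. N2 (wprod w \<ominus> l \<otimes> y) = 0)) \<and>
    (\<not> fst (hd w) \<longrightarrow> (\<exists>e\<in>E. st e = 0 \<and> (wprod w = e \<or> (\<exists>y\<in>alg. N2 (wprod w \<ominus> e \<otimes> (l \<otimes> y)) = 0))))"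
  using assms
proof (induction w)
  case (Cons p w)
  obtain t c where p: "p = (t, c)" by force
  have w: "\<forall>p\<in>set w. letter p" "distinct_adj (map fst w)" and lp: "letter p"
    using Cons.prems by (auto simp: distinct_adj_Cons)
  have wc: "wprod w \<in> alg" using wprod_carrier w by blast
  have cc: "c \<in> alg" using letter_carrier[OF lp] p by simp
  show ?case
  proof (cases t)
    case True
    then obtain a b where ab: "a \<in> alg" "b \<in> alg" "c = l \<otimes> a \<oplus> b \<otimes> star l"
      using lp p by (auto simp: letter_def lform_def)
    have "\<exists>y\<in>alg. N2 (c \<otimes> wprod w \<ominus> l \<otimes> y) = 0"
    proof (cases "w = []")
      case True
      have "c \<ominus> l \<otimes> a = b \<otimes> star l" using ab by (simp add: ring_exp)
      hence "N2 (c \<ominus> l \<otimes> a) = 0" using ab N2_null_mult[of b "star l"] N2_star_l by simp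
      thus ?thesis using True cc ab(1) by (intro bexI[of _ a]) simp_all
    next
      case False
      have "\<not> fst (hd w)" using Cons.prems False p True by (cases w) auto
      then obtain e where e: "e \<in> E" "st e = 0"
        and or: "wprod w = e \<or> (\<exists>y\<in>alg. N2 (wprod w \<ominus> e \<otimes> (l \<otimes> y)) = 0)"
        using Cons.IH[OF False w(2,1)] by blast
      have ec: "e \<in> alg" using Ec[OF e(1)] .
      from or show ?thesis
      proof
        assume "wprod w = e"
        have "c \<otimes> e \<ominus> l \<otimes> (a \<otimes> e) = b \<otimes> (star l \<otimes> e)" using ab ec by (simp add: ring_exp)
        hence "N2 (c \<otimes> e \<ominus> l \<otimes> (a \<otimes> e)) = 0" using lE[OF e(1)] N2_null_mult[of b "star l \<otimes> e"] ab ec by simp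
        thus ?thesis using \<open>wprod w = e\<close> ab ec by (intro bexI[of _ "a \<otimes> e"]) auto
      next
        assume "\<exists>y\<in>alg. N2 (wprod w \<ominus> e \<otimes> (l \<otimes> y)) = 0"
        then obtain y where y: "y \<in> alg" "N2 (wprod w \<ominus> e \<otimes> (l \<otimes> y)) = 0" by blast
        have "star l \<otimes> (e \<otimes> (l \<otimes> y)) = (star l \<otimes> (e \<otimes> l)) \<otimes> y" using ec y by (simp add: m_assoc)
        hence z: "star l \<otimes> (e \<otimes> (l \<otimes> y)) = \<zero>" using ll[OF e(1)] e y by simp
        have "c \<otimes> (e \<otimes> (l \<otimes> y)) = l \<otimes> (a \<otimes> (e \<otimes> (l \<otimes> y))) \<oplus> b \<otimes> (star l \<otimes> (e \<otimes> (l \<otimes> y)))"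
          using ab ec y by (simp add: l_distr m_assoc)
        also have "\<dots> = l \<otimes> (a \<otimes> (e \<otimes> (l \<otimes> y)))" unfolding z using ab ec y by simp
        finally show ?thesis using N2_null_minus[OF wc _ cc y(2)] ab ec y
          by (intro bexI[of _ "a \<otimes> (e \<otimes> (l \<otimes> y))"]) auto
      qed
    qed
    thus ?thesis using p True by simp
  next
    case False
    hence e: "c \<in> E" "st c = 0" using lp p by (auto simp: letter_def)
    show ?thesis
    proof (cases "w = []")
      case True thus ?thesis using p False e cc by auto
    next
      case w0: False
      have "fst (hd w)" using Cons.prems w0 p False by (cases w) auto
      then obtain y where y: "y \<in> alg" "N2 (wprod w \<ominus> l \<otimes> y) = 0"
        using Cons.IH[OF w0 w(2,1)] by blast
      have "N2 (c \<otimes> wprod w \<ominus> c \<otimes> (l \<otimes> y)) = 0" using N2_null_minus[OF wc _ cc y(2)] y by simp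
      thus ?thesis using p False e y by auto
    qed
  qed
qed simp

lemma free_words:
  assumes "w \<noteq> []" "distinct_adj (map fst w)" "\<forall>p\<in>set w. letter p"
  shows "st (wprod w) = 0"
proof -
  have wc: "wprod w \<in> alg" using wprod_carrier assms by blast
  have eq: "st (wprod w) = st z" if "z \<in> alg" "N2 (wprod w \<ominus> z) = 0" for z
    using st_null[of "wprod w \<ominus> z"] that wc by (simp add: st_diff)
  show ?thesis
  proof (cases "fst (hd w)")
    case True
    then obtain y where "y \<in> alg" "N2 (wprod w \<ominus> l \<otimes> y) = 0" using free_words_vacuum[OF assms] by blast
    thus ?thesis using eq[of "l \<otimes> y"] st_l_left by simp
  next
    case False
    then obtain e where e: "e \<in> E" "st e = 0" "wprod w = e \<or> (\<exists>y\<in>alg. N2 (wprod w \<ominus> e \<otimes> (l \<otimes> y)) = 0)"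
      using free_words_vacuum[OF assms] by blast
    have ec: "e \<in> alg" using Ec e by blast
    have sy: "st (e \<otimes> (l \<otimes> y)) = 0" if y: "y \<in> alg" for y
    proof -
      have "e \<otimes> (l \<otimes> y) = star (star l \<otimes> star e) \<otimes> y" using ec y by (simp add: adj_mult m_assoc)
      thus ?thesis using CS[of "star l \<otimes> star e" y] lE[OF Es(6)[OF e(1)]] ec y by simp
    qed
    from e(3) show ?thesis
    proof
      assume "\<exists>y\<in>alg. N2 (wprod w \<ominus> e \<otimes> (l \<otimes> y)) = 0"
      then obtain y where "y \<in> alg" "N2 (wprod w \<ominus> e \<otimes> (l \<otimes> y)) = 0" by blast
      thus ?thesis using eq[of "e \<otimes> (l \<otimes> y)"] sy ec by simp
    qed (simp add: e(2))
  qed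
qed

end

text \<open>The same \<open>l\<close> also carries a Fock structure over the scalars; it describes
  the algebra generated by \<open>s\<close> alone.\<close>

lemma (in pre_prob) fock_scalars:
  assumes "l \<in> alg" "star l \<otimes> l = \<one>" "N2 (star l) = 0"
  shows "fock A (range (\<lambda>z. sc z \<one>)) l"
proof
  show "star_subalg (range (\<lambda>z. sc z \<one>))"
    unfolding star_subalg_def
    by (auto simp: adj_cscale cscale_mult_left cscale_mult_right image_iff
        intro: exI[of _ 1] exI[of _ "_ + _"] cscale_add_left[symmetric])
  fix e assume "e \<in> range (\<lambda>z. sc z \<one>)"
  then obtain z where z: "e = sc z \<one>" by blast
  show "star l \<otimes> (e \<otimes> l) = sc (st e) \<one>"
    using assms by (simp add: z cscale_mult_left cscale_mult_right st_cscale)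
  show "N2 (star l \<otimes> e) = 0" using assms by (simp add: z cscale_mult_right N2_cscale)
  fix M :: real assume M: "0 \<le> M" "\<And>x. x \<in> range (\<lambda>z. sc z \<one>) \<Longrightarrow> N2 (e \<otimes> x) \<le> M * N2 x"
  have "\<one> \<in> range (\<lambda>z. sc z \<one>)" using cscale_one[OF one_closed] by (metis rangeI)
  from M(2)[OF this] show "nn e \<le> M" by (simp add: z N2_cscale nrm_cscale)
qed (use assms in auto)

section \<open>Reduced words in free unitaries\<close>

text \<open>In the application \<open>B False\<close> is the image of the given algebra and
  \<open>B True\<close> that of the functions on the circle.\<close>

locale free_pair = pre_prob A for A :: "'a cstar_prob" (structure) +
  fixes B :: "bool \<Rightarrow> 'a set"
  assumes Bs: "star_subalg (B s)" and free: "free_family A B"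
begin

lemma Bc: "x \<in> B s \<Longrightarrow> x \<in> alg" using star_subalgD(1)[OF Bs] .

definition wd :: "(bool \<times> 'a) list \<Rightarrow> bool" where
  "wd w \<longleftrightarrow> distinct_adj (map fst w) \<and> (\<forall>p\<in>set w. snd p \<in> B (fst p) \<and> st (snd p) = 0)"

abbreviation pr :: "(bool \<times> 'a) list \<Rightarrow> 'a" where
  "pr w \<equiv> foldr (\<otimes>) (map snd w) \<one>"

lemma wd_free: "wd w \<Longrightarrow> w \<noteq> [] \<Longrightarrow> st (pr w) = 0"
  using free unfolding free_family_def wd_def by (fastforce simp: case_prod_beta)

lemma wd_Nil [simp]: "wd []" by (simp add: wd_def)

lemma wd_Cons: "wd (p # w) \<longleftrightarrow> snd p \<in> B (fst p) \<and> st (snd p) = 0 \<and> wd w \<and> (w \<noteq> [] \<longrightarrow> fst p \<noteq> fst (hd w))"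
  by (cases w) (auto simp: wd_def distinct_adj_Cons)

lemma wd_append: "wd (u @ v) \<longleftrightarrow> wd u \<and> wd v \<and> (u \<noteq> [] \<longrightarrow> v \<noteq> [] \<longrightarrow> fst (last u) \<noteq> fst (hd v))"
  by (auto simp: wd_def distinct_adj_append_iff last_map hd_map)

lemma pr_closed: "wd w \<Longrightarrow> pr w \<in> alg"
  by (induction w) (auto simp: wd_Cons Bc)

lemma pr_append: "wd u \<Longrightarrow> wd v \<Longrightarrow> pr (u @ v) = pr u \<otimes> pr v"
  by (induction u) (auto simp: wd_Cons Bc pr_closed m_assoc)

definition swd :: "(bool \<times> 'a) list \<Rightarrow> (bool \<times> 'a) list" where
  "swd w = rev (map (\<lambda>p. (fst p, star (snd p))) w)"

lemma swd_simps [simp]: "swd [] = []" "swd (u @ v) = swd v @ swd u" "swd w = [] \<longleftrightarrow> w = []"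
  by (auto simp: swd_def)

lemma swd_hd: "w \<noteq> [] \<Longrightarrow> fst (hd (swd w)) = fst (last w)"
  and swd_last: "w \<noteq> [] \<Longrightarrow> fst (last (swd w)) = fst (hd w)"
  by (auto simp: swd_def hd_rev last_rev last_map hd_map)

lemma swd_wd: "wd w \<Longrightarrow> wd (swd w)"
proof (induction w)
  case (Cons p w)
  have "swd (p # w) = swd w @ [(fst p, star (snd p))]" by (simp add: swd_def)
  moreover have "wd [(fst p, star (snd p))]"
    using Cons.prems star_subalgD(6)[OF Bs] st_adj[of "snd p"] Bc by (auto simp: wd_Cons)
  ultimately show ?case using Cons by (auto simp: wd_append wd_Cons swd_last)
qed simp

lemma swd_pr: "wd w \<Longrightarrow> pr (swd w) = star (pr w)"
proof (induction w)
  case (Cons p w)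
  have *: "wd [(fst p, star (snd p))]"
    using Cons.prems star_subalgD(6)[OF Bs] st_adj[of "snd p"] Bc by (auto simp: wd_Cons)
  have "swd (p # w) = swd w @ [(fst p, star (snd p))]" by (simp add: swd_def)
  hence "pr (swd (p # w)) = pr (swd w) \<otimes> pr [(fst p, star (snd p))]"
    using pr_append[OF swd_wd *] Cons.prems by (simp add: wd_Cons)
  moreover have "snd p \<in> alg" "pr w \<in> alg" using Cons.prems Bc pr_closed by (auto simp: wd_Cons)
  ultimately show ?case using Cons by (simp add: wd_Cons adj_mult)
qed simp

text \<open>Linear span of the reduced words satisfying \<open>Q\<close>. Conditions on the first
  and last letter single out the subspaces and operator spaces used below.\<close>

inductive_set Sp :: "((bool \<times> 'a) list \<Rightarrow> bool) \<Rightarrow> 'a set" for Q where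
  Sp_zero: "\<zero> \<in> Sp Q"
| Sp_base: "wd w \<Longrightarrow> Q w \<Longrightarrow> sc c (pr w) \<in> Sp Q"
| Sp_add: "x \<in> Sp Q \<Longrightarrow> y \<in> Sp Q \<Longrightarrow> x \<oplus> y \<in> Sp Q"

lemma Sp_closed: "x \<in> Sp Q \<Longrightarrow> x \<in> alg"
  by (induction rule: Sp.induct) (auto simp: pr_closed)

lemma Sp_word: "wd w \<Longrightarrow> Q w \<Longrightarrow> pr w \<in> Sp Q"
  using Sp_base[of w Q 1] pr_closed by simp

lemma Sp_sc: "x \<in> Sp Q \<Longrightarrow> sc c x \<in> Sp Q"
  by (induction rule: Sp.induct) (auto simp: pr_closed Sp_closed cscale_add_right intro: Sp.intros)

lemma Sp_mono: "x \<in> Sp Q \<Longrightarrow> (\<And>w. wd w \<Longrightarrow> Q w \<Longrightarrow> Q' w) \<Longrightarrow> x \<in> Sp Q'"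
  by (induction rule: Sp.induct) (auto intro: Sp.intros)

lemma Sp_uminus: "x \<in> Sp Q \<Longrightarrow> \<ominus> x \<in> Sp Q"
  using Sp_sc[of x Q "-1"] Sp_closed[of x Q] by (simp add: cscale_m1)

lemma Sp_minus: "x \<in> Sp Q \<Longrightarrow> y \<in> Sp Q \<Longrightarrow> x \<ominus> y \<in> Sp Q"
  by (simp add: minus_eq Sp_add Sp_uminus)

lemma Sp_st: assumes "x \<in> Sp Q" "\<And>w. Q w \<Longrightarrow> w \<noteq> []" shows "st x = 0"
  using assms(1) by (induction rule: Sp.induct) (use assms(2) wd_free pr_closed in \<open>auto simp: st_cscale st_add Sp_closed\<close>)

text \<open>Linearity in the middle factor: statements about spans reduce to statements about single
  reduced words.\<close>

lemma Sp_sandwich: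
  assumes x: "x \<in> Sp Q" and u: "u \<in> alg" "v \<in> alg"
    and w: "\<And>w. wd w \<Longrightarrow> Q w \<Longrightarrow> u \<otimes> (pr w \<otimes> v) \<in> Sp Q'"
  shows "u \<otimes> (x \<otimes> v) \<in> Sp Q'"
  using x
proof (induction rule: Sp.induct)
  case Sp_zero thus ?case using u by (simp add: Sp.Sp_zero)
next
  case (Sp_base w c)
  have "u \<otimes> (sc c (pr w) \<otimes> v) = sc c (u \<otimes> (pr w \<otimes> v))"
    using u pr_closed[OF Sp_base(1)] by (simp add: cscale_mult_left cscale_mult_right)
  thus ?case using w[OF Sp_base] Sp_sc by simp
next
  case (Sp_add x y)
  thus ?case using u Sp_closed by (simp add: l_distr r_distr Sp.Sp_add)
qed

lemma B_star_mult: "x \<in> B s \<Longrightarrow> y \<in> B s \<Longrightarrow> star x \<otimes> y \<in> B s"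
  using star_subalgD(4,6)[OF Bs] by blast

lemma B_mult: "x \<in> B s \<Longrightarrow> y \<in> B s \<Longrightarrow> x \<otimes> y \<in> B s"
  using star_subalgD(4)[OF Bs] by blast

definition cent :: "'a \<Rightarrow> 'a" where "cent x = x \<ominus> sc (st x) \<one>"

lemma cent_B: "x \<in> B s \<Longrightarrow> cent x \<in> B s \<and> st (cent x) = 0"
  using star_subalgD[OF Bs] Bc by (simp add: cent_def st_diff st_cscale)

lemma cent_split: "x \<in> alg \<Longrightarrow> x = sc (st x) \<one> \<oplus> cent x"
  by (simp add: cent_def ring_exp)

lemma cent_left: assumes x: "x \<in> alg" "y \<in> alg"
  shows "x \<otimes> y = sc (st x) y \<oplus> cent x \<otimes> y"
proof -
  have "cent x \<in> alg" using x by (simp add: cent_def)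
  thus ?thesis using x by (subst cent_split[OF x(1)]) (simp add: l_distr cscale_mult_left)
qed

lemma cent_right: assumes x: "x \<in> alg" "y \<in> alg"
  shows "y \<otimes> x = sc (st x) y \<oplus> y \<otimes> cent x"
proof -
  have "cent x \<in> alg" using x by (simp add: cent_def)
  thus ?thesis using x by (subst cent_split[OF x(1)]) (simp add: r_distr cscale_mult_right)
qed

text \<open>The algebraic free product, dense in the reduced one; cancellation is analysed here,
  where elements are finite sums of words.\<close>

abbreviation "D0 \<equiv> Sp (\<lambda>_. True)"

lemma D0_left_letter: assumes x: "x \<in> B s" and w: "wd w" shows "x \<otimes> pr w \<in> D0"
proof -
  have xc: "x \<in> alg" using Bc[OF x] .
  show ?thesis
  proof (cases "w \<noteq> [] \<and> fst (hd w) = s")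
    case True
    then obtain y w' where y: "w = (s, y) # w'" by (cases w) auto
    have yB: "y \<in> B s" and w': "wd w'" "w' \<noteq> [] \<longrightarrow> s \<noteq> fst (hd w')" using w y by (auto simp: wd_Cons)
    have xy: "x \<otimes> y \<in> B s" using star_subalgD(4)[OF Bs] x yB by blast
    have "x \<otimes> pr w = (x \<otimes> y) \<otimes> pr w'" using y xc Bc[OF yB] pr_closed[OF w'(1)] by (simp add: m_assoc)
    also have "\<dots> = sc (st (x \<otimes> y)) (pr w') \<oplus> pr ((s, cent (x \<otimes> y)) # w')"
      using cent_left[OF Bc[OF xy] pr_closed[OF w'(1)]] by simp
    finally show ?thesis using cent_B[OF xy] w'
      by (auto simp: wd_Cons intro!: Sp_add Sp_base[where Q="\<lambda>_. True"] Sp_word simp del: foldr.simps list.map)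
  next
    case False
    have "x \<otimes> pr w = sc (st x) (pr w) \<oplus> pr ((s, cent x) # w)"
      using cent_left[OF xc pr_closed[OF w]] by simp
    thus ?thesis using cent_B[OF x] w False
      by (auto simp: wd_Cons intro!: Sp_add Sp_base[where Q="\<lambda>_. True"] Sp_word simp del: foldr.simps list.map)
  qed
qed

lemma D0_mult_left: assumes x: "x \<in> B s" and y: "y \<in> D0" shows "x \<otimes> y \<in> D0"
  using Sp_sandwich[OF y Bc[OF x] one_closed] D0_left_letter[OF x] Bc[OF x] pr_closed Sp_closed[OF y] by simp

lemma D0_star_subalg: "star_subalg D0"
proof -
  have m: "pr w \<otimes> y \<in> D0" if "wd w" "y \<in> D0" for w y
    using that
  proof (induction w)
    case (Cons p w)
    hence "pr (p # w) \<otimes> y = snd p \<otimes> (pr w \<otimes> y)"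
      using Bc pr_closed Sp_closed by (auto simp: wd_Cons m_assoc)
    thus ?case using Cons D0_mult_left by (auto simp: wd_Cons)
  qed (simp add: Sp_closed)
  have mult: "x \<otimes> y \<in> D0" if "x \<in> D0" "y \<in> D0" for x y
    using Sp_sandwich[OF that(1) one_closed Sp_closed[OF that(2)]] m that pr_closed Sp_closed by simp
  have one: "\<one> \<in> D0" using Sp_word[of "[]" "\<lambda>_. True"] by simp
  have st: "star x \<in> D0" if "x \<in> D0" for x
    using that
  proof (induction rule: Sp.induct)
    case (Sp_base w c)
    thus ?case using pr_closed swd_pr[of w] Sp.Sp_base[OF swd_wd, of w "\<lambda>_. True" "cnj c"] by (simp add: adj_cscale)
  qed (auto simp: adj_add Sp_closed intro: Sp.intros)
  show ?thesis unfolding star_subalg_def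
    by (intro conjI ballI allI subsetI mult one st Sp_sc Sp_add) (auto intro: Sp_closed)
qed

lemma B_D0: "x \<in> B s \<Longrightarrow> x \<in> D0"
  using D0_left_letter[of x s "[]"] Bc by simp

text \<open>A letter can merge with the first letter only, so at least one letter of the word
  survives and the state vanishes.\<close>

lemma st_letter_word: assumes x: "x \<in> B s" and w: "wd w" "length w \<ge> 2" shows "st (x \<otimes> pr w) = 0"
proof -
  have xc: "x \<in> alg" using Bc[OF x] .
  show ?thesis
  proof (cases "fst (hd w) = s")
    case True
    then obtain y w' where y: "w = (s, y) # w'" using w by (cases w) auto
    have yB: "y \<in> B s" and w': "wd w'" "w' \<noteq> []" "s \<noteq> fst (hd w')" using w y by (auto simp: wd_Cons)
    have xy: "x \<otimes> y \<in> B s" using star_subalgD(4)[OF Bs] x yB by blast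
    have "x \<otimes> pr w = (x \<otimes> y) \<otimes> pr w'" using y xc Bc[OF yB] pr_closed[OF w'(1)] by (simp add: m_assoc)
    also have "\<dots> = sc (st (x \<otimes> y)) (pr w') \<oplus> pr ((s, cent (x \<otimes> y)) # w')"
      using cent_left[OF Bc[OF xy] pr_closed[OF w'(1)]] by simp
    finally have e: "x \<otimes> pr w = sc (st (x \<otimes> y)) (pr w') \<oplus> pr ((s, cent (x \<otimes> y)) # w')" .
    have "wd ((s, cent (x \<otimes> y)) # w')" using cent_B[OF xy] w' by (simp add: wd_Cons)
    thus ?thesis unfolding e
      using wd_free[OF w'(1,2)] wd_free pr_closed[OF w'(1)] pr_closed
      by (simp add: st_add st_cscale del: foldr.simps list.map)
  next
    case False
    have wn: "w \<noteq> []" using w by auto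
    have e: "x \<otimes> pr w = sc (st x) (pr w) \<oplus> pr ((s, cent x) # w)"
      using cent_left[OF xc pr_closed[OF w(1)]] by simp
    have "wd ((s, cent x) # w)" using cent_B[OF x] w False by (auto simp: wd_Cons)
    thus ?thesis unfolding e
      using wd_free[OF w(1) wn] wd_free pr_closed[OF w(1)] pr_closed
      by (simp add: st_add st_cscale del: foldr.simps list.map)
  qed
qed

text \<open>Against words of length at least two both sides vanish by \<open>st_letter_word\<close>,
  so commuting under the state with one's own factor is enough to commute under the state with all
  of \<open>D0\<close>.\<close>

lemma central_D0:
  assumes u: "u \<in> B s" and cz: "\<And>x. x \<in> B s \<Longrightarrow> st (u \<otimes> x) = st (x \<otimes> u)" and y: "y \<in> D0"
  shows "st (u \<otimes> y) = st (y \<otimes> u)"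
  using y
proof (induction rule: Sp.induct)
  case (Sp_base w c)
  have uc: "u \<in> alg" using Bc[OF u] .
  have wc: "pr w \<in> alg" using pr_closed Sp_base by blast
  have "st (u \<otimes> pr w) = st (pr w \<otimes> u)"
  proof (cases "length w \<ge> 2")
    case True
    have "st (pr w \<otimes> u) = cnj (st (star u \<otimes> pr (swd w)))"
      using st_adj[of "star u \<otimes> star (pr w)"] uc wc by (simp add: adj_mult swd_pr[OF Sp_base(1)])
    also have "\<dots> = 0" using st_letter_word[of "star u" s "swd w"] star_subalgD(6)[OF Bs u] swd_wd[OF Sp_base(1)] True
      by (simp add: swd_def)
    finally show ?thesis using st_letter_word[OF u Sp_base(1) True] by simp
  next
    case False
    then consider "w = []" | t x where "w = [(t, x)]" by (cases w; cases "tl w") force+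
    thus ?thesis
    proof cases
      case 1 thus ?thesis using uc by simp
    next
      case (2 t x)
      hence x: "x \<in> B t" "st x = 0" "x \<in> alg" using Sp_base Bc by (auto simp: wd_Cons)
      show ?thesis
      proof (cases "t = s")
        case True thus ?thesis using 2 x uc cz by simp
      next
        case False
        have c: "cent u \<in> B s" "st (cent u) = 0" "cent u \<in> alg" using cent_B[OF u] Bc by auto
        have "st (cent u \<otimes> x) = 0" "st (x \<otimes> cent u) = 0"
          using wd_free[of "[(s, cent u), (t, x)]"] wd_free[of "[(t, x), (s, cent u)]"] c x False by (auto simp: wd_Cons)
        thus ?thesis using cent_left[OF uc x(3)] cent_right[OF uc x(3)] x uc c 2
          by (simp add: st_add st_cscale)
      qed
    qed
  qed
  thus ?case using uc wc by (simp add: cscale_mult_left cscale_mult_right st_cscale)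
next
  case (Sp_add x y)
  thus ?case using Bc[OF u] Sp_closed by (simp add: l_distr r_distr st_add)
qed (use Bc[OF u] in simp)

end

section \<open>Conjugation by long initial segments of an aperiodic word\<close>

text \<open>By \<open>aper\<close>, two copies of the sequence that are shifted by an even amount
  somewhere show orthogonal letters, and cancellation between them stops there. For an odd shift the
  letters that meet come from different factors and never merge.\<close>

locale unitary_word = free_pair +
  fixes g :: "nat \<Rightarrow> 'a"
  assumes gB: "g i \<in> B (odd i)" and gu: "star (g i) \<otimes> g i = \<one>" "g i \<otimes> star (g i) = \<one>"
    and g0: "st (g i) = 0"
    and gcz: "x \<in> B (odd i) \<Longrightarrow> st (g i \<otimes> x) = st (x \<otimes> g i)"
    and aper: "\<lbrakk>p < q; even (q - p)\<rbrakk> \<Longrightarrow> \<exists>i. st (star (g (p + i)) \<otimes> g (q + i)) = 0"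
begin

lemma gc [simp]: "g i \<in> alg" using Bc[OF gB] .

definition gw :: "nat \<Rightarrow> nat \<Rightarrow> (bool \<times> 'a) list" where
  "gw p m = map (\<lambda>i. (odd i, g i)) [p..<m]"

lemma gw_Cons: "p < m \<Longrightarrow> gw p m = (odd p, g p) # gw (Suc p) m"
  by (simp add: gw_def upt_conv_Cons)

lemma gw_Nil [simp]: "gw p m = [] \<longleftrightarrow> m \<le> p" by (auto simp: gw_def)

lemma gw_hd: "p < m \<Longrightarrow> fst (hd (gw p m)) = odd p" by (simp add: gw_Cons)

lemma gw_last: "p < m \<Longrightarrow> fst (last (gw p m)) = odd (m - 1)"
  by (simp add: gw_def last_map)

lemma gw_wd [simp]: "wd (gw p m)"
proof (induction "m - p" arbitrary: p)
  case (Suc n)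
  hence "p < m" "wd (gw (Suc p) m)" by auto
  thus ?case using gB[of p] g0 gw_hd[of "Suc p" m] by (auto simp: gw_Cons wd_Cons not_le)
qed (simp add: wd_def gw_def)

definition PP :: "nat \<Rightarrow> nat \<Rightarrow> 'a" where "PP p m = pr (gw p m)"

lemma PP_closed [simp]: "PP p m \<in> alg" by (simp add: PP_def pr_closed)

lemma PP_step: "p < m \<Longrightarrow> PP p m = g p \<otimes> PP (Suc p) m" by (simp add: PP_def gw_Cons)

lemma PP_self [simp]: "m \<le> p \<Longrightarrow> PP p m = \<one>" by (simp add: PP_def gw_def)

lemma PP_unitary: "star (PP p m) \<otimes> PP p m = \<one>" "PP p m \<otimes> star (PP p m) = \<one>"
proof -
  have "star (PP p m) \<otimes> PP p m = \<one> \<and> PP p m \<otimes> star (PP p m) = \<one>"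
  proof (induction "m - p" arbitrary: p)
    case (Suc n)
    hence lt: "p < m" and IH: "star (PP (Suc p) m) \<otimes> PP (Suc p) m = \<one>"
      "PP (Suc p) m \<otimes> star (PP (Suc p) m) = \<one>" by auto
    define Q where "Q = PP (Suc p) m"
    have Q: "Q \<in> alg" by (simp add: Q_def)
    have "star Q \<otimes> (star (g p) \<otimes> (g p \<otimes> Q)) = star Q \<otimes> ((star (g p) \<otimes> g p) \<otimes> Q)"
      "g p \<otimes> (Q \<otimes> (star Q \<otimes> star (g p))) = g p \<otimes> ((Q \<otimes> star Q) \<otimes> star (g p))"
      using Q by (simp_all add: m_assoc)
    thus ?case using IH Q unfolding PP_step[OF lt] Q_def[symmetric] by (simp add: adj_mult m_assoc gu)
  qed simp
  thus "star (PP p m) \<otimes> PP p m = \<one>" "PP p m \<otimes> star (PP p m) = \<one>" by auto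
qed

text \<open>The parity of \<open>m - 1\<close> is the type of the last letter of the segment, which
  ends up on the outside after conjugation.\<close>

definition TT :: "nat \<Rightarrow> 'a set" where
  "TT m = Sp (\<lambda>w. w = [] \<or> fst (hd w) = odd (m - 1) \<and> fst (last w) = odd (m - 1))"

text \<open>Two starting positions are kept because the left and the right segment may lose
  different numbers of letters to \<open>x\<close>; what remains to be analysed is then an instance
  with larger indices.\<close>

definition ev :: "'a \<Rightarrow> nat \<Rightarrow> nat \<Rightarrow> bool" where
  "ev x p q \<longleftrightarrow> (\<forall>\<^sub>F m in sequentially. star (PP p m) \<otimes> (x \<otimes> PP q m) \<in> TT m)"

lemma ev_add: assumes "ev x p q" "ev y p q" "x \<in> alg" "y \<in> alg" shows "ev (x \<oplus> y) p q"
  using assms(1,2) unfolding ev_def TT_def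
  by eventually_elim (use assms(3,4) in \<open>simp add: l_distr r_distr Sp_add\<close>)

lemma ev_sc: assumes "ev x p q" "x \<in> alg" shows "ev (sc c x) p q"
  using assms(1) unfolding ev_def TT_def
  by eventually_elim (use assms(2) in \<open>simp add: cscale_mult_left cscale_mult_right Sp_sc\<close>)

lemma ev_left: assumes "ev (star (g p) \<otimes> x) (Suc p) q" "x \<in> alg" shows "ev x p q"
  using assms(1) eventually_ge_at_top[of "Suc p"] unfolding ev_def
  by eventually_elim (use assms(2) in \<open>simp add: PP_step adj_mult m_assoc\<close>)

lemma ev_right: assumes "ev (x \<otimes> g q) p (Suc q)" "x \<in> alg" shows "ev x p q"
  using assms(1) eventually_ge_at_top[of "Suc q"] unfolding ev_def
  by eventually_elim (use assms(2) in \<open>simp add: PP_step m_assoc\<close>)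

text \<open>The case in which neither side can merge with \<open>w\<close>: the concatenation is
  already reduced and remains so for all later \<open>m\<close>.\<close>

lemma ev_locked_list:
  assumes w: "wd w" and h: "if w = [] then odd p \<noteq> odd q else fst (hd w) \<noteq> odd p \<and> fst (last w) \<noteq> odd q"
  shows "ev (pr w) p q"
  unfolding ev_def
proof (rule eventually_sequentiallyI)
  fix m assume "Suc (max p q) \<le> m"
  hence m: "p < m" "q < m" by auto
  have 1: "wd (w @ gw q m)" using w h m gw_hd[of q m] by (auto simp: wd_append split: if_splits)
  have 2: "wd (swd (gw p m) @ (w @ gw q m))"
    unfolding wd_append[of "swd (gw p m)"] using 1 h m gw_hd[of q m] gw_hd[of p m] swd_wd[OF gw_wd] swd_last[of "gw p m"]
    by (cases w) (auto split: if_splits)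
  have "star (PP p m) \<otimes> (pr w \<otimes> PP q m) = pr (swd (gw p m) @ (w @ gw q m))"
    unfolding PP_def using pr_append[OF swd_wd[OF gw_wd] 1] pr_append[OF w gw_wd] swd_pr[OF gw_wd] by simp
  moreover have "fst (hd (swd (gw p m) @ (w @ gw q m))) = odd (m - 1)"
    using m swd_hd[of "gw p m"] gw_last[of p m] by (simp add: hd_append)
  moreover have "fst (last (swd (gw p m) @ (w @ gw q m))) = odd (m - 1)"
    using m gw_last[of q m] by (simp add: last_append)
  ultimately show "star (PP p m) \<otimes> (pr w \<otimes> PP q m) \<in> TT m"
    using Sp_word[OF 2] unfolding TT_def by simp
qed

text \<open>The product of the two leading letters is a scalar plus a centred letter. The centred
  part is locked between letters of the other factor, and the scalar part moves both positions on by
  one until the orthogonal pair is reached, where no scalar is left.\<close>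

lemma ev_one_aux:
  "st (star (g (p + i)) \<otimes> g (q + i)) = 0 \<Longrightarrow> even p = even q \<Longrightarrow> ev \<one> p q"
proof (induction i arbitrary: p q)
  case (0 p q)
  have "star (g p) \<otimes> g q \<in> B (odd p)"
    using B_star_mult[OF gB[of p], of "g q"] gB[of q] 0 by simp
  hence "ev (pr [(odd p, star (g p) \<otimes> g q)]) (Suc p) (Suc q)"
    using 0 by (intro ev_locked_list) (auto simp: wd_Cons)
  hence "ev ((star (g p) \<otimes> \<one>) \<otimes> g q) (Suc p) (Suc q)" by simp
  thus ?case by (rule ev_left[OF ev_right]) simp_all
next
  case (Suc i p q)
  define x where "x = star (g p) \<otimes> g q"
  have x: "x \<in> B (odd p)" unfolding x_def
    using B_star_mult[OF gB[of p], of "g q"] gB[of q] Suc.prems by simp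
  hence xc: "x \<in> alg" using Bc by blast
  have "ev (pr [(odd p, cent x)]) (Suc p) (Suc q)"
    using Suc cent_B[OF x] by (intro ev_locked_list) (auto simp: wd_Cons)
  moreover have "cent x \<in> alg" using xc by (simp add: cent_def)
  moreover have "ev \<one> (Suc p) (Suc q)" using Suc.IH[of "Suc p" "Suc q"] Suc.prems by simp
  ultimately have "ev (sc (st x) \<one> \<oplus> cent x) (Suc p) (Suc q)" by (intro ev_add ev_sc) auto
  hence "ev x (Suc p) (Suc q)" using cent_split[OF xc] by simp
  hence "ev ((star (g p) \<otimes> \<one>) \<otimes> g q) (Suc p) (Suc q)" by (simp add: x_def)
  thus ?case by (rule ev_left[OF ev_right]) simp_all
qed

lemma ev_star: assumes "ev x p q" "x \<in> alg" shows "ev (star x) q p"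
proof -
  have s: "star y \<in> TT m" if "y \<in> TT m" for y m
    using that unfolding TT_def
  proof (induction rule: Sp.induct)
    case (Sp_base w c)
    have "sc (cnj c) (pr (swd w)) \<in> Sp (\<lambda>w. w = [] \<or> fst (hd w) = odd (m - 1) \<and> fst (last w) = odd (m - 1))"
      using Sp_base swd_hd[of w] swd_last[of w] by (intro Sp.Sp_base swd_wd) auto
    thus ?case using pr_closed swd_pr[of w] Sp_base by (simp add: adj_cscale)
  qed (auto simp: adj_add Sp_closed intro: Sp.intros)
  show ?thesis
    using assms(1) unfolding ev_def
  proof eventually_elim
    case (elim m)
    show ?case using s[OF elim] assms(2) by (simp add: adj_mult m_assoc)
  qed
qed

lemma ev_one: "ev \<one> p q"
proof (cases "even p = even q")
  case False
  thus ?thesis using ev_locked_list[of "[]" p q] by simp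
next
  case True
  consider "p = q" | "p < q" | "q < p" by linarith
  thus ?thesis
  proof cases
    case 1
    have "\<one> \<in> TT m" for m using Sp_word[of "[]"] unfolding TT_def by simp
    thus ?thesis unfolding ev_def using 1 by (simp add: PP_unitary)
  next
    case 2
    thus ?thesis using aper[of p q] True ev_one_aux by (auto simp: even_diff_nat)
  next
    case 3
    hence "ev \<one> q p" using aper[of q p] True ev_one_aux by (auto simp: even_diff_nat)
    thus ?thesis using ev_star[of \<one> q p] by simp
  qed
qed

text \<open>With the left end fixed, the word is consumed from the right: merging its last letter
  gives a locked word plus a multiple of a shorter one, and the empty word is left to
  \<open>ev_one\<close>.\<close>

lemma ev_left_locked: "wd w \<Longrightarrow> w \<noteq> [] \<Longrightarrow> fst (hd w) \<noteq> odd p \<Longrightarrow> ev (pr w) p q"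
proof (induction w arbitrary: q rule: rev_induct)
  case (snoc r w q)
  have rw: "wd w" "snd r \<in> B (fst r)" "st (snd r) = 0" "w \<noteq> [] \<longrightarrow> fst (last w) \<noteq> fst r"
    using snoc.prems by (auto simp: wd_append wd_Cons)
  show ?case
  proof (cases "fst r = odd q")
    case False
    thus ?thesis using snoc.prems by (intro ev_locked_list) auto
  next
    case True
    define x where "x = snd r \<otimes> g q"
    have x: "x \<in> B (odd q)" unfolding x_def using B_mult[OF _ gB[of q], of "snd r"] rw True by simp
    have c: "x \<in> alg" "pr w \<in> alg" "snd r \<in> alg" "pr (w @ [r]) \<in> alg" "cent x \<in> alg"
      using Bc[OF x] Bc[OF rw(2)] pr_closed[OF rw(1)] pr_closed[OF snoc.prems(1)]
      by (simp_all add: cent_def del: map_append foldr_append)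
    have 1: "wd (w @ [(odd q, cent x)])" using rw True cent_B[OF x] by (auto simp: wd_append wd_Cons)
    have "fst (hd (w @ [(odd q, cent x)])) \<noteq> odd p" using snoc.prems True by (cases w) auto
    hence "ev (pr (w @ [(odd q, cent x)])) p (Suc q)" using 1 by (intro ev_locked_list) auto
    moreover have "pr (w @ [(odd q, cent x)]) = pr w \<otimes> cent x"
      using 1 pr_append[of w "[(odd q, cent x)]"] c by (simp add: wd_append)
    moreover have "ev (pr w) p (Suc q)"
    proof (cases "w = []")
      case True thus ?thesis by (simp add: ev_one)
    next
      case False thus ?thesis using snoc.IH[of "Suc q"] rw snoc.prems by simp
    qed
    ultimately have "ev (sc (st x) (pr w) \<oplus> pr w \<otimes> cent x) p (Suc q)" using c by (intro ev_add ev_sc) auto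
    moreover have "pr (w @ [r]) \<otimes> g q = pr w \<otimes> x"
      using pr_append[of w "[r]"] rw c by (simp add: wd_Cons x_def m_assoc)
    ultimately have "ev (pr (w @ [r]) \<otimes> g q) p (Suc q)" using cent_right[OF c(1,2)] by simp
    thus ?thesis by (rule ev_right) (rule c(4))
  qed
qed simp

text \<open>The same peeling from the left; its centred part has a locked left end and is covered by
  \<open>ev_left_locked\<close>.\<close>

lemma ev_word: "wd w \<Longrightarrow> ev (pr w) p q"
proof (induction w arbitrary: p)
  case (Nil p) thus ?case by (simp add: ev_one)
next
  case (Cons r w p)
  have rw: "wd w" "snd r \<in> B (fst r)" "st (snd r) = 0" "w \<noteq> [] \<longrightarrow> fst r \<noteq> fst (hd w)"
    using Cons.prems by (auto simp: wd_Cons)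
  show ?case
  proof (cases "fst r = odd p")
    case False
    thus ?thesis using Cons.prems by (intro ev_left_locked) auto
  next
    case True
    define x where "x = star (g p) \<otimes> snd r"
    have x: "x \<in> B (odd p)" unfolding x_def using B_star_mult[OF gB[of p], of "snd r"] rw True by simp
    have c: "x \<in> alg" "pr w \<in> alg" "snd r \<in> alg" "cent x \<in> alg"
      using Bc[OF x] Bc[OF rw(2)] pr_closed[OF rw(1)] by (simp_all add: cent_def)
    have 1: "wd ((odd p, cent x) # w)" using rw True cent_B[OF x] by (auto simp: wd_Cons)
    hence "ev (pr ((odd p, cent x) # w)) (Suc p) q" by (intro ev_left_locked) auto
    hence "ev (sc (st x) (pr w) \<oplus> cent x \<otimes> pr w) (Suc p) q"
      using c Cons.IH[OF rw(1)] by (intro ev_add ev_sc) auto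
    hence "ev (star (g p) \<otimes> pr (r # w)) (Suc p) q"
      using cent_left[OF c(1,2)] c by (simp add: x_def m_assoc)
    thus ?thesis by (rule ev_left) (use c in simp)
  qed
qed

lemma ev_D0: "x \<in> D0 \<Longrightarrow> ev x p q"
proof (induction rule: Sp.induct)
  case Sp_zero
  have "\<zero> \<in> TT m" for m unfolding TT_def by (rule Sp.Sp_zero)
  thus ?case unfolding ev_def by simp
qed (auto intro: ev_add ev_sc ev_word pr_closed Sp_closed)

definition ZZ :: "'a set" where "ZZ = Sp (\<lambda>w. w \<noteq> [] \<and> fst (hd w) \<and> fst (last w))"

lemma TT_split: assumes "x \<in> TT m" "odd (m - 1)" shows "\<exists>y\<in>ZZ. x = sc (st x) \<one> \<oplus> y"
proof -
  have "\<exists>c. \<exists>y\<in>ZZ. x = sc c \<one> \<oplus> y"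
    using assms(1) unfolding TT_def
  proof (induction rule: Sp.induct)
    case Sp_zero
    thus ?case by (intro exI[of _ 0] bexI[of _ \<zero>]) (auto simp: ZZ_def Sp.Sp_zero)
  next
    case (Sp_base w c)
    show ?case
    proof (cases "w = []")
      case True
      thus ?thesis by (intro exI[of _ c] bexI[of _ "\<zero>"]) (auto simp: ZZ_def Sp.Sp_zero)
    next
      case False
      hence "sc c (pr w) \<in> ZZ" unfolding ZZ_def using Sp_base assms(2) by (intro Sp.Sp_base) auto
      thus ?thesis using pr_closed[OF Sp_base(1)] by (intro exI[of _ 0] bexI[of _ "sc c (pr w)"]) simp_all
    qed
  next
    case (Sp_add x y)
    then obtain c d u v where *: "u \<in> ZZ" "v \<in> ZZ" "x = sc c \<one> \<oplus> u" "y = sc d \<one> \<oplus> v" by blast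
    hence "u \<in> alg" "v \<in> alg" using Sp_closed unfolding ZZ_def by auto
    hence "x \<oplus> y = sc (c + d) \<one> \<oplus> (u \<oplus> v)" using * by (simp add: cscale_add_left a_ac)
    moreover have "u \<oplus> v \<in> ZZ" using * Sp.Sp_add unfolding ZZ_def by blast
    ultimately show ?case by blast
  qed
  then obtain c y where y: "y \<in> ZZ" "x = sc c \<one> \<oplus> y" by blast
  have "st y = 0" using y(1) unfolding ZZ_def by (rule Sp_st) simp
  moreover have "y \<in> alg" using y Sp_closed unfolding ZZ_def by blast
  ultimately have "st x = c" using y by (simp add: st_add st_cscale)
  thus ?thesis using y by blast
qed

lemma PP_D0: "PP p m \<in> D0" unfolding PP_def by (rule Sp_word) simp_all

text \<open>Here the centralizer enters: under the state each \<open>g p\<close> can be moved around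
  and cancelled against its adjoint, from the outermost letter inwards when the segment is
  unfolded.\<close>

lemma st_conj_PP: "x \<in> D0 \<Longrightarrow> st (star (PP p m) \<otimes> (x \<otimes> PP p m)) = st x"
proof (induction "m - p" arbitrary: p x)
  case 0 thus ?case using Sp_closed by simp
next
  case (Suc n)
  note d = star_subalgD[OF D0_star_subalg]
  have lt: "p < m" using Suc by simp
  have xc: "x \<in> alg" using Suc Sp_closed by blast
  have gD: "g p \<in> D0" using B_D0[OF gB] .
  have "star (PP p m) \<otimes> (x \<otimes> PP p m) = star (PP (Suc p) m) \<otimes> ((star (g p) \<otimes> (x \<otimes> g p)) \<otimes> PP (Suc p) m)"
    using lt xc by (simp add: PP_step adj_mult m_assoc)
  also have "st \<dots> = st (star (g p) \<otimes> (x \<otimes> g p))"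
    using Suc gD d(4,6) by simp
  also have "\<dots> = st ((star (g p) \<otimes> x) \<otimes> g p)" using xc by (simp add: m_assoc)
  also have "\<dots> = st (g p \<otimes> (star (g p) \<otimes> x))"
    using central_D0[OF gB[of p] gcz[of _ p], where y = "star (g p) \<otimes> x"] gD d(4,6) Suc.prems by simp
  also have "\<dots> = st x" using xc gu(2)[of p] by (simp add: m_assoc[symmetric])
  finally show ?case .
qed

lemma conj_PP_ZZ:
  assumes x: "x \<in> D0"
  shows "\<exists>K. \<forall>m\<ge>K. even m \<longrightarrow> (\<exists>y\<in>ZZ. star (PP 0 m) \<otimes> (x \<otimes> PP 0 m) = sc (st x) \<one> \<oplus> y)"
proof -
  obtain K where K: "\<And>m. m \<ge> K \<Longrightarrow> star (PP 0 m) \<otimes> (x \<otimes> PP 0 m) \<in> TT m"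
    using ev_D0[OF x, of 0 0] unfolding ev_def eventually_sequentially by blast
  \<comment> \<open>\<open>Suc K\<close> excludes \<open>m = 0\<close>, where \<open>m - 1\<close>
    truncates to an even number and the outer letter would not be a circle letter.\<close>
  have "\<exists>y\<in>ZZ. star (PP 0 m) \<otimes> (x \<otimes> PP 0 m) = sc (st x) \<one> \<oplus> y" if "m \<ge> Suc K" "even m" for m
    using TT_split[OF K[of m]] that st_conj_PP[OF x, of 0 m] by simp
  thus ?thesis by blast
qed

text \<open>The one-sided analogue of \<open>ev\<close>: with nothing on the right, the whole vector
  eventually starts with the last letter of the segment. It serves to show that annihilation kills
  \<open>x\<close> on the vacuum.\<close>

definition evl :: "'a \<Rightarrow> nat \<Rightarrow> bool" where
  "evl x p \<longleftrightarrow> (\<forall>\<^sub>F m in sequentially. star (PP p m) \<otimes> x \<in> Sp (\<lambda>w. w \<noteq> [] \<and> fst (hd w) = odd (m - 1)))"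

lemma evl_add: assumes "evl x p" "evl y p" "x \<in> alg" "y \<in> alg" shows "evl (x \<oplus> y) p"
  using assms(1,2) unfolding evl_def by eventually_elim (use assms(3,4) in \<open>simp add: r_distr Sp_add\<close>)

lemma evl_sc: assumes "evl x p" "x \<in> alg" shows "evl (sc c x) p"
  using assms(1) unfolding evl_def by eventually_elim (use assms(2) in \<open>simp add: cscale_mult_right Sp_sc\<close>)

lemma evl_left: assumes "evl (star (g p) \<otimes> x) (Suc p)" "x \<in> alg" shows "evl x p"
  using assms(1) eventually_ge_at_top[of "Suc p"] unfolding evl_def
  by eventually_elim (use assms(2) in \<open>simp add: PP_step adj_mult m_assoc\<close>)

lemma evl_locked: assumes w: "wd w" "w = [] \<or> fst (hd w) \<noteq> odd p" shows "evl (pr w) p"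
  unfolding evl_def
proof (rule eventually_sequentiallyI)
  fix m assume "Suc p \<le> m"
  hence m: "p < m" by simp
  have 2: "wd (swd (gw p m) @ w)"
    using w m gw_hd[of p m] swd_wd[OF gw_wd] swd_last[of "gw p m"] by (auto simp: wd_append)
  have "star (PP p m) \<otimes> pr w = pr (swd (gw p m) @ w)"
    unfolding PP_def using pr_append[OF swd_wd[OF gw_wd] w(1)] swd_pr[OF gw_wd] by simp
  moreover have "fst (hd (swd (gw p m) @ w)) = odd (m - 1)" "swd (gw p m) @ w \<noteq> []"
    using m swd_hd[of "gw p m"] gw_last[of p m] by (auto simp: hd_append)
  ultimately show "star (PP p m) \<otimes> pr w \<in> Sp (\<lambda>w. w \<noteq> [] \<and> fst (hd w) = odd (m - 1))"
    using Sp_word[OF 2, of "\<lambda>w. w \<noteq> [] \<and> fst (hd w) = odd (m - 1)"] by simp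
qed

lemma evl_word: "wd w \<Longrightarrow> evl (pr w) p"
proof (induction w arbitrary: p)
  case (Nil p) thus ?case using evl_locked[of "[]" p] by simp
next
  case (Cons r w p)
  have rw: "wd w" "snd r \<in> B (fst r)" "st (snd r) = 0" "w \<noteq> [] \<longrightarrow> fst r \<noteq> fst (hd w)"
    using Cons.prems by (auto simp: wd_Cons)
  show ?case
  proof (cases "fst r = odd p")
    case False
    thus ?thesis using Cons.prems by (intro evl_locked) auto
  next
    case True
    define x where "x = star (g p) \<otimes> snd r"
    have x: "x \<in> B (odd p)" unfolding x_def using B_star_mult[OF gB[of p], of "snd r"] rw True by simp
    have c: "x \<in> alg" "pr w \<in> alg" "snd r \<in> alg" "cent x \<in> alg"
      using Bc[OF x] Bc[OF rw(2)] pr_closed[OF rw(1)] by (simp_all add: cent_def)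
    have 1: "wd ((odd p, cent x) # w)" using rw True cent_B[OF x] by (auto simp: wd_Cons)
    hence "evl (pr ((odd p, cent x) # w)) (Suc p)" by (intro evl_locked) auto
    hence "evl (sc (st x) (pr w) \<oplus> cent x \<otimes> pr w) (Suc p)"
      using c Cons.IH[OF rw(1)] by (intro evl_add evl_sc) auto
    hence "evl (star (g p) \<otimes> pr (r # w)) (Suc p)" using cent_left[OF c(1,2)] c by (simp add: x_def m_assoc)
    thus ?thesis by (rule evl_left) (use c in simp)
  qed
qed

lemma evl_D0: "x \<in> D0 \<Longrightarrow> evl x p"
proof (induction rule: Sp.induct)
  case Sp_zero thus ?case unfolding evl_def by (simp add: Sp.Sp_zero)
qed (auto intro: evl_add evl_sc evl_word pr_closed Sp_closed)

end

section \<open>Operators on the GNS space\<close>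

lemma cmod_divide_le: "c \<noteq> 0 \<Longrightarrow> u \<le> cmod (1 / c) * v \<Longrightarrow> cmod c * u \<le> v"
  by (simp add: norm_divide field_simps)

lemma form_cauchy_schwarz:
  fixes s :: complex and X Y :: real
  assumes X: "X \<ge> 0" and pos: "\<And>c. 0 \<le> (cmod c)\<^sup>2 * X + 2 * Re (cnj c * s) + Y"
  shows "(cmod s)\<^sup>2 \<le> X * Y"
proof -
  have *: "0 \<le> r\<^sup>2 * (cmod s)\<^sup>2 * X - 2 * r * (cmod s)\<^sup>2 + Y" for r :: real
  proof -
    have "cnj (- (of_real r * s)) * s = - of_real (r * (cmod s)\<^sup>2)"
      using complex_norm_square[of s] by (simp add: mult.commute mult.left_commute)
    hence "Re (cnj (- (of_real r * s)) * s) = - (r * (cmod s)\<^sup>2)"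
      by (simp only: Re_complex_of_real uminus_complex.sel)
    thus ?thesis using pos[of "- (of_real r * s)"] by (simp add: norm_mult power_mult_distrib)
  qed
  show ?thesis
  proof (cases "X = 0")
    case True
    have "s = 0"
    proof (rule ccontr)
      assume "s \<noteq> 0"
      hence "(cmod s)\<^sup>2 > 0" by simp
      \<comment> \<open>With \<open>X = 0\<close> the form takes the value \<open>-1\<close> at this
        \<open>r\<close>.\<close>
      thus False using *[of "(Y + 1) / (2 * (cmod s)\<^sup>2)"] True by (simp add: field_simps)
    qed
    thus ?thesis using True by simp
  next
    case False
    hence "X > 0" using X by simp
    moreover from this have "(1 / X)\<^sup>2 * (cmod s)\<^sup>2 * X = (cmod s)\<^sup>2 / X" by (simp add: power2_eq_square)
    ultimately have "(cmod s)\<^sup>2 / X \<le> Y" using *[of "1 / X"] by simp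
    thus ?thesis using \<open>X > 0\<close> by (simp add: field_simps)
  qed
qed

locale pre_hilbert =
  fixes V :: "'v::ab_group_add set" and hs :: "complex \<Rightarrow> 'v \<Rightarrow> 'v" and ip :: "'v \<Rightarrow> 'v \<Rightarrow> complex"
    and vac :: 'v
  assumes V_zero [simp]: "0 \<in> V" and V_add [simp]: "\<lbrakk>x \<in> V; y \<in> V\<rbrakk> \<Longrightarrow> x + y \<in> V"
    and V_hs [simp]: "x \<in> V \<Longrightarrow> hs c x \<in> V"
    and hs_one: "x \<in> V \<Longrightarrow> hs 1 x = x" and hs_hs: "x \<in> V \<Longrightarrow> hs c (hs d x) = hs (c * d) x"
    and hs_add_left: "x \<in> V \<Longrightarrow> hs (c + d) x = hs c x + hs d x"
    and hs_add: "\<lbrakk>x \<in> V; y \<in> V\<rbrakk> \<Longrightarrow> hs c (x + y) = hs c x + hs c y"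
    and ip_add: "\<lbrakk>x \<in> V; y \<in> V; z \<in> V\<rbrakk> \<Longrightarrow> ip (x + y) z = ip x z + ip y z"
    and ip_hs: "\<lbrakk>x \<in> V; z \<in> V\<rbrakk> \<Longrightarrow> ip (hs c x) z = c * ip x z"
    and ip_sym: "\<lbrakk>x \<in> V; y \<in> V\<rbrakk> \<Longrightarrow> ip x y = cnj (ip y x)"
    and ip_pos: "x \<in> V \<Longrightarrow> ip x x \<in> \<real>\<^sub>\<ge>\<^sub>0"
    and ip_def: "x \<in> V \<Longrightarrow> ip x x = 0 \<Longrightarrow> x = 0"
    and vac [simp]: "vac \<in> V" and ip_vac: "ip vac vac = 1"
begin

definition hn :: "'v \<Rightarrow> real" where "hn x = sqrt (Re (ip x x))"

lemma hn_nonneg [simp]: "x \<in> V \<Longrightarrow> 0 \<le> hn x"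
  using ip_pos[of x] by (simp add: hn_def complex_nonneg_Reals_iff)

lemma ip_sq: "x \<in> V \<Longrightarrow> ip x x = of_real ((hn x)\<^sup>2)"
  using ip_pos[of x] by (auto simp: hn_def complex_nonneg_Reals_iff complex_eq_iff)

lemma hn_eq_0: "x \<in> V \<Longrightarrow> hn x = 0 \<longleftrightarrow> x = 0"
proof
  assume x: "x \<in> V"
  show "hn x = 0 \<Longrightarrow> x = 0" using ip_sq[OF x] ip_def[OF x] by simp
  have h0: "hs 0 0 = 0" using ip_def[of "hs 0 0"] ip_hs[of 0 "hs 0 0" 0] by simp
  have "ip 0 0 = 0" using ip_hs[of 0 0 0] h0 by simp
  thus "x = 0 \<Longrightarrow> hn x = 0" by (simp add: hn_def)
qed

lemma hs_0 [simp]: "x \<in> V \<Longrightarrow> hs 0 x = 0"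
  using ip_def[of "hs 0 x"] ip_hs[of x "hs 0 x" 0] by simp

lemma hs_zero [simp]: "hs c 0 = 0"
  using hs_hs[of 0 c 0] by simp

lemma hs_m1: assumes "x \<in> V" shows "hs (-1) x = - x"
proof -
  have "hs (-1) x + hs 1 x = hs (-1 + 1) x" using assms by (simp only: hs_add_left)
  hence "hs (-1) x + x = 0" using assms by (simp add: hs_one)
  thus ?thesis by (simp add: eq_neg_iff_add_eq_0)
qed

lemma V_uminus [simp]: "x \<in> V \<Longrightarrow> - x \<in> V"
  using V_hs[of x "-1"] by (simp add: hs_m1)

lemma V_minus [simp]: "x \<in> V \<Longrightarrow> y \<in> V \<Longrightarrow> x - y \<in> V"
  using V_add[of x "- y"] by simp

lemma ip_uminus: "x \<in> V \<Longrightarrow> z \<in> V \<Longrightarrow> ip (- x) z = - ip x z"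
  using ip_hs[of x z "-1"] by (simp add: hs_m1)

lemma ip_minus: "\<lbrakk>x \<in> V; y \<in> V; z \<in> V\<rbrakk> \<Longrightarrow> ip (x - y) z = ip x z - ip y z"
  using ip_add[of x "- y" z] by (simp add: ip_uminus)

lemma ip_add_right: "\<lbrakk>x \<in> V; y \<in> V; z \<in> V\<rbrakk> \<Longrightarrow> ip z (x + y) = ip z x + ip z y"
  using ip_sym[of z "x + y"] ip_sym[of z x] ip_sym[of z y] by (simp add: ip_add)

lemma ip_hs_right: "\<lbrakk>x \<in> V; z \<in> V\<rbrakk> \<Longrightarrow> ip z (hs c x) = cnj c * ip z x"
  using ip_sym[of z "hs c x"] ip_sym[of z x] by (simp add: ip_hs)

lemma ip_zero [simp]: "x \<in> V \<Longrightarrow> ip 0 x = 0" "x \<in> V \<Longrightarrow> ip x 0 = 0"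
  using ip_hs[of 0 x 0] ip_hs_right[of 0 x 0] by auto

lemma hn_hs: assumes x: "x \<in> V" shows "hn (hs c x) = cmod c * hn x"
proof -
  have "of_real ((hn (hs c x))\<^sup>2) = c * cnj c * of_real ((hn x)\<^sup>2)"
    using x ip_sq[of "hs c x"] ip_sq[OF x] by (simp add: ip_hs ip_hs_right mult_ac)
  also have "c * cnj c = of_real ((cmod c)\<^sup>2)" using complex_norm_square[of c] by simp
  finally have "of_real ((hn (hs c x))\<^sup>2) = (of_real ((cmod c * hn x)\<^sup>2) :: complex)" by (simp add: power_mult_distrib)
  hence "(hn (hs c x))\<^sup>2 = (cmod c * hn x)\<^sup>2" by (simp only: of_real_eq_iff)
  thus ?thesis using x by (simp add: power2_eq_iff_nonneg)
qed

lemma hn_sq_add: assumes x: "x \<in> V" "y \<in> V"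
  shows "(hn (x + y))\<^sup>2 = (hn x)\<^sup>2 + 2 * Re (ip x y) + (hn y)\<^sup>2"
proof -
  have "ip (x + y) (x + y) = ip x x + ip x y + (cnj (ip x y) + ip y y)"
    using x ip_sym[of y x] by (simp add: ip_add ip_add_right)
  hence "of_real ((hn (x + y))\<^sup>2) = of_real ((hn x)\<^sup>2) + ip x y + (cnj (ip x y) + of_real ((hn y)\<^sup>2))"
    using x by (simp add: ip_sq)
  hence "Re (of_real ((hn (x + y))\<^sup>2)) = Re (of_real ((hn x)\<^sup>2) + ip x y + (cnj (ip x y) + of_real ((hn y)\<^sup>2)))"
    by simp
  thus ?thesis by simp
qed

lemma ip_CS: assumes x: "x \<in> V" "y \<in> V" shows "cmod (ip x y) \<le> hn x * hn y"
proof -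
  have "0 \<le> (cmod c)\<^sup>2 * (hn x)\<^sup>2 + 2 * Re (cnj c * ip x y) + (hn y)\<^sup>2" for c
    using hn_sq_add[of "hs (cnj c) x" y] x zero_le_power2[of "hn (hs (cnj c) x + y)"]
    by (simp add: hn_hs ip_hs power_mult_distrib)
  from form_cauchy_schwarz[OF _ this] have "(cmod (ip x y))\<^sup>2 \<le> (hn x * hn y)\<^sup>2"
    by (simp add: power_mult_distrib)
  thus ?thesis by (rule power2_le_imp_le) (use x in simp)
qed

lemma hn_triangle: assumes x: "x \<in> V" "y \<in> V" shows "hn (x + y) \<le> hn x + hn y"
proof -
  have "Re (ip x y) \<le> hn x * hn y" using ip_CS[OF x] complex_Re_le_cmod order_trans by blast
  hence "(hn (x + y))\<^sup>2 \<le> (hn x + hn y)\<^sup>2" using hn_sq_add[OF x] by (simp add: power2_sum)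
  thus ?thesis by (rule power2_le_imp_le) (use x in simp)
qed

text \<open>Without completeness a bounded operator need not have an adjoint, so the pair is taken
  as primitive; linearity then follows from it. Operators vanish outside \<open>V\<close>, so that
  equality of functions is equality of operators.\<close>

definition adjoint_pair :: "('v \<Rightarrow> 'v) \<Rightarrow> ('v \<Rightarrow> 'v) \<Rightarrow> bool" where
  "adjoint_pair T T' \<longleftrightarrow> (\<forall>x. if x \<in> V then T x \<in> V \<and> T' x \<in> V else T x = 0 \<and> T' x = 0) \<and>
     (\<forall>x\<in>V. \<forall>y\<in>V. ip (T x) y = ip x (T' y))"

definition op_bound :: "('v \<Rightarrow> 'v) \<Rightarrow> real \<Rightarrow> bool" where
  "op_bound T C \<longleftrightarrow> 0 \<le> C \<and> (\<forall>x\<in>V. hn (T x) \<le> C * hn x)"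

lemma adjoint_pairD:
  assumes "adjoint_pair T T'"
  shows "x \<in> V \<Longrightarrow> T x \<in> V" "x \<in> V \<Longrightarrow> T' x \<in> V" "x \<notin> V \<Longrightarrow> T x = 0" "x \<notin> V \<Longrightarrow> T' x = 0"
    "\<lbrakk>x \<in> V; y \<in> V\<rbrakk> \<Longrightarrow> ip (T x) y = ip x (T' y)"
  using assms unfolding adjoint_pair_def by (metis)+

lemma adjoint_pair_sym: assumes "adjoint_pair T T'" shows "adjoint_pair T' T"
proof -
  note a = adjoint_pairD[OF assms]
  have "ip (T' x) y = ip x (T y)" if "x \<in> V" "y \<in> V" for x y
    using ip_sym[of "T' x" y] ip_sym[of x "T y"] a(5)[OF that(2,1)] a that by simp
  thus ?thesis unfolding adjoint_pair_def using a by auto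
qed

lemma ip_ext: assumes "x \<in> V" "y \<in> V" "\<And>z. z \<in> V \<Longrightarrow> ip x z = ip y z" shows "x = y"
proof -
  have "ip (x - y) (x - y) = 0" using assms by (simp add: ip_minus)
  thus ?thesis using ip_def[of "x - y"] assms by simp
qed

lemma adjoint_unique: assumes "adjoint_pair T T1" "adjoint_pair T T2" shows "T1 = T2"
proof
  fix x
  note a = adjoint_pairD[OF assms(1)] and b = adjoint_pairD[OF assms(2)]
  show "T1 x = T2 x"
  proof (cases "x \<in> V")
    case True
    have "ip (T1 x) z = ip (T2 x) z" if "z \<in> V" for z
      using a(5)[OF that True] b(5)[OF that True] ip_sym[of "T1 x" z] ip_sym[of "T2 x" z] a(2) b(2) True that by simp
    thus ?thesis using a b True by (intro ip_ext) auto
  qed (use a b in auto)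
qed

lemma adjoint_linear:
  assumes "adjoint_pair T T'" "x \<in> V" "y \<in> V"
  shows "T (x + y) = T x + T y" "T (hs c x) = hs c (T x)" "T 0 = 0"
proof -
  note a = adjoint_pairD[OF assms(1)]
  show "T (x + y) = T x + T y" using assms a by (intro ip_ext) (auto simp: ip_add)
  show "T (hs c x) = hs c (T x)" using assms a by (intro ip_ext) (auto simp: ip_hs)
  have "ip (T 0) (T 0) = 0" using a(5)[of 0 "T 0"] a by simp
  thus "T 0 = 0" using ip_def a(1)[of 0] by simp
qed

lemma bound_adjoint: assumes "adjoint_pair T T'" "op_bound T C" shows "op_bound T' C"
  unfolding op_bound_def
proof (intro conjI ballI)
  note a = adjoint_pairD[OF assms(1)]
  show C: "0 \<le> C" using assms(2) by (simp add: op_bound_def)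
  fix y assume y: "y \<in> V"
  have "(hn (T' y))\<^sup>2 = cmod (ip (T (T' y)) y)"
    using a(5)[of "T' y" y] a y ip_sq[of "T' y"] by (simp add: norm_power)
  also have "\<dots> \<le> hn (T (T' y)) * hn y" using a y by (intro ip_CS) auto
  also have "\<dots> \<le> (C * hn (T' y)) * hn y"
    using assms(2) a y by (intro mult_right_mono) (auto simp: op_bound_def)
  finally have "hn (T' y) * hn (T' y) \<le> hn (T' y) * (C * hn y)" by (simp add: power2_eq_square mult_ac)
  thus "hn (T' y) \<le> C * hn y"
    using a y C by (cases "hn (T' y) = 0") (auto simp: mult_le_cancel_left less_le)
qed

definition Bop :: "('v \<Rightarrow> 'v) cstar_prob" where
  "Bop = \<lparr>
     carrier = {T. (\<exists>T'. adjoint_pair T T') \<and> (\<exists>C. op_bound T C)},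
     mult = (\<lambda>T S x. T (S x)),
     one = (\<lambda>x. if x \<in> V then x else 0),
     ring.zero = (\<lambda>x. 0),
     add = (\<lambda>T S x. T x + S x),
     cscale = (\<lambda>c T x. hs c (T x)),
     adj = (\<lambda>T. THE T'. adjoint_pair T T'),
     nrm = (\<lambda>T. Inf {C. op_bound T C}),
     state = (\<lambda>T. ip (T vac) vac)\<rparr>"

lemma Bop_simps [simp]: "mult Bop T S = (\<lambda>x. T (S x))" "one Bop = (\<lambda>x. if x \<in> V then x else 0)"
  "ring.zero Bop = (\<lambda>x. 0)" "add Bop T S = (\<lambda>x. T x + S x)" "cscale Bop c T = (\<lambda>x. hs c (T x))"
  "state Bop T = ip (T vac) vac"
  by (simp_all add: Bop_def)

lemma Bop_carrierI: "\<lbrakk>adjoint_pair T T'; op_bound T C\<rbrakk> \<Longrightarrow> T \<in> carrier Bop"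
  by (auto simp: Bop_def)

lemma Bop_adjI: "adjoint_pair T T' \<Longrightarrow> adj Bop T = T'"
  using adjoint_unique by (auto simp: Bop_def intro!: the_equality)

lemma Bop_adj: "T \<in> carrier Bop \<Longrightarrow> adjoint_pair T (adj Bop T)"
  using Bop_adjI by (auto simp: Bop_def[THEN arg_cong, of carrier])

lemma Bop_nrm:
  assumes "T \<in> carrier Bop"
  shows "op_bound T (nrm Bop T)" "op_bound T C \<Longrightarrow> nrm Bop T \<le> C"
proof -
  let ?S = "{C. op_bound T C}"
  have n: "nrm Bop T = Inf ?S" by (simp add: Bop_def)
  have ne: "?S \<noteq> {}" using assms by (auto simp: Bop_def)
  have bd: "bdd_below ?S" by (intro bdd_belowI[of _ 0]) (simp add: op_bound_def)
  show "op_bound T C \<Longrightarrow> nrm Bop T \<le> C" unfolding n by (rule cInf_lower) (use bd in auto)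
  have "0 \<le> Inf ?S" using ne by (intro cInf_greatest) (auto simp: op_bound_def)
  moreover have "hn (T x) \<le> Inf ?S * hn x" if x: "x \<in> V" for x
  proof (cases "hn x = 0")
    case True
    thus ?thesis using ne x by (auto simp: op_bound_def)
  next
    case False
    hence p: "hn x > 0" using x by (simp add: less_le)
    have "hn (T x) / hn x \<le> Inf ?S" using ne p x
      by (intro cInf_greatest) (auto simp: op_bound_def divide_le_eq)
    thus ?thesis using p by (simp add: divide_le_eq)
  qed
  ultimately show "op_bound T (nrm Bop T)" unfolding n op_bound_def[of T "Inf ?S"] by blast
qed

lemma adjoint_pair_ops:
  assumes T: "adjoint_pair T T'" and S: "adjoint_pair S S'"
  shows "adjoint_pair (\<lambda>x. T (S x)) (\<lambda>x. S' (T' x))" "adjoint_pair (\<lambda>x. T x + S x) (\<lambda>x. T' x + S' x)"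
    "adjoint_pair (\<lambda>x. hs c (T x)) (\<lambda>x. hs (cnj c) (T' x))"
proof -
  note t = adjoint_pairD[OF T] and s = adjoint_pairD[OF S]
  have t0: "T 0 = 0" "S' 0 = 0"
    using adjoint_linear(3)[OF T V_zero V_zero] adjoint_linear(3)[OF adjoint_pair_sym[OF S] V_zero V_zero] .
  show "adjoint_pair (\<lambda>x. T (S x)) (\<lambda>x. S' (T' x))" "adjoint_pair (\<lambda>x. T x + S x) (\<lambda>x. T' x + S' x)"
    "adjoint_pair (\<lambda>x. hs c (T x)) (\<lambda>x. hs (cnj c) (T' x))"
    unfolding adjoint_pair_def using t s t0
    by (auto simp: ip_add ip_add_right ip_hs ip_hs_right)
qed

lemma op_bound_ops:
  assumes T: "adjoint_pair T T'" "op_bound T C" and S: "adjoint_pair S S'" "op_bound S D"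
  shows "op_bound (\<lambda>x. T (S x)) (C * D)" "op_bound (\<lambda>x. T x + S x) (C + D)" "op_bound (\<lambda>x. hs c (T x)) (cmod c * C)"
proof -
  note t = adjoint_pairD[OF T(1)] and s = adjoint_pairD[OF S(1)]
  have C: "0 \<le> C" "0 \<le> D" and b: "\<And>x. x \<in> V \<Longrightarrow> hn (T x) \<le> C * hn x" "\<And>x. x \<in> V \<Longrightarrow> hn (S x) \<le> D * hn x"
    using T S by (auto simp: op_bound_def)
  have "hn (T (S x)) \<le> C * D * hn x" if "x \<in> V" for x
    using order_trans[OF b(1)[of "S x"] mult_left_mono[OF b(2)[OF that] C(1)]] s that by (simp add: mult.assoc)
  thus "op_bound (\<lambda>x. T (S x)) (C * D)" using C by (simp add: op_bound_def)
  have "hn (T x + S x) \<le> (C + D) * hn x" if "x \<in> V" for x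
    using order_trans[OF hn_triangle add_mono[OF b(1)[OF that] b(2)[OF that]]] s t that by (simp add: distrib_right)
  thus "op_bound (\<lambda>x. T x + S x) (C + D)" using C by (simp add: op_bound_def)
  show "op_bound (\<lambda>x. hs c (T x)) (cmod c * C)"
    using C b t by (auto simp: op_bound_def hn_hs mult.assoc intro: mult_left_mono)
qed

lemma adjoint_pair_id: "adjoint_pair (\<lambda>x. if x \<in> V then x else 0) (\<lambda>x. if x \<in> V then x else 0)"
  by (simp add: adjoint_pair_def)

lemma Bop_closed:
  assumes T: "T \<in> carrier Bop" and S: "S \<in> carrier Bop"
  shows "T \<otimes>\<^bsub>Bop\<^esub> S \<in> carrier Bop" "T \<oplus>\<^bsub>Bop\<^esub> S \<in> carrier Bop" "cscale Bop c T \<in> carrier Bop"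
    "adj Bop T \<in> carrier Bop"
proof -
  note t = Bop_adj[OF T] Bop_nrm(1)[OF T] and s = Bop_adj[OF S] Bop_nrm(1)[OF S]
  note a = adjoint_pair_ops[OF t(1) s(1)] and b = op_bound_ops[OF t s]
  show "T \<otimes>\<^bsub>Bop\<^esub> S \<in> carrier Bop" "T \<oplus>\<^bsub>Bop\<^esub> S \<in> carrier Bop" "cscale Bop c T \<in> carrier Bop"
    using Bop_carrierI[OF a(1) b(1)] Bop_carrierI[OF a(2) b(2)] Bop_carrierI[OF a(3) b(3)] by simp_all
  show "adj Bop T \<in> carrier Bop"
    by (rule Bop_carrierI[OF adjoint_pair_sym[OF t(1)] bound_adjoint[OF t]])
qed

lemma Bop_one_closed: "\<one>\<^bsub>Bop\<^esub> \<in> carrier Bop"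
  using Bop_carrierI[OF adjoint_pair_id, of 1] by (simp add: op_bound_def)

lemma Bop_zero_closed: "\<zero>\<^bsub>Bop\<^esub> \<in> carrier Bop"
  using Bop_carrierI[of "\<lambda>x. 0" "\<lambda>x. 0" 0] hn_eq_0[of 0] by (simp add: op_bound_def adjoint_pair_def)

lemma Bop_ops_ext:
  assumes "adjoint_pair T T'" "adjoint_pair S S'" "\<And>x. x \<in> V \<Longrightarrow> T x = S x" shows "T = S"
proof
  fix x show "T x = S x" using adjoint_pairD(3)[OF assms(1)] adjoint_pairD(3)[OF assms(2)] assms(3) by (cases "x \<in> V") auto
qed

lemma Bop_pre_cstar: "pre_cstar Bop"
proof -
  have V: "T x \<in> V" if "T \<in> carrier Bop" "x \<in> V" for T x using adjoint_pairD(1)[OF Bop_adj[OF that(1)] that(2)] .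
  have V0: "T x = 0" if "T \<in> carrier Bop" "x \<notin> V" for T x using adjoint_pairD(3)[OF Bop_adj[OF that(1)] that(2)] .
  have V1: "T x \<in> V" if "T \<in> carrier Bop" for T x using V[OF that] V0[OF that] by (cases "x \<in> V") auto
  have lin: "T (x + y) = T x + T y" "T (hs c x) = hs c (T x)" "T 0 = 0" if "T \<in> carrier Bop" "x \<in> V" "y \<in> V" for T x y c
    using adjoint_linear[OF Bop_adj[OF that(1)] that(2,3)] .
  have ring: "ring Bop"
  proof (rule ringI)
    show "abelian_group Bop"
    proof (rule abelian_groupI)
      fix T assume T: "T \<in> carrier Bop"
      have "cscale Bop (-1) T \<oplus>\<^bsub>Bop\<^esub> T = \<zero>\<^bsub>Bop\<^esub>" using V1[OF T] by (simp add: hs_m1)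
      thus "\<exists>y\<in>carrier Bop. y \<oplus>\<^bsub>Bop\<^esub> T = \<zero>\<^bsub>Bop\<^esub>" using Bop_closed(3)[OF T T] by blast
    qed (use Bop_closed(2) Bop_zero_closed in \<open>auto simp: algebra_simps\<close>)
    show "monoid Bop"
    proof (rule monoidI)
      fix T assume T: "T \<in> carrier Bop"
      show "\<one>\<^bsub>Bop\<^esub> \<otimes>\<^bsub>Bop\<^esub> T = T" using V1[OF T] by auto
      show "T \<otimes>\<^bsub>Bop\<^esub> \<one>\<^bsub>Bop\<^esub> = T" using V0[OF T] lin(3)[OF T V_zero V_zero] by (auto simp: fun_eq_iff)
    qed (use Bop_closed(1) Bop_one_closed in auto)
    fix T S R assume T: "T \<in> carrier Bop" "S \<in> carrier Bop" "R \<in> carrier Bop"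
    show "(T \<oplus>\<^bsub>Bop\<^esub> S) \<otimes>\<^bsub>Bop\<^esub> R = T \<otimes>\<^bsub>Bop\<^esub> R \<oplus>\<^bsub>Bop\<^esub> S \<otimes>\<^bsub>Bop\<^esub> R" by simp
    show "R \<otimes>\<^bsub>Bop\<^esub> (T \<oplus>\<^bsub>Bop\<^esub> S) = R \<otimes>\<^bsub>Bop\<^esub> T \<oplus>\<^bsub>Bop\<^esub> R \<otimes>\<^bsub>Bop\<^esub> S" using V1 T lin(1) by simp
  qed
  interpret R: ring Bop by (rule ring)
  show ?thesis
  proof
    fix T c d assume T: "T \<in> carrier Bop"
    note a = Bop_adj[OF T] and n = Bop_nrm[OF T]
    show "cscale Bop c T \<in> carrier Bop" "adj Bop T \<in> carrier Bop" using Bop_closed[OF T T] by auto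
    show "cscale Bop 1 T = T" "cscale Bop c (cscale Bop d T) = cscale Bop (c * d) T"
      "cscale Bop (c + d) T = cscale Bop c T \<oplus>\<^bsub>Bop\<^esub> cscale Bop d T"
      using V1[OF T] by (simp_all add: hs_one hs_hs hs_add_left)
    show "adj Bop (adj Bop T) = T" using Bop_adjI[OF adjoint_pair_sym[OF a]] .
    show "adj Bop (cscale Bop c T) = cscale Bop (cnj c) (adj Bop T)"
      using Bop_adjI[OF adjoint_pair_ops(3)[OF a a]] by simp
    show n0: "0 \<le> nrm Bop T" using n(1) by (simp add: op_bound_def)
    show "nrm Bop T = 0 \<longleftrightarrow> T = \<zero>\<^bsub>Bop\<^esub>"
    proof
      assume "nrm Bop T = 0"
      hence "hn (T x) \<le> 0" if "x \<in> V" for x using n(1) that by (auto simp: op_bound_def)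
      hence "T x = 0" if "x \<in> V" for x using that hn_eq_0[of "T x"] hn_nonneg[of "T x"] V1[OF T] by (metis antisym)
      thus "T = \<zero>\<^bsub>Bop\<^esub>" using V0[OF T] by (auto simp: fun_eq_iff)
    next
      assume "T = \<zero>\<^bsub>Bop\<^esub>"
      hence "op_bound T 0" using hn_eq_0[of 0] by (simp add: op_bound_def)
      thus "nrm Bop T = 0" using n(2)[of 0] n0 by simp
    qed
    show "nrm Bop (cscale Bop c T) = cmod c * nrm Bop T"
    proof (rule antisym)
      show le: "nrm Bop (cscale Bop c T) \<le> cmod c * nrm Bop T"
        using Bop_nrm(2)[OF Bop_closed(3)[OF T T], of c "cmod c * nrm Bop T"] op_bound_ops(3)[OF a n(1) a n(1), of c] by simp
      show "cmod c * nrm Bop T \<le> nrm Bop (cscale Bop c T)"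
      proof (cases "c = 0")
        case True
        thus ?thesis using Bop_nrm(1)[OF Bop_closed(3)[OF T T, of c]] by (simp add: op_bound_def)
      next
        case False
        let ?S = "cscale Bop c T"
        have S: "?S \<in> carrier Bop" using Bop_closed(3)[OF T T] .
        have eq: "(\<lambda>x. hs (1 / c) (?S x)) = T" using V1[OF T] False by (simp add: hs_hs hs_one)
        have "op_bound T (cmod (1 / c) * nrm Bop ?S)"
          using op_bound_ops(3)[OF Bop_adj[OF S] Bop_nrm(1)[OF S] Bop_adj[OF S] Bop_nrm(1)[OF S], of "1 / c"] unfolding eq .
        hence "nrm Bop T \<le> cmod (1 / c) * nrm Bop ?S" by (rule n(2))
        thus ?thesis by (rule cmod_divide_le[OF False])
      qed
    qed
    show "nrm Bop (adj Bop T \<otimes>\<^bsub>Bop\<^esub> T) = (nrm Bop T)\<^sup>2"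
    proof (rule antisym)
      have c: "adj Bop T \<otimes>\<^bsub>Bop\<^esub> T \<in> carrier Bop" by (rule Bop_closed(1)[OF Bop_closed(4)[OF T T] T])
      have "op_bound (adj Bop T \<otimes>\<^bsub>Bop\<^esub> T) (nrm Bop T * nrm Bop T)"
        using op_bound_ops(1)[OF adjoint_pair_sym[OF a] bound_adjoint[OF a n(1)] a n(1)] by simp
      thus "nrm Bop (adj Bop T \<otimes>\<^bsub>Bop\<^esub> T) \<le> (nrm Bop T)\<^sup>2" using Bop_nrm(2)[OF c] by (simp add: power2_eq_square)
      define q where "q = nrm Bop (adj Bop T \<otimes>\<^bsub>Bop\<^esub> T)"
      have q: "op_bound (adj Bop T \<otimes>\<^bsub>Bop\<^esub> T) q" using Bop_nrm(1)[OF c] by (simp add: q_def)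
      hence q0: "q \<ge> 0" by (simp add: op_bound_def)
      have "op_bound T (sqrt q)" unfolding op_bound_def
      proof (intro conjI ballI)
        fix x assume x: "x \<in> V"
        have Tx: "T x \<in> V" "adj Bop T (T x) \<in> V" using adjoint_pairD(1,2)[OF a] x by auto
        have "(hn (T x))\<^sup>2 = cmod (ip (adj Bop T (T x)) x)"
          using adjoint_pairD(5)[OF adjoint_pair_sym[OF a] Tx(1) x] ip_sq[OF Tx(1)] by (simp add: norm_power)
        also have "\<dots> \<le> hn (adj Bop T (T x)) * hn x" using Tx x by (intro ip_CS)
        also have "\<dots> \<le> q * hn x * hn x" using q x by (intro mult_right_mono) (auto simp: op_bound_def)
        finally have "(hn (T x))\<^sup>2 \<le> (sqrt q * hn x)\<^sup>2" using q0
          by (simp only: power_mult_distrib real_sqrt_pow2 power2_eq_square[of "hn x"] mult.assoc)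
        thus "hn (T x) \<le> sqrt q * hn x" by (rule power2_le_imp_le) (use q0 x in simp)
      qed (use q0 in simp)
      hence "nrm Bop T \<le> sqrt q" by (rule n(2))
      hence "(nrm Bop T)\<^sup>2 \<le> (sqrt q)\<^sup>2" using n0 by (rule power_mono)
      thus "(nrm Bop T)\<^sup>2 \<le> nrm Bop (adj Bop T \<otimes>\<^bsub>Bop\<^esub> T)" using q0 by (simp add: q_def)
    qed
  next
    fix T S c assume T: "T \<in> carrier Bop" and S: "S \<in> carrier Bop"
    note a = Bop_adj[OF T] Bop_adj[OF S] and n = Bop_nrm[OF T] Bop_nrm[OF S]
    show "cscale Bop c (T \<oplus>\<^bsub>Bop\<^esub> S) = cscale Bop c T \<oplus>\<^bsub>Bop\<^esub> cscale Bop c S"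
      using V1[OF T] V1[OF S] by (simp add: hs_add)
    show "cscale Bop c T \<otimes>\<^bsub>Bop\<^esub> S = cscale Bop c (T \<otimes>\<^bsub>Bop\<^esub> S)" by simp
    show "T \<otimes>\<^bsub>Bop\<^esub> cscale Bop c S = cscale Bop c (T \<otimes>\<^bsub>Bop\<^esub> S)"
      using lin(2)[OF T V1[OF S] V_zero] by simp
    show "adj Bop (T \<oplus>\<^bsub>Bop\<^esub> S) = adj Bop T \<oplus>\<^bsub>Bop\<^esub> adj Bop S"
      using Bop_adjI[OF adjoint_pair_ops(2)[OF a]] by simp
    show "adj Bop (T \<otimes>\<^bsub>Bop\<^esub> S) = adj Bop S \<otimes>\<^bsub>Bop\<^esub> adj Bop T"
      using Bop_adjI[OF adjoint_pair_ops(1)[OF a]] by simp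
    show "nrm Bop (T \<oplus>\<^bsub>Bop\<^esub> S) \<le> nrm Bop T + nrm Bop S"
      using Bop_nrm(2)[OF Bop_closed(2)[OF T S]] op_bound_ops(2)[OF a(1) n(1) a(2) n(3)] by simp
    show "nrm Bop (T \<otimes>\<^bsub>Bop\<^esub> S) \<le> nrm Bop T * nrm Bop S"
      using Bop_nrm(2)[OF Bop_closed(1)[OF T S]] op_bound_ops(1)[OF a(1) n(1) a(2) n(3)] by simp
  qed
qed

sublocale BB: pre_cstar Bop by (rule Bop_pre_cstar)

lemma Bop_V: "T \<in> carrier Bop \<Longrightarrow> x \<in> V \<Longrightarrow> T x \<in> V"
  using adjoint_pairD(1)[OF Bop_adj] .

lemma Bop_ip: "\<lbrakk>T \<in> carrier Bop; x \<in> V; y \<in> V\<rbrakk> \<Longrightarrow> ip (adj Bop T x) y = ip x (T y)"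
  using adjoint_pairD(5)[OF adjoint_pair_sym[OF Bop_adj]] .

lemma Bop_state_sq: "T \<in> carrier Bop \<Longrightarrow> state Bop (adj Bop T \<otimes>\<^bsub>Bop\<^esub> T) = ip (T vac) (T vac)"
  using Bop_ip[of T "T vac" vac] Bop_V[of T vac] by simp

sublocale BB: pre_prob Bop
proof
  show st: "is_state Bop"
    unfolding is_state_def
  proof (intro conjI ballI allI)
    fix T assume T: "T \<in> carrier Bop"
    show "state Bop (adj Bop T \<otimes>\<^bsub>Bop\<^esub> T) \<in> \<real>\<^sub>\<ge>\<^sub>0"
      unfolding Bop_state_sq[OF T] using ip_pos Bop_V[OF T vac] .
  qed (simp_all add: Bop_V ip_add ip_hs ip_vac)
  fix T X assume T: "T \<in> carrier Bop" and X: "X \<in> carrier Bop"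
  have N: "pre_state.N2 Bop S = hn (S vac)" if S: "S \<in> carrier Bop" for S
  proof -
    interpret pre_state Bop by unfold_locales (rule st)
    show ?thesis unfolding N2_def hn_def Bop_state_sq[OF S] ..
  qed
  show "pre_state.N2 Bop (T \<otimes>\<^bsub>Bop\<^esub> X) \<le> nrm Bop T * pre_state.N2 Bop X"
    using N[OF X] N[OF Bop_closed(1)[OF T X]] Bop_nrm(1)[OF T] Bop_V[OF X vac] by (simp add: op_bound_def)
qed

lemma BB_N2: "S \<in> carrier Bop \<Longrightarrow> BB.N2 S = hn (S vac)"
  unfolding BB.N2_def hn_def by (subst Bop_state_sq) auto

end

section \<open>The GNS space of a dense subalgebra\<close>

locale dense_rep = pre_prob A for A :: "'a cstar_prob" (structure) +
  fixes W :: "'a set"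
  assumes W: "star_subalg W"
begin

lemmas Ws = star_subalgD[OF W]

lemma Wc [simp]: "x \<in> W \<Longrightarrow> x \<in> alg" by (rule Ws)

text \<open>The GNS vector of \<open>x\<close>, encoded by its inner products with \<open>W\<close>.
  Null vectors become the zero function, so the quotient is taken without cosets, and functions
  provide the additive group.\<close>

definition kv :: "'a \<Rightarrow> 'a \<Rightarrow> complex" where
  "kv x = (\<lambda>y. if y \<in> W then st (star y \<otimes> x) else 0)"

definition hs :: "complex \<Rightarrow> ('a \<Rightarrow> complex) \<Rightarrow> 'a \<Rightarrow> complex" where "hs c f = (\<lambda>y. c * f y)"

definition rp :: "('a \<Rightarrow> complex) \<Rightarrow> 'a" where "rp f = (SOME w. w \<in> W \<and> f = kv w)"

definition ip :: "('a \<Rightarrow> complex) \<Rightarrow> ('a \<Rightarrow> complex) \<Rightarrow> complex" where "ip f g = f (rp g)"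

definition VV :: "('a \<Rightarrow> complex) set" where "VV = kv ` W"

lemma kv_V [simp]: "x \<in> W \<Longrightarrow> kv x \<in> VV" by (simp add: VV_def)

lemma VVE: assumes "f \<in> VV" obtains x where "x \<in> W" "f = kv x" using assms by (auto simp: VV_def)

lemma rp: assumes "f \<in> VV" shows "rp f \<in> W" "kv (rp f) = f"
proof -
  have "\<exists>w. w \<in> W \<and> f = kv w" using assms by (auto simp: VV_def)
  from someI_ex[OF this] show "rp f \<in> W" "kv (rp f) = f" by (simp_all add: rp_def)
qed

lemma kv_eq_st: assumes "x \<in> W" "x' \<in> W" "kv x = kv x'" "y \<in> W" shows "st (star y \<otimes> x) = st (star y \<otimes> x')"
  using fun_cong[OF assms(3), of y] assms(4) by (simp add: kv_def)

lemma kv_eqI: assumes "\<And>y. y \<in> W \<Longrightarrow> st (star y \<otimes> x) = st (star y \<otimes> x')" shows "kv x = kv x'"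
  using assms by (auto simp: kv_def)

lemma st_flip: "x \<in> alg \<Longrightarrow> y \<in> alg \<Longrightarrow> st (star x \<otimes> y) = cnj (st (star y \<otimes> x))"
  using st_adj[of "star y \<otimes> x"] by (simp add: adj_mult)

lemma ip_kv: assumes x: "x \<in> W" "y \<in> W" shows "ip (kv x) (kv y) = st (star y \<otimes> x)"
proof -
  note r = rp[OF kv_V[OF x(2)]]
  have "st (star x \<otimes> rp (kv y)) = st (star x \<otimes> y)" using kv_eq_st[OF r(1) x(2) r(2) x(1)] .
  thus ?thesis using r(1) x st_flip[of "rp (kv y)" x] st_flip[of y x] by (simp add: ip_def kv_def[of x])
qed

lemma kv_add: "x \<in> W \<Longrightarrow> y \<in> W \<Longrightarrow> kv (x \<oplus> y) = kv x + kv y"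
  by (auto simp: kv_def fun_eq_iff r_distr st_add)

lemma kv_sc: "x \<in> W \<Longrightarrow> kv (sc c x) = hs c (kv x)"
  by (auto simp: kv_def hs_def fun_eq_iff cscale_mult_right st_cscale)

lemma kv_zero: "kv \<zero> = 0"
  by (auto simp: kv_def fun_eq_iff)

lemma kv_pre_hilbert: "pre_hilbert VV hs ip (kv \<one>)"
proof
  show "0 \<in> VV" using kv_V[OF Ws(7)] kv_zero by simp
  show "x + y \<in> VV" if "x \<in> VV" "y \<in> VV" for x y
    using that kv_V[OF Ws(3)] by (auto simp: VV_def simp flip: kv_add)
  show "hs c x \<in> VV" if "x \<in> VV" for x c
    using that kv_V[OF Ws(5)] by (auto simp: VV_def simp flip: kv_sc)
  show "ip x y = cnj (ip y x)" if "x \<in> VV" "y \<in> VV" for x y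
  proof -
    obtain u v where "u \<in> W" "v \<in> W" "x = kv u" "y = kv v" using \<open>x \<in> VV\<close> \<open>y \<in> VV\<close> by (auto elim!: VVE)
    thus ?thesis using st_flip[of v u] by (simp only: ip_kv Wc)
  qed
  show "ip x x \<in> \<real>\<^sub>\<ge>\<^sub>0" if "x \<in> VV" for x using that by (auto elim!: VVE simp: ip_kv intro: st_pos[OF Wc])
  show "x = 0" if "x \<in> VV" "ip x x = 0" for x
  proof -
    obtain w where w: "w \<in> W" "x = kv w" using \<open>x \<in> VV\<close> by (rule VVE)
    hence "N2 w = 0" using \<open>ip x x = 0\<close> by (simp add: ip_kv N2_def)
    hence "st (star y \<otimes> w) = 0" if "y \<in> W" for y using CS[of y w] that w by simp
    thus ?thesis using w(2) by (auto simp: kv_def fun_eq_iff)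
  qed
  show "kv \<one> \<in> VV" "ip (kv \<one>) (kv \<one>) = 1" using Ws(2) by (simp_all add: ip_kv)
qed (auto simp: hs_def ip_def fun_eq_iff distrib_left distrib_right)

sublocale H: pre_hilbert VV hs ip "kv \<one>" by (rule kv_pre_hilbert)

lemma hn_kv: "x \<in> W \<Longrightarrow> H.hn (kv x) = N2 x"
  by (simp add: H.hn_def ip_kv N2_def)

definition opr :: "('a \<Rightarrow> 'a) \<Rightarrow> ('a \<Rightarrow> complex) \<Rightarrow> 'a \<Rightarrow> complex" where
  "opr \<phi> f = (if f \<in> VV then kv (\<phi> (rp f)) else 0)"

text \<open>The formal adjoint makes \<open>kv (\<phi> x)\<close> depend on \<open>kv x\<close>
  alone and forces linearity, so \<open>\<phi>\<close> may be given by arbitrary choices modulo null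
  vectors.\<close>

lemma opr:
  assumes \<phi>: "\<And>x. x \<in> W \<Longrightarrow> \<phi> x \<in> W" "\<And>x. x \<in> W \<Longrightarrow> \<psi> x \<in> W"
    and ad: "\<And>x y. x \<in> W \<Longrightarrow> y \<in> W \<Longrightarrow> st (star y \<otimes> \<phi> x) = st (star (\<psi> y) \<otimes> x)"
    and b: "C \<ge> 0" "\<And>x. x \<in> W \<Longrightarrow> N2 (\<phi> x) \<le> C * N2 x"
  shows "opr \<phi> \<in> carrier H.Bop" "adj H.Bop (opr \<phi>) = opr \<psi>" "x \<in> W \<Longrightarrow> opr \<phi> (kv x) = kv (\<phi> x)"
    "x \<in> W \<Longrightarrow> opr \<psi> (kv x) = kv (\<psi> x)" "nrm H.Bop (opr \<phi>) \<le> C"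
proof -
  have ad': "st (star y \<otimes> \<psi> x) = st (star (\<phi> y) \<otimes> x)" if "x \<in> W" "y \<in> W" for x y
    using ad[OF that(2,1)] st_flip[of y "\<psi> x"] st_flip[of "\<phi> y" x] that \<phi> by simp
  have 1: "opr \<phi> (kv x) = kv (\<phi> x)" if x: "x \<in> W" for x
  proof -
    note r = rp[OF kv_V[OF x]]
    have "kv (\<phi> (rp (kv x))) = kv (\<phi> x)"
      by (rule kv_eqI) (use kv_eq_st[OF r(1) x r(2) \<phi>(2)] ad r x in simp)
    thus ?thesis using x by (simp add: opr_def)
  qed
  have 2: "opr \<psi> (kv x) = kv (\<psi> x)" if x: "x \<in> W" for x
  proof -
    note r = rp[OF kv_V[OF x]]
    have "kv (\<psi> (rp (kv x))) = kv (\<psi> x)"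
      by (rule kv_eqI) (use kv_eq_st[OF r(1) x r(2) \<phi>(1)] ad' r x in simp)
    thus ?thesis using x by (simp add: opr_def)
  qed
  have ap: "H.adjoint_pair (opr \<phi>) (opr \<psi>)"
    unfolding H.adjoint_pair_def
  proof (intro conjI allI ballI)
    fix f show "if f \<in> VV then opr \<phi> f \<in> VV \<and> opr \<psi> f \<in> VV else opr \<phi> f = 0 \<and> opr \<psi> f = 0"
      using rp(1)[of f] \<phi> by (simp add: opr_def)
  next
    fix f g assume "f \<in> VV" "g \<in> VV"
    then obtain x y where "x \<in> W" "y \<in> W" "f = kv x" "g = kv y" by (auto elim!: VVE)
    thus "ip (opr \<phi> f) g = ip f (opr \<psi> g)" using 1 2 \<phi> ad by (simp add: ip_kv)
  qed
  have bd: "H.op_bound (opr \<phi>) C"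
    unfolding H.op_bound_def
  proof (intro conjI ballI)
    fix f assume "f \<in> VV"
    then obtain x where "x \<in> W" "f = kv x" by (rule VVE)
    thus "H.hn (opr \<phi> f) \<le> C * H.hn f" using 1 b \<phi> by (simp add: hn_kv)
  qed (rule b)
  show "opr \<phi> \<in> carrier H.Bop" using H.Bop_carrierI[OF ap bd] .
  thus "nrm H.Bop (opr \<phi>) \<le> C" using H.Bop_nrm(2) bd by blast
  show "adj H.Bop (opr \<phi>) = opr \<psi>" using H.Bop_adjI[OF ap] .
  show "x \<in> W \<Longrightarrow> opr \<phi> (kv x) = kv (\<phi> x)" "x \<in> W \<Longrightarrow> opr \<psi> (kv x) = kv (\<psi> x)" using 1 2 by auto
qed

lemma Bop_eqI:
  assumes "T \<in> carrier H.Bop" "S \<in> carrier H.Bop" "\<And>x. x \<in> W \<Longrightarrow> T (kv x) = S (kv x)" shows "T = S"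
proof (rule H.Bop_ops_ext[OF H.Bop_adj[OF assms(1)] H.Bop_adj[OF assms(2)]])
  fix f assume "f \<in> VV"
  thus "T f = S f" using assms(3) by (auto elim!: VVE)
qed

definition Lop :: "'a \<Rightarrow> ('a \<Rightarrow> complex) \<Rightarrow> 'a \<Rightarrow> complex" where "Lop e = opr (\<lambda>x. e \<otimes> x)"

lemma Lop:
  assumes e: "e \<in> W"
  shows "Lop e \<in> carrier H.Bop" "adj H.Bop (Lop e) = Lop (star e)" "x \<in> W \<Longrightarrow> Lop e (kv x) = kv (e \<otimes> x)"
    "nrm H.Bop (Lop e) \<le> nn e"
proof -
  have a: "st (star y \<otimes> (e \<otimes> x)) = st (star (star e \<otimes> y) \<otimes> x)" if "x \<in> W" "y \<in> W" for x y
    using that e by (simp add: adj_mult m_assoc)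
  note o = opr[of "\<lambda>x. e \<otimes> x" "\<lambda>x. star e \<otimes> x" "nn e", OF Ws(4)[OF e] Ws(4)[OF Ws(6)[OF e]] a _ N2_mult]
  show "Lop e \<in> carrier H.Bop" "adj H.Bop (Lop e) = Lop (star e)" "x \<in> W \<Longrightarrow> Lop e (kv x) = kv (e \<otimes> x)"
    "nrm H.Bop (Lop e) \<le> nn e"
    using o e by (simp_all add: Lop_def)
qed

lemma Lop_simps:
  assumes e: "e \<in> W" and f: "f \<in> W"
  shows "Lop (e \<otimes> f) = Lop e \<otimes>\<^bsub>H.Bop\<^esub> Lop f" "Lop (e \<oplus> f) = Lop e \<oplus>\<^bsub>H.Bop\<^esub> Lop f"
    "Lop (sc c e) = cscale H.Bop c (Lop e)" "Lop \<one> = \<one>\<^bsub>H.Bop\<^esub>" "state H.Bop (Lop e) = st e"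
proof -
  note L = Lop[OF e] Lop[OF f]
  show "Lop (e \<otimes> f) = Lop e \<otimes>\<^bsub>H.Bop\<^esub> Lop f"
  proof (rule Bop_eqI[OF Lop(1)[OF Ws(4)[OF e f]] H.Bop_closed(1)[OF L(1) L(5)]])
    fix x assume x: "x \<in> W"
    show "Lop (e \<otimes> f) (kv x) = (Lop e \<otimes>\<^bsub>H.Bop\<^esub> Lop f) (kv x)"
      using Lop(3)[OF Ws(4)[OF e f] x] L(3)[OF Ws(4)[OF f x]] L(7)[OF x] e f x by (simp add: m_assoc)
  qed
  show "Lop (e \<oplus> f) = Lop e \<oplus>\<^bsub>H.Bop\<^esub> Lop f"
  proof (rule Bop_eqI[OF Lop(1)[OF Ws(3)[OF e f]] H.Bop_closed(2)[OF L(1) L(5)]])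
    fix x assume x: "x \<in> W"
    show "Lop (e \<oplus> f) (kv x) = (Lop e \<oplus>\<^bsub>H.Bop\<^esub> Lop f) (kv x)"
      using Lop(3)[OF Ws(3)[OF e f] x] L(3)[OF x] L(7)[OF x] kv_add[OF Ws(4)[OF e x] Ws(4)[OF f x]] e f x
      by (simp add: l_distr)
  qed
  show "Lop (sc c e) = cscale H.Bop c (Lop e)"
  proof (rule Bop_eqI[OF Lop(1)[OF Ws(5)[OF e]] H.Bop_closed(3)[OF L(1) L(1)]])
    fix x assume x: "x \<in> W"
    show "Lop (sc c e) (kv x) = cscale H.Bop c (Lop e) (kv x)"
      using Lop(3)[OF Ws(5)[OF e] x] L(3)[OF x] kv_sc[OF Ws(4)[OF e x]] e x by (simp add: cscale_mult_left)
  qed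
  show "Lop \<one> = \<one>\<^bsub>H.Bop\<^esub>"
  proof (rule Bop_eqI[OF Lop(1)[OF Ws(2)] H.Bop_one_closed])
    fix x assume x: "x \<in> W"
    show "Lop \<one> (kv x) = \<one>\<^bsub>H.Bop\<^esub> (kv x)"
      using Lop(3)[OF Ws(2) x] x by simp
  qed
  show "state H.Bop (Lop e) = st e" using L(3)[OF Ws(2)] Ws(2) e by (simp add: ip_kv)
qed

lemma Lop_isometric:
  assumes f: "faithful_prob A" and d: "\<And>x e. x \<in> alg \<Longrightarrow> e > 0 \<Longrightarrow> \<exists>y\<in>W. nn (x \<ominus> y) < e" and e: "e \<in> W"
  shows "nrm H.Bop (Lop e) = nn e"
proof (rule antisym)
  show "nn e \<le> nrm H.Bop (Lop e)"
  proof (rule faithful_prob.gns_isometric_dense[OF f Wc[OF e] H.BB.nrm_nonneg[OF Lop(1)[OF e]] _ d])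
    fix x assume x: "x \<in> W"
    show "N2 (e \<otimes> x) \<le> nrm H.Bop (Lop e) * N2 x"
      using H.Bop_nrm(1)[OF Lop(1)[OF e]] Lop(3)[OF e x] x Ws(4)[OF e x] kv_V[OF x]
      by (auto simp: H.op_bound_def hn_kv dest: bspec[of _ _ "kv x"])
  qed (use Ws(1) in auto)
qed (rule Lop(4)[OF e])

end

section \<open>Finite sums with orthogonal summands\<close>

context pre_cstar
begin

abbreviation nsum :: "nat \<Rightarrow> (nat \<Rightarrow> 'a) \<Rightarrow> 'a" where "nsum n f \<equiv> (\<Oplus>i\<in>{..<n}. f i)"

lemma nsum_0: "nsum 0 f = \<zero>" by simp

lemma nsum_Suc: "(\<And>i. f i \<in> alg) \<Longrightarrow> nsum (Suc n) f = f n \<oplus> nsum n f"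
  by (simp add: lessThan_Suc Pi_def)

lemma nsum_closed [simp]: "(\<And>i. f i \<in> alg) \<Longrightarrow> nsum n f \<in> alg"
  by (simp add: Pi_def)

lemma nsum_star: "(\<And>i. f i \<in> alg) \<Longrightarrow> star (nsum n f) = nsum n (\<lambda>i. star (f i))"
  by (induction n) (simp_all add: nsum_Suc adj_add del: lessThan_Suc finsum_insert)

lemma nsum_sc: "(\<And>i. f i \<in> alg) \<Longrightarrow> sc c (nsum n f) = nsum n (\<lambda>i. sc c (f i))"
  by (induction n) (simp_all add: nsum_Suc cscale_add_right)

lemma nsum_lmult: "(\<And>i. f i \<in> alg) \<Longrightarrow> a \<in> alg \<Longrightarrow> a \<otimes> nsum n f = nsum n (\<lambda>i. a \<otimes> f i)"
  by (induction n) (simp_all add: nsum_Suc r_distr)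

lemma nsum_rmult: "(\<And>i. f i \<in> alg) \<Longrightarrow> a \<in> alg \<Longrightarrow> nsum n f \<otimes> a = nsum n (\<lambda>i. f i \<otimes> a)"
  by (induction n) (simp_all add: nsum_Suc l_distr)

lemma nsum_add:
  "(\<And>i. f i \<in> alg) \<Longrightarrow> (\<And>i. g i \<in> alg) \<Longrightarrow> nsum n (\<lambda>i. f i \<oplus> g i) = nsum n f \<oplus> nsum n g"
  by (induction n) (simp_all add: nsum_Suc a_ac)

lemma nsum_cong:
  assumes "\<And>i. f i \<in> alg" "\<And>i. g i \<in> alg" "\<And>i. i < n \<Longrightarrow> f i = g i" shows "nsum n f = nsum n g"
  using assms(3) by (induction n) (simp_all add: nsum_Suc assms(1,2))

lemma nsum_single:
  assumes "\<And>i. f i \<in> alg" "j < n" "\<And>i. i < n \<Longrightarrow> i \<noteq> j \<Longrightarrow> f i = \<zero>"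
  shows "nsum n f = f j"
proof -
  have z: "nsum m f = \<zero>" if "m \<le> j" "m \<le> n" for m
    using that by (induction m) (simp_all add: nsum_Suc assms)
  have "m \<le> n \<Longrightarrow> j < m \<Longrightarrow> nsum m f = f j" for m
  proof (induction m)
    case (Suc m)
    thus ?case using z[of m] assms by (cases "j = m") (auto simp: nsum_Suc)
  qed simp
  thus ?thesis using assms(2) by simp
qed

lemma nsum_const: "x \<in> alg \<Longrightarrow> nsum n (\<lambda>i. x) = sc (of_nat n) x"
  by (induction n) (simp_all add: nsum_Suc cscale_add_left a_comm)

lemma nsum_nrm: "(\<And>i. f i \<in> alg) \<Longrightarrow> (\<And>i. i < n \<Longrightarrow> nn (f i) \<le> b) \<Longrightarrow> nn (nsum n f) \<le> real n * b"
proof (induction n)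
  case (Suc n)
  have "nn (nsum (Suc n) f) \<le> nn (f n) + nn (nsum n f)" using Suc.prems by (simp add: nsum_Suc nrm_triangle)
  thus ?case using Suc.IH Suc.prems by (force simp: algebra_simps)
qed simp

lemma nsum_mult_nsum:
  assumes f: "\<And>i. f i \<in> alg" and g: "\<And>i. g i \<in> alg"
  shows "nsum n f \<otimes> nsum n g = nsum n (\<lambda>i. nsum n (\<lambda>j. f i \<otimes> g j))"
proof -
  have "nsum n f \<otimes> nsum n g = nsum n (\<lambda>i. f i \<otimes> nsum n g)" using f g by (intro nsum_rmult) auto
  also have "\<dots> = nsum n (\<lambda>i. nsum n (\<lambda>j. f i \<otimes> g j))" using f g by (simp add: nsum_lmult)
  finally show ?thesis .
qed

lemma nsum_orthogonal_mult:
  assumes f: "\<And>i. f i \<in> alg" and g: "\<And>i. g i \<in> alg"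
    and o: "\<And>i j. i < n \<Longrightarrow> j < n \<Longrightarrow> i \<noteq> j \<Longrightarrow> f i \<otimes> g j = \<zero>"
  shows "nsum n f \<otimes> nsum n g = nsum n (\<lambda>i. f i \<otimes> g i)"
  unfolding nsum_mult_nsum[OF f g] by (rule nsum_cong) (use f g o in \<open>auto intro!: nsum_single\<close>)

text \<open>Powers of an orthogonal sum are sums of powers, so only the number of summands enters the bound, and
  taking \<open>2 ^ k\<close>-th roots removes it.\<close>

lemma nsum_orthogonal_nrm:
  assumes f: "\<And>i. f i \<in> alg" and sa: "\<And>i. star (f i) = f i"
    and o: "\<And>i j. i < n \<Longrightarrow> j < n \<Longrightarrow> i \<noteq> j \<Longrightarrow> f i \<otimes> f j = \<zero>"
    and b: "b > 0" "\<And>i. nn (f i) \<le> b"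
  shows "nn (nsum n f) \<le> b"
proof (rule le_of_powers_le_const[of b _ "real n"])
  have p: "nsum n f [^] Suc k = nsum n (\<lambda>i. f i [^] Suc k)" for k
  proof (induction k)
    case 0 show ?case using f by simp
  next
    case (Suc k)
    have "nsum n f [^] Suc (Suc k) = nsum n (\<lambda>i. f i [^] Suc k) \<otimes> nsum n f" using Suc by simp
    also have "\<dots> = nsum n (\<lambda>i. f i [^] Suc k \<otimes> f i)"
      by (rule nsum_orthogonal_mult) (use f o in \<open>auto simp: m_assoc\<close>)
    finally show ?case by simp
  qed
  have s: "star (nsum n f) = nsum n f" using f sa by (simp add: nsum_star)
  fix i
  obtain k where k: "2 ^ i = Suc k" using not0_implies_Suc[of "2 ^ i"] by auto
  have "nn (nsum n f) ^ 2 ^ i = nn (nsum n (\<lambda>j. f j [^] (2 ^ i :: nat)))"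
    using nrm_pow_self_adj[OF nsum_closed[OF f] s, of i] p[of k] k by simp
  also have "\<dots> \<le> real n * b ^ 2 ^ i"
    by (rule nsum_nrm) (use f sa b in \<open>auto simp: nrm_pow_self_adj intro: power_mono\<close>)
  finally show "nn (nsum n f) ^ 2 ^ i \<le> real n * b ^ 2 ^ i" .
qed fact

end

section \<open>Averaged creation operators\<close>

text \<open>The abstract form of the averaging: \<open>Ro\<close> says that the ranges of the
  operators \<open>R i q\<close> are mutually orthogonal, and the two conditions on \<open>h\<close>
  say that it maps the complement of \<open>q\<close> isometrically into the range of
  \<open>q\<close>.\<close>

locale averaged_creation = pre_cstar A for A :: "('a, 'm) cstar_scheme" (structure) +
  fixes q h :: 'a and R :: "nat \<Rightarrow> 'a" and n :: nat
  assumes q [simp]: "q \<in> alg" and q_sa: "star q = q" and qq: "q \<otimes> q = q"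
    and h [simp]: "h \<in> alg" and h_sa: "star h = h"
    and comp_h: "(\<one> \<ominus> q) \<otimes> (h \<otimes> (\<one> \<ominus> q)) = \<zero>"
    and comp_hh: "(\<one> \<ominus> q) \<otimes> (h \<otimes> (h \<otimes> (\<one> \<ominus> q))) = \<one> \<ominus> q"
    and R [simp]: "R i \<in> alg" and Ru: "star (R i) \<otimes> R i = \<one>" "R i \<otimes> star (R i) = \<one>"
    and Ro: "\<lbrakk>i < n; j < n; i \<noteq> j\<rbrakk> \<Longrightarrow> q \<otimes> (star (R i) \<otimes> (R j \<otimes> q)) = \<zero>"
    and n: "n > 0" and nn_one: "nn \<one> = 1"
begin

definition "q' = \<one> \<ominus> q"
definition "a0 = q \<otimes> (h \<otimes> q')"
definition "y0 = q \<otimes> (h \<otimes> q)"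
definition "rn = complex_of_real (1 / sqrt (real n))"
definition "ell = sc rn (nsum n (\<lambda>i. R i \<otimes> (a0 \<otimes> star (R i))))"
definition "avg = sc rn (nsum n (\<lambda>i. R i \<otimes> (h \<otimes> star (R i))))"

lemma cl [simp]: "q' \<in> alg" "a0 \<in> alg" "y0 \<in> alg"
  by (simp_all add: q'_def a0_def y0_def)

lemma cl2 [simp]: "ell \<in> alg" "avg \<in> alg"
  by (simp_all add: ell_def avg_def)

lemma Ru_left: "x \<in> alg \<Longrightarrow> star (R i) \<otimes> (R i \<otimes> x) = x"
  using Ru(1)[of i] by (simp flip: m_assoc)

lemma rn: "rn * rn = of_real (1 / real n)" "cnj rn = rn" "cmod rn = 1 / sqrt (real n)"
  by (simp_all add: rn_def norm_divide flip: of_real_mult real_sqrt_mult)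

lemma q': "star q' = q'" "q' \<otimes> q' = q'" "q \<otimes> q' = \<zero>" "q' \<otimes> q = \<zero>" "q \<oplus> q' = \<one>"
  using q_sa qq by (simp_all add: q'_def adj_add adj_uminus ring_exp r_neg r_neg2)

lemma qx: "x \<in> alg \<Longrightarrow> q \<otimes> (q \<otimes> x) = q \<otimes> x" "x \<in> alg \<Longrightarrow> q' \<otimes> (q' \<otimes> x) = q' \<otimes> x"
  "x \<in> alg \<Longrightarrow> q \<otimes> (q' \<otimes> x) = \<zero>" "x \<in> alg \<Longrightarrow> q' \<otimes> (q \<otimes> x) = \<zero>"
  using q' qq by (simp_all flip: m_assoc)

lemma star_a0: "star a0 = q' \<otimes> (h \<otimes> q)"
  using q_sa h_sa q' by (simp add: a0_def adj_mult m_assoc)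

lemma h_split: "h = a0 \<oplus> star a0 \<oplus> y0"
proof -
  have "h = (q \<oplus> q') \<otimes> (h \<otimes> (q \<oplus> q'))" by (simp add: q')
  also have "\<dots> = q \<otimes> (h \<otimes> q') \<oplus> (q' \<otimes> (h \<otimes> q) \<oplus> (q \<otimes> (h \<otimes> q) \<oplus> q' \<otimes> (h \<otimes> q')))"
    by (simp only: r_distr l_distr q h cl m_closed add.m_closed a_ac)
  also have "\<dots> = a0 \<oplus> star a0 \<oplus> y0"
    unfolding star_a0 using comp_h by (simp add: a0_def y0_def a_assoc flip: q'_def)
  finally show ?thesis .
qed

text \<open>Inserting \<open>q + q'\<close> between the two factors \<open>h\<close> in
  \<open>comp_hh\<close>, the contribution of \<open>q'\<close> vanishes by
  \<open>comp_h\<close>.\<close>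

lemma a0_a0: "star a0 \<otimes> a0 = q'"
proof -
  have "q' \<otimes> (h \<otimes> (h \<otimes> q')) = q' \<otimes> (h \<otimes> ((q \<oplus> q') \<otimes> (h \<otimes> q')))" by (simp add: q')
  also have "\<dots> = q' \<otimes> (h \<otimes> (q \<otimes> (h \<otimes> q'))) \<oplus> q' \<otimes> (h \<otimes> q') \<otimes> (h \<otimes> q')"
    using qx(2)[of "h \<otimes> q'"] by (simp add: r_distr l_distr m_assoc)
  also have "\<dots> = q' \<otimes> (h \<otimes> (q \<otimes> (h \<otimes> q')))" using comp_h by (simp flip: q'_def)
  finally show ?thesis unfolding star_a0 using comp_hh by (simp add: a0_def m_assoc qx flip: q'_def)
qed

definition "pj i = R i \<otimes> (q \<otimes> star (R i))"
definition "yj i = R i \<otimes> (y0 \<otimes> star (R i))"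
definition "lj i = R i \<otimes> (a0 \<otimes> star (R i))"

lemma cl3 [simp]: "pj i \<in> alg" "yj i \<in> alg" "lj i \<in> alg"
  by (simp_all add: pj_def yj_def lj_def)

lemma star_sand: "x \<in> alg \<Longrightarrow> star (R i \<otimes> (x \<otimes> star (R i))) = R i \<otimes> (star x \<otimes> star (R i))"
  by (simp add: adj_mult m_assoc)

lemma nn_R: "nn (R i) \<le> 1" "nn (star (R i)) \<le> 1"
proof -
  have "(nn (R i))\<^sup>2 = 1" using nrm_adj_mult[of "R i"] Ru nn_one by simp
  thus "nn (R i) \<le> 1" by (simp add: power2_eq_1_iff) linarith
  thus "nn (star (R i)) \<le> 1" by simp
qed

lemma nn_sand: assumes "x \<in> alg" shows "nn (R i \<otimes> (x \<otimes> star (R i))) \<le> nn x"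
proof -
  have "nn (R i \<otimes> (x \<otimes> star (R i))) \<le> nn (R i) * (nn x * nn (star (R i)))"
    using assms by (intro order_trans[OF nrm_mult] mult_left_mono nrm_mult) auto
  also have "\<dots> \<le> 1 * (nn x * 1)" using assms nn_R by (intro mult_mono) auto
  finally show ?thesis by simp
qed

lemma sand_orth:
  assumes "x \<in> alg" "y \<in> alg" "i < n" "j < n" "i \<noteq> j"
  shows "R i \<otimes> ((x \<otimes> q) \<otimes> star (R i)) \<otimes> (R j \<otimes> ((q \<otimes> y) \<otimes> star (R j))) = \<zero>"
proof -
  have "R i \<otimes> ((x \<otimes> q) \<otimes> star (R i)) \<otimes> (R j \<otimes> ((q \<otimes> y) \<otimes> star (R j))) =
    R i \<otimes> (x \<otimes> ((q \<otimes> (star (R i) \<otimes> (R j \<otimes> q))) \<otimes> (y \<otimes> star (R j))))"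
    using assms by (simp add: m_assoc)
  thus ?thesis using Ro[OF assms(3-5)] assms(1,2) by simp
qed

lemma nn_q: "nn q \<le> 1"
proof -
  have "(nn q)\<^sup>2 = nn q" using nrm_adj_mult[OF q] by (simp add: q_sa qq)
  hence "nn q * nn q = nn q * 1" by (simp add: power2_eq_square)
  hence "nn q = 0 \<or> nn q = 1" by (subst (asm) mult_cancel_left) auto
  thus ?thesis by auto
qed

lemma nn_pj_sum: "nn (nsum n pj) \<le> 1"
proof (rule nsum_orthogonal_nrm)
  show "pj i \<otimes> pj j = \<zero>" if "i < n" "j < n" "i \<noteq> j" for i j
    using sand_orth[OF q q that] by (simp add: pj_def qq)
  show "nn (pj i) \<le> 1" for i using order_trans[OF nn_sand[OF q] nn_q] by (simp add: pj_def)
qed (simp_all add: pj_def star_sand q_sa)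

lemma nn_yj_sum: assumes "b > 0" "nn h \<le> b" shows "nn (nsum n yj) \<le> b"
proof (rule nsum_orthogonal_nrm)
  show "yj i \<otimes> yj j = \<zero>" if "i < n" "j < n" "i \<noteq> j" for i j
    using sand_orth[of "q \<otimes> h" "h \<otimes> q", OF _ _ that] by (simp add: yj_def y0_def m_assoc)
  have "nn y0 \<le> nn q * (nn h * nn q)"
    unfolding y0_def by (intro order_trans[OF nrm_mult] mult_left_mono nrm_mult) auto
  also have "\<dots> \<le> 1 * (b * 1)" using nn_q assms by (intro mult_mono) auto
  finally show "nn (yj i) \<le> b" for i using nn_sand[of y0 i] by (simp add: yj_def)
  show "star (yj i) = yj i" for i by (simp add: yj_def star_sand y0_def adj_mult q_sa h_sa m_assoc)
qed (use assms in simp_all)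

text \<open>The difference comes from the corner \<open>q h q\<close>. Its conjugates are mutually
  orthogonal, so their sum is no larger than \<open>h\<close> itself and the normalisation
  \<open>1 / sqrt n\<close> makes it small.\<close>

lemma avg_minus: assumes "b > 0" "nn h \<le> b" shows "nn (avg \<ominus> (ell \<oplus> star ell)) \<le> b / sqrt (real n)"
proof -
  have 1: "avg = sc rn (nsum n (\<lambda>i. (lj i \<oplus> star (lj i)) \<oplus> yj i))"
  proof -
    have "R i \<otimes> (h \<otimes> star (R i)) = (lj i \<oplus> star (lj i)) \<oplus> yj i" for i
      by (subst h_split) (simp add: lj_def yj_def star_sand r_distr l_distr)
    thus ?thesis unfolding avg_def by simp
  qed
  have "ell \<oplus> star ell = sc rn (nsum n (\<lambda>i. lj i \<oplus> star (lj i)))"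
    unfolding ell_def lj_def[symmetric] by (simp add: adj_cscale rn nsum_star nsum_add cscale_add_right)
  hence "avg = (ell \<oplus> star ell) \<oplus> sc rn (nsum n yj)"
    unfolding 1 by (simp add: nsum_add cscale_add_right)
  hence "avg \<ominus> (ell \<oplus> star ell) = sc rn (nsum n yj)"
    by (simp add: ring_exp r_neg r_neg1 r_neg2 r_neg3 r_neg4)
  thus ?thesis using nn_yj_sum[OF assms] by (simp add: nrm_cscale rn divide_right_mono)
qed

text \<open>Only diagonal terms survive, each equal to \<open>z (1 - pj i)\<close>. Their average is
  \<open>z\<close> up to \<open>z / n\<close> times a sum of mutually orthogonal projections, a sum
  of norm at most one.\<close>

lemma ell_sandwich:
  assumes e: "e \<in> alg"
    and eR: "\<And>i j. i < n \<Longrightarrow> j < n \<Longrightarrow> q \<otimes> ((star (R i) \<otimes> (e \<otimes> R j)) \<otimes> q) = (if i = j then sc z q else \<zero>)"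
  shows "nn (star ell \<otimes> (e \<otimes> ell) \<ominus> sc z \<one>) \<le> cmod z / real n"
proof -
  have qa: "q \<otimes> a0 = a0" "star a0 \<otimes> q = star a0" unfolding star_a0 by (simp_all add: a0_def qx m_assoc qq)
  have t: "star (lj i) \<otimes> (e \<otimes> lj j) = (if i = j then sc z \<one> \<ominus> sc z (pj i) else \<zero>)" if ij: "i < n" "j < n" for i j
  proof -
    have "star (lj i) \<otimes> (e \<otimes> lj j) = R i \<otimes> ((star a0 \<otimes> q) \<otimes> ((star (R i) \<otimes> (e \<otimes> R j)) \<otimes> ((q \<otimes> a0) \<otimes> star (R j))))"
      unfolding qa using e by (simp add: lj_def star_sand m_assoc)
    also have "\<dots> = R i \<otimes> (star a0 \<otimes> ((q \<otimes> ((star (R i) \<otimes> (e \<otimes> R j)) \<otimes> q)) \<otimes> (a0 \<otimes> star (R j))))"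
      using e by (simp add: m_assoc)
    also have "\<dots> = (if i = j then R i \<otimes> (star a0 \<otimes> (sc z q \<otimes> (a0 \<otimes> star (R j)))) else \<zero>)"
      unfolding eR[OF ij] by simp
    finally have 1: "star (lj i) \<otimes> (e \<otimes> lj j) =
      (if i = j then R i \<otimes> (star a0 \<otimes> (sc z q \<otimes> (a0 \<otimes> star (R j)))) else \<zero>)" .
    have "R i \<otimes> (star a0 \<otimes> (sc z q \<otimes> (a0 \<otimes> star (R i)))) = sc z (R i \<otimes> ((star a0 \<otimes> (q \<otimes> a0)) \<otimes> star (R i)))"
      by (simp add: cscale_mult_left cscale_mult_right m_assoc)
    also have "R i \<otimes> ((star a0 \<otimes> (q \<otimes> a0)) \<otimes> star (R i)) = \<one> \<ominus> pj i"
      unfolding qa a0_a0 using Ru by (simp add: q'_def pj_def minus_eq l_distr r_distr l_minus r_minus)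
    finally show ?thesis using 1 by (auto simp: cscale_diff_right)
  qed
  define S where "S = nsum n lj"
  have S: "S \<in> alg" "ell = sc rn S" by (simp_all add: S_def ell_def lj_def)
  have "star ell \<otimes> (e \<otimes> ell) = sc (rn * rn) (star S \<otimes> (e \<otimes> S))"
    unfolding S(2) using S(1) e by (simp add: adj_cscale rn(2) cscale_mult_left cscale_mult_right)
  also have "star S \<otimes> (e \<otimes> S) = nsum n (\<lambda>i. star (lj i)) \<otimes> nsum n (\<lambda>j. e \<otimes> lj j)"
    unfolding S_def using e by (simp add: nsum_star nsum_lmult)
  also have "nsum n (\<lambda>i. star (lj i)) \<otimes> nsum n (\<lambda>j. e \<otimes> lj j) = nsum n (\<lambda>i. star (lj i) \<otimes> (e \<otimes> lj i))"
    by (rule nsum_orthogonal_mult) (use t e in auto)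
  also have "\<dots> = nsum n (\<lambda>i. sc z \<one> \<oplus> sc (- z) (pj i))"
    by (rule nsum_cong) (use t e in \<open>auto simp: cscale_minus_left minus_eq\<close>)
  also have "\<dots> = sc (of_nat n * z) \<one> \<oplus> sc (- z) (nsum n pj)"
    by (simp add: nsum_add nsum_const nsum_sc)
  also have "sc (rn * rn) \<dots> = sc z \<one> \<oplus> sc (- z / of_nat n) (nsum n pj)"
    unfolding rn using n by (simp add: cscale_add_right)
  finally have "star ell \<otimes> (e \<otimes> ell) \<ominus> sc z \<one> = sc (- z / of_nat n) (nsum n pj)"
    by (simp add: ring_exp r_neg r_neg1 r_neg2 r_neg3 r_neg4)
  moreover have "cmod z / real n * nn (nsum n pj) \<le> cmod z / real n * 1"
    using nn_pj_sum by (intro mult_left_mono) auto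
  ultimately show ?thesis by (simp add: nrm_cscale norm_divide)
qed

text \<open>Sandwiching the unit gives the squared norm up to an error of one, so it is at most two;
  the bound is rounded up to \<open>2^2\<close>. Uniformity in \<open>n\<close> is all that
  matters.\<close>

lemma nn_ell: "nn ell \<le> 2"
proof -
  have "nn (star ell \<otimes> (\<one> \<otimes> ell) \<ominus> sc 1 \<one>) \<le> cmod 1 / real n"
  proof (rule ell_sandwich)
    fix i j assume "i < n" "j < n"
    thus "q \<otimes> ((star (R i) \<otimes> (\<one> \<otimes> R j)) \<otimes> q) = (if i = j then sc 1 q else \<zero>)"
      using Ro[of i j] Ru(1)[of i] by (cases "i = j") (simp_all add: m_assoc qq Ru_left)
  qed simp
  hence le: "nn (star ell \<otimes> ell \<ominus> \<one>) \<le> 1" using n by (simp add: order_trans)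
  have "star ell \<otimes> ell = (star ell \<otimes> ell \<ominus> \<one>) \<oplus> \<one>" by (simp add: minus_eq a_assoc l_neg)
  hence "nn (star ell \<otimes> ell) \<le> nn (star ell \<otimes> ell \<ominus> \<one>) + nn \<one>" using nrm_triangle[of "star ell \<otimes> ell \<ominus> \<one>" \<one>] by simp
  hence "(nn ell)\<^sup>2 \<le> 2\<^sup>2" using le nn_one nrm_adj_mult[OF cl2(1)] by simp
  thus ?thesis by (rule power2_le_imp_le) simp
qed

end

section \<open>Faithfulness expressed by the seminorm\<close>

context pre_prob
begin

lemma N2_eq_0_iff: "x \<in> alg \<Longrightarrow> st (star x \<otimes> x) = 0 \<longleftrightarrow> N2 x = 0"
  by (simp add: st_sq)

lemma gns_null_iff: "x \<in> gns_null A \<longleftrightarrow> x \<in> alg \<and> N2 x = 0"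
  using N2_eq_0_iff by (auto simp: gns_null_def)

lemma gns_coset_iff:
  assumes "x \<in> alg"
  shows "z \<in> gns_null A +> x \<longleftrightarrow> z \<in> alg \<and> N2 (z \<ominus> x) = 0"
proof
  assume "z \<in> gns_null A +> x"
  then obtain u where "u \<in> gns_null A" "z = u \<oplus> x" by (auto simp: a_r_coset_def')
  thus "z \<in> alg \<and> N2 (z \<ominus> x) = 0"
    using assms by (auto simp: gns_null_iff minus_eq a_assoc r_neg)
next
  assume z: "z \<in> alg \<and> N2 (z \<ominus> x) = 0"
  hence "z = (z \<ominus> x) \<oplus> x" "z \<ominus> x \<in> gns_null A"
    using assms by (auto simp: gns_null_iff minus_eq a_assoc l_neg)
  thus "z \<in> gns_null A +> x" by (auto simp: a_r_coset_def')
qed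

lemma gns_coset_eq_iff:
  assumes "x \<in> alg" "y \<in> alg"
  shows "gns_null A +> x = gns_null A +> y \<longleftrightarrow> N2 (x \<ominus> y) = 0"
proof
  assume "gns_null A +> x = gns_null A +> y"
  moreover have "x \<in> gns_null A +> x" using assms by (simp add: gns_coset_iff minus_eq r_neg)
  ultimately show "N2 (x \<ominus> y) = 0" using assms gns_coset_iff by simp
next
  assume n: "N2 (x \<ominus> y) = 0"
  have e: "z \<ominus> y = (z \<ominus> x) \<oplus> (x \<ominus> y)" "z \<ominus> x = (z \<ominus> y) \<oplus> \<ominus> (x \<ominus> y)" if "z \<in> alg" for z
    using assms that by (simp_all add: minus_eq minus_add a_ac r_neg r_neg1 r_neg2 r_neg3 r_neg4)
  show "gns_null A +> x = gns_null A +> y"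
  proof (intro Set.set_eqI)
    fix z show "z \<in> gns_null A +> x \<longleftrightarrow> z \<in> gns_null A +> y"
    proof (cases "z \<in> alg")
      case z: True
      have "N2 (z \<ominus> y) = 0" if "N2 (z \<ominus> x) = 0"
        unfolding e(1)[OF z] by (rule N2_null_add) (use z assms n that in simp_all)
      moreover have "N2 (z \<ominus> x) = 0" if "N2 (z \<ominus> y) = 0"
        unfolding e(2)[OF z] by (rule N2_null_add) (use z assms n that in simp_all)
      ultimately show ?thesis using assms by (auto simp: gns_coset_iff)
    qed (use assms in \<open>simp add: gns_coset_iff\<close>)
  qed
qed

lemma gns_rep_coset:
  assumes x: "x \<in> alg" and y: "y \<in> alg"
  shows "gns_rep A x (gns_null A +> y) = gns_null A +> (x \<otimes> y)"
proof -
  have *: "gns_null A +> (x \<otimes> z) = gns_null A +> (x \<otimes> y)" if "z \<in> gns_null A +> y" for z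
  proof -
    have z: "z \<in> alg" "N2 (z \<ominus> y) = 0" using that y by (auto simp: gns_coset_iff)
    have "x \<otimes> z \<ominus> x \<otimes> y = x \<otimes> (z \<ominus> y)" using x y z by (simp add: minus_eq r_distr r_minus)
    thus ?thesis using gns_coset_eq_iff[of "x \<otimes> z" "x \<otimes> y"] N2_null_mult[OF x _ z(2)] x y z by simp
  qed
  have "y \<in> gns_null A +> y" using y by (simp add: gns_coset_iff minus_eq r_neg)
  hence "(\<Union>z\<in>gns_null A +> y. gns_null A +> (x \<otimes> z)) = gns_null A +> (x \<otimes> y)"
    using * by blast
  moreover have "gns_null A +> y \<in> a_rcosets (gns_null A)" using y by (auto simp: A_RCOSETS_def')
  ultimately show ?thesis by (simp add: gns_rep_def)
qed

lemma gns_rep_eq_iff: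
  assumes x: "x \<in> alg" and x': "x' \<in> alg"
  shows "gns_rep A x = gns_rep A x' \<longleftrightarrow> (\<forall>y\<in>alg. N2 ((x \<ominus> x') \<otimes> y) = 0)"
proof -
  have "gns_rep A x = gns_rep A x' \<longleftrightarrow> (\<forall>y\<in>alg. gns_rep A x (gns_null A +> y) = gns_rep A x' (gns_null A +> y))"
  proof
    assume r: "\<forall>y\<in>alg. gns_rep A x (gns_null A +> y) = gns_rep A x' (gns_null A +> y)"
    show "gns_rep A x = gns_rep A x'"
    proof
      fix V show "gns_rep A x V = gns_rep A x' V"
      proof (cases "V \<in> a_rcosets (gns_null A)")
        case True thus ?thesis using r by (auto simp: A_RCOSETS_def')
      next
        case False thus ?thesis by (simp add: gns_rep_def)
      qed
    qed
  qed simp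
  also have "\<dots> \<longleftrightarrow> (\<forall>y\<in>alg. N2 ((x \<ominus> x') \<otimes> y) = 0)"
    using x x' by (simp add: gns_rep_coset gns_coset_eq_iff minus_eq l_distr l_minus)
  finally show ?thesis .
qed

text \<open>Removes the cosets: an element acts as zero on the GNS quotient exactly when all its
  products with elements of the algebra on the right are null.\<close>

lemma gns_faithful_iff:
  "gns_faithful A \<longleftrightarrow> (\<forall>x\<in>alg. (\<forall>y\<in>alg. N2 (x \<otimes> y) = 0) \<longrightarrow> x = \<zero>)"
proof
  assume g: "gns_faithful A"
  show "\<forall>x\<in>alg. (\<forall>y\<in>alg. N2 (x \<otimes> y) = 0) \<longrightarrow> x = \<zero>"
  proof (intro ballI impI)
    fix x assume x: "x \<in> alg" "\<forall>y\<in>alg. N2 (x \<otimes> y) = 0"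
    hence "gns_rep A x = gns_rep A \<zero>" by (subst gns_rep_eq_iff) (auto simp: minus_eq)
    thus "x = \<zero>" using g x by (auto simp: gns_faithful_def inj_on_def)
  qed
next
  assume g: "\<forall>x\<in>alg. (\<forall>y\<in>alg. N2 (x \<otimes> y) = 0) \<longrightarrow> x = \<zero>"
  show "gns_faithful A"
    unfolding gns_faithful_def inj_on_def
  proof (intro ballI impI)
    fix x x' assume x: "x \<in> alg" "x' \<in> alg" "gns_rep A x = gns_rep A x'"
    hence "x \<ominus> x' = \<zero>" using g gns_rep_eq_iff[of x x'] by simp
    thus "x = x'" using x nrm_diff_eq_0[of x x'] by simp
  qed
qed

lemma subalg_pre_prob:
  assumes B: "star_subalg B"
  shows "pre_prob (A\<lparr>carrier := B\<rparr>)" "pre_state.N2 (A\<lparr>carrier := B\<rparr>) = N2"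
proof -
  interpret B: pre_cstar "A\<lparr>carrier := B\<rparr>" by (rule subalg_pre_cstar[OF B])
  note b = star_subalgD(1)[OF B]
  have s: "pre_state (A\<lparr>carrier := B\<rparr>)"
    by unfold_locales (use b in \<open>auto simp: is_state_def st_add st_cscale intro: st_pos\<close>)
  then interpret B: pre_state "A\<lparr>carrier := B\<rparr>" .
  show n: "B.N2 = N2" by (simp add: fun_eq_iff B.N2_def N2_def)
  show "pre_prob (A\<lparr>carrier := B\<rparr>)" by unfold_locales (use b N2_mult in \<open>simp add: n\<close>)
qed

end

lemma cstar_prob_space_iff: "cstar_prob_space A \<longleftrightarrow> faithful_prob A"
proof
  assume c: "cstar_prob_space A"
  then interpret cstar_algebra A by (simp add: cstar_prob_space_def)
  interpret pre_prob A using c by (auto simp: cstar_prob_space_def intro: cstar_state_pre_prob)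
  show "faithful_prob A" by unfold_locales (use c gns_faithful_iff in \<open>auto simp: cstar_prob_space_def\<close>)
next
  assume "faithful_prob A"
  then interpret faithful_prob A .
  show "cstar_prob_space A"
    unfolding cstar_prob_space_def gns_faithful_iff
    by (intro conjI ballI impI cstar_algebra_axioms state_is_state) (rule gns_inj, auto)
qed

section \<open>Generated star algebras and their closures\<close>

context pre_cstar
begin

definition salg :: "'a set \<Rightarrow> 'a set" where "salg S = star_subalg hull S"

lemma star_subalg_Inter:
  assumes "\<And>B. B \<in> \<B> \<Longrightarrow> star_subalg B" "\<B> \<noteq> {}" shows "star_subalg (\<Inter>\<B>)"
  using assms unfolding star_subalg_def by blast

lemma salg_subalg: assumes "S \<subseteq> alg" shows "star_subalg (salg S)"
proof -
  have "star_subalg (\<Inter>{B. star_subalg B \<and> S \<subseteq> B})"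
    by (rule star_subalg_Inter) (use assms star_subalg_carrier in auto)
  thus ?thesis by (simp add: salg_def hull_def)
qed

lemma salg_inc: "S \<subseteq> salg S" unfolding salg_def by (rule hull_subset)

lemma salg_minimal: "\<lbrakk>S \<subseteq> B; star_subalg B\<rbrakk> \<Longrightarrow> salg S \<subseteq> B" unfolding salg_def by (rule hull_minimal)

lemma cstar_generated_nclosure: assumes S: "S \<subseteq> alg" shows "cstar_generated A S = nclosure (salg S)"
proof
  note s = salg_subalg[OF S]
  have c: "salg S \<subseteq> alg" using star_subalgD(1)[OF s] by auto
  show "cstar_generated A S \<subseteq> nclosure (salg S)"
    by (rule cstar_generated_minimal) (use salg_inc nclosure_inc[OF c] nclosure_cstar_subalgebra[OF s] in auto)
  have g: "star_subalg (cstar_generated A S)" "nclosed (cstar_generated A S)"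
    using cstar_generated_subalgebra[OF S] by (auto simp: cstar_subalgebra_iff)
  have "salg S \<subseteq> cstar_generated A S" by (rule salg_minimal[OF cstar_generated_inc g(1)])
  thus "nclosure (salg S) \<subseteq> cstar_generated A S"
    using g(2) unfolding nclosure_def nclosed_def by blast
qed

lemma subset_nclosure: "star_subalg B \<Longrightarrow> B \<subseteq> nclosure B"
  using nclosure_inc[of B] star_subalgD(1)[of B] by auto

end

context pre_prob
begin

lemma centered_approx:
  assumes Q: "star_subalg Q" and x: "x \<in> nclosure Q" "st x = 0" and e: "e > 0"
  shows "\<exists>y\<in>Q. st y = 0 \<and> nn (y \<ominus> x) < e"
proof -
  note q = star_subalgD[OF Q]
  have xc: "x \<in> alg" using x(1) by (simp add: nclosure_def)
  obtain w where w: "w \<in> Q" "nn (x \<ominus> w) < e / 2" using x(1) half_gt_zero[OF e] unfolding nclosure_def by blast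
  have wc: "w \<in> alg" by (rule q(1)[OF w(1)])
  let ?y = "w \<ominus> sc (st w) \<one>"
  have "cmod (st w) \<le> nn (x \<ominus> w)" using st_bound[of "x \<ominus> w"] xc wc x(2) by (simp add: st_diff)
  moreover have "?y \<ominus> x = \<ominus> (x \<ominus> w) \<ominus> sc (st w) \<one>" using xc wc by (simp add: ring_exp)
  ultimately have "nn (?y \<ominus> x) < e"
    using nrm_minus_triangle[of "\<ominus> (x \<ominus> w)" "sc (st w) \<one>"] xc wc w(2) by (simp add: nrm_cscale)
  moreover have "?y \<in> Q" "st ?y = 0" using q(2,5,9) w(1) wc by (auto simp: st_diff st_cscale)
  ultimately show ?thesis by blast
qed

text \<open>An element \<open>x\<close> that acts as zero has approximants \<open>y\<close> of small
  GNS norm. On \<open>Q\<close> the GNS norm dominates the norm, so these approximants, and with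
  them \<open>x\<close>, are small in norm.\<close>

lemma nclosure_faithful:
  assumes A: "cstar_algebra A" and Q: "star_subalg Q"
    and b: "\<And>y M. y \<in> Q \<Longrightarrow> M \<ge> 0 \<Longrightarrow> \<forall>z\<in>Q. N2 (y \<otimes> z) \<le> M * N2 z \<Longrightarrow> nn y \<le> M"
  shows "cstar_prob_space (A\<lparr>carrier := nclosure Q\<rparr>)"
proof -
  let ?B = "A\<lparr>carrier := nclosure Q\<rparr>"
  have C: "cstar_subalgebra A (nclosure Q)" "star_subalg (nclosure Q)"
    using nclosure_cstar_subalgebra[OF Q] by (auto simp: cstar_subalgebra_iff)
  interpret B: pre_prob ?B by (rule subalg_pre_prob(1)[OF C(2)])
  have N: "B.N2 = N2" by (rule subalg_pre_prob(2)[OF C(2)])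
  note q = star_subalgD(1)[OF Q]
  have "gns_faithful ?B"
    unfolding B.gns_faithful_iff
  proof (intro ballI impI)
    fix x assume "x \<in> carrier ?B" and 0: "\<forall>y\<in>carrier ?B. B.N2 (x \<otimes>\<^bsub>?B\<^esub> y) = 0"
    hence x: "x \<in> alg" "\<And>e. e > 0 \<Longrightarrow> \<exists>y\<in>Q. nn (x \<ominus> y) < e" by (auto simp: nclosure_def)
    have "nn x \<le> 0"
    proof (rule field_le_epsilon)
      fix e :: real assume "e > 0"
      then obtain y where y: "y \<in> Q" "nn (x \<ominus> y) < e / 2" using x(2)[of "e / 2"] by auto
      have "nn y \<le> e / 2"
      proof (rule b[OF y(1)])
        show "\<forall>z\<in>Q. N2 (y \<otimes> z) \<le> e / 2 * N2 z"
        proof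
          fix z assume z: "z \<in> Q"
          have "N2 (x \<otimes> z) = 0" using 0 z subset_nclosure[OF Q] by (auto simp: N)
          moreover have "y \<otimes> z = x \<otimes> z \<ominus> (x \<ominus> y) \<otimes> z"
            using x(1) q[OF y(1)] q[OF z] by (simp add: ring_exp r_neg r_neg1 r_neg2 r_neg3 r_neg4)
          ultimately have "N2 (y \<otimes> z) \<le> N2 ((x \<ominus> y) \<otimes> z)"
            using N2_minus_triangle[of "x \<otimes> z" "(x \<ominus> y) \<otimes> z"] x(1) q[OF y(1)] q[OF z] by simp
          also have "\<dots> \<le> nn (x \<ominus> y) * N2 z" using N2_mult x(1) q[OF y(1)] q[OF z] by simp
          also have "\<dots> \<le> e / 2 * N2 z" using y(2) q[OF z] by (intro mult_right_mono) auto
          finally show "N2 (y \<otimes> z) \<le> e / 2 * N2 z" .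
        qed
      qed (use \<open>e > 0\<close> in simp)
      moreover have "nn x \<le> nn (x \<ominus> y) + nn y"
        using nrm_triangle[of "x \<ominus> y" y] x(1) q[OF y(1)] by (simp add: minus_eq a_assoc l_neg)
      ultimately show "nn x \<le> 0 + e" using y(2) by simp
    qed
    thus "x = \<zero>\<^bsub>?B\<^esub>" using nrm_eq_0_iff[OF x(1)] nrm_nonneg[OF x(1)] by simp
  qed
  thus ?thesis
    using subalg_cstar_algebra[OF A C(1)] B.state_is_state by (simp add: cstar_prob_space_def)
qed

end

lemma star_hom_image:
  assumes A: "pre_cstar A" and D: "pre_cstar D" and f: "star_hom A D f" and B: "pre_cstar.star_subalg A B"
  shows "pre_cstar.star_subalg D (f ` B)"
proof -
  interpret A: pre_cstar A by (rule A)
  interpret D: pre_cstar D by (rule D)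
  note h = star_homD[OF f] and b = A.star_subalgD[OF B]
  show ?thesis
    unfolding D.star_subalg_def
  proof (intro conjI ballI allI)
    show "f ` B \<subseteq> carrier D" using h(1) b(1) by auto
    show "\<one>\<^bsub>D\<^esub> \<in> f ` B" using h(4) b(2) by (metis imageI)
    fix u assume "u \<in> f ` B"
    then obtain x where x: "x \<in> B" "u = f x" by blast
    note xc = b(1)[OF x(1)]
    show "D.star u \<in> f ` B" unfolding x(2) h(6)[OF xc, symmetric] by (rule imageI[OF b(6)[OF x(1)]])
    show "D.sc t u \<in> f ` B" for t unfolding x(2) h(5)[OF xc, symmetric] by (rule imageI[OF b(5)[OF x(1)]])
    fix v assume "v \<in> f ` B"
    then obtain y where y: "y \<in> B" "v = f y" by blast
    show "u \<oplus>\<^bsub>D\<^esub> v \<in> f ` B" unfolding x(2) y(2) h(3)[OF xc b(1)[OF y(1)], symmetric] by (rule imageI[OF b(3)[OF x(1) y(1)]])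
    show "u \<otimes>\<^bsub>D\<^esub> v \<in> f ` B" unfolding x(2) y(2) h(2)[OF xc b(1)[OF y(1)], symmetric] by (rule imageI[OF b(4)[OF x(1) y(1)]])
  qed
qed

section \<open>A semicircular element in the ultrapower\<close>

text \<open>The interface between the averaging and the ultrapower: \<open>L\<close> is the
  isometric representation of the dense algebra by operators, and \<open>N\<close> transports limits
  of sequences to limits along the ultrafilter.\<close>

locale semicircular_model = faithful_prob A + B: pre_prob B
  for A :: "'a cstar_prob" (structure) and B :: "'b cstar_prob" +
  fixes W :: "'a set" and L :: "'a \<Rightarrow> 'b" and s :: "nat \<Rightarrow> 'a" and ell :: "nat \<Rightarrow> 'b"
    and \<omega> :: "'i filter" and N :: "'i \<Rightarrow> nat" and bd :: real
  assumes W: "star_subalg W" and dense: "\<lbrakk>x \<in> alg; e > 0\<rbrakk> \<Longrightarrow> \<exists>y\<in>W. nn (x \<ominus> y) < e"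
    and L [simp]: "x \<in> W \<Longrightarrow> L x \<in> carrier B"
    and L_mult: "\<lbrakk>x \<in> W; y \<in> W\<rbrakk> \<Longrightarrow> L (x \<otimes> y) = L x \<otimes>\<^bsub>B\<^esub> L y"
    and L_add: "\<lbrakk>x \<in> W; y \<in> W\<rbrakk> \<Longrightarrow> L (x \<oplus> y) = L x \<oplus>\<^bsub>B\<^esub> L y"
    and L_sc: "x \<in> W \<Longrightarrow> L (sc c x) = B.sc c (L x)" and L_one: "L \<one> = \<one>\<^bsub>B\<^esub>"
    and L_star: "x \<in> W \<Longrightarrow> L (star x) = B.star (L x)"
    and L_nrm: "x \<in> W \<Longrightarrow> B.nn (L x) = nn x" and L_st: "x \<in> W \<Longrightarrow> B.st (L x) = st x"
    and s: "s n \<in> W" and s_bound: "nn (s n) \<le> bd"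
    and ell: "ell n \<in> carrier B" and ell_bound: "B.nn (ell n) \<le> 2"
    and s_ell: "(\<lambda>n. B.nn (L (s n) \<ominus>\<^bsub>B\<^esub> (ell n \<oplus>\<^bsub>B\<^esub> B.star (ell n)))) \<longlonglongrightarrow> 0"
    and ell_W: "w \<in> W \<Longrightarrow> (\<lambda>n. B.nn (B.star (ell n) \<otimes>\<^bsub>B\<^esub> (L w \<otimes>\<^bsub>B\<^esub> ell n) \<ominus>\<^bsub>B\<^esub> B.sc (st w) \<one>\<^bsub>B\<^esub>)) \<longlonglongrightarrow> 0"
    and ell_vac: "w \<in> W \<Longrightarrow> (\<lambda>n. B.N2 (B.star (ell n) \<otimes>\<^bsub>B\<^esub> L w)) \<longlonglongrightarrow> 0"
    and \<omega>: "free_ultrafilter \<omega>" and N: "filterlim N at_top \<omega>"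
begin

sublocale UA: ultra_prob A \<omega> by unfold_locales (rule \<omega>)
sublocale UB: ultra_prob B \<omega> by unfold_locales (rule \<omega>)

abbreviation "U \<equiv> ultrapower A \<omega>"
abbreviation "V \<equiv> ultrapower B \<omega>"

lemmas Ws = star_subalgD[OF W]

lemma along_N: "f \<longlonglongrightarrow> l \<Longrightarrow> ((\<lambda>i. f (N i)) \<longlongrightarrow> l) \<omega>"
  using filterlim_compose[OF _ N] by auto

text \<open>Approximating entry \<open>i\<close> within \<open>1 / (N i + 1)\<close> changes the
  family by something that vanishes along the ultrafilter. Hence \<open>L\<close>, defined on
  \<open>W\<close> only, reaches every class.\<close>

lemma W_rep: assumes x: "x \<in> carrier U" shows "\<exists>b\<in>carrier (linf A). (\<forall>i. b i \<in> W) \<and> x = UA.cls b"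
proof -
  obtain a where a: "a \<in> carrier (linf A)" "x = UA.cls a" using x by (rule UA.cls_E)
  have "\<forall>i. \<exists>y. y \<in> W \<and> nn (a i \<ominus> y) < inverse (real (Suc (N i)))"
    using dense[OF UA.linfD[OF a(1)]] by (meson inverse_positive_iff_positive of_nat_0_less_iff zero_less_Suc)
  then obtain b where b: "b i \<in> W" "nn (a i \<ominus> b i) < inverse (real (Suc (N i)))" for i by metis
  obtain K where K: "K \<ge> 0" "nn (a i) \<le> K" for i using UA.linfE[OF a(1)] by blast
  have bl: "b \<in> carrier (linf A)"
  proof (rule UA.linfI)
    fix i show bc: "b i \<in> alg" using Ws(1) b by blast
    have ac: "a i \<in> alg" using UA.linfD[OF a(1)] .
    have "nn (b i) \<le> nn (a i) + nn (a i \<ominus> b i)"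
      using nrm_minus_triangle[of "a i" "a i \<ominus> b i"] ac bc by (simp add: minus_eq minus_add r_neg1 r_neg2 r_neg3)
    moreover have "inverse (real (Suc (N i))) \<le> 1" by (simp add: inverse_eq_divide)
    ultimately show "nn (b i) \<le> K + 1" using K(2)[of i] b(2)[of i] by linarith
  qed
  have "UA.cls a = UA.cls b"
    by (rule UA.cls_eqI[OF a(1) bl along_N[OF LIMSEQ_inverse_real_of_nat]]) (use b(2) in \<open>simp add: less_imp_le\<close>)
  thus ?thesis using a(2) bl b(1) by blast
qed

text \<open>The ultrapower of \<open>L\<close>, an isometric state-preserving homomorphism. It
  embeds the ultrapower in which \<open>s\<close> lives into the one in which its creation part
  \<open>lU\<close> is available.\<close>

definition Phi :: "('i \<Rightarrow> 'a) set \<Rightarrow> ('i \<Rightarrow> 'b) set" where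
  "Phi x = UB.cls (\<lambda>i. L ((SOME b. b \<in> carrier (linf A) \<and> (\<forall>i. b i \<in> W) \<and> x = UA.cls b) i))"

lemma L_minus: "x \<in> W \<Longrightarrow> y \<in> W \<Longrightarrow> L (x \<ominus> y) = L x \<ominus>\<^bsub>B\<^esub> L y"
  using L_add[OF _ Ws(5), of x y "-1"] L_sc[of y "-1"] Ws(1) by (simp add: cscale_m1 minus_eq B.cscale_m1 B.minus_eq)

lemma L_linf: assumes "b \<in> carrier (linf A)" "\<And>i. b i \<in> W" shows "(\<lambda>i. L (b i)) \<in> carrier (linf B)"
proof -
  obtain K where "nn (b i) \<le> K" for i using UA.linfE[OF assms(1)] by blast
  thus ?thesis using assms(2) by (intro UB.linfI[of _ K]) (auto simp: L_nrm)
qed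

lemma Phi_cls: assumes b: "b \<in> carrier (linf A)" "\<And>i. b i \<in> W" shows "Phi (UA.cls b) = UB.cls (\<lambda>i. L (b i))"
proof -
  define b' where "b' = (SOME b'. b' \<in> carrier (linf A) \<and> (\<forall>i. b' i \<in> W) \<and> UA.cls b = UA.cls b')"
  have "b' \<in> carrier (linf A) \<and> (\<forall>i. b' i \<in> W) \<and> UA.cls b = UA.cls b'"
    unfolding b'_def by (rule someI[of _ b]) (use b in simp)
  hence b': "b' \<in> carrier (linf A)" "\<And>i. b' i \<in> W" "UA.cls b' = UA.cls b" by auto
  have "((\<lambda>i. nn (b' i \<ominus> b i)) \<longlongrightarrow> 0) \<omega>" using UA.cls_eq[OF b'(1) b(1)] b'(3) by simp
  moreover have "B.nn (L (b' i) \<ominus>\<^bsub>B\<^esub> L (b i)) = nn (b' i \<ominus> b i)" for i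
    using L_minus[OF b'(2) b(2)] L_nrm[OF Ws(9)[OF b'(2) b(2)]] by metis
  ultimately have "UB.cls (\<lambda>i. L (b' i)) = UB.cls (\<lambda>i. L (b i))"
    using UB.cls_eq[OF L_linf[OF b'(1,2)] L_linf[OF b]] by simp
  thus ?thesis by (simp add: Phi_def b'_def)
qed

lemma Phi_closed: assumes "x \<in> carrier U" shows "Phi x \<in> carrier V"
proof -
  obtain b where b: "b \<in> carrier (linf A)" "\<And>i. b i \<in> W" "x = UA.cls b" using W_rep[OF assms] by blast
  show ?thesis unfolding b(3) Phi_cls[OF b(1,2)] by (rule UB.cls_closed[OF L_linf[OF b(1,2)]])
qed

lemma Phi_hom:
  assumes "x \<in> carrier U" "y \<in> carrier U"
  shows "Phi (x \<otimes>\<^bsub>U\<^esub> y) = Phi x \<otimes>\<^bsub>V\<^esub> Phi y" "Phi (x \<oplus>\<^bsub>U\<^esub> y) = Phi x \<oplus>\<^bsub>V\<^esub> Phi y"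
    "Phi (cscale U c x) = cscale V c (Phi x)" "Phi (adj U x) = adj V (Phi x)"
    "nrm V (Phi x) = nrm U x" "state V (Phi x) = state U x"
proof -
  obtain a where a: "a \<in> carrier (linf A)" "\<And>i. a i \<in> W" "x = UA.cls a" using W_rep[OF assms(1)] by blast
  obtain b where b: "b \<in> carrier (linf A)" "\<And>i. b i \<in> W" "y = UA.cls b" using W_rep[OF assms(2)] by blast
  note La = L_linf[OF a(1,2)] and Lb = L_linf[OF b(1,2)] and Pa = Phi_cls[OF a(1,2)] and Pb = Phi_cls[OF b(1,2)]
  show "Phi (x \<otimes>\<^bsub>U\<^esub> y) = Phi x \<otimes>\<^bsub>V\<^esub> Phi y"
    unfolding a(3) b(3) UA.cls_mult[OF a(1) b(1)] Pa Pb UB.cls_mult[OF La Lb]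
    by (subst Phi_cls[OF UA.linf_mult[OF a(1) b(1)] Ws(4)[OF a(2) b(2)]]) (simp add: L_mult[OF a(2) b(2)])
  show "Phi (x \<oplus>\<^bsub>U\<^esub> y) = Phi x \<oplus>\<^bsub>V\<^esub> Phi y"
    unfolding a(3) b(3) UA.cls_add[OF a(1) b(1)] Pa Pb UB.cls_add[OF La Lb]
    by (subst Phi_cls[OF UA.linf_add[OF a(1) b(1)] Ws(3)[OF a(2) b(2)]]) (simp add: L_add[OF a(2) b(2)])
  show "Phi (cscale U c x) = cscale V c (Phi x)"
    unfolding a(3) UA.cls_sc[OF a(1)] Pa UB.cls_sc[OF La]
    by (subst Phi_cls[OF UA.linf_sc[OF a(1)] Ws(5)[OF a(2)]]) (simp add: L_sc[OF a(2)])
  show "Phi (adj U x) = adj V (Phi x)"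
    unfolding a(3) UA.cls_star[OF a(1)] Pa UB.cls_star[OF La]
    by (subst Phi_cls[OF UA.linf_star[OF a(1)] Ws(6)[OF a(2)]]) (simp add: L_star[OF a(2)])
  show "nrm V (Phi x) = nrm U x"
    unfolding a(3) Pa by (rule UB.nrm_cls_eqI[OF La]) (use UA.cls_nrm[OF a(1)] in \<open>simp add: L_nrm[OF a(2)]\<close>)
  show "state V (Phi x) = state U x"
    unfolding a(3) Pa by (rule UB.st_cls_eqI[OF La]) (use UA.cls_st[OF a(1)] in \<open>simp add: L_st[OF a(2)]\<close>)
qed

lemma Phi_one: "Phi \<one>\<^bsub>U\<^esub> = \<one>\<^bsub>V\<^esub>"
  unfolding UA.cls_one UB.cls_one using Phi_cls[OF UA.linf_const[OF one_closed] Ws(2)] by (simp add: L_one)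

lemma N2_Phi: assumes "x \<in> carrier U" shows "UB.UP.N2 (Phi x) = UA.UP.N2 x"
  unfolding UA.UP.N2_def UB.UP.N2_def
  using Phi_hom(1)[OF UA.UP.adj_closed[OF assms] assms] Phi_hom(4)[OF assms assms]
    Phi_hom(6)[OF UA.UP.m_closed[OF UA.UP.adj_closed[OF assms] assms] assms] by metis

lemma Phi_star_hom: "star_hom U V Phi"
  unfolding star_hom_def
proof (intro conjI ballI allI ring_hom_memI)
  fix x y c assume "x \<in> carrier U" "y \<in> carrier U"
  note h = Phi_hom[OF this]
  show "Phi (x \<otimes>\<^bsub>U\<^esub> y) = Phi x \<otimes>\<^bsub>V\<^esub> Phi y" "Phi (x \<oplus>\<^bsub>U\<^esub> y) = Phi x \<oplus>\<^bsub>V\<^esub> Phi y"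
    by (rule h)+
qed (simp_all only: Phi_closed Phi_one Phi_hom(3,4)[OF _ UA.UP.one_closed])

lemmas Phi_star_subalg = star_hom_image[OF UA.UP.pre_cstar_axioms UB.UP.pre_cstar_axioms Phi_star_hom]

definition "sU = UA.cls (\<lambda>i. s (N i))"
definition "lU = UB.cls (\<lambda>i. ell (N i))"

lemma s_linf: "(\<lambda>i. s (N i)) \<in> carrier (linf A)"
  by (rule UA.linfI[of _ bd]) (use s Ws(1) s_bound in auto)

lemma ell_linf: "(\<lambda>i. ell (N i)) \<in> carrier (linf B)"
  by (rule UB.linfI[of _ 2]) (use ell ell_bound in auto)

lemma sU: "sU \<in> carrier U" unfolding sU_def by (rule UA.cls_closed[OF s_linf])

lemma lU: "lU \<in> carrier V" unfolding lU_def by (rule UB.cls_closed[OF ell_linf])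

lemma Phi_sU: "Phi sU = lU \<oplus>\<^bsub>V\<^esub> adj V lU"
proof -
  note star = UB.linf_star[OF ell_linf]
  have "Phi sU = UB.cls (\<lambda>i. L (s (N i)))" unfolding sU_def by (rule Phi_cls[OF s_linf s])
  also have "\<dots> = UB.cls (\<lambda>i. ell (N i) \<oplus>\<^bsub>B\<^esub> B.star (ell (N i)))"
    by (rule UB.cls_eqI[OF L_linf[OF s_linf s] UB.linf_add[OF ell_linf star] along_N[OF s_ell]]) simp
  finally show ?thesis unfolding lU_def UB.cls_star[OF ell_linf] UB.cls_add[OF ell_linf star] .
qed

abbreviation "PD x \<equiv> Phi (UA.diag x)"

lemma PD_W: assumes "x \<in> W" shows "PD x = UB.cls (\<lambda>i. L x)"
  unfolding UA.diag_cls by (rule Phi_cls[OF UA.linf_const[OF Ws(1)[OF assms]] assms])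

lemma lU_W: assumes e: "e \<in> W" shows "adj V lU \<otimes>\<^bsub>V\<^esub> (PD e \<otimes>\<^bsub>V\<^esub> lU) = cscale V (st e) \<one>\<^bsub>V\<^esub>"
proof -
  note 1 = UB.linf_const[OF L[OF e]] and 2 = UB.linf_star[OF ell_linf] and 3 = UB.linf_const[OF B.one_closed]
  note 4 = UB.linf_mult[OF 1 ell_linf] note 5 = UB.linf_mult[OF 2 4] and 6 = UB.linf_sc[OF 3, of "st e"]
  show ?thesis
    unfolding PD_W[OF e] lU_def UB.cls_star[OF ell_linf] UB.cls_mult[OF 1 ell_linf] UB.cls_mult[OF 2 4] UB.cls_one UB.cls_sc[OF 3]
    by (rule UB.cls_eqI[OF 5 6 along_N[OF ell_W[OF e]]]) simp
qed

lemma lU_vac: assumes e: "e \<in> W" shows "UB.UP.N2 (adj V lU \<otimes>\<^bsub>V\<^esub> PD e) = 0"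
proof -
  note 1 = UB.linf_const[OF L[OF e]] and 2 = UB.linf_star[OF ell_linf]
  note 4 = UB.linf_mult[OF 2 1]
  have "((\<lambda>i. B.N2 (B.star (ell (N i)) \<otimes>\<^bsub>B\<^esub> L e)) \<longlongrightarrow> UB.UP.N2 (adj V lU \<otimes>\<^bsub>V\<^esub> PD e)) \<omega>"
    unfolding PD_W[OF e] lU_def UB.cls_star[OF ell_linf] UB.cls_mult[OF 2 1] by (rule UB.N2_cls[OF 4])
  thus ?thesis using along_N[OF ell_vac[OF e]] tendsto_unique[OF UA.ne] by blast
qed

definition "E0 = UA.diag ` W"

lemma E0_subalg: "UA.UP.star_subalg E0"
proof -
  have "star_hom A U UA.diag"
    unfolding star_hom_def by (intro conjI ballI allI ring_hom_memI) (simp_all only: UA.diag_simps UA.diag_closed)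
  thus ?thesis unfolding E0_def by (rule star_hom_image[OF pre_cstar_axioms UA.UP.pre_cstar_axioms _ W])
qed

lemma N2_diag: assumes "x \<in> alg" shows "UA.UP.N2 (UA.diag x) = N2 x"
  unfolding UA.UP.N2_def N2_def using UA.diag_simps(2)[OF adj_closed[OF assms] assms] UA.diag_simps(4)[OF assms]
    UA.diag_st[OF m_closed[OF adj_closed[OF assms] assms]] by metis

text \<open>The asymptotic relations of the averaged operators become exact in the ultrapower;
  \<open>iso\<close> is the faithfulness of the given state, tested on the dense subalgebra.\<close>

sublocale F: fock V "Phi ` E0" lU
proof
  show "UB.UP.star_subalg (Phi ` E0)" by (rule Phi_star_subalg[OF E0_subalg])
  show "lU \<in> carrier V" by (rule lU)
  fix e assume "e \<in> Phi ` E0"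
  then obtain x where x: "x \<in> W" "e = PD x" by (auto simp: E0_def)
  note xc = Ws(1)[OF x(1)] UA.diag_closed[OF Ws(1)[OF x(1)]]
  have "state V (PD x) = st x" using Phi_hom(6)[OF xc(2,2)] UA.diag_st[OF xc(1)] by simp
  thus "adj V lU \<otimes>\<^bsub>V\<^esub> (e \<otimes>\<^bsub>V\<^esub> lU) = cscale V (state V e) \<one>\<^bsub>V\<^esub>" using lU_W[OF x(1)] x(2) by simp
  show "UB.UP.N2 (adj V lU \<otimes>\<^bsub>V\<^esub> e) = 0" unfolding x(2) by (rule lU_vac[OF x(1)])
  show "nrm V e \<le> M" if M: "M \<ge> 0" and b: "\<And>y. y \<in> Phi ` E0 \<Longrightarrow> UB.UP.N2 (e \<otimes>\<^bsub>V\<^esub> y) \<le> M * UB.UP.N2 y" for M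
  proof -
    have "nn x \<le> M"
    proof (rule gns_isometric_dense[OF xc(1) M _ dense])
      fix y assume y: "y \<in> W"
      note yc = Ws(1)[OF y]
      have "PD x \<otimes>\<^bsub>V\<^esub> PD y = PD (x \<otimes> y)"
        using Phi_hom(1)[OF xc(2) UA.diag_closed[OF yc]] UA.diag_simps(2)[OF xc(1) yc] by metis
      hence "UB.UP.N2 (PD (x \<otimes> y)) \<le> M * UB.UP.N2 (PD y)" using b[of "PD y"] y x(2) by (auto simp: E0_def)
      thus "N2 (x \<otimes> y) \<le> M * N2 y"
        using xc(1) yc N2_Phi[OF UA.diag_closed] N2_diag m_closed by metis
    qed (use Ws(1) in auto)
    thus ?thesis using x(2) Phi_hom(5)[OF xc(2,2)] UA.diag_nrm[OF xc(1)] by simp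
  qed
qed

end

section \<open>The algebras generated by the semicircular element\<close>

context semicircular_model
begin

lemma Phi_DD_subalg:
  assumes "fock V E lU"
  shows "UA.UP.star_subalg {x \<in> carrier U. \<exists>D. fock.DD V E lU D (Phi x)}"
proof -
  interpret G: fock V E lU by (rule assms)
  show ?thesis
    unfolding UA.UP.star_subalg_def
  proof (intro conjI ballI allI)
    have d1: "G.DD 0 (cscale V c \<one>\<^bsub>V\<^esub>)" for c by (rule G.DD_E[OF G.Es(5)[OF G.Es(2)]])
    show "\<one>\<^bsub>U\<^esub> \<in> {x \<in> carrier U. \<exists>D. G.DD D (Phi x)}"
      using UA.UP.one_closed Phi_one G.DD_E[OF G.Es(2)] by auto
    fix x assume x: "x \<in> {x \<in> carrier U. \<exists>D. G.DD D (Phi x)}"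
    then obtain D where D: "x \<in> carrier U" "G.DD D (Phi x)" by blast
    show "adj U x \<in> {x \<in> carrier U. \<exists>D. G.DD D (Phi x)}"
      using UA.UP.adj_closed[OF D(1)] Phi_hom(4)[OF D(1,1)] G.DD_star[OF D(2)] by auto
    show "cscale U c x \<in> {x \<in> carrier U. \<exists>D. G.DD D (Phi x)}" for c
    proof -
      have "cscale V c (Phi x) = cscale V c \<one>\<^bsub>V\<^esub> \<otimes>\<^bsub>V\<^esub> Phi x"
        using UB.UP.cscale_mult_left[OF UB.UP.one_closed Phi_closed[OF D(1)]] UB.UP.l_one[OF Phi_closed[OF D(1)]] by metis
      hence "G.DD (0 + D) (Phi (cscale U c x))"
        using G.DD_mult[OF d1 D(2)] Phi_hom(3)[OF D(1,1)] by metis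
      thus ?thesis using UA.UP.cscale_closed[OF D(1)] by blast
    qed
    fix y assume y: "y \<in> {x \<in> carrier U. \<exists>D. G.DD D (Phi x)}"
    then obtain D' where D': "y \<in> carrier U" "G.DD D' (Phi y)" by blast
    show "x \<oplus>\<^bsub>U\<^esub> y \<in> {x \<in> carrier U. \<exists>D. G.DD D (Phi x)}"
      using UA.UP.a_closed[OF D(1) D'(1)] Phi_hom(2)[OF D(1) D'(1)]
        G.DD_add[OF G.DD_mono[OF D(2) max.cobounded1] G.DD_mono[OF D'(2) max.cobounded2]] by force
    show "x \<otimes>\<^bsub>U\<^esub> y \<in> {x \<in> carrier U. \<exists>D. G.DD D (Phi x)}"
      using UA.UP.m_closed[OF D(1) D'(1)] Phi_hom(1)[OF D(1) D'(1)] G.DD_mult[OF D(2) D'(2)] by force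
  qed blast
qed

text \<open>Used for both Fock structures on \<open>lU\<close>: over the diagonal it gives the
  algebra \<open>P\<close>, over the scalars the algebra \<open>C\<close>. The norm estimate is made
  on the image under \<open>Phi\<close> and pulled back by isometry.\<close>

lemma fock_prob_space:
  assumes G: "fock V E lU" and T: "T \<subseteq> carrier U" and DT: "\<forall>x\<in>T. \<exists>D. fock.DD V E lU D (Phi x)"
    and E: "E \<subseteq> Phi ` UA.UP.salg T" and sT: "sU \<in> T"
  shows "\<forall>x\<in>UA.UP.salg T. \<exists>D. fock.DD V E lU D (Phi x)"
    "cstar_prob_space (U\<lparr>carrier := UA.UP.nclosure (UA.UP.salg T)\<rparr>)"
proof -
  interpret G: fock V E lU by (rule G)
  note sub = UA.UP.salg_subalg[OF T]
  have "UA.UP.salg T \<subseteq> {x \<in> carrier U. \<exists>D. G.DD D (Phi x)}"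
    by (rule UA.UP.salg_minimal[OF _ Phi_DD_subalg[OF G]]) (use T DT in blast)
  thus DD: "\<forall>x\<in>UA.UP.salg T. \<exists>D. G.DD D (Phi x)" by blast
  have DD': "\<exists>D. G.DD D x" if "x \<in> Phi ` UA.UP.salg T" for x using DD that by blast
  have sP: "lU \<oplus>\<^bsub>V\<^esub> adj V lU \<in> Phi ` UA.UP.salg T"
    using Phi_sU UA.UP.salg_inc[of T] sT by (metis imageI subsetD)
  show "cstar_prob_space (U\<lparr>carrier := UA.UP.nclosure (UA.UP.salg T)\<rparr>)"
  proof (rule UA.UP.nclosure_faithful[OF UA.U_cstar_algebra[OF cstar_algebra_axioms] sub])
    fix y and M :: real
    assume y: "y \<in> UA.UP.salg T" and M: "M \<ge> 0"
      and b: "\<forall>z\<in>UA.UP.salg T. UA.UP.N2 (y \<otimes>\<^bsub>U\<^esub> z) \<le> M * UA.UP.N2 z"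
    note c = UA.UP.star_subalgD(1)[OF sub]
    have "nrm V (Phi y) \<le> M"
    proof (rule G.nrm_le_GNS[OF Phi_star_subalg[OF sub] E sP DD' imageI[OF y] M])
      fix u assume "u \<in> Phi ` UA.UP.salg T"
      then obtain z where z: "z \<in> UA.UP.salg T" "u = Phi z" by blast
      show "UB.UP.N2 (Phi y \<otimes>\<^bsub>V\<^esub> u) \<le> M * UB.UP.N2 u"
        using b z Phi_hom(1)[OF c[OF y] c[OF z(1)]] N2_Phi[OF c[OF z(1)]] N2_Phi[OF UA.UP.m_closed[OF c[OF y] c[OF z(1)]]]
        by metis
    qed
    thus "nrm U y \<le> M" using Phi_hom(5)[OF c[OF y] c[OF y]] by simp
  qed
qed

definition "P0 = UA.UP.salg (E0 \<union> {sU})"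
definition "C0 = UA.UP.salg {sU}"
definition "PU = UA.UP.nclosure P0"
definition "CU = UA.UP.nclosure C0"
definition "EU = UA.UP.nclosure E0"

lemma E0_carrier: "E0 \<subseteq> carrier U" using UA.UP.star_subalgD(1)[OF E0_subalg] by blast

lemma gens: "E0 \<union> {sU} \<subseteq> carrier U" "{sU} \<subseteq> carrier U" using E0_carrier sU by auto

lemma C0_subalg: "UA.UP.star_subalg C0" unfolding C0_def by (rule UA.UP.salg_subalg[OF gens(2)])

lemma PU_gen: "PU = cstar_generated U (E0 \<union> {sU})" and CU_gen: "CU = cstar_generated U {sU}"
  unfolding PU_def CU_def P0_def C0_def
  using UA.UP.cstar_generated_nclosure[OF gens(1)] UA.UP.cstar_generated_nclosure[OF gens(2)] by simp_all

lemma PU_sub: "cstar_subalgebra U PU" and CU_sub: "cstar_subalgebra U CU"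
  unfolding PU_gen CU_gen using UA.UP.cstar_generated_subalgebra gens by blast+

lemma PUs: "UA.UP.star_subalg PU" "UA.UP.nclosed PU" and CUs: "UA.UP.star_subalg CU"
  using PU_sub CU_sub by (simp_all only: UA.UP.cstar_subalgebra_iff)

lemma E0_PU: "E0 \<subseteq> PU" and s_PU: "sU \<in> PU" and s_CU: "sU \<in> CU"
  unfolding PU_gen CU_gen using UA.UP.cstar_generated_inc[of "E0 \<union> {sU}"] UA.UP.cstar_generated_inc[of "{sU}"]
  by simp_all

lemma CU_PU: "CU \<subseteq> PU" unfolding CU_gen by (rule UA.UP.cstar_generated_minimal[OF _ PU_sub]) (use s_PU in blast)

lemma EU_PU: "EU \<subseteq> PU"
  using E0_PU PUs(2) unfolding EU_def UA.UP.nclosure_def UA.UP.nclosed_def by blast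

lemma diag_EU: assumes x: "x \<in> alg" shows "UA.diag x \<in> EU"
  unfolding EU_def UA.UP.nclosure_def
proof (intro CollectI conjI allI impI UA.diag_closed[OF x])
  fix e :: real assume "e > 0"
  then obtain w where w: "w \<in> W" "nn (x \<ominus> w) < e" using dense[OF x] by blast
  have "nrm U (UA.diag x \<ominus>\<^bsub>U\<^esub> UA.diag w) = nn (x \<ominus> w)"
    using UA.diag_simps(5)[OF x Ws(1)[OF w(1)]] UA.diag_nrm[OF minus_closed[OF x Ws(1)[OF w(1)]]] by simp
  thus "\<exists>y\<in>E0. nrm U (UA.diag x \<ominus>\<^bsub>U\<^esub> y) < e" using w unfolding E0_def by (metis imageI)
qed

lemma lU_isometry: "adj V lU \<otimes>\<^bsub>V\<^esub> lU = \<one>\<^bsub>V\<^esub>"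
  using F.ll[OF F.Es(2)] UB.UP.l_one[OF lU] UB.UP.st_one UB.UP.cscale_one[OF UB.UP.one_closed] by metis

sublocale G: fock V "range (\<lambda>z. cscale V z \<one>\<^bsub>V\<^esub>)" lU
  by (rule UB.UP.fock_scalars[OF lU lU_isometry F.N2_star_l])

lemma P_prob_space: "cstar_prob_space (U\<lparr>carrier := PU\<rparr>)"
  unfolding PU_def P0_def
proof (rule fock_prob_space(2)[OF F.fock_axioms gens(1)])
  have "\<exists>D. F.DD D (Phi x)" if "x \<in> E0" for x by (intro exI) (rule F.DD_E[OF imageI[OF that]])
  moreover have "\<exists>D. F.DD D (Phi sU)" unfolding Phi_sU by (intro exI) (rule F.DD_s)
  ultimately show "\<forall>x\<in>E0 \<union> {sU}. \<exists>D. F.DD D (Phi x)" by (metis Un_iff singletonD)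
  show "Phi ` E0 \<subseteq> Phi ` UA.UP.salg (E0 \<union> {sU})" using UA.UP.salg_inc by blast
qed simp

lemma C0_DD: "\<forall>x\<in>C0. \<exists>D. G.DD D (Phi x)" and C_prob_space: "cstar_prob_space (U\<lparr>carrier := CU\<rparr>)"
proof -
  have 1: "\<forall>x\<in>{sU}. \<exists>D. G.DD D (Phi x)" using G.DD_s Phi_sU by auto
  have 2: "range (\<lambda>z. cscale V z \<one>\<^bsub>V\<^esub>) \<subseteq> Phi ` UA.UP.salg {sU}"
  proof
    fix y assume "y \<in> range (\<lambda>z. cscale V z \<one>\<^bsub>V\<^esub>)"
    then obtain z where "y = cscale V z \<one>\<^bsub>V\<^esub>" by blast
    hence "y = Phi (cscale U z \<one>\<^bsub>U\<^esub>)"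
      using Phi_hom(3)[OF UA.UP.one_closed UA.UP.one_closed] Phi_one by metis
    moreover note s = UA.UP.star_subalgD[OF UA.UP.salg_subalg[OF gens(2)]]
    ultimately show "y \<in> Phi ` UA.UP.salg {sU}" using imageI[OF s(5)[OF s(2)], of Phi z] by (simp only:)
  qed
  note f = fock_prob_space[OF G.fock_axioms gens(2) 1 2 singletonI]
  show "\<forall>x\<in>C0. \<exists>D. G.DD D (Phi x)" "cstar_prob_space (U\<lparr>carrier := CU\<rparr>)"
    using f unfolding CU_def C0_def by blast+
qed

lemma sU_centered: "state U sU = 0"
proof -
  have "state U sU = state V (Phi sU)" using Phi_hom(6)[OF sU sU] by simp
  also have "\<dots> = state V (lU \<otimes>\<^bsub>V\<^esub> \<one>\<^bsub>V\<^esub>) + state V (\<one>\<^bsub>V\<^esub> \<otimes>\<^bsub>V\<^esub> adj V lU)"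
    unfolding Phi_sU using UB.UP.st_add[OF lU UB.UP.adj_closed[OF lU]] UB.UP.r_one[OF lU] UB.UP.l_one[OF UB.UP.adj_closed[OF lU]]
    by metis
  also have "\<dots> = 0" using F.st_l_left[OF UB.UP.one_closed] F.st_l_right[OF UB.UP.one_closed] by simp
  finally show ?thesis .
qed

text \<open>On the vacuum \<open>l\<close> is isometric and its adjoint vanishes, so
  \<open>s\<close> cannot be null. Being centred, it is then not a scalar, and \<open>C\<close> is
  nontrivial.\<close>

lemma N2_sU: "UA.UP.N2 sU \<ge> 1"
proof -
  note ls = UB.UP.adj_closed[OF lU]
  have "UB.UP.N2 lU = 1"
    using lU_isometry by (simp add: UB.UP.N2_def UB.UP.st_one del: UB.U_ring_simps)
  moreover have "lU = (lU \<oplus>\<^bsub>V\<^esub> adj V lU) \<ominus>\<^bsub>V\<^esub> adj V lU"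
    using UB.UP.minus_eq UB.UP.a_assoc UB.UP.r_neg UB.UP.r_zero lU ls UB.UP.a_inv_closed by metis
  ultimately have "1 \<le> UB.UP.N2 (lU \<oplus>\<^bsub>V\<^esub> adj V lU) + UB.UP.N2 (adj V lU)"
    using UB.UP.N2_minus_triangle[OF UB.UP.a_closed[OF lU ls] ls] by metis
  thus ?thesis using F.N2_star_l N2_Phi[OF sU] Phi_sU by simp
qed

lemma CU_nontrivial: "CU \<noteq> range (\<lambda>c. cscale U c \<one>\<^bsub>U\<^esub>)"
proof
  assume "CU = range (\<lambda>c. cscale U c \<one>\<^bsub>U\<^esub>)"
  then obtain c where c: "sU = cscale U c \<one>\<^bsub>U\<^esub>" using s_CU by blast
  have "state U sU = c" unfolding c using UA.UP.st_cscale[OF UA.UP.one_closed] UA.UP.st_one by simp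
  hence "sU = \<zero>\<^bsub>U\<^esub>" using c sU_centered UA.UP.cscale_0[OF UA.UP.one_closed] by metis
  thus False using N2_sU UA.UP.N2_zero by simp
qed

text \<open>The Fock structure over the scalars yields the normal form and its constant term is the
  mean; the result is read in the structure over the diagonal, which has the same
  \<open>lU\<close>.\<close>

lemma C0_lform: assumes x: "x \<in> C0" "state U x = 0" shows "F.lform (Phi x)"
proof -
  have xc: "x \<in> carrier U" using UA.UP.star_subalgD(1)[OF C0_subalg x(1)] .
  obtain D where D: "G.DD D (Phi x)" using C0_DD x(1) by blast
  have "\<exists>t a b. a \<in> carrier V \<and> b \<in> carrier V \<and>
      Phi x = cscale V t \<one>\<^bsub>V\<^esub> \<oplus>\<^bsub>V\<^esub> (lU \<otimes>\<^bsub>V\<^esub> a \<oplus>\<^bsub>V\<^esub> b \<otimes>\<^bsub>V\<^esub> adj V lU)"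
    by (rule G.scalar_DD_form[OF _ D]) blast
  then obtain t a b where ab: "a \<in> carrier V" "b \<in> carrier V"
    and P: "Phi x = cscale V t \<one>\<^bsub>V\<^esub> \<oplus>\<^bsub>V\<^esub> (lU \<otimes>\<^bsub>V\<^esub> a \<oplus>\<^bsub>V\<^esub> b \<otimes>\<^bsub>V\<^esub> adj V lU)" by blast
  note la = UB.UP.m_closed[OF lU ab(1)] and bl = UB.UP.m_closed[OF ab(2) UB.UP.adj_closed[OF lU]]
  note Y = UB.UP.a_closed[OF la bl] and sc1 = UB.UP.cscale_closed[OF UB.UP.one_closed]
  have "state V (Phi x) = t * 1 + (0 + 0)"
    unfolding P UB.UP.st_add[OF sc1 Y] UB.UP.st_add[OF la bl] UB.UP.st_cscale[OF UB.UP.one_closed] UB.UP.st_one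
      F.st_l_left[OF ab(1)] F.st_l_right[OF ab(2)] ..
  hence "t = 0" using Phi_hom(6)[OF xc xc] x(2) by simp
  hence "Phi x = lU \<otimes>\<^bsub>V\<^esub> a \<oplus>\<^bsub>V\<^esub> b \<otimes>\<^bsub>V\<^esub> adj V lU"
    using P UB.UP.cscale_0[OF UB.UP.one_closed] UB.UP.l_zero[OF Y] by metis
  thus ?thesis unfolding F.lform_def using ab by blast
qed

section \<open>Freeness in the closed algebras\<close>

lemma approx_letter:
  assumes x: "x \<in> (if i then CU else EU)" "state U x = 0" and e: "e > 0"
  shows "\<exists>y\<in>carrier U. F.letter (i, Phi y) \<and> nrm U (y \<ominus>\<^bsub>U\<^esub> x) < e"
proof -
  define Q where "Q = (if i then C0 else E0)"
  have Q: "UA.UP.star_subalg Q" using C0_subalg E0_subalg by (simp add: Q_def)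
  have "x \<in> UA.UP.nclosure Q" using x(1) by (simp add: Q_def CU_def EU_def split: if_splits)
  from UA.UP.centered_approx[OF Q this x(2) e] obtain y where
    y: "y \<in> Q" "state U y = 0" "nrm U (y \<ominus>\<^bsub>U\<^esub> x) < e" by blast
  have yc: "y \<in> carrier U" using UA.UP.star_subalgD(1)[OF Q y(1)] .
  have "F.letter (i, Phi y)"
    using y C0_lform[of y] Phi_hom(6)[OF yc yc] by (auto simp: F.letter_def Q_def split: if_splits)
  thus ?thesis using y yc by blast
qed

abbreviation "prU w \<equiv> foldr (\<otimes>\<^bsub>U\<^esub>) (map snd w) \<one>\<^bsub>U\<^esub>"

lemma prU_closed: "\<forall>p\<in>set w. snd p \<in> carrier U \<Longrightarrow> prU w \<in> carrier U"
  by (induction w) (auto simp del: UA.U_ring_simps)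

lemma Phi_prU: "\<forall>p\<in>set w. snd p \<in> carrier U \<Longrightarrow> Phi (prU w) = F.wprod (map (\<lambda>p. (fst p, Phi (snd p))) w)"
proof (induction w)
  case Nil thus ?case using Phi_one by simp
next
  case (Cons p w)
  thus ?case using Phi_hom(1)[OF _ prU_closed, of "snd p" w] by (simp del: UA.U_ring_simps UB.U_ring_simps)
qed

lemma approx_word:
  assumes "\<forall>p\<in>set w. snd p \<in> (if fst p then CU else EU) \<and> state U (snd p) = 0" "e > 0"
  shows "\<exists>v. map fst v = map fst w \<and> (\<forall>p\<in>set v. snd p \<in> carrier U \<and> F.letter (fst p, Phi (snd p))) \<and>
     nrm U (prU v \<ominus>\<^bsub>U\<^esub> prU w) < e"
  using assms
proof (induction w arbitrary: e)
  case Nil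
  have "nrm U (\<one>\<^bsub>U\<^esub> \<ominus>\<^bsub>U\<^esub> \<one>\<^bsub>U\<^esub>) = 0" using UA.UP.nrm_diff_eq_0[OF UA.UP.one_closed UA.UP.one_closed] by simp
  thus ?case using Nil(2) by (intro exI[of _ "[]"]) simp
next
  case (Cons p w e)
  have sub: "(if b then CU else EU) \<subseteq> carrier U" for b
    using UA.UP.star_subalgD(1)[OF CUs] by (cases b) (auto simp: EU_def UA.UP.nclosure_def)
  have "\<forall>p\<in>set (p # w). snd p \<in> carrier U" using Cons.prems(1) sub by blast
  hence wc: "\<forall>p\<in>set w. snd p \<in> carrier U" and xc: "snd p \<in> carrier U" by simp_all
  define x where "x = snd p"
  have x: "x \<in> (if fst p then CU else EU)" "state U x = 0" "x \<in> carrier U"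
    using Cons.prems(1) xc by (auto simp: x_def)
  have nx: "nrm U x + 1 > 0" using UA.UP.nrm_nonneg[OF x(3)] by simp
  have IH: "\<exists>v. map fst v = map fst w \<and> (\<forall>p\<in>set v. snd p \<in> carrier U \<and> F.letter (fst p, Phi (snd p))) \<and>
     nrm U (prU v \<ominus>\<^bsub>U\<^esub> prU w) < d" if "d > 0" for d using Cons.IH[OF _ that] Cons.prems(1) by simp
  \<comment> \<open>The order of choice matters: the tail is approximated first, with accuracy set
    by \<open>x\<close>, and then the head, with accuracy set by the approximated tail.\<close>
  obtain v where v: "map fst v = map fst w" "\<forall>p\<in>set v. snd p \<in> carrier U \<and> F.letter (fst p, Phi (snd p))"
    "nrm U (prU v \<ominus>\<^bsub>U\<^esub> prU w) < e / (2 * (nrm U x + 1))"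
    using IH[of "e / (2 * (nrm U x + 1))"] nx Cons.prems(2) by auto
  have vc: "prU v \<in> carrier U" "prU w \<in> carrier U" using prU_closed v(2) wc by blast+
  have nv: "nrm U (prU v) + 1 > 0" using UA.UP.nrm_nonneg[OF vc(1)] by simp
  have "e / (2 * (nrm U (prU v) + 1)) > 0" using nv Cons.prems(2) by simp
  note approx_letter[OF x(1,2) this]
  then obtain y where y: "y \<in> carrier U" "F.letter (fst p, Phi y)"
    "nrm U (y \<ominus>\<^bsub>U\<^esub> x) < e / (2 * (nrm U (prU v) + 1))" by blast
  have "nrm U (y \<otimes>\<^bsub>U\<^esub> prU v \<ominus>\<^bsub>U\<^esub> x \<otimes>\<^bsub>U\<^esub> prU w) \<le>
    nrm U (y \<ominus>\<^bsub>U\<^esub> x) * nrm U (prU v) + nrm U x * nrm U (prU v \<ominus>\<^bsub>U\<^esub> prU w)"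
    by (rule UA.UP.nrm_mult_diff[OF y(1) vc(1) x(3) vc(2)])
  also have "\<dots> < e"
  proof -
    have "nrm U (y \<ominus>\<^bsub>U\<^esub> x) * nrm U (prU v) \<le> nrm U (y \<ominus>\<^bsub>U\<^esub> x) * (nrm U (prU v) + 1)"
      using UA.UP.nrm_nonneg[OF UA.UP.minus_closed[OF y(1) x(3)]] by (intro mult_left_mono) auto
    also have "\<dots> < e / 2" using y(3) nv by (simp add: field_simps)
    finally have 1: "nrm U (y \<ominus>\<^bsub>U\<^esub> x) * nrm U (prU v) < e / 2" .
    have "nrm U x * nrm U (prU v \<ominus>\<^bsub>U\<^esub> prU w) \<le> (nrm U x + 1) * nrm U (prU v \<ominus>\<^bsub>U\<^esub> prU w)"
      using UA.UP.nrm_nonneg[OF UA.UP.minus_closed[OF vc]] by (intro mult_right_mono) auto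
    also have "\<dots> < e / 2" using v(3) nx by (simp add: field_simps)
    finally show ?thesis using 1 by simp
  qed
  finally show ?case
    using v y by (intro exI[of _ "(fst p, y) # v"]) (auto simp: x_def simp del: UA.U_ring_simps)
qed

lemma words_free:
  assumes "w \<noteq> []" "distinct_adj (map fst w)"
    "\<forall>p\<in>set w. snd p \<in> (if fst p then CU else EU) \<and> state U (snd p) = 0"
  shows "state U (prU w) = 0"
proof -
  have sub: "(if b then CU else EU) \<subseteq> carrier U" for b
    using UA.UP.star_subalgD(1)[OF CUs] by (cases b) (auto simp: EU_def UA.UP.nclosure_def)
  have "\<forall>p\<in>set w. snd p \<in> carrier U" using assms(3) sub by blast
  hence wc: "prU w \<in> carrier U" by (rule prU_closed)
  have "cmod (state U (prU w)) \<le> 0"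
  proof (rule field_le_epsilon)
    fix e :: real assume "e > 0"
    then obtain v where v: "map fst v = map fst w"
      "\<forall>p\<in>set v. snd p \<in> carrier U \<and> F.letter (fst p, Phi (snd p))" "nrm U (prU v \<ominus>\<^bsub>U\<^esub> prU w) < e"
      using approx_word[OF assms(3)] by blast
    have vc: "prU v \<in> carrier U" using prU_closed v(2) by blast
    have "state V (F.wprod (map (\<lambda>p. (fst p, Phi (snd p))) v)) = 0"
    proof (rule F.free_words)
      have "v \<noteq> []" using v(1) assms(1) by (metis map_is_Nil_conv)
      thus "map (\<lambda>p. (fst p, Phi (snd p))) v \<noteq> []" by simp
      have "map fst (map (\<lambda>p. (fst p, Phi (snd p))) v) = map fst w" using v(1) by (simp add: comp_def)
      thus "distinct_adj (map fst (map (\<lambda>p. (fst p, Phi (snd p))) v))" using assms(2) by simp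
    qed (use v(2) in auto)
    hence "state U (prU v) = 0" using Phi_prU[of v] v(2) Phi_hom(6)[OF vc vc] by simp
    hence "cmod (state U (prU w)) = cmod (state U (prU v \<ominus>\<^bsub>U\<^esub> prU w))"
      using UA.UP.st_diff[OF vc wc] by simp
    also have "\<dots> \<le> nrm U (prU v \<ominus>\<^bsub>U\<^esub> prU w)" by (rule UA.UP.st_bound[OF UA.UP.minus_closed[OF vc wc]])
    finally show "cmod (state U (prU w)) \<le> 0 + e" using v(3) by simp
  qed
  thus ?thesis by simp
qed

lemma A_prob_space: "cstar_prob_space A" unfolding cstar_prob_space_iff by unfold_locales

theorem P_free_product:
  "reduced_free_product (U\<lparr>carrier := PU\<rparr>) A (U\<lparr>carrier := CU\<rparr>) UA.diag (\<lambda>x. x)"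
  unfolding reduced_free_product_def
proof (intro conjI)
  show "cstar_prob_space A" "cstar_prob_space (U\<lparr>carrier := CU\<rparr>)" "cstar_prob_space (U\<lparr>carrier := PU\<rparr>)"
    by (rule A_prob_space C_prob_space P_prob_space)+
  show "UA.diag \<in> cps_hom A (U\<lparr>carrier := PU\<rparr>)"
    unfolding cps_hom_def
    using subsetD[OF EU_PU diag_EU] UA.diag_simps UA.diag_st
    by (auto intro!: ring_hom_memI simp del: UA.U_ring_simps)
  show "(\<lambda>x. x) \<in> cps_hom (U\<lparr>carrier := CU\<rparr>) (U\<lparr>carrier := PU\<rparr>)"
    unfolding cps_hom_def using CU_PU by (auto intro!: ring_hom_memI simp del: UA.U_ring_simps)
  show "free_family (U\<lparr>carrier := PU\<rparr>)
     (\<lambda>second. if second then (\<lambda>x. x) ` carrier (U\<lparr>carrier := CU\<rparr>) else UA.diag ` alg)"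
    unfolding free_family_def
  proof (intro allI impI, elim conjE)
    fix w :: "(bool \<times> ('i \<Rightarrow> 'a) set) list"
    assume w: "w \<noteq> []" "distinct_adj (map fst w)"
      "\<forall>(i, x)\<in>set w. x \<in> (if i then (\<lambda>x. x) ` carrier (U\<lparr>carrier := CU\<rparr>) else UA.diag ` alg) \<and>
         state (U\<lparr>carrier := PU\<rparr>) x = 0"
    have "state U (prU w) = 0"
    proof (rule words_free[OF w(1,2)])
      show "\<forall>p\<in>set w. snd p \<in> (if fst p then CU else EU) \<and> state U (snd p) = 0"
      proof
        fix p assume p: "p \<in> set w"
        show "snd p \<in> (if fst p then CU else EU) \<and> state U (snd p) = 0"
          using bspec[OF w(3) p] diag_EU by (cases p; cases "fst p") auto
      qed
    qed
    thus "state (U\<lparr>carrier := PU\<rparr>)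
       (foldr (\<otimes>\<^bsub>U\<lparr>carrier := PU\<rparr>\<^esub>) (map snd w) \<one>\<^bsub>U\<lparr>carrier := PU\<rparr>\<^esub>) = 0"
      by simp
  qed
  show "cstar_generated (U\<lparr>carrier := PU\<rparr>) (UA.diag ` alg \<union> (\<lambda>x. x) ` carrier (U\<lparr>carrier := CU\<rparr>))
      = carrier (U\<lparr>carrier := PU\<rparr>)"
  proof -
    let ?T = "UA.diag ` alg \<union> CU"
    have T: "?T \<subseteq> PU" using diag_EU EU_PU CU_PU by blast
    have "cstar_generated U ?T = PU"
    proof
      show "cstar_generated U ?T \<subseteq> PU" by (rule UA.UP.cstar_generated_minimal[OF T PU_sub])
      have "cstar_subalgebra U (cstar_generated U ?T)"
        by (rule UA.UP.cstar_generated_subalgebra) (use T UA.UP.star_subalgD(1)[OF PUs(1)] in blast)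
      moreover have "E0 \<union> {sU} \<subseteq> ?T" using Ws(1) s_CU unfolding E0_def by blast
      ultimately show "PU \<subseteq> cstar_generated U ?T"
        unfolding PU_gen using UA.UP.cstar_generated_inc[of ?T] by (intro UA.UP.cstar_generated_minimal) auto
    qed
    thus ?thesis using UA.UP.subalg_generated[OF PU_sub T] by simp
  qed
qed

text \<open>The free product and its second factor are realised as subalgebras of the ultrapower, so
  \<open>\<sigma>\<close> is the inclusion. The condition on \<open>Bs\<close> holds because
  \<open>s\<close> is represented by a family from \<open>Bs\<close> and the ultrapower of
  \<open>Bs\<close> is closed.\<close>

theorem selfless_data:
  assumes Bs: "cstar_subalgebra A Bs" and sB: "\<And>n. s n \<in> Bs"
  shows "\<exists>(C :: ('i \<Rightarrow> 'a) set cstar_prob) (P :: ('i \<Rightarrow> 'a) set cstar_prob) \<iota> \<kappa> \<sigma>.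
    cstar_prob_space C \<and> carrier C \<noteq> range (\<lambda>c. cscale C c \<one>\<^bsub>C\<^esub>) \<and> reduced_free_product P A C \<iota> \<kappa> \<and>
    \<sigma> \<in> cps_embedding P U \<and> (\<forall>x\<in>alg. \<sigma> (\<iota> x) = UA.diag x) \<and>
    \<sigma> ` cstar_generated P (\<iota> ` Bs \<union> \<kappa> ` carrier C) \<subseteq> ultra_sub A \<omega> Bs"
proof -
  let ?P = "U\<lparr>carrier := PU\<rparr>" and ?C = "U\<lparr>carrier := CU\<rparr>"
  have emb: "(\<lambda>x. x) \<in> cps_embedding ?P U"
    unfolding cps_embedding_def cps_hom_def using UA.UP.star_subalgD(1)[OF PUs(1)]
    by (auto intro!: ring_hom_memI simp del: UA.U_ring_simps)
  have Bc: "Bs \<subseteq> alg" using Bs star_subalgD(1) unfolding cstar_subalgebra_iff by blast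
  note us = UA.ultra_sub_subalgebra[OF Bs N]
  have sub: "UA.diag ` Bs \<subseteq> ultra_sub A \<omega> Bs"
    using UA.ultra_subI[OF UA.linf_const] Bc by (auto simp: UA.diag_cls)
  have "sU \<in> ultra_sub A \<omega> Bs" unfolding sU_def by (rule UA.ultra_subI[OF s_linf sB])
  hence CB: "CU \<subseteq> ultra_sub A \<omega> Bs" unfolding CU_gen by (intro UA.UP.cstar_generated_minimal us) blast
  have "UA.diag ` Bs \<union> CU \<subseteq> PU" using Bc diag_EU EU_PU CU_PU by blast
  hence "cstar_generated ?P (UA.diag ` Bs \<union> CU) = cstar_generated U (UA.diag ` Bs \<union> CU)"
    by (rule UA.UP.subalg_generated[OF PU_sub])
  moreover have "cstar_generated U (UA.diag ` Bs \<union> CU) \<subseteq> ultra_sub A \<omega> Bs"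
    using sub CB by (intro UA.UP.cstar_generated_minimal us) blast
  ultimately have "(\<lambda>x. x) ` cstar_generated ?P (UA.diag ` Bs \<union> (\<lambda>x. x) ` carrier ?C) \<subseteq> ultra_sub A \<omega> Bs"
    by simp
  moreover have "carrier ?C \<noteq> range (\<lambda>c. cscale ?C c \<one>\<^bsub>?C\<^esub>)" using CU_nontrivial by simp
  ultimately show ?thesis using C_prob_space P_free_product emb by blast
qed

end

section \<open>Unitary letters and orthogonal words\<close>

locale unitary_letters = free_pair A B for A :: "'a cstar_prob" (structure) and B +
  fixes a b c z :: 'a
  assumes aB: "a \<in> B False" and au: "star a \<otimes> a = \<one>" "a \<otimes> star a = \<one>" and a0: "st a = 0"
    and bB: "b \<in> B False" and bu: "star b \<otimes> b = \<one>" "b \<otimes> star b = \<one>" and b0: "st b = 0"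
    and cB: "c \<in> B False" and cu: "star c \<otimes> c = \<one>" "c \<otimes> star c = \<one>" and c0: "st c = 0"
    and zB: "z \<in> B True" and zu: "star z \<otimes> z = \<one>" "z \<otimes> star z = \<one>" and z0: "st z = 0"
    and acz: "x \<in> B False \<Longrightarrow> st (a \<otimes> x) = st (x \<otimes> a)" and bcz: "x \<in> B False \<Longrightarrow> st (b \<otimes> x) = st (x \<otimes> b)"
    and ccz: "x \<in> B False \<Longrightarrow> st (c \<otimes> x) = st (x \<otimes> c)"
    and zc: "x \<in> B True \<Longrightarrow> z \<otimes> x = x \<otimes> z"
    and cb0: "st (star c \<otimes> b) = 0" and zz0: "st (z \<otimes> z) = 0"
begin

lemma letters_closed [simp]: "a \<in> alg" "b \<in> alg" "c \<in> alg" "z \<in> alg"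
  using Bc aB bB cB zB by auto

text \<open>Period four, except that \<open>c\<close> marks the powers of two, which are preserved by no shift.\<close>

definition gseq :: "nat \<Rightarrow> 'a" where
  "gseq i = (if i mod 4 = 0 then if \<exists>k. i div 4 = 2 ^ k then c else b
    else if i mod 4 = 1 then star z else if i mod 4 = 2 then a else z)"

lemma gseq_cases:
  "even i \<and> (gseq i = a \<or> gseq i = b \<or> gseq i = c) \<or> odd i \<and> (gseq i = z \<or> gseq i = star z)"
proof -
  have "i mod 4 < 4" by simp
  then consider "i mod 4 = 0" | "i mod 4 = 1" | "i mod 4 = 2" | "i mod 4 = 3" by linarith
  thus ?thesis
  proof cases
    case 1 hence "even i" by presburger
    thus ?thesis using 1 by (simp add: gseq_def)
  next
    case 2 hence "odd i" by presburger
    thus ?thesis using 2 by (simp add: gseq_def)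
  next
    case 3 hence "even i" by presburger
    thus ?thesis using 3 by (simp add: gseq_def)
  next
    case 4 hence "odd i" by presburger
    thus ?thesis using 4 by (simp add: gseq_def)
  qed
qed

lemma zsB: "star z \<in> B True" using star_subalgD(6)[OF Bs zB] .

lemma zsc: assumes "x \<in> B True" shows "star z \<otimes> x = x \<otimes> star z"
proof -
  have "z \<otimes> star x = star x \<otimes> z" using zc star_subalgD(6)[OF Bs assms] by blast
  hence "star (z \<otimes> star x) = star (star x \<otimes> z)" by (rule arg_cong)
  thus ?thesis unfolding adj_mult[OF letters_closed(4) adj_closed[OF Bc[OF assms]]]
      adj_mult[OF adj_closed[OF Bc[OF assms]] letters_closed(4)] adj_adj[OF Bc[OF assms]] by (rule sym)
qed

text \<open>A shift by \<open>2\<close> modulo \<open>4\<close> pairs \<open>z*\<close> with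
  \<open>z\<close>. A shift by a multiple of four pairs the \<open>c\<close> at a large power of two
  with a \<open>b\<close>.\<close>

lemma gseq_aper:
  assumes pq: "p < q" "even (q - p)"
  shows "\<exists>i. st (star (gseq (p + i)) \<otimes> gseq (q + i)) = 0"
proof -
  have *: "d mod 4 = 2 \<or> d mod 4 = 0" if "even d" for d :: nat using that by presburger
  obtain d where d: "q = p + d" "even d" using pq by (metis le_add_diff_inverse less_imp_le)
  show ?thesis
  proof (cases "d mod 4 = 2")
    case 1: True
    \<comment> \<open>Adding \<open>3 p + 1\<close> moves \<open>p\<close> to
      \<open>4 p + 1\<close>, a place holding \<open>star z\<close>; the shifted place holds
      \<open>z\<close>, so the product under the state is \<open>z z\<close>.\<close>
    have "(p + (3 * p + 1)) mod 4 = 1" by presburger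
    moreover have "(q + (3 * p + 1)) mod 4 = 3" using 1 unfolding d(1) by presburger
    ultimately show ?thesis using zz0 by (intro exI[of _ "3 * p + 1"]) (simp add: gseq_def)
  next
    case False
    hence 2: "d mod 4 = 0" using *[OF d(2)] by simp
    then obtain e where e: "q = p + 4 * e" unfolding d(1) by auto
    hence e0: "e > 0" using pq(1) by simp
    \<comment> \<open>This \<open>m\<close> makes \<open>2 ^ m\<close> exceed \<open>e\<close>, so
      \<open>2 ^ m + e\<close> lies strictly between consecutive powers of two; it also makes
      \<open>4 * 2 ^ m\<close> at least \<open>p\<close>, so that the subtraction defining
      \<open>i\<close> is exact.\<close>
    define m where "m = p + e"
    have m: "m < 2 ^ m" by simp
    have eM: "e \<le> m" by (simp add: m_def)
    define i where "i = 4 * 2 ^ m - p"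
    have "p \<le> 4 * 2 ^ m" using m unfolding m_def by linarith
    hence pi: "p + i = 4 * 2 ^ m" "q + i = 4 * (2 ^ m + e)" unfolding i_def e by simp_all
    have gen: "x < y" "y < 2 * x" if "x + e = y" "0 < e" "e < x" for x y e :: nat using that by auto
    have "\<not> (\<exists>k. 2 ^ m + e = 2 ^ k)"
    proof
      assume "\<exists>k. 2 ^ m + e = 2 ^ k"
      then obtain k where k: "2 ^ m + e = 2 ^ k" by blast
      have "(2::nat) ^ m < 2 ^ k" "(2::nat) ^ k < 2 ^ Suc m" using gen[OF k e0 le_less_trans[OF eM m]] by (simp_all only: power_Suc)
      hence "m < k" "k < Suc m" by (simp_all only: power_strict_increasing_iff one_less_numeral_iff semiring_norm)
      thus False by simp
    qed
    hence "gseq (p + i) = c" "gseq (q + i) = b" unfolding pi by (auto simp: gseq_def)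
    thus ?thesis using cb0 by (intro exI[of _ i]) simp
  qed
qed

sublocale unitary_word A B gseq
proof
  show "gseq i \<in> B (odd i)" for i using gseq_cases[of i] aB bB cB zB zsB by auto
  show "star (gseq i) \<otimes> gseq i = \<one>" "gseq i \<otimes> star (gseq i) = \<one>" for i
    using gseq_cases[of i] au bu cu zu by auto
  show "st (gseq i) = 0" for i using gseq_cases[of i] a0 b0 c0 z0 st_adj[of z] by auto
  show "st (gseq i \<otimes> x) = st (x \<otimes> gseq i)" if "x \<in> B (odd i)" for i x
  proof (cases "even i")
    case True
    hence "x \<in> B False" using that by simp
    moreover have "gseq i = a \<or> gseq i = b \<or> gseq i = c" using gseq_cases[of i] True by blast
    ultimately show ?thesis by (elim disjE) (simp_all only: acz bcz ccz)
  next
    case False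
    hence "x \<in> B True" using that by simp
    moreover have "gseq i = z \<or> gseq i = star z" using gseq_cases[of i] False by blast
    ultimately show ?thesis by (elim disjE) (simp_all only: zc zsc)
  qed
qed (rule gseq_aper)

text \<open>The range and the kernel of the projection \<open>q\<close> constructed below; the
  vacuum is counted in the kernel.\<close>

abbreviation SA :: "'a set" where "SA \<equiv> Sp (\<lambda>w. w \<noteq> [] \<and> \<not> fst (hd w))"
abbreviation SZ :: "'a set" where "SZ \<equiv> Sp (\<lambda>w. w = [] \<or> fst (hd w))"

text \<open>The word of \<open>t_i\<close>: \<open>i\<close> blocks \<open>b z* a z\<close> followed
  by one block \<open>c z* a z\<close>. For different indices the common blocks cancel until a
  \<open>c\<close> faces a \<open>b\<close>.\<close>

primrec tw :: "nat \<Rightarrow> (bool \<times> 'a) list" where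
  "tw 0 = [(False, c), (True, star z), (False, a), (True, z)]"
| "tw (Suc i) = [(False, b), (True, star z), (False, a), (True, z)] @ tw i"

lemma tw_shape [simp]: "tw i \<noteq> []" "\<not> fst (hd (tw i))" "fst (last (tw i))"
  by (induction i) auto

lemma tw_wd [simp]: "wd (tw i)"
proof (induction i)
  case 0
  show ?case using aB cB zB zsB a0 c0 z0 st_adj[of z] by (auto simp: wd_Cons)
next
  case (Suc i)
  have "wd [(False, b), (True, star z), (False, a), (True, z)]"
    using aB bB zB zsB a0 b0 z0 st_adj[of z] by (auto simp: wd_Cons)
  thus ?case using Suc by (simp only: tw.simps(2) wd_append tw_shape list.simps last.simps fst_conv) simp
qed

definition tt :: "nat \<Rightarrow> 'a" where "tt i = pr (tw i)"

lemma tt_closed [simp]: "tt i \<in> alg" by (simp add: tt_def pr_closed)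

lemma tt_simps: "tt 0 = c \<otimes> (star z \<otimes> (a \<otimes> z))" "tt (Suc i) = b \<otimes> (star z \<otimes> (a \<otimes> (z \<otimes> tt i)))"
  by (simp_all add: tt_def pr_closed)

lemma cancel_left:
  "x \<in> alg \<Longrightarrow> star a \<otimes> (a \<otimes> x) = x" "x \<in> alg \<Longrightarrow> star b \<otimes> (b \<otimes> x) = x"
  "x \<in> alg \<Longrightarrow> star c \<otimes> (c \<otimes> x) = x" "x \<in> alg \<Longrightarrow> star z \<otimes> (z \<otimes> x) = x"
  "x \<in> alg \<Longrightarrow> a \<otimes> (star a \<otimes> x) = x" "x \<in> alg \<Longrightarrow> b \<otimes> (star b \<otimes> x) = x"
  "x \<in> alg \<Longrightarrow> c \<otimes> (star c \<otimes> x) = x" "x \<in> alg \<Longrightarrow> z \<otimes> (star z \<otimes> x) = x"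
  using au bu cu zu by (simp_all flip: m_assoc)

lemma tt_unitary: "star (tt i) \<otimes> tt i = \<one>" "tt i \<otimes> star (tt i) = \<one>"
proof -
  have "star (tt i) \<otimes> tt i = \<one> \<and> tt i \<otimes> star (tt i) = \<one>"
  proof (induction i)
    case 0
    thus ?case using au bu cu zu by (simp add: tt_simps adj_mult m_assoc cancel_left)
  next
    case (Suc i)
    have "tt i \<otimes> (star (tt i) \<otimes> x) = x" if "x \<in> alg" for x
      using Suc that by (simp flip: m_assoc)
    thus ?case using Suc au bu cu zu by (simp add: tt_simps adj_mult m_assoc cancel_left)
  qed
  thus "star (tt i) \<otimes> tt i = \<one>" "tt i \<otimes> star (tt i) = \<one>" by auto
qed

lemma ZZ_closed: "x \<in> ZZ \<Longrightarrow> x \<in> alg" unfolding ZZ_def by (rule Sp_closed)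

lemma ZZ_star: "x \<in> ZZ \<Longrightarrow> star x \<in> ZZ"
  unfolding ZZ_def
proof (induction rule: Sp.induct)
  case (Sp_base w c)
  have "sc (cnj c) (pr (swd w)) \<in> Sp (\<lambda>w. w \<noteq> [] \<and> fst (hd w) \<and> fst (last w))"
    using Sp_base swd_hd[of w] swd_last[of w] by (intro Sp.Sp_base swd_wd) auto
  thus ?case using pr_closed swd_pr[of w] Sp_base by (simp add: adj_cscale)
qed (auto simp: adj_add Sp_closed intro: Sp.intros)

text \<open>Since \<open>rho(c* b) = 0\<close>, the product \<open>c* b\<close> is itself a centred
  letter; no cancellation occurs and the remaining word begins and ends on the circle.\<close>

lemma tt_0_Suc: "star (tt 0) \<otimes> tt (Suc j) \<in> ZZ"
proof -
  let ?w = "[(True, star z), (False, star a), (True, z), (False, star c \<otimes> b), (True, star z), (False, a), (True, z)] @ tw j"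
  have l: "wd [(True, star z), (False, star a), (True, z), (False, star c \<otimes> b), (True, star z), (False, a), (True, z)]"
    using aB zB zsB a0 z0 st_adj[of z] st_adj[of a] cb0 B_star_mult[OF cB bB] star_subalgD(6)[OF Bs aB]
    by (auto simp: wd_Cons)
  have w: "wd ?w" unfolding wd_append using l by simp
  have "pr ?w = star (tt 0) \<otimes> tt (Suc j)"
    unfolding pr_append[OF l tw_wd] by (simp add: tt_simps adj_mult m_assoc tt_def pr_closed)
  moreover have "pr ?w \<in> ZZ" unfolding ZZ_def by (rule Sp_word[OF w]) simp
  ultimately show ?thesis by simp
qed

lemma tt_orth: "i \<noteq> j \<Longrightarrow> star (tt i) \<otimes> tt j \<in> ZZ"
proof (induction i arbitrary: j)
  case 0
  thus ?case using tt_0_Suc by (cases j) auto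
next
  case (Suc i)
  show ?case
  proof (cases j)
    case 0
    have "star (star (tt 0) \<otimes> tt (Suc i)) \<in> ZZ" by (rule ZZ_star[OF tt_0_Suc])
    thus ?thesis using 0 by (simp add: adj_mult)
  next
    case (Suc j')
    have "star (tt (Suc i)) \<otimes> tt (Suc j') = star (tt i) \<otimes> tt j'"
      using au bu cu zu by (simp add: tt_simps adj_mult m_assoc cancel_left)
    thus ?thesis using Suc Suc.IH[of j'] Suc.prems by simp
  qed
qed

lemma tt_ZZ: assumes y: "y \<in> ZZ" shows "star (tt i) \<otimes> (y \<otimes> tt j) \<in> ZZ"
  unfolding ZZ_def
proof (rule Sp_sandwich[OF y[unfolded ZZ_def]])
  fix w assume w: "wd w" "w \<noteq> [] \<and> fst (hd w) \<and> fst (last w)"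
  have 1: "wd (w @ tw j)" using w by (simp add: wd_append)
  have 2: "wd (swd (tw i) @ (w @ tw j))"
    unfolding wd_append[of "swd (tw i)"] using 1 w swd_wd[OF tw_wd] swd_last[of "tw i"] by simp
  have "star (tt i) \<otimes> (pr w \<otimes> tt j) = pr (swd (tw i) @ (w @ tw j))"
    unfolding pr_append[OF swd_wd[OF tw_wd] 1] pr_append[OF w(1) tw_wd] swd_pr[OF tw_wd] tt_def ..
  also have "\<dots> \<in> Sp (\<lambda>w. w \<noteq> [] \<and> fst (hd w) \<and> fst (last w))"
    by (rule Sp_word[OF 2]) (use swd_hd[of "tw i"] w in simp)
  finally show "star (tt i) \<otimes> (pr w \<otimes> tt j) \<in> Sp (\<lambda>w. w \<noteq> [] \<and> fst (hd w) \<and> fst (last w))" .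
qed simp_all

lemma tt_SZ: assumes y: "y \<in> Sp (\<lambda>w. w \<noteq> [] \<and> fst (hd w))" shows "star (tt i) \<otimes> y \<in> SZ"
proof -
  have "star (tt i) \<otimes> (y \<otimes> \<one>) \<in> SZ"
  proof (rule Sp_sandwich[OF y])
    fix w assume w: "wd w" "w \<noteq> [] \<and> fst (hd w)"
    have 2: "wd (swd (tw i) @ w)"
      unfolding wd_append using w swd_wd[OF tw_wd] swd_last[of "tw i"] by simp
    have "star (tt i) \<otimes> (pr w \<otimes> \<one>) = pr (swd (tw i) @ w)"
      unfolding pr_append[OF swd_wd[OF tw_wd] w(1)] swd_pr[OF tw_wd] tt_def using pr_closed[OF w(1)] by simp
    also have "\<dots> \<in> SZ" by (rule Sp_word[OF 2]) (use swd_hd[of "tw i"] w in simp)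
    finally show "star (tt i) \<otimes> (pr w \<otimes> \<one>) \<in> SZ" .
  qed simp_all
  thus ?thesis using Sp_closed[OF y] by simp
qed

text \<open>The length \<open>4 * n\<close> consists of whole periods, so the segment is a product
  of the blocks available in the complexification and, for \<open>n > 0\<close>, ends with the
  circle letter \<open>z\<close>.\<close>

definition rr :: "nat \<Rightarrow> nat \<Rightarrow> 'a" where "rr n i = PP 0 (4 * n) \<otimes> tt i"

lemma rr_closed [simp]: "rr n i \<in> alg" by (simp add: rr_def)

lemma tt_D0: "tt i \<in> D0" unfolding tt_def by (rule Sp_word) simp_all

lemma rr_D0: "rr n i \<in> D0" unfolding rr_def by (rule star_subalgD(4)[OF D0_star_subalg PP_D0 tt_D0])

lemma PP_cancel: "x \<in> alg \<Longrightarrow> star (PP p m) \<otimes> (PP p m \<otimes> x) = x" "x \<in> alg \<Longrightarrow> PP p m \<otimes> (star (PP p m) \<otimes> x) = x"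
  using PP_unitary by (simp_all flip: m_assoc)

lemma tt_cancel: "x \<in> alg \<Longrightarrow> tt i \<otimes> (star (tt i) \<otimes> x) = x"
  using tt_unitary by (simp flip: m_assoc)

lemma rr_unitary: "star (rr n i) \<otimes> rr n i = \<one>" "rr n i \<otimes> star (rr n i) = \<one>"
  using tt_unitary PP_unitary by (simp_all add: rr_def adj_mult m_assoc PP_cancel tt_cancel)

lemma rr_orth: "i \<noteq> j \<Longrightarrow> star (rr n i) \<otimes> rr n j \<in> ZZ"
  using tt_orth[of i j] by (simp add: rr_def adj_mult m_assoc PP_cancel)

text \<open>The threshold depends on \<open>x\<close> alone: conjugation by \<open>PP\<close> does
  the work, and the outer \<open>tt\<close> only separate indices. Uniformity in \<open>i\<close>
  and \<open>j\<close> is essential since the number of summands grows with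
  \<open>n\<close>.\<close>

lemma rr_sandwich:
  assumes x: "x \<in> D0"
  shows "\<exists>K. \<forall>n\<ge>K. \<forall>i j. \<exists>w\<in>ZZ. star (rr n i) \<otimes> (x \<otimes> rr n j) = sc (if i = j then st x else 0) \<one> \<oplus> w"
proof -
  have xc: "x \<in> alg" using Sp_closed[OF x] .
  obtain K where K: "\<forall>m\<ge>K. even m \<longrightarrow> (\<exists>y\<in>ZZ. star (PP 0 m) \<otimes> (x \<otimes> PP 0 m) = sc (st x) \<one> \<oplus> y)"
    using conj_PP_ZZ[OF x] by blast
  have "\<exists>w\<in>ZZ. star (rr n i) \<otimes> (x \<otimes> rr n j) = sc (if i = j then st x else 0) \<one> \<oplus> w" if n: "n \<ge> K" for n i j
  proof -
    obtain y where y: "y \<in> ZZ" "star (PP 0 (4 * n)) \<otimes> (x \<otimes> PP 0 (4 * n)) = sc (st x) \<one> \<oplus> y"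
      using K[rule_format, of "4 * n"] n by auto
    have yc: "y \<in> alg" using ZZ_closed[OF y(1)] .
    have "star (rr n i) \<otimes> (x \<otimes> rr n j) = star (tt i) \<otimes> ((star (PP 0 (4 * n)) \<otimes> (x \<otimes> PP 0 (4 * n))) \<otimes> tt j)"
      using xc by (simp add: rr_def adj_mult m_assoc)
    also have "\<dots> = sc (st x) (star (tt i) \<otimes> tt j) \<oplus> star (tt i) \<otimes> (y \<otimes> tt j)"
      unfolding y(2) using yc by (simp add: l_distr r_distr cscale_mult_left cscale_mult_right)
    finally have *: "star (rr n i) \<otimes> (x \<otimes> rr n j) = sc (st x) (star (tt i) \<otimes> tt j) \<oplus> star (tt i) \<otimes> (y \<otimes> tt j)" .
    have s: "star (tt i) \<otimes> (y \<otimes> tt j) \<in> ZZ" by (rule tt_ZZ[OF y(1)])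
    show ?thesis
    proof (cases "i = j")
      case True
      thus ?thesis using * s tt_unitary by auto
    next
      case False
      have "sc (st x) (star (tt i) \<otimes> tt j) \<oplus> star (tt i) \<otimes> (y \<otimes> tt j) \<in> ZZ"
        using s tt_orth[OF False] Sp_sc Sp_add unfolding ZZ_def by blast
      thus ?thesis using False xc unfolding *[symmetric]
        by (intro bexI[of _ "star (rr n i) \<otimes> (x \<otimes> rr n j)"]) simp_all
    qed
  qed
  thus ?thesis by blast
qed

lemma rr_SZ:
  assumes x: "x \<in> D0"
  shows "\<exists>K. \<forall>n\<ge>K. \<forall>i. star (rr n i) \<otimes> x \<in> SZ"
proof -
  have xc: "x \<in> alg" using Sp_closed[OF x] .
  obtain K where K: "\<forall>m\<ge>K. star (PP 0 m) \<otimes> x \<in> Sp (\<lambda>w. w \<noteq> [] \<and> fst (hd w) = odd (m - 1))"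
    using evl_D0[OF x, of 0] unfolding evl_def eventually_sequentially by blast
  \<comment> \<open>\<open>Suc K\<close> makes \<open>n\<close> positive, so that
    \<open>4 * n - 1\<close> is an odd position.\<close>
  have "star (rr n i) \<otimes> x \<in> SZ" if n: "n \<ge> Suc K" for n i
  proof -
    have "odd (4 * n - 1)" "4 * n \<ge> K" using n by auto
    hence "star (PP 0 (4 * n)) \<otimes> x \<in> Sp (\<lambda>w. w \<noteq> [] \<and> fst (hd w))" using K[rule_format, of "4 * n"] by simp
    from tt_SZ[OF this, of i] show ?thesis using xc by (simp add: rr_def adj_mult m_assoc)
  qed
  thus ?thesis by blast
qed

lemma PP_step4: "PP 0 (4 * Suc n) = PP 0 (4 * n) \<otimes> ((if \<exists>k. n = 2 ^ k then c else b) \<otimes> (star z \<otimes> (a \<otimes> z)))"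
proof -
  have app: "PP 0 (m + k) = PP 0 m \<otimes> PP m (m + k)" for m k
  proof -
    have "gw 0 (m + k) = gw 0 m @ gw m (m + k)" unfolding gw_def upt_add_eq_append[OF le0] map_append ..
    thus ?thesis unfolding PP_def by (simp only: pr_append gw_wd)
  qed
  have "PP (4 * n) (4 * n + 4) = gseq (4 * n) \<otimes> (gseq (4 * n + 1) \<otimes> (gseq (4 * n + 2) \<otimes> gseq (4 * n + 3)))"
    by (simp add: PP_step numeral_3_eq_3)
  moreover have "(4 * n + 1) mod 4 = 1" "(4 * n + 2) mod 4 = 2" "(4 * n + 3) mod 4 = 3" by presburger+
  ultimately show ?thesis using app[of "4 * n" 4] by (simp add: gseq_def add.commute)
qed

text \<open>Everything is assembled from \<open>b\<close>, \<open>c\<close> and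
  \<open>z* a z\<close>; a lone \<open>z\<close> or \<open>a\<close> never has to belong to
  \<open>E\<close>.\<close>

lemma rr_mem:
  assumes E: "star_subalg E" and "b \<in> E" "c \<in> E" "star z \<otimes> (a \<otimes> z) \<in> E"
  shows "rr n i \<in> E"
proof -
  note e = star_subalgD[OF E]
  have P: "PP 0 (4 * n) \<in> E"
  proof (induction n)
    case (Suc n)
    have "(if \<exists>k. n = 2 ^ k then c else b) \<otimes> (star z \<otimes> (a \<otimes> z)) \<in> E" using assms e(4) by simp
    thus ?case unfolding PP_step4 using e(4) Suc by blast
  qed (simp add: e(2))
  have "tt i \<in> E"
  proof (induction i)
    case 0 show ?case unfolding tt_simps using assms e(4) by blast
  next
    case (Suc i)
    have "tt (Suc i) = b \<otimes> ((star z \<otimes> (a \<otimes> z)) \<otimes> tt i)" by (simp add: tt_simps m_assoc)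
    thus ?case using e(4)[OF assms(2) e(4)[OF assms(4) Suc]] by simp
  qed
  thus ?thesis unfolding rr_def using e(4) P by blast
qed

end

lemma (in pre_prob) N2_nsum_null:
  assumes "\<And>i. f i \<in> alg" "\<And>i. i < n \<Longrightarrow> N2 (f i) = 0" shows "N2 (nsum n f) = 0"
  using assms(2)
proof (induction n)
  case (Suc n)
  thus ?case unfolding nsum_Suc[OF assms(1)] by (intro N2_null_add assms(1) nsum_closed) auto
qed simp

lemma (in averaged_creation) star_ell_mult:
  assumes X: "X \<in> alg"
  shows "star ell \<otimes> X = sc rn (nsum n (\<lambda>i. R i \<otimes> (q' \<otimes> (h \<otimes> (q \<otimes> (star (R i) \<otimes> X))))))"
proof -
  have "star ell \<otimes> X = sc rn (nsum n (\<lambda>i. star (lj i) \<otimes> X))"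
    unfolding ell_def lj_def[symmetric] using X
    by (simp add: adj_cscale rn(2) nsum_star cscale_mult_left nsum_rmult)
  also have "(\<lambda>i. star (lj i) \<otimes> X) = (\<lambda>i. R i \<otimes> (q' \<otimes> (h \<otimes> (q \<otimes> (star (R i) \<otimes> X)))))"
    using X by (simp add: lj_def star_sand star_a0 m_assoc)
  finally show ?thesis .
qed

section \<open>The averaging realised on the GNS space\<close>

locale semicircular_words = unitary_letters A B a b c z + faithful_prob A
  for A :: "'a cstar_prob" (structure) and B a b c z +
  fixes h :: 'a
  assumes hB: "h \<in> B False" and h_sa: "star h = h" and h0: "st h = 0" and h1: "st (h \<otimes> h) = 1"
    and D0_dense: "\<lbrakk>x \<in> alg; e > 0\<rbrakk> \<Longrightarrow> \<exists>y\<in>D0. nn (x \<ominus> y) < e"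
begin

sublocale R: dense_rep A D0 by unfold_locales (rule D0_star_subalg)

abbreviation "OP \<equiv> R.H.Bop"

lemma h_closed [simp]: "h \<in> alg" using Bc[OF hB] .

lemma h_D0: "h \<in> D0" by (rule B_D0[OF hB])

lemma SA_D0: "x \<in> SA \<Longrightarrow> x \<in> D0" and SZ_D0: "x \<in> SZ \<Longrightarrow> x \<in> D0" and ZZ_D0: "x \<in> ZZ \<Longrightarrow> x \<in> D0"
  unfolding ZZ_def by (erule Sp_mono, simp)+

text \<open>If the first letters lie in different factors, or one word is empty and the other is
  not, the product of the adjoint word with the other is a nonempty reduced word.\<close>

lemma SA_SZ_orth: assumes u: "u \<in> SA" and v: "v \<in> SZ" shows "st (star u \<otimes> v) = 0" "st (star v \<otimes> u) = 0"
proof -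
  have uc: "u \<in> alg" using Sp_closed[OF u] .
  have *: "star (pr w) \<otimes> (u \<otimes> \<one>) \<in> Sp (\<lambda>w. w \<noteq> [])" if w: "wd w" "w = [] \<or> fst (hd w)" for w
  proof (rule Sp_sandwich[OF u])
    fix w' assume w': "wd w'" "w' \<noteq> [] \<and> \<not> fst (hd w')"
    have 1: "wd (swd w @ w')" unfolding wd_append using w w' swd_wd[OF w(1)] swd_last[of w] by auto
    have "star (pr w) \<otimes> (pr w' \<otimes> \<one>) = pr (swd w @ w')"
      unfolding pr_append[OF swd_wd[OF w(1)] w'(1)] swd_pr[OF w(1)] using pr_closed[OF w'(1)] by simp
    also have "\<dots> \<in> Sp (\<lambda>w. w \<noteq> [])" by (rule Sp_word[OF 1]) (use w' in simp)
    finally show "star (pr w) \<otimes> (pr w' \<otimes> \<one>) \<in> Sp (\<lambda>w. w \<noteq> [])" .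
  qed (use pr_closed[OF w(1)] in simp_all)
  show 1: "st (star v \<otimes> u) = 0"
    using v
  proof (induction rule: Sp.induct)
    case (Sp_base w c)
    have "st (star (pr w) \<otimes> u) = 0" using Sp_st[OF *[OF Sp_base]] uc by simp
    thus ?case using pr_closed[OF Sp_base(1)] uc by (simp add: adj_cscale cscale_mult_left st_cscale)
  qed (use uc in \<open>auto simp: adj_add Sp_closed l_distr st_add\<close>)
  show "st (star u \<otimes> v) = 0" using 1 R.st_flip[OF uc Sp_closed[OF v]] by simp
qed

lemma SA_SZ_split: "x \<in> D0 \<Longrightarrow> \<exists>u\<in>SA. x \<ominus> u \<in> SZ"
proof (induction rule: Sp.induct)
  case Sp_zero
  thus ?case using Sp.Sp_zero by (intro bexI[of _ \<zero>]) (auto simp: minus_eq)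
next
  case (Sp_base w c)
  note cl = pr_closed[OF Sp_base(1)]
  show ?case
  proof (cases "w \<noteq> [] \<and> \<not> fst (hd w)")
    case True
    have "sc c (pr w) \<ominus> sc c (pr w) = \<zero>" using cl by (simp add: minus_eq r_neg)
    thus ?thesis using Sp.Sp_base[of w "\<lambda>w. w \<noteq> [] \<and> \<not> fst (hd w)" c] Sp_base(1) True Sp.Sp_zero by (intro bexI[of _ "sc c (pr w)"]) simp_all
  next
    case False
    have "sc c (pr w) \<ominus> \<zero> = sc c (pr w)" using cl by (simp add: minus_eq)
    thus ?thesis using Sp.Sp_base[of w "\<lambda>w. w = [] \<or> fst (hd w)" c] Sp_base(1) False Sp.Sp_zero by (intro bexI[of _ \<zero>]) simp_all
  qed
next
  case (Sp_add x y)
  then obtain u v where uv: "u \<in> SA" "x \<ominus> u \<in> SZ" "v \<in> SA" "y \<ominus> v \<in> SZ" by blast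
  have "(x \<oplus> y) \<ominus> (u \<oplus> v) = (x \<ominus> u) \<oplus> (y \<ominus> v)"
    using Sp_closed[OF Sp_add(1)] Sp_closed[OF Sp_add(2)] Sp_closed[OF uv(1)] Sp_closed[OF uv(3)] by (simp add: ring_exp)
  thus ?case using Sp.Sp_add[OF uv(1,3)] Sp.Sp_add[OF uv(2,4)] by (intro bexI[of _ "u \<oplus> v"]) simp_all
qed

text \<open>The component in \<open>SA\<close> is chosen, since it is determined only up to null
  vectors; by \<open>opr\<close> the choice disappears once it is shown to be formally
  self-adjoint.\<close>

definition pA :: "'a \<Rightarrow> 'a" where "pA x = (SOME u. u \<in> SA \<and> x \<ominus> u \<in> SZ)"

lemma pA: assumes "x \<in> D0" shows "pA x \<in> SA" "x \<ominus> pA x \<in> SZ"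
proof -
  have "\<exists>u. u \<in> SA \<and> x \<ominus> u \<in> SZ" using SA_SZ_split[OF assms] by blast
  from someI_ex[OF this] show "pA x \<in> SA" "x \<ominus> pA x \<in> SZ" by (simp_all add: pA_def)
qed

lemma split_sum: "x \<in> alg \<Longrightarrow> u \<in> alg \<Longrightarrow> x = u \<oplus> (x \<ominus> u)"
  by (simp add: minus_eq a_lcomm[of u x] r_neg)

lemma st_split_right: assumes y: "y \<in> SA" and x: "x \<in> D0" shows "st (star y \<otimes> x) = st (star y \<otimes> pA x)"
proof -
  note p = pA[OF x]
  have cl: "y \<in> alg" "x \<in> alg" "pA x \<in> alg" "x \<ominus> pA x \<in> alg"
    using Sp_closed y x p by blast+
  have "st (star y \<otimes> x) = st (star y \<otimes> (pA x \<oplus> (x \<ominus> pA x)))" using split_sum[OF cl(2,3)] by simp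
  also have "\<dots> = st (star y \<otimes> pA x)" using cl SA_SZ_orth(1)[OF y p(2)] by (simp add: r_distr st_add)
  finally show ?thesis .
qed

lemma pA_adj: assumes x: "x \<in> D0" and y: "y \<in> D0" shows "st (star y \<otimes> pA x) = st (star (pA y) \<otimes> x)"
proof -
  have cl: "y \<in> alg" "x \<in> alg" "pA x \<in> alg" "pA y \<in> alg"
    using Sp_closed[OF x] Sp_closed[OF y] Sp_closed[OF pA(1)[OF x]] Sp_closed[OF pA(1)[OF y]] by auto
  have "st (star y \<otimes> pA x) = cnj (st (star (pA x) \<otimes> y))" by (rule R.st_flip) (use cl in auto)
  also have "\<dots> = cnj (st (star (pA x) \<otimes> pA y))" unfolding st_split_right[OF pA(1)[OF x] y] ..
  also have "\<dots> = st (star (pA y) \<otimes> pA x)" by (rule R.st_flip[symmetric]) (use cl in auto)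
  also have "\<dots> = st (star (pA y) \<otimes> x)" unfolding st_split_right[OF pA(1)[OF y] x] ..
  finally show ?thesis .
qed

lemma pA_bound: assumes x: "x \<in> D0" shows "N2 (pA x) \<le> 1 * N2 x"
proof -
  have cl: "x \<in> alg" "pA x \<in> alg" using Sp_closed[OF x] Sp_closed[OF pA(1)[OF x]] by auto
  have "(N2 (pA x))\<^sup>2 = cmod (st (star (pA x) \<otimes> x))"
    unfolding st_split_right[OF pA(1)[OF x] x] st_sq[OF cl(2)] by (simp add: norm_power)
  also have "\<dots> \<le> N2 (pA x) * N2 x" by (rule CS) (use cl in auto)
  finally have "N2 (pA x) * N2 (pA x) \<le> N2 (pA x) * N2 x" by (simp add: power2_eq_square)
  thus ?thesis using cl by (cases "N2 (pA x) = 0") (auto simp: mult_le_cancel_left less_le)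
qed

definition q :: "('a \<Rightarrow> complex) \<Rightarrow> 'a \<Rightarrow> complex" where "q = R.opr pA"

lemma q_op:
  shows "q \<in> carrier OP" "adj OP q = q" "x \<in> D0 \<Longrightarrow> q (R.kv x) = R.kv (pA x)"
proof -
  note o = R.opr[of pA pA 1, OF SA_D0[OF pA(1)] SA_D0[OF pA(1)] pA_adj zero_le_one pA_bound]
  show "q \<in> carrier OP" "adj OP q = q" "x \<in> D0 \<Longrightarrow> q (R.kv x) = R.kv (pA x)"
    using o by (simp_all add: q_def)
qed

lemma kv_null: assumes d: "d \<in> SA" "d \<in> SZ" shows "R.kv d = 0"
proof -
  have dc: "d \<in> alg" using Sp_closed[OF d(1)] .
  have "N2 d = 0" using SA_SZ_orth(1)[OF d] dc by (simp add: st_sq)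
  hence "st (star y \<otimes> d) = 0" if "y \<in> D0" for y using CS[of y d] Sp_closed[OF that] dc by simp
  hence "R.kv d = R.kv \<zero>" by (intro R.kv_eqI) (auto simp: Sp_closed)
  thus ?thesis by (simp add: R.kv_zero)
qed

lemma kv_eq_of_diff: assumes "x \<in> D0" "y \<in> D0" "R.kv (x \<ominus> y) = 0" shows "R.kv x = R.kv y"
proof -
  have "x = y \<oplus> (x \<ominus> y)" using split_sum Sp_closed assms by blast
  hence "R.kv x = R.kv y + R.kv (x \<ominus> y)" using R.kv_add[OF assms(2) R.Ws(9)[OF assms(1,2)]] by metis
  thus ?thesis using assms(3) by simp
qed

lemma q_SA: assumes x: "x \<in> SA" shows "q (R.kv x) = R.kv x"
proof -
  note p = pA[OF SA_D0[OF x]]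
  have "R.kv (x \<ominus> pA x) = 0" by (rule kv_null[OF Sp_minus[OF x p(1)] p(2)])
  thus ?thesis using q_op(3)[OF SA_D0[OF x]] kv_eq_of_diff[OF SA_D0[OF x] SA_D0[OF p(1)]] by simp
qed

lemma q_SZ: assumes x: "x \<in> SZ" shows "q (R.kv x) = 0"
proof -
  note p = pA[OF SZ_D0[OF x]]
  have cl: "x \<in> alg" "pA x \<in> alg" using Sp_closed[OF x] Sp_closed[OF p(1)] by auto
  have "x \<ominus> (x \<ominus> pA x) = pA x" using cl by (simp add: ring_exp r_neg r_neg1 r_neg2 r_neg3 r_neg4)
  hence "pA x \<in> SZ" using Sp_minus[OF x p(2)] by simp
  thus ?thesis using q_op(3)[OF SZ_D0[OF x]] kv_null[OF p(1)] by simp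
qed

lemma OP_minus: assumes "T \<in> carrier OP" "S \<in> carrier OP" "x \<in> D0"
  shows "(T \<ominus>\<^bsub>OP\<^esub> S) (R.kv x) = T (R.kv x) - S (R.kv x)"
proof -
  have "T \<ominus>\<^bsub>OP\<^esub> S = T \<oplus>\<^bsub>OP\<^esub> cscale OP (-1) S" unfolding R.H.BB.minus_eq R.H.BB.cscale_m1[OF assms(2)] ..
  thus ?thesis using R.H.Bop_V[OF assms(2) R.kv_V[OF assms(3)]] by (simp add: R.H.hs_m1)
qed

definition "q1 = \<one>\<^bsub>OP\<^esub> \<ominus>\<^bsub>OP\<^esub> q"

lemma q1_closed: "q1 \<in> carrier OP" unfolding q1_def by (rule R.H.BB.minus_closed[OF R.H.Bop_one_closed q_op(1)])

lemma q1_SA: "x \<in> SA \<Longrightarrow> q1 (R.kv x) = 0" and q1_SZ: "x \<in> SZ \<Longrightarrow> q1 (R.kv x) = R.kv x"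
  unfolding q1_def using OP_minus[OF R.H.Bop_one_closed q_op(1), of x] q_SA[of x] q_SZ[of x] SA_D0[of x] SZ_D0[of x] by simp_all

lemma OP_split_eqI:
  assumes T: "T \<in> carrier OP" and S: "S \<in> carrier OP"
    and u: "\<And>u. u \<in> SA \<Longrightarrow> T (R.kv u) = S (R.kv u)" and v: "\<And>v. v \<in> SZ \<Longrightarrow> T (R.kv v) = S (R.kv v)"
  shows "T = S"
proof (rule R.Bop_eqI[OF T S])
  fix x assume x: "x \<in> D0"
  note p = pA[OF x]
  note pd = SA_D0[OF p(1)] SZ_D0[OF p(2)]
  have "x = pA x \<oplus> (x \<ominus> pA x)" by (rule split_sum[OF Sp_closed[OF x] Sp_closed[OF p(1)]])
  hence k: "R.kv x = R.kv (pA x) + R.kv (x \<ominus> pA x)" using R.kv_add[OF pd] by metis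
  have "T (R.kv x) = T (R.kv (pA x)) + T (R.kv (x \<ominus> pA x))" "S (R.kv x) = S (R.kv (pA x)) + S (R.kv (x \<ominus> pA x))"
    unfolding k by (rule R.H.adjoint_linear(1)[OF R.H.Bop_adj[OF T] R.kv_V[OF pd(1)] R.kv_V[OF pd(2)]]
      R.H.adjoint_linear(1)[OF R.H.Bop_adj[OF S] R.kv_V[OF pd(1)] R.kv_V[OF pd(2)]])+
  thus "T (R.kv x) = S (R.kv x)" using u[OF p(1)] v[OF p(2)] by simp
qed

text \<open>A centred letter of the given algebra can be put in front of such a word without
  merging. Applied to \<open>h\<close>, this is why its corner at \<open>1 - q\<close>
  vanishes.\<close>

lemma letter_SZ: assumes y: "y \<in> B False" "st y = 0" and x: "x \<in> SZ" shows "y \<otimes> x \<in> SA"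
proof -
  have yc: "y \<in> alg" using Bc[OF y(1)] .
  have "y \<otimes> (x \<otimes> \<one>) \<in> SA"
  proof (rule Sp_sandwich[OF x yc one_closed])
    fix w assume w: "wd w" "w = [] \<or> fst (hd w)"
    have 1: "wd ((False, y) # w)" using w y by (auto simp: wd_Cons)
    have "y \<otimes> (pr w \<otimes> \<one>) = pr ((False, y) # w)" using pr_closed[OF w(1)] by simp
    also have "\<dots> \<in> SA" by (rule Sp_word[OF 1]) simp
    finally show "y \<otimes> (pr w \<otimes> \<one>) \<in> SA" .
  qed
  thus ?thesis using Sp_closed[OF x] by simp
qed

lemma ZZ_SA: assumes y: "y \<in> ZZ" and x: "x \<in> SA" shows "y \<otimes> x \<in> SZ"
proof -
  have xc: "x \<in> alg" using Sp_closed[OF x] .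
  have "\<one> \<otimes> (y \<otimes> x) \<in> SZ"
  proof (rule Sp_sandwich[OF y[unfolded ZZ_def] one_closed xc])
    fix w assume w: "wd w" "w \<noteq> [] \<and> fst (hd w) \<and> fst (last w)"
    have "pr w \<otimes> (x \<otimes> \<one>) \<in> SZ"
    proof (rule Sp_sandwich[OF x pr_closed[OF w(1)] one_closed])
      fix w' assume w': "wd w'" "w' \<noteq> [] \<and> \<not> fst (hd w')"
      have 1: "wd (w @ w')" unfolding wd_append using w w' by simp
      have "pr w \<otimes> (pr w' \<otimes> \<one>) = pr (w @ w')" unfolding pr_append[OF w(1) w'(1)] using pr_closed[OF w'(1)] by simp
      also have "\<dots> \<in> SZ" by (rule Sp_word[OF 1]) (use w in simp)
      finally show "pr w \<otimes> (pr w' \<otimes> \<one>) \<in> SZ" .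
    qed
    thus "\<one> \<otimes> (pr w \<otimes> x) \<in> SZ" using xc pr_closed[OF w(1)] by simp
  qed
  thus ?thesis using xc ZZ_closed[OF y] by simp
qed

text \<open>Elements of \<open>ZZ\<close> end on the circle and hence carry words starting in the
  other factor to longer reduced words that start on the circle; only the scalar part survives the
  compression by \<open>q\<close>.\<close>

lemma q_Lop_q:
  assumes x: "x \<in> D0" and y: "y \<in> ZZ" and e: "x = sc t \<one> \<oplus> y"
  shows "q \<otimes>\<^bsub>OP\<^esub> (R.Lop x \<otimes>\<^bsub>OP\<^esub> q) = cscale OP t q"
proof (rule OP_split_eqI)
  note L = R.Lop(1)[OF x]
  show "q \<otimes>\<^bsub>OP\<^esub> (R.Lop x \<otimes>\<^bsub>OP\<^esub> q) \<in> carrier OP" "cscale OP t q \<in> carrier OP"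
    using R.H.Bop_closed(1)[OF q_op(1) R.H.Bop_closed(1)[OF L q_op(1)]] R.H.Bop_closed(3)[OF q_op(1) q_op(1)] by auto
next
  fix u assume u: "u \<in> SA"
  have uc: "u \<in> alg" using Sp_closed[OF u] .
  have m: "sc t u \<in> SA" "y \<otimes> u \<in> SZ" using Sp_sc[OF u] ZZ_SA[OF y u] by auto
  have "x \<otimes> u = sc t u \<oplus> y \<otimes> u" unfolding e using uc ZZ_closed[OF y] by (simp add: l_distr cscale_mult_left)
  hence k: "R.kv (x \<otimes> u) = R.kv (sc t u) + R.kv (y \<otimes> u)" using R.kv_add[OF SA_D0[OF m(1)] SZ_D0[OF m(2)]] by simp
  have "q (R.kv (x \<otimes> u)) = q (R.kv (sc t u)) + q (R.kv (y \<otimes> u))"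
    unfolding k by (rule R.H.adjoint_linear(1)[OF R.H.Bop_adj[OF q_op(1)] R.kv_V[OF SA_D0[OF m(1)]] R.kv_V[OF SZ_D0[OF m(2)]]])
  also have "\<dots> = R.hs t (R.kv u)" using q_SA[OF m(1)] q_SZ[OF m(2)] R.kv_sc[OF SA_D0[OF u]] by simp
  finally show "(q \<otimes>\<^bsub>OP\<^esub> (R.Lop x \<otimes>\<^bsub>OP\<^esub> q)) (R.kv u) = (cscale OP t q) (R.kv u)"
    using q_SA[OF u] R.Lop(3)[OF x SA_D0[OF u]] by simp
next
  fix v assume v: "v \<in> SZ"
  have "R.Lop x 0 = 0" "q 0 = 0"
    using R.H.adjoint_linear(3)[OF R.H.Bop_adj[OF R.Lop(1)[OF x]] R.H.V_zero R.H.V_zero]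
      R.H.adjoint_linear(3)[OF R.H.Bop_adj[OF q_op(1)] R.H.V_zero R.H.V_zero] by auto
  thus "(q \<otimes>\<^bsub>OP\<^esub> (R.Lop x \<otimes>\<^bsub>OP\<^esub> q)) (R.kv v) = (cscale OP t q) (R.kv v)"
    using q_SZ[OF v] by simp
qed

lemma op_zero: "T \<in> carrier OP \<Longrightarrow> T 0 = 0"
  using R.H.adjoint_linear(3)[OF R.H.Bop_adj R.H.V_zero R.H.V_zero] .

text \<open>For the last identity \<open>h^2\<close> is one plus a centred letter, because
  \<open>h\<close> has variance one; the centred letter maps \<open>SZ\<close> into
  \<open>SA\<close> and is removed by \<open>q1\<close>.\<close>

lemma q_props:
  "q \<otimes>\<^bsub>OP\<^esub> q = q"
  "q1 \<otimes>\<^bsub>OP\<^esub> (R.Lop h \<otimes>\<^bsub>OP\<^esub> q1) = \<zero>\<^bsub>OP\<^esub>"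
  "q1 \<otimes>\<^bsub>OP\<^esub> (R.Lop h \<otimes>\<^bsub>OP\<^esub> (R.Lop h \<otimes>\<^bsub>OP\<^esub> q1)) = q1"
proof -
  note L = R.Lop(1)[OF h_D0] and z = op_zero[OF q_op(1)] op_zero[OF q1_closed] op_zero[OF R.Lop(1)[OF h_D0]]
  note cl = R.H.Bop_closed(1)
  show "q \<otimes>\<^bsub>OP\<^esub> q = q"
    by (rule OP_split_eqI[OF cl[OF q_op(1) q_op(1)] q_op(1)]) (simp_all add: q_SA q_SZ z)
  show "q1 \<otimes>\<^bsub>OP\<^esub> (R.Lop h \<otimes>\<^bsub>OP\<^esub> q1) = \<zero>\<^bsub>OP\<^esub>"
  proof (rule OP_split_eqI[OF cl[OF q1_closed cl[OF L q1_closed]] R.H.Bop_zero_closed])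
    fix v assume v: "v \<in> SZ"
    show "(q1 \<otimes>\<^bsub>OP\<^esub> (R.Lop h \<otimes>\<^bsub>OP\<^esub> q1)) (R.kv v) = \<zero>\<^bsub>OP\<^esub> (R.kv v)"
      using q1_SZ[OF v] R.Lop(3)[OF h_D0 SZ_D0[OF v]] q1_SA[OF letter_SZ[OF hB h0 v]] by simp
  qed (simp add: q1_SA z)
  show "q1 \<otimes>\<^bsub>OP\<^esub> (R.Lop h \<otimes>\<^bsub>OP\<^esub> (R.Lop h \<otimes>\<^bsub>OP\<^esub> q1)) = q1"
  proof (rule OP_split_eqI[OF cl[OF q1_closed cl[OF L cl[OF L q1_closed]]] q1_closed])
    fix v assume v: "v \<in> SZ"
    have vc: "v \<in> alg" using Sp_closed[OF v] .
    define y where "y = cent (h \<otimes> h)"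
    have hh: "h \<otimes> h \<in> B False" by (rule B_mult[OF hB hB])
    have y: "y \<in> B False" "st y = 0" using cent_B[OF hh] by (auto simp: y_def)
    have yv: "y \<otimes> v \<in> SA" by (rule letter_SZ[OF y v])
    have "h \<otimes> (h \<otimes> v) = v \<oplus> y \<otimes> v"
      using cent_left[of "h \<otimes> h" v] vc by (simp add: h1 y_def m_assoc)
    hence k: "R.kv (h \<otimes> (h \<otimes> v)) = R.kv v + R.kv (y \<otimes> v)" using R.kv_add[OF SZ_D0[OF v] SA_D0[OF yv]] by simp
    have "q1 (R.kv (h \<otimes> (h \<otimes> v))) = q1 (R.kv v) + q1 (R.kv (y \<otimes> v))"
      unfolding k by (rule R.H.adjoint_linear(1)[OF R.H.Bop_adj[OF q1_closed] R.kv_V[OF SZ_D0[OF v]] R.kv_V[OF SA_D0[OF yv]]])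
    hence "q1 (R.kv (h \<otimes> (h \<otimes> v))) = R.kv v" using q1_SZ[OF v] q1_SA[OF yv] by simp
    thus "(q1 \<otimes>\<^bsub>OP\<^esub> (R.Lop h \<otimes>\<^bsub>OP\<^esub> (R.Lop h \<otimes>\<^bsub>OP\<^esub> q1))) (R.kv v) = q1 (R.kv v)"
      using q1_SZ[OF v] R.Lop(3)[OF h_D0 SZ_D0[OF v]] R.Lop(3)[OF h_D0 SA_D0[OF letter_SZ[OF hB h0 v]]] by simp
  qed (simp add: q1_SA z)
qed

abbreviation "RO n i \<equiv> R.Lop (rr n i)"

lemma RO_sandwich:
  assumes x: "x \<in> D0"
  shows "adj OP (RO n i) \<otimes>\<^bsub>OP\<^esub> (R.Lop x \<otimes>\<^bsub>OP\<^esub> RO n j) = R.Lop (star (rr n i) \<otimes> (x \<otimes> rr n j))"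
  using R.Lop_simps(1)[OF x rr_D0] R.Lop_simps(1)[OF R.Ws(6)[OF rr_D0] R.Ws(4)[OF x rr_D0]] R.Lop(2)[OF rr_D0] by metis

lemma creation: "n > 0 \<Longrightarrow> averaged_creation OP q (R.Lop h) (RO n) n"
proof
  note cl = R.H.Bop_closed(1)
  have one: "star (rr n i) \<otimes> rr n j = star (rr n i) \<otimes> (\<one> \<otimes> rr n j)" for i j by simp
  have sr: "star (rr n i) \<in> D0" for i using R.Ws(6)[OF rr_D0] .
  show "adj OP (RO n i) \<otimes>\<^bsub>OP\<^esub> RO n i = \<one>\<^bsub>OP\<^esub>" "RO n i \<otimes>\<^bsub>OP\<^esub> adj OP (RO n i) = \<one>\<^bsub>OP\<^esub>" for i
    using R.Lop_simps(1)[OF sr rr_D0, of i n i] R.Lop_simps(1)[OF rr_D0 sr, of n i i] R.Lop(2)[OF rr_D0, of n i] rr_unitary R.Lop_simps(4)[OF sr sr]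
    by metis+
  show "q \<otimes>\<^bsub>OP\<^esub> (adj OP (RO n i) \<otimes>\<^bsub>OP\<^esub> (RO n j \<otimes>\<^bsub>OP\<^esub> q)) = \<zero>\<^bsub>OP\<^esub>" if "i \<noteq> j" for i j
  proof -
    have zz: "star (rr n i) \<otimes> rr n j \<in> ZZ" by (rule rr_orth[OF that])
    have "q \<otimes>\<^bsub>OP\<^esub> (R.Lop (star (rr n i) \<otimes> rr n j) \<otimes>\<^bsub>OP\<^esub> q) = cscale OP 0 q"
      by (rule q_Lop_q[OF ZZ_D0[OF zz] zz]) simp
    thus ?thesis
      unfolding R.Lop_simps(1)[OF sr rr_D0] R.Lop(2)[OF rr_D0, symmetric] R.H.BB.cscale_0[OF q_op(1)]
        R.H.BB.m_assoc[OF R.H.BB.adj_closed[OF R.Lop(1)[OF rr_D0]] R.Lop(1)[OF rr_D0] q_op(1)] .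
  qed
  show "adj OP (R.Lop h) = R.Lop h" using R.Lop(2)[OF h_D0] h_sa by simp
qed (use q_op q_props[unfolded q1_def] R.Lop(1)[OF h_D0] R.Lop(1)[OF rr_D0] R.H.BB.nrm_one in \<open>auto simp del: R.H.Bop_simps\<close>)

text \<open>Zero at \<open>n = 0\<close> is a default, as the averaging requires at least one
  summand; only large \<open>n\<close> matter.\<close>

definition "ell n = (if n = 0 then \<zero>\<^bsub>OP\<^esub> else averaged_creation.ell OP q (R.Lop h) (RO n) n)"

definition "ss n = sc (of_real (1 / sqrt (real n))) (nsum n (\<lambda>i. rr n i \<otimes> (h \<otimes> star (rr n i))))"

lemma term_D0: "rr n i \<otimes> (h \<otimes> star (rr n i)) \<in> D0"
  by (rule R.Ws(4)[OF rr_D0 R.Ws(4)[OF h_D0 R.Ws(6)[OF rr_D0]]])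

lemma nsum_mem: assumes E: "star_subalg E" and f: "\<And>i. f i \<in> E" shows "nsum n f \<in> E"
proof (induction n)
  case (Suc n)
  have "nsum (Suc n) f = f n \<oplus> nsum n f" by (rule nsum_Suc) (rule star_subalgD(1)[OF E f])
  thus ?case using star_subalgD(3)[OF E f Suc] by simp
qed (simp add: star_subalgD(7)[OF E])

lemma ss_mem:
  assumes E: "star_subalg E" and m: "b \<in> E" "c \<in> E" "star z \<otimes> (a \<otimes> z) \<in> E" "h \<in> E"
  shows "ss n \<in> E"
proof -
  note e = star_subalgD[OF E]
  have "rr n i \<otimes> (h \<otimes> star (rr n i)) \<in> E" for i
    by (rule e(4)[OF rr_mem[OF E m(1-3)] e(4)[OF m(4) e(6)[OF rr_mem[OF E m(1-3)]]]])
  thus ?thesis unfolding ss_def by (rule e(5)[OF nsum_mem[OF E]])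
qed

lemma ss_D0: "ss n \<in> D0"
  unfolding ss_def by (rule R.Ws(5)[OF nsum_mem[OF D0_star_subalg term_D0]])

lemma Lop_nsum: assumes f: "\<And>i. f i \<in> D0" shows "R.Lop (nsum n f) = R.H.BB.nsum n (\<lambda>i. R.Lop (f i))"
proof (induction n)
  case 0
  have "R.Lop \<zero> = R.Lop (sc 0 \<one>)" by simp
  also have "\<dots> = \<zero>\<^bsub>OP\<^esub>"
    unfolding R.Lop_simps(3)[OF R.Ws(2) R.Ws(2)] R.Lop_simps(4)[OF R.Ws(2) R.Ws(2)] by (rule R.H.BB.cscale_0[OF R.H.Bop_one_closed])
  finally show ?case unfolding nsum_0 R.H.BB.nsum_0 .
next
  case (Suc n)
  have "nsum (Suc n) f = f n \<oplus> nsum n f" by (rule nsum_Suc) (rule Sp_closed[OF f])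
  hence "R.Lop (nsum (Suc n) f) = R.Lop (f n) \<oplus>\<^bsub>OP\<^esub> R.Lop (nsum n f)"
    using R.Lop_simps(2)[OF f nsum_mem[OF D0_star_subalg f]] by (simp only:)
  also have "\<dots> = R.H.BB.nsum (Suc n) (\<lambda>i. R.Lop (f i))"
    unfolding Suc by (rule R.H.BB.nsum_Suc[OF R.Lop(1)[OF f], symmetric])
  finally show ?case .
qed

lemma Lop_ss: assumes "n > 0" shows "R.Lop (ss n) = averaged_creation.avg OP (R.Lop h) (RO n) n"
proof -
  interpret C: averaged_creation OP q "R.Lop h" "RO n" n by (rule creation[OF assms])
  have "R.Lop (rr n i \<otimes> (h \<otimes> star (rr n i))) = RO n i \<otimes>\<^bsub>OP\<^esub> (R.Lop h \<otimes>\<^bsub>OP\<^esub> adj OP (RO n i))" for i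
    unfolding R.Lop_simps(1)[OF rr_D0 R.Ws(4)[OF h_D0 R.Ws(6)[OF rr_D0]]] R.Lop_simps(1)[OF h_D0 R.Ws(6)[OF rr_D0]]
      R.Lop(2)[OF rr_D0] ..
  thus ?thesis
    unfolding ss_def C.avg_def C.rn_def R.Lop_simps(3)[OF nsum_mem[OF D0_star_subalg term_D0] R.Ws(2)] Lop_nsum[OF term_D0]
    by (simp only:)
qed

lemma ell_closed: "ell n \<in> carrier OP"
proof (cases "n = 0")
  case True thus ?thesis using R.H.Bop_zero_closed by (simp add: ell_def)
next
  case False
  then interpret C: averaged_creation OP q "R.Lop h" "RO n" n by (intro creation) simp
  show ?thesis using False C.cl2(1) by (simp add: ell_def)
qed

lemma ell_bound: "nrm OP (ell n) \<le> 2"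
proof (cases "n = 0")
  case True thus ?thesis using R.H.BB.nrm_zero by (simp add: ell_def)
next
  case False
  then interpret C: averaged_creation OP q "R.Lop h" "RO n" n by (intro creation) simp
  show ?thesis using False C.nn_ell by (simp add: ell_def)
qed

text \<open>The added one makes the bound strictly positive, as the estimate for orthogonal sums
  requires.\<close>

definition "hb = nrm OP (R.Lop h) + 1"

lemma hb: "hb > 0" "nrm OP (R.Lop h) \<le> hb"
  using R.H.BB.nrm_nonneg[OF R.Lop(1)[OF h_D0]] by (simp_all add: hb_def)

lemma ss_ell_bound:
  assumes "n > 0"
  shows "nrm OP (R.Lop (ss n) \<ominus>\<^bsub>OP\<^esub> (ell n \<oplus>\<^bsub>OP\<^esub> adj OP (ell n))) \<le> hb / sqrt (real n)"
proof -
  interpret C: averaged_creation OP q "R.Lop h" "RO n" n by (rule creation[OF assms])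
  show ?thesis using C.avg_minus[OF hb] Lop_ss[OF assms] assms by (simp add: ell_def del: R.H.Bop_simps)
qed

lemma ss_ell: "(\<lambda>n. nrm OP (R.Lop (ss n) \<ominus>\<^bsub>OP\<^esub> (ell n \<oplus>\<^bsub>OP\<^esub> adj OP (ell n)))) \<longlonglongrightarrow> 0"
proof (rule tendsto_sandwich[of "\<lambda>_. 0" _ _ "\<lambda>n. hb / sqrt (real n)"])
  show "\<forall>\<^sub>F n in sequentially. nrm OP (R.Lop (ss n) \<ominus>\<^bsub>OP\<^esub> (ell n \<oplus>\<^bsub>OP\<^esub> adj OP (ell n))) \<le> hb / sqrt (real n)"
    using ss_ell_bound by (intro eventually_sequentiallyI[of 1]) simp
  show "(\<lambda>n. hb / sqrt (real n)) \<longlonglongrightarrow> 0"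
    by (intro tendsto_divide_0[OF tendsto_const] filterlim_at_top_imp_at_infinity filterlim_compose[OF sqrt_at_top filterlim_real_sequentially])
  show "\<forall>\<^sub>F n in sequentially. 0 \<le> nrm OP (R.Lop (ss n) \<ominus>\<^bsub>OP\<^esub> (ell n \<oplus>\<^bsub>OP\<^esub> adj OP (ell n)))"
    by (intro always_eventually allI R.H.BB.nrm_nonneg R.H.BB.minus_closed R.H.BB.a_closed R.H.BB.adj_closed ell_closed R.Lop(1)[OF ss_D0])
qed simp

lemma Lop_nrm: "x \<in> D0 \<Longrightarrow> nrm OP (R.Lop x) = nn x"
  by (rule R.Lop_isometric[OF faithful_prob_axioms D0_dense])

text \<open>The triangle inequality for the average would allow growth like \<open>sqrt n\<close>.
  Splitting it into creation, annihilation and a small rest gives \<open>2 + 2 + hb\<close>, so the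
  averages define a class in the ultrapower.\<close>

lemma ss_bound: "nn (ss n) \<le> hb + 4"
proof (cases "n = 0")
  case True thus ?thesis using hb by (simp add: ss_def)
next
  case False
  note L = R.Lop(1)[OF ss_D0[of n]] and e = ell_closed[of n] and es = R.H.BB.adj_closed[OF ell_closed[of n]]
  note s = R.H.BB.a_closed[OF e es]
  let ?d = "R.Lop (ss n) \<ominus>\<^bsub>OP\<^esub> (ell n \<oplus>\<^bsub>OP\<^esub> adj OP (ell n))"
  have "R.Lop (ss n) = ?d \<oplus>\<^bsub>OP\<^esub> (ell n \<oplus>\<^bsub>OP\<^esub> adj OP (ell n))"
    using R.H.BB.minus_eq R.H.BB.a_assoc R.H.BB.l_neg R.H.BB.r_zero L s R.H.BB.a_inv_closed by metis
  hence "nrm OP (R.Lop (ss n)) \<le> nrm OP ?d + nrm OP (ell n \<oplus>\<^bsub>OP\<^esub> adj OP (ell n))"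
    using R.H.BB.nrm_triangle[OF R.H.BB.minus_closed[OF L s] s] by metis
  also have "\<dots> \<le> hb / sqrt (real n) + (2 + 2)"
    using ss_ell_bound[of n] False R.H.BB.nrm_triangle[OF e es] R.H.BB.nrm_adj[OF e] ell_bound[of n] by linarith
  also have "hb / sqrt (real n) \<le> hb" using hb(1) False by (simp add: divide_le_eq)
  finally show ?thesis using Lop_nrm[OF ss_D0] by simp
qed

lemma ell_D0:
  assumes x: "x \<in> D0"
  shows "(\<lambda>n. nrm OP (adj OP (ell n) \<otimes>\<^bsub>OP\<^esub> (R.Lop x \<otimes>\<^bsub>OP\<^esub> ell n) \<ominus>\<^bsub>OP\<^esub> cscale OP (st x) \<one>\<^bsub>OP\<^esub>)) \<longlonglongrightarrow> 0"
proof -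
  obtain K where K: "\<forall>n\<ge>K. \<forall>i j. \<exists>w\<in>ZZ. star (rr n i) \<otimes> (x \<otimes> rr n j) = sc (if i = j then st x else 0) \<one> \<oplus> w"
    using rr_sandwich[OF x] by blast
  have b: "nrm OP (adj OP (ell n) \<otimes>\<^bsub>OP\<^esub> (R.Lop x \<otimes>\<^bsub>OP\<^esub> ell n) \<ominus>\<^bsub>OP\<^esub> cscale OP (st x) \<one>\<^bsub>OP\<^esub>) \<le> cmod (st x) / real n"
    if n: "n \<ge> Suc K" for n
  proof -
    interpret C: averaged_creation OP q "R.Lop h" "RO n" n using n by (intro creation) simp
    have "q \<otimes>\<^bsub>OP\<^esub> ((adj OP (RO n i) \<otimes>\<^bsub>OP\<^esub> (R.Lop x \<otimes>\<^bsub>OP\<^esub> RO n j)) \<otimes>\<^bsub>OP\<^esub> q) = (if i = j then cscale OP (st x) q else \<zero>\<^bsub>OP\<^esub>)" for i j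
    proof -
      obtain w where w: "w \<in> ZZ" "star (rr n i) \<otimes> (x \<otimes> rr n j) = sc (if i = j then st x else 0) \<one> \<oplus> w"
        using K n by (meson Suc_leD)
      have "star (rr n i) \<otimes> (x \<otimes> rr n j) \<in> D0" by (intro R.Ws(4) R.Ws(6) rr_D0 x)
      from q_Lop_q[OF this w] have "q \<otimes>\<^bsub>OP\<^esub> ((adj OP (RO n i) \<otimes>\<^bsub>OP\<^esub> (R.Lop x \<otimes>\<^bsub>OP\<^esub> RO n j)) \<otimes>\<^bsub>OP\<^esub> q) =
        cscale OP (if i = j then st x else 0) q" unfolding RO_sandwich[OF x] .
      thus ?thesis using R.H.BB.cscale_0[OF q_op(1)] by (cases "i = j") (simp_all del: R.H.Bop_simps)
    qed
    thus ?thesis using C.ell_sandwich[OF R.Lop(1)[OF x]] n by (simp add: ell_def del: R.H.Bop_simps)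
  qed
  show ?thesis
  proof (rule tendsto_sandwich[of "\<lambda>_. 0" _ _ "\<lambda>n. cmod (st x) / real n"])
    show "(\<lambda>n. cmod (st x) / real n) \<longlonglongrightarrow> 0"
      by (intro tendsto_divide_0[OF tendsto_const] filterlim_at_top_imp_at_infinity filterlim_real_sequentially)
    show "\<forall>\<^sub>F n in sequentially. 0 \<le> nrm OP (adj OP (ell n) \<otimes>\<^bsub>OP\<^esub> (R.Lop x \<otimes>\<^bsub>OP\<^esub> ell n) \<ominus>\<^bsub>OP\<^esub> cscale OP (st x) \<one>\<^bsub>OP\<^esub>)"
      by (intro always_eventually allI R.H.BB.nrm_nonneg R.H.BB.minus_closed R.H.BB.m_closed R.H.BB.adj_closed ell_closed
        R.Lop(1)[OF x] R.H.BB.cscale_closed R.H.BB.one_closed)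
  qed (use b in \<open>auto intro: eventually_sequentiallyI\<close>)
qed

text \<open>For large \<open>n\<close> every vector \<open>star (rr n i) \<otimes> x\<close> starts
  on the circle or is a multiple of the vacuum, so \<open>q\<close> kills it in each summand. The
  terms vanish exactly, not only in the limit.\<close>

lemma ell_vac:
  assumes x: "x \<in> D0"
  shows "(\<lambda>n. R.H.BB.N2 (adj OP (ell n) \<otimes>\<^bsub>OP\<^esub> R.Lop x)) \<longlonglongrightarrow> 0"
proof -
  obtain K where K: "\<forall>n\<ge>K. \<forall>i. star (rr n i) \<otimes> x \<in> SZ" using rr_SZ[OF x] by blast
  have "R.H.BB.N2 (adj OP (ell n) \<otimes>\<^bsub>OP\<^esub> R.Lop x) = 0" if n: "n \<ge> Suc K" for n
  proof -
    interpret C: averaged_creation OP q "R.Lop h" "RO n" n using n by (intro creation) simp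
    note L = R.Lop(1)[OF x]
    have z: "R.H.BB.N2 (q \<otimes>\<^bsub>OP\<^esub> (adj OP (RO n i) \<otimes>\<^bsub>OP\<^esub> R.Lop x)) = 0" for i
    proof -
      have m: "star (rr n i) \<otimes> x \<in> SZ" using K n by simp
      have e: "adj OP (RO n i) \<otimes>\<^bsub>OP\<^esub> R.Lop x = R.Lop (star (rr n i) \<otimes> x)"
        unfolding R.Lop(2)[OF rr_D0] R.Lop_simps(1)[OF R.Ws(6)[OF rr_D0] x] ..
      have "(q \<otimes>\<^bsub>OP\<^esub> R.Lop (star (rr n i) \<otimes> x)) (R.kv \<one>) = 0"
        using R.Lop(3)[OF SZ_D0[OF m] R.Ws(2)] q_SZ[OF m] Sp_closed[OF m] by simp
      thus ?thesis unfolding e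
        using R.H.BB_N2[OF R.H.Bop_closed(1)[OF q_op(1) R.Lop(1)[OF SZ_D0[OF m]]]] R.H.hn_eq_0[of 0] R.H.V_zero by metis
    qed
    let ?t = "\<lambda>i. RO n i \<otimes>\<^bsub>OP\<^esub> (C.q' \<otimes>\<^bsub>OP\<^esub> (R.Lop h \<otimes>\<^bsub>OP\<^esub> (q \<otimes>\<^bsub>OP\<^esub> (adj OP (RO n i) \<otimes>\<^bsub>OP\<^esub> R.Lop x))))"
    have "R.H.BB.N2 (R.H.BB.nsum n ?t) = 0"
      by (rule R.H.BB.N2_nsum_null)
        (intro R.H.BB.N2_null_mult R.H.BB.m_closed z R.H.BB.adj_closed C.cl C.q C.h C.R L)+
    moreover have "R.H.BB.nsum n ?t \<in> carrier OP"
      by (intro R.H.BB.nsum_closed R.H.BB.m_closed R.H.BB.adj_closed C.cl C.q C.h C.R L)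
    ultimately have "R.H.BB.N2 (adj OP C.ell \<otimes>\<^bsub>OP\<^esub> R.Lop x) = 0"
      unfolding C.star_ell_mult[OF L] using R.H.BB.N2_cscale by simp
    thus ?thesis using n by (simp add: ell_def del: R.H.Bop_simps)
  qed
  hence "\<forall>\<^sub>F n in sequentially. R.H.BB.N2 (adj OP (ell n) \<otimes>\<^bsub>OP\<^esub> R.Lop x) = 0"
    by (intro eventually_sequentiallyI)
  thus ?thesis by (rule tendsto_eventually)
qed

text \<open>The subalgebra \<open>E\<close> is kept variable because the statement is used for the
  whole free product and for the complexification with its own state.\<close>

theorem model:
  assumes E: "cstar_subalgebra A E" and f: "cstar_prob_space (A\<lparr>carrier := E\<rparr>)"
    and d: "\<And>x e. x \<in> E \<Longrightarrow> e > 0 \<Longrightarrow> \<exists>y\<in>E \<inter> D0. nn (x \<ominus> y) < e" and s: "\<And>n. ss n \<in> E"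
    and \<omega>: "free_ultrafilter \<omega>" and N: "filterlim N at_top \<omega>"
  shows "semicircular_model (A\<lparr>carrier := E\<rparr>) OP (E \<inter> D0) R.Lop ss ell \<omega> N (hb + 4)"
proof -
  have Es: "star_subalg E" using E by (simp add: cstar_subalgebra_iff)
  note e = star_subalgD[OF Es]
  interpret S: faithful_prob "A\<lparr>carrier := E\<rparr>" using f by (simp add: cstar_prob_space_iff)
  have m: "x \<ominus>\<^bsub>A\<lparr>carrier := E\<rparr>\<^esub> y = x \<ominus> y" if "x \<in> E" "y \<in> E" for x y by (rule subalg_minus[OF Es that])
  show ?thesis
  proof
    show "S.star_subalg (E \<inter> D0)"
      unfolding S.star_subalg_def using e R.Ws by (simp add: subset_eq)
    show "\<exists>y\<in>E \<inter> D0. nrm (A\<lparr>carrier := E\<rparr>) (x \<ominus>\<^bsub>A\<lparr>carrier := E\<rparr>\<^esub> y) < \<epsilon>"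
      if "x \<in> carrier (A\<lparr>carrier := E\<rparr>)" "\<epsilon> > 0" for x \<epsilon>
      using d[of x \<epsilon>] m[of x] that by auto
    show "R.Lop (x \<otimes>\<^bsub>A\<lparr>carrier := E\<rparr>\<^esub> y) = R.Lop x \<otimes>\<^bsub>OP\<^esub> R.Lop y" if "x \<in> E \<inter> D0" "y \<in> E \<inter> D0" for x y
      using R.Lop_simps(1)[of x y] that by (simp del: R.H.Bop_simps)
    show "R.Lop (x \<oplus>\<^bsub>A\<lparr>carrier := E\<rparr>\<^esub> y) = R.Lop x \<oplus>\<^bsub>OP\<^esub> R.Lop y" if "x \<in> E \<inter> D0" "y \<in> E \<inter> D0" for x y
      using R.Lop_simps(2)[of x y] that by (simp del: R.H.Bop_simps)
    show "R.Lop (cscale (A\<lparr>carrier := E\<rparr>) t x) = cscale OP t (R.Lop x)" if "x \<in> E \<inter> D0" for x t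
      using R.Lop_simps(3)[of x x t] that by (simp del: R.H.Bop_simps)
    show "R.Lop \<one>\<^bsub>A\<lparr>carrier := E\<rparr>\<^esub> = \<one>\<^bsub>OP\<^esub>" using R.Lop_simps(4)[OF R.Ws(2) R.Ws(2)] by (simp del: R.H.Bop_simps)
    show "R.Lop (adj (A\<lparr>carrier := E\<rparr>) x) = adj OP (R.Lop x)" if "x \<in> E \<inter> D0" for x
      using R.Lop(2)[of x] that by simp
    show "nrm OP (R.Lop x) = nrm (A\<lparr>carrier := E\<rparr>) x" if "x \<in> E \<inter> D0" for x using Lop_nrm[of x] that by simp
    show "state OP (R.Lop x) = state (A\<lparr>carrier := E\<rparr>) x" if "x \<in> E \<inter> D0" for x
      using R.Lop_simps(5)[of x x] that by (simp del: R.H.Bop_simps)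
    show "ss n \<in> E \<inter> D0" for n using s ss_D0 by blast
    show "nrm (A\<lparr>carrier := E\<rparr>) (ss n) \<le> hb + 4" for n using ss_bound by simp
    show "(\<lambda>n. nrm OP (adj OP (ell n) \<otimes>\<^bsub>OP\<^esub> (R.Lop w \<otimes>\<^bsub>OP\<^esub> ell n) \<ominus>\<^bsub>OP\<^esub> cscale OP (state (A\<lparr>carrier := E\<rparr>) w) \<one>\<^bsub>OP\<^esub>)) \<longlonglongrightarrow> 0"
      if "w \<in> E \<inter> D0" for w using ell_D0[of w] that by (simp del: R.H.Bop_simps)
    show "(\<lambda>n. R.H.BB.N2 (adj OP (ell n) \<otimes>\<^bsub>OP\<^esub> R.Lop w)) \<longlonglongrightarrow> 0" if "w \<in> E \<inter> D0" for w
      using ell_vac[of w] that by (simp del: R.H.Bop_simps)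
  qed (use R.Lop(1) ell_closed ell_bound ss_ell \<omega> N in \<open>auto simp del: R.H.Bop_simps\<close>)
qed

end

section \<open>The free complexification\<close>

text \<open>In the order of filters, ultrafilters are the minimal proper ones, so Zorn is used
  downwards. If \<open>P\<close> does not fail eventually, restricting to \<open>P\<close> gives a
  proper filter below the minimal one, hence equal to it.\<close>

lemma ultrafilter_below:
  fixes F :: "'i filter"
  assumes "F \<noteq> bot"
  shows "\<exists>\<omega>\<le>F. \<omega> \<noteq> bot \<and> (\<forall>P. eventually P \<omega> \<or> eventually (\<lambda>i. \<not> P i) \<omega>)"
proof -
  let ?A = "{G :: 'i filter. G \<noteq> bot \<and> G \<le> F}"
  have po: "partial_order_on ?A (relation_of (\<ge>) ?A)"
    by (rule partial_order_on_relation_ofI) auto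
  have "\<exists>m\<in>?A. \<forall>G\<in>?A. m \<ge> G \<longrightarrow> G = m"
  proof (rule predicate_Zorn[OF po])
    fix C assume C: "C \<in> Chains (relation_of (\<ge>) ?A)"
    have sub: "C \<subseteq> ?A" and tot: "\<And>G H. G \<in> C \<Longrightarrow> H \<in> C \<Longrightarrow> G \<le> H \<or> H \<le> G"
      using C by (auto simp: Chains_def relation_of_def)
    show "\<exists>u\<in>?A. \<forall>G\<in>C. G \<ge> u"
    proof (cases "C = {}")
      case True thus ?thesis using assms by (intro bexI[of _ F]) auto
    next
      case False
      \<comment> \<open>A finite nonempty part of a chain has a least member, so finite infima
        remain proper.\<close>
      have fin: "X \<subseteq> C \<Longrightarrow> X \<noteq> {} \<Longrightarrow> \<exists>G\<in>X. G \<le> Inf X" if "finite X" for X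
        using that
      proof (induction X rule: finite_induct)
        case (insert G X)
        show ?case
        proof (cases "X = {}")
          case False
          then obtain H where H: "H \<in> X" "H \<le> Inf X" using insert by auto
          hence "G \<le> H \<or> H \<le> G" using tot insert.prems by auto
          thus ?thesis using H by (auto intro: order_trans)
        qed simp
      qed simp
      have "Inf C \<noteq> bot"
      proof (rule Inf_filter_not_bot)
        fix X assume X: "X \<subseteq> C" "finite X"
        show "Inf X \<noteq> bot"
        proof (cases "X = {}")
          case True
          hence "F \<le> Inf X" by simp
          thus ?thesis using assms bot.extremum_uniqueI by metis
        next
          case False
          then obtain G where "G \<in> X" "G \<le> Inf X" using fin[OF X(2,1)] by blast
          thus ?thesis using sub X(1) by (auto simp: bot_unique)
        qed
      qed
      moreover have "Inf C \<le> F" using False sub by (auto intro: Inf_lower2)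
      ultimately show ?thesis by (intro bexI[of _ "Inf C"]) (auto intro: Inf_lower)
    qed
  qed
  then obtain m where m: "m \<noteq> bot" "m \<le> F" and max: "\<And>G. G \<noteq> bot \<Longrightarrow> G \<le> F \<Longrightarrow> G \<le> m \<Longrightarrow> G = m" by blast
  have "eventually P m \<or> eventually (\<lambda>i. \<not> P i) m" for P
  proof (cases "inf m (principal {i. P i}) = bot")
    case True
    hence "eventually (\<lambda>i. False) (inf m (principal {i. P i}))" by simp
    thus ?thesis by (simp add: eventually_inf_principal)
  next
    case False
    hence "inf m (principal {i. P i}) = m" using max[OF False] m(2) by (simp add: le_infI1)
    hence "m \<le> principal {i. P i}" by (metis inf.cobounded2)
    thus ?thesis by (simp add: le_principal)
  qed
  thus ?thesis using m by blast
qed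

text \<open>The second component of the index is used to push the ultrafilter to infinity. This
  makes it free and also supplies the numerical scale \<open>N\<close> that transports sequences to
  it.\<close>

lemma ultra_index_filter:
  obtains \<omega> :: "('i \<times> nat) filter" where "free_ultrafilter \<omega>" "filterlim snd at_top \<omega>"
proof -
  let ?F = "filtercomap (snd :: 'i \<times> nat \<Rightarrow> nat) sequentially"
  have "?F \<noteq> bot" by (rule filtercomap_neq_bot_surj) (auto simp: surj_def)
  then obtain \<omega> where \<omega>: "\<omega> \<le> ?F" "\<omega> \<noteq> bot" "\<And>P. eventually P \<omega> \<or> eventually (\<lambda>i. \<not> P i) \<omega>"
    using ultrafilter_below[of ?F] by blast
  have l: "filterlim snd at_top \<omega>" by (rule filterlim_mono[OF filterlim_filtercomap order_refl \<omega>(1)])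
  have "eventually (\<lambda>i. i \<noteq> j) \<omega>" for j
  proof -
    have "eventually (\<lambda>i. snd i \<ge> Suc (snd j)) \<omega>" using l by (auto simp: filterlim_at_top)
    thus ?thesis by (rule eventually_mono) auto
  qed
  thus ?thesis using that[of \<omega>] \<omega> l by (simp add: free_ultrafilter_def)
qed

lemma star_hom_contractive:
  assumes A: "cstar_algebra A" and D: "faithful_prob D" and f: "star_hom A D f" and x: "x \<in> carrier A"
  shows "nrm D (f x) \<le> nrm A x"
proof -
  interpret A: cstar_algebra A by (rule A)
  interpret D: faithful_prob D by (rule D)
  show ?thesis
    by (rule D.gns_isometric[OF star_homD(1)[OF f x] A.nrm_nonneg[OF x]]) (rule star_hom_N2_le[OF A D.pre_state_axioms f x])
qed

text \<open>The preimage is closed because homomorphisms are contractive. An inclusion of a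
  generated subalgebra can then be checked on generators through a homomorphism.\<close>

lemma star_hom_vimage:
  fixes D :: "'d cstar_prob" (structure)
  assumes A: "cstar_algebra A" and D: "faithful_prob D" and f: "star_hom A D f" and Q: "cstar_subalgebra D Q"
  shows "cstar_subalgebra A {x \<in> carrier A. f x \<in> Q}"
proof -
  interpret A: cstar_algebra A by (rule A)
  interpret D: faithful_prob D by (rule D)
  note h = star_homD[OF f]
  have Q': "D.star_subalg Q" "D.nclosed Q" using Q unfolding D.cstar_subalgebra_iff by auto
  note q = D.star_subalgD[OF Q'(1)]
  have minus: "f (x \<ominus>\<^bsub>A\<^esub> y) = f x \<ominus> f y" if "x \<in> carrier A" "y \<in> carrier A" for x y
  proof -
    have "f (x \<oplus>\<^bsub>A\<^esub> A.sc (-1) y) = f x \<oplus> D.sc (-1) (f y)" using that by (simp add: h)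
    thus ?thesis using that h(1) by (simp add: A.cscale_m1 A.minus_eq D.cscale_m1 D.minus_eq)
  qed
  have "A.star_subalg {x \<in> carrier A. f x \<in> Q}"
    unfolding A.star_subalg_def using q(2-6) by (auto simp: h)
  moreover have "A.nclosed {x \<in> carrier A. f x \<in> Q}"
    unfolding A.nclosed_def
  proof (intro ballI impI)
    fix x assume x: "x \<in> carrier A" "\<forall>e>0. \<exists>y\<in>{x \<in> carrier A. f x \<in> Q}. A.nn (x \<ominus>\<^bsub>A\<^esub> y) < e"
    have "\<exists>u\<in>Q. D.nn (f x \<ominus> u) < e" if "e > 0" for e
    proof -
      obtain y where y: "y \<in> carrier A" "f y \<in> Q" "A.nn (x \<ominus>\<^bsub>A\<^esub> y) < e" using x(2) \<open>e > 0\<close> by blast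
      have "D.nn (f x \<ominus> f y) \<le> A.nn (x \<ominus>\<^bsub>A\<^esub> y)"
        using star_hom_contractive[OF A D f A.minus_closed[OF x(1) y(1)]] minus[OF x(1) y(1)] by simp
      thus ?thesis using y by (intro bexI[of _ "f y"]) auto
    qed
    thus "x \<in> {x \<in> carrier A. f x \<in> Q}" using Q'(2) x(1) h(1)[OF x(1)] unfolding D.nclosed_def by blast
  qed
  ultimately show ?thesis unfolding A.cstar_subalgebra_iff by simp
qed

section \<open>The functions on the circle\<close>

lemma circle_gen_closed: "circle_gen \<in> carrier circle_space"
proof -
  have "continuous_on circle circle_gen \<longleftrightarrow> continuous_on circle (\<lambda>x. x)"
    by (rule continuous_on_cong) (simp_all add: circle_gen_def)
  thus ?thesis by (simp add: circle_space_def) (simp add: circle_gen_def)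
qed

lemma circle_commute: "f \<otimes>\<^bsub>circle_space\<^esub> g = g \<otimes>\<^bsub>circle_space\<^esub> f"
  by (simp add: circle_space_def mult.commute)

lemma circle_gen_unitary: "adj circle_space circle_gen \<otimes>\<^bsub>circle_space\<^esub> circle_gen = \<one>\<^bsub>circle_space\<^esub>"
proof -
  have "cnj x * x = 1" if "x \<in> circle" for x :: complex
    using that complex_norm_square[of x] by (simp add: mult.commute)
  thus ?thesis by (auto simp: circle_space_def circle_gen_def fun_eq_iff)
qed

lemma integral_cis_multiple:
  assumes "n > 0" shows "integral {0..2 * pi} (\<lambda>t. cis (real n * t)) = 0"
proof -
  define c where "c = 1 / (\<i> * of_nat n)"
  have c: "c * (\<i> * of_nat n) = 1" using assms by (simp add: c_def)
  have "((\<lambda>t. cis (real n * t)) has_integral (c * cis (real n * (2 * pi)) - c * cis (real n * 0))) {0..2 * pi}"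
  proof (rule fundamental_theorem_of_calculus)
    fix t :: real
    have "((\<lambda>t. c * cis (real n * t)) has_derivative (\<lambda>x. c * ((real n * x) *\<^sub>R (\<i> * cis (real n * t))))) (at t within {0..2 * pi})"
      by (intro has_derivative_mult_right has_derivative_cis has_derivative_ident)
    moreover have "(\<lambda>x. c * ((real n * x) *\<^sub>R (\<i> * cis (real n * t)))) = (\<lambda>x. x *\<^sub>R cis (real n * t))"
    proof
      fix x :: real
      have "c * ((real n * x) *\<^sub>R (\<i> * cis (real n * t))) = (c * (\<i> * of_nat n)) * (x *\<^sub>R cis (real n * t))"
        by (simp add: scaleR_conv_of_real mult_ac)
      thus "c * ((real n * x) *\<^sub>R (\<i> * cis (real n * t))) = x *\<^sub>R cis (real n * t)" unfolding c by simp
    qed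
    ultimately show "((\<lambda>t. c * cis (real n * t)) has_vector_derivative cis (real n * t)) (at t within {0..2 * pi})"
      by (simp only: has_vector_derivative_def)
  qed simp
  moreover have "cis (real n * (2 * pi)) = 1" using cis_multiple_2pi[of "real n"] by (simp add: mult_ac)
  ultimately have "((\<lambda>t. cis (real n * t)) has_integral 0) {0..2 * pi}" by simp
  thus ?thesis by (rule integral_unique)
qed

lemma circle_state: "state circle_space f = integral {0..2 * pi} (\<lambda>t. f (cis t)) / (2 * pi)"
  by (simp add: circle_space_def)

lemma circle_gen_state: "state circle_space circle_gen = 0" "state circle_space (circle_gen \<otimes>\<^bsub>circle_space\<^esub> circle_gen) = 0"
proof -
  have 1: "circle_gen (cis t) = cis (real 1 * t)" for t by (simp add: circle_gen_def)
  have 2: "(circle_gen \<otimes>\<^bsub>circle_space\<^esub> circle_gen) (cis t) = cis (real 2 * t)" for t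
    by (simp add: circle_gen_def circle_space_def cis_mult)
  show "state circle_space circle_gen = 0" "state circle_space (circle_gen \<otimes>\<^bsub>circle_space\<^esub> circle_gen) = 0"
    unfolding circle_state 1 2 integral_cis_multiple[OF zero_less_one] integral_cis_multiple[OF zero_less_numeral] by simp_all
qed

text \<open>With \<open>r\<close> the real part of \<open>rho(b^2)\<close>, the centred self-adjoint
  elements \<open>b + b*\<close> and \<open>i (b - b*\<close> \<open>)\<close> have variances
  \<open>2 + 2 r\<close> and \<open>2 - 2 r\<close>. The sign of \<open>r\<close> selects one of
  positive variance, which is then normalised.\<close>

lemma (in pre_prob) self_adjoint_of_unitary:
  assumes b: "b \<in> alg" "star b \<otimes> b = \<one>" "b \<otimes> star b = \<one>" "st b = 0" and E: "star_subalg E" and bE: "b \<in> E"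
  shows "\<exists>h\<in>E. star h = h \<and> st h = 0 \<and> st (h \<otimes> h) = 1"
proof -
  note e = star_subalgD[OF E]
  have main: ?thesis if k: "k \<in> E" "star k = k" "st k = 0" "st (k \<otimes> k) = of_real v" "v > 0" for k and v :: real
  proof -
    have kc: "k \<in> alg" using e(1) k(1) .
    let ?t = "complex_of_real (1 / sqrt v)"
    have tt: "?t * (?t * of_real v) = 1" using k(5) by (simp flip: of_real_mult)
    show ?thesis
      by (intro bexI[of _ "sc ?t k"] conjI)
        (use k kc tt e(5) in \<open>simp_all add: adj_cscale st_cscale cscale_mult_left cscale_mult_right\<close>)
  qed
  let ?x = "b \<oplus> star b" and ?y = "sc \<i> (b \<ominus> star b)"
  define r where "r = Re (st (b \<otimes> b))"
  have sb: "star b \<in> alg" "st (star b) = 0" "st (star b \<otimes> star b) = cnj (st (b \<otimes> b))"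
    using b st_adj[of b] st_adj[of "b \<otimes> b"] by (simp_all add: adj_mult)
  have x: "st (?x \<otimes> ?x) = of_real (2 + 2 * r)"
    using b sb by (simp add: l_distr r_distr st_add r_def complex_eq_iff)
  have y: "st (?y \<otimes> ?y) = of_real (2 - 2 * r)"
    using b sb by (simp add: cscale_mult_left cscale_mult_right st_cscale minus_eq l_distr r_distr l_minus r_minus st_add st_uminus r_def complex_eq_iff)
  show ?thesis
  proof (cases "r \<ge> 0")
    case True
    thus ?thesis
      using main[OF _ _ _ x] b sb e(3)[OF bE e(6)[OF bE]] by (simp add: adj_add st_add a_comm)
  next
    case False
    have "star ?y = ?y" using b
      by (simp add: adj_cscale adj_add adj_uminus cscale_minus_left minus_eq cscale_add_right cscale_minus_right a_comm)
    thus ?thesis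
      using False main[OF _ _ _ y] b sb e(5)[OF e(9)[OF bE e(6)[OF bE]]] by (simp add: st_cscale st_diff)
  qed
qed

section \<open>The complexification inside the free product\<close>

locale complexification = A: faithful_prob A + D: faithful_prob D
  for A :: "'a cstar_prob" and D :: "'d cstar_prob" (structure) +
  fixes S :: "'a set" and a b c :: 'a and \<iota> :: "'a \<Rightarrow> 'd" and \<kappa> :: "(complex \<Rightarrow> complex) \<Rightarrow> 'd"
  assumes S: "S \<subseteq> carrier A"
    and a: "a \<in> unitaries A" "a \<in> proj_right A S" "a \<in> centralizer A" "state A a = 0"
    and b: "b \<in> unitaries A" "b \<in> proj_left A S" "b \<in> centralizer A" "state A b = 0"
    and c: "c \<in> unitaries A" "c \<in> proj_left A S" "c \<in> centralizer A" "state A c = 0"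
    and cb: "state A (inv\<^bsub>A\<^esub> c \<otimes>\<^bsub>A\<^esub> b) = 0"
    and free: "reduced_free_product D A circle_space \<iota> \<kappa>"
begin

lemma unitaryD: assumes "u \<in> unitaries A"
  shows "u \<in> A.alg" "A.star u \<otimes>\<^bsub>A\<^esub> u = \<one>\<^bsub>A\<^esub>" "u \<otimes>\<^bsub>A\<^esub> A.star u = \<one>\<^bsub>A\<^esub>"
  using assms by (auto simp: unitaries_def)

lemmas au = unitaryD[OF a(1)] and bu = unitaryD[OF b(1)] and cu = unitaryD[OF c(1)]

lemma centralizerD: "u \<in> centralizer A \<Longrightarrow> x \<in> A.alg \<Longrightarrow> A.st (u \<otimes>\<^bsub>A\<^esub> x) = A.st (x \<otimes>\<^bsub>A\<^esub> u)"
  by (simp add: centralizer_def)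

lemma C: "faithful_prob circle_space"
  using free by (simp add: reduced_free_product_def cstar_prob_space_iff)

sublocale C: faithful_prob circle_space by (rule C)

lemma \<iota>: "star_hom A D \<iota>" and \<iota>_st: "x \<in> A.alg \<Longrightarrow> D.st (\<iota> x) = A.st x"
  and \<kappa>: "star_hom circle_space D \<kappa>" and \<kappa>_st: "f \<in> carrier circle_space \<Longrightarrow> D.st (\<kappa> f) = C.st f"
  using free by (auto simp: reduced_free_product_def cps_hom_def star_hom_def)

lemmas \<iota>_simps = star_homD[OF \<iota>] and \<kappa>_simps = star_homD[OF \<kappa>]

definition BB :: "bool \<Rightarrow> 'd set" where
  "BB s = (if s then \<kappa> ` carrier circle_space else \<iota> ` A.alg)"

definition zz :: 'd where "zz = \<kappa> circle_gen"

lemma BB_subalg: "D.star_subalg (BB s)"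
  using star_hom_image[OF A.pre_cstar_axioms D.pre_cstar_axioms \<iota> A.star_subalg_carrier] star_hom_image[OF C.pre_cstar_axioms D.pre_cstar_axioms \<kappa> C.star_subalg_carrier]
  by (simp add: BB_def)

lemma BB_free: "free_family D BB"
  using free unfolding reduced_free_product_def BB_def by blast

lemma cb0: "A.st (A.star c \<otimes>\<^bsub>A\<^esub> b) = 0"
proof -
  have "A.star c = inv\<^bsub>A\<^esub> c" using A.inv_unique'[of c "A.star c"] cu by simp
  thus ?thesis using cb by simp
qed

lemma gen_unitary: "circle_gen \<otimes>\<^bsub>circle_space\<^esub> C.star circle_gen = \<one>\<^bsub>circle_space\<^esub>"
  using circle_gen_unitary circle_commute by metis

lemma zz: "zz \<in> carrier D" "D.star zz \<otimes> zz = \<one>" "zz \<otimes> D.star zz = \<one>" "D.st zz = 0" "D.st (zz \<otimes> zz) = 0"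
proof -
  note g = circle_gen_closed and gs = C.adj_closed[OF circle_gen_closed]
  show "zz \<in> carrier D" using \<kappa>_simps(1)[OF g] by (simp add: zz_def)
  show "D.star zz \<otimes> zz = \<one>"
    unfolding zz_def \<kappa>_simps(6)[OF g, symmetric] \<kappa>_simps(2)[OF gs g, symmetric] circle_gen_unitary by (rule \<kappa>_simps(4))
  show "zz \<otimes> D.star zz = \<one>"
    unfolding zz_def \<kappa>_simps(6)[OF g, symmetric] \<kappa>_simps(2)[OF g gs, symmetric] gen_unitary by (rule \<kappa>_simps(4))
  show "D.st zz = 0" unfolding zz_def \<kappa>_st[OF g] by (rule circle_gen_state(1))
  show "D.st (zz \<otimes> zz) = 0"
    unfolding zz_def \<kappa>_simps(2)[OF g g, symmetric] \<kappa>_st[OF C.m_closed[OF g g]] by (rule circle_gen_state(2))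
qed

sublocale L: unitary_letters D BB "\<iota> a" "\<iota> b" "\<iota> c" zz
proof
  show "D.star_subalg (BB s)" for s by (rule BB_subalg)
  show "free_family D BB" by (rule BB_free)
  show "\<iota> a \<in> BB False" "\<iota> b \<in> BB False" "\<iota> c \<in> BB False" using au bu cu by (simp_all add: BB_def)
  have u: "D.star (\<iota> u) \<otimes> \<iota> u = \<one>" "\<iota> u \<otimes> D.star (\<iota> u) = \<one>" if "u \<in> unitaries A" for u
  proof -
    note w = unitaryD[OF that]
    show "D.star (\<iota> u) \<otimes> \<iota> u = \<one>" "\<iota> u \<otimes> D.star (\<iota> u) = \<one>"
      unfolding \<iota>_simps(6)[OF w(1), symmetric] \<iota>_simps(2)[OF A.adj_closed[OF w(1)] w(1), symmetric]
        \<iota>_simps(2)[OF w(1) A.adj_closed[OF w(1)], symmetric] w(2,3) by (rule \<iota>_simps(4))+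
  qed
  show "D.star (\<iota> a) \<otimes> \<iota> a = \<one>" "\<iota> a \<otimes> D.star (\<iota> a) = \<one>" using u[OF a(1)] .
  show "D.star (\<iota> b) \<otimes> \<iota> b = \<one>" "\<iota> b \<otimes> D.star (\<iota> b) = \<one>" using u[OF b(1)] .
  show "D.star (\<iota> c) \<otimes> \<iota> c = \<one>" "\<iota> c \<otimes> D.star (\<iota> c) = \<one>" using u[OF c(1)] .
  show "D.st (\<iota> a) = 0" "D.st (\<iota> b) = 0" "D.st (\<iota> c) = 0"
    unfolding \<iota>_st[OF au(1)] \<iota>_st[OF bu(1)] \<iota>_st[OF cu(1)] by (rule a(4) b(4) c(4))+
  have cz: "D.st (\<iota> u \<otimes> x) = D.st (x \<otimes> \<iota> u)" if u: "u \<in> A.alg" "u \<in> centralizer A" and x: "x \<in> BB False" for u x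
  proof -
    obtain y where y: "y \<in> A.alg" "x = \<iota> y" using x by (auto simp: BB_def)
    show ?thesis
      unfolding y(2) \<iota>_simps(2)[OF u(1) y(1), symmetric] \<iota>_simps(2)[OF y(1) u(1), symmetric]
        \<iota>_st[OF A.m_closed[OF u(1) y(1)]] \<iota>_st[OF A.m_closed[OF y(1) u(1)]] by (rule centralizerD[OF u(2) y(1)])
  qed
  show "D.st (\<iota> a \<otimes> x) = D.st (x \<otimes> \<iota> a)" if "x \<in> BB False" for x by (rule cz[OF au(1) a(3) that])
  show "D.st (\<iota> b \<otimes> x) = D.st (x \<otimes> \<iota> b)" if "x \<in> BB False" for x by (rule cz[OF bu(1) b(3) that])
  show "D.st (\<iota> c \<otimes> x) = D.st (x \<otimes> \<iota> c)" if "x \<in> BB False" for x by (rule cz[OF cu(1) c(3) that])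
  show "zz \<otimes> x = x \<otimes> zz" if x: "x \<in> BB True" for x
  proof -
    obtain f where f: "f \<in> carrier circle_space" "x = \<kappa> f" using x by (auto simp: BB_def)
    show ?thesis
      unfolding f(2) zz_def \<kappa>_simps(2)[OF f(1) circle_gen_closed, symmetric] \<kappa>_simps(2)[OF circle_gen_closed f(1), symmetric]
      by (rule arg_cong[OF circle_commute])
  qed
  show "D.st (D.star (\<iota> c) \<otimes> \<iota> b) = 0"
    unfolding \<iota>_simps(6)[OF cu(1), symmetric] \<iota>_simps(2)[OF A.adj_closed[OF cu(1)] bu(1), symmetric]
      \<iota>_st[OF A.m_closed[OF A.adj_closed[OF cu(1)] bu(1)]] by (rule cb0)
  show "zz \<in> BB True" by (simp add: BB_def zz_def circle_gen_closed)
qed (rule zz)+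

lemma D0_dense: assumes "x \<in> carrier D" "e > 0" shows "\<exists>y\<in>L.D0. D.nn (x \<ominus> y) < e"
proof -
  have "\<iota> ` A.alg \<union> \<kappa> ` carrier circle_space \<subseteq> L.D0"
    using L.B_D0[of _ False] L.B_D0[of _ True] by (auto simp: BB_def)
  also have "\<dots> \<subseteq> D.nclosure L.D0" by (rule D.subset_nclosure[OF L.D0_star_subalg])
  finally have "cstar_generated D (\<iota> ` A.alg \<union> \<kappa> ` carrier circle_space) \<subseteq> D.nclosure L.D0"
    by (rule D.cstar_generated_minimal[OF _ D.nclosure_cstar_subalgebra[OF L.D0_star_subalg]])
  hence "x \<in> D.nclosure L.D0" using free assms(1) by (auto simp: reduced_free_product_def)
  thus ?thesis using assms(2) by (auto simp: D.nclosure_def)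
qed

definition "X = {\<iota> x \<otimes> zz | x. x \<in> S}"
definition "At = free_complexification D \<iota> \<kappa> S"

lemma At_gen: "At = cstar_generated D X" by (simp add: At_def free_complexification_def X_def zz_def)

lemma X_carrier: "X \<subseteq> carrier D" using S \<iota>_simps(1) zz(1) by (auto simp: X_def)

lemma At_sub: "cstar_subalgebra D At" unfolding At_gen by (rule D.cstar_generated_subalgebra[OF X_carrier])

lemma At_star: "D.star_subalg At" using At_sub by (simp add: D.cstar_subalgebra_iff)

lemma X_At: "x \<in> S \<Longrightarrow> \<iota> x \<otimes> zz \<in> At"
  unfolding At_gen using D.cstar_generated_inc[of X] by (auto simp: X_def)

text \<open>In \<open>x z\<close> times the adjoint of \<open>y z\<close> the inner factors
  \<open>z\<close> cancel, so these products lie in the complexification without any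
  conjugation.\<close>

lemma proj_left_At: assumes "y \<in> proj_left A S" shows "\<iota> y \<in> At"
proof -
  note At = D.star_subalgD[OF At_star]
  have "proj_left A S \<subseteq> {x \<in> A.alg. \<iota> x \<in> At}"
    unfolding proj_left_def
  proof (rule A.cstar_generated_minimal[OF _ star_hom_vimage[OF A.cstar_algebra_axioms D.faithful_prob_axioms \<iota> At_sub]])
    have "x \<otimes>\<^bsub>A\<^esub> A.star y \<in> A.alg \<and> \<iota> (x \<otimes>\<^bsub>A\<^esub> A.star y) \<in> At" if "x \<in> S" "y \<in> S" for x y
    proof -
      have c: "x \<in> A.alg" "y \<in> A.alg" using S that by auto
      note i = \<iota>_simps(1)[OF c(1)] \<iota>_simps(1)[OF c(2)]
      have "(\<iota> x \<otimes> zz) \<otimes> D.star (\<iota> y \<otimes> zz) = \<iota> x \<otimes> ((zz \<otimes> D.star zz) \<otimes> D.star (\<iota> y))"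
        using i zz(1) by (simp add: D.adj_mult D.m_assoc)
      also have "\<dots> = \<iota> (x \<otimes>\<^bsub>A\<^esub> A.star y)" unfolding zz(3) using i c by (simp add: \<iota>_simps)
      finally show ?thesis using At(4)[OF X_At[OF that(1)] At(6)[OF X_At[OF that(2)]]] c by simp
    qed
    thus "{x \<otimes>\<^bsub>A\<^esub> A.star y |x y. x \<in> S \<and> y \<in> S} \<subseteq> {x \<in> A.alg. \<iota> x \<in> At}" by blast
  qed
  thus ?thesis using assms by blast
qed

text \<open>The adjoint of \<open>x z\<close> times \<open>y z\<close> leaves \<open>x* y\<close>
  enclosed by \<open>z* ... z\<close>. As \<open>z\<close> is unitary this conjugation is a
  homomorphism, so membership extends from generators to the whole projective algebra.\<close>

lemma conj_star_hom: "star_hom A D (\<lambda>x. D.star zz \<otimes> (\<iota> x \<otimes> zz))"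
proof -
  have z: "zz \<otimes> (D.star zz \<otimes> x) = x" if "x \<in> carrier D" for x
    using zz that by (simp flip: D.m_assoc)
  show ?thesis
    unfolding star_hom_def
  proof (intro conjI ring_hom_memI)
    show "D.star zz \<otimes> (\<iota> \<one>\<^bsub>A\<^esub> \<otimes> zz) = \<one>" using zz by (simp add: \<iota>_simps)
  qed (use zz(1) in \<open>simp_all add: \<iota>_simps D.m_assoc z D.l_distr D.r_distr D.cscale_mult_left D.cscale_mult_right D.adj_mult\<close>)
qed

lemma proj_right_At: assumes "y \<in> proj_right A S" shows "D.star zz \<otimes> (\<iota> y \<otimes> zz) \<in> At"
proof -
  note At = D.star_subalgD[OF At_star]
  have "proj_right A S \<subseteq> {x \<in> A.alg. D.star zz \<otimes> (\<iota> x \<otimes> zz) \<in> At}"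
    unfolding proj_right_def
  proof (rule A.cstar_generated_minimal[OF _ star_hom_vimage[OF A.cstar_algebra_axioms D.faithful_prob_axioms conj_star_hom At_sub]])
    have "A.star x \<otimes>\<^bsub>A\<^esub> y \<in> A.alg \<and> D.star zz \<otimes> (\<iota> (A.star x \<otimes>\<^bsub>A\<^esub> y) \<otimes> zz) \<in> At" if "x \<in> S" "y \<in> S" for x y
    proof -
      have c: "x \<in> A.alg" "y \<in> A.alg" using S that by auto
      note i = \<iota>_simps(1)[OF c(1)] \<iota>_simps(1)[OF c(2)]
      have "D.star (\<iota> x \<otimes> zz) \<otimes> (\<iota> y \<otimes> zz) = D.star zz \<otimes> (\<iota> (A.star x \<otimes>\<^bsub>A\<^esub> y) \<otimes> zz)"
        using i c zz(1) by (simp add: D.adj_mult D.m_assoc \<iota>_simps)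
      thus ?thesis using At(4)[OF At(6)[OF X_At[OF that(1)]] X_At[OF that(2)]] c by simp
    qed
    thus "{A.star x \<otimes>\<^bsub>A\<^esub> y |x y. x \<in> S \<and> y \<in> S} \<subseteq> {x \<in> A.alg. D.star zz \<otimes> (\<iota> x \<otimes> zz) \<in> At}"
      by blast
  qed
  thus ?thesis using assms by blast
qed

lemma At_dense: assumes x: "x \<in> At" and e: "e > 0" shows "\<exists>y\<in>At \<inter> L.D0. D.nn (x \<ominus> y) < e"
proof -
  have "X \<subseteq> L.D0"
  proof
    fix x assume "x \<in> X"
    then obtain y where y: "y \<in> S" "x = \<iota> y \<otimes> zz" by (auto simp: X_def)
    have "\<iota> y \<in> BB False" using y S by (auto simp: BB_def)
    thus "x \<in> L.D0" unfolding y(2) by (intro D.star_subalgD(4)[OF L.D0_star_subalg] L.B_D0[OF L.zB] L.B_D0)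
  qed
  hence 1: "D.salg X \<subseteq> L.D0" by (rule D.salg_minimal[OF _ L.D0_star_subalg])
  have "X \<subseteq> At" unfolding At_gen by (rule D.cstar_generated_inc)
  hence 2: "D.salg X \<subseteq> At" by (rule D.salg_minimal[OF _ At_star])
  have "x \<in> D.nclosure (D.salg X)" using x unfolding At_gen D.cstar_generated_nclosure[OF X_carrier] .
  then obtain y where "y \<in> D.salg X" "D.nn (x \<ominus> y) < e" using e by (auto simp: D.nclosure_def)
  thus ?thesis using 1 2 by blast
qed

text \<open>With \<open>E\<close> the whole free product this is selflessness of the inclusion; with
  \<open>E\<close> the complexification it is selflessness of the complexification itself. The
  ultrapower is formed over \<open>E\<close>, and the averages belong to the complexification in
  either case.\<close>

theorem complexification_selfless:
  assumes E: "cstar_subalgebra D E" and AtE: "At \<subseteq> E" and f: "cstar_prob_space (D\<lparr>carrier := E\<rparr>)"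
    and d: "\<And>x e. x \<in> E \<Longrightarrow> e > 0 \<Longrightarrow> \<exists>y\<in>E \<inter> L.D0. D.nn (x \<ominus> y) < e"
  shows "selfless_inclusion (D\<lparr>carrier := E\<rparr>) At"
proof -
  have pl: "A.star_subalg (proj_left A S)"
  proof -
    have "{x \<otimes>\<^bsub>A\<^esub> A.star y |x y. x \<in> S \<and> y \<in> S} \<subseteq> A.alg" using S by (auto intro!: A.m_closed A.adj_closed)
    from A.cstar_generated_subalgebra[OF this] show ?thesis by (simp add: proj_left_def A.cstar_subalgebra_iff)
  qed
  \<comment> \<open>Taken from the algebra generated by products \<open>x y*\<close>,
    \<open>h\<close> is carried by \<open>\<iota>\<close> into the complexification without
    conjugation.\<close>
  obtain h where h: "h \<in> proj_left A S" "A.star h = h" "A.st h = 0" "A.st (h \<otimes>\<^bsub>A\<^esub> h) = 1"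
    using A.self_adjoint_of_unitary[OF bu b(4) pl b(2)] by blast
  have hc: "h \<in> A.alg" using A.star_subalgD(1)[OF pl h(1)] .
  interpret M: semicircular_words D BB "\<iota> a" "\<iota> b" "\<iota> c" zz "\<iota> h"
  proof
    show "\<iota> h \<in> BB False" using hc by (simp add: BB_def)
    show "D.star (\<iota> h) = \<iota> h" unfolding \<iota>_simps(6)[OF hc, symmetric] h(2) ..
    show "D.st (\<iota> h) = 0" using \<iota>_st[OF hc] h(3) by simp
    show "D.st (\<iota> h \<otimes> \<iota> h) = 1"
      unfolding \<iota>_simps(2)[OF hc hc, symmetric] \<iota>_st[OF A.m_closed[OF hc hc]] by (rule h(4))
  qed (rule D0_dense)
  have ss: "M.ss n \<in> At" for n
    by (rule M.ss_mem[OF At_star proj_left_At[OF b(2)] proj_left_At[OF c(2)] proj_right_At[OF a(2)] proj_left_At[OF h(1)]])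
  obtain \<omega> :: "'d ultra_index filter" where \<omega>: "free_ultrafilter \<omega>" "filterlim snd at_top \<omega>"
    by (rule ultra_index_filter)
  let ?E = "D\<lparr>carrier := E\<rparr>"
  interpret N: semicircular_model ?E M.OP "E \<inter> L.D0" M.R.Lop M.ss M.ell \<omega> snd "M.hb + 4"
  proof (rule M.model[OF E f])
    show "M.ss n \<in> E" for n using ss[of n] AtE by (rule subsetD[rotated])
    show "\<exists>y\<in>E \<inter> L.D0. D.nn (x \<ominus> y) < e" if "x \<in> E" "e > 0" for x e using d[OF that] .
  qed (rule \<omega>)+
  have Es: "D.star_subalg E" "D.nclosed E" using E by (simp_all add: D.cstar_subalgebra_iff)
  have sub: "cstar_subalgebra ?E At" using D.subalg_subalgebra_iff[OF Es] AtE At_sub by simp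
  obtain C P :: "'d ultra_elem cstar_prob" and \<iota>' \<kappa>' \<sigma> where
    "cstar_prob_space C" "carrier C \<noteq> range (\<lambda>c. cscale C c \<one>\<^bsub>C\<^esub>)" "reduced_free_product P ?E C \<iota>' \<kappa>'"
    "\<sigma> \<in> cps_embedding P (ultrapower ?E \<omega>)" "\<forall>x\<in>carrier ?E. \<sigma> (\<iota>' x) = ultra_diag ?E \<omega> x"
    "\<sigma> ` cstar_generated P (\<iota>' ` At \<union> \<kappa>' ` carrier C) \<subseteq> ultra_sub ?E \<omega> At"
    using N.selfless_data[OF sub ss] by (elim exE conjE) (rule that)
  with f sub \<omega>(1) show ?thesis
    unfolding selfless_inclusion_def
    by (intro conjI exI[of _ \<omega>] exI[of _ C] exI[of _ P] exI[of _ \<iota>'] exI[of _ \<kappa>'] exI[of _ \<sigma>])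
qed

theorem complexification_cases:
  "selfless_inclusion D At" "gns_faithful (D\<lparr>carrier := At\<rparr>) \<Longrightarrow> selfless (D\<lparr>carrier := At\<rparr>)"
proof -
  have D: "D\<lparr>carrier := carrier D\<rparr> = D" by simp
  have ps: "cstar_prob_space D" unfolding cstar_prob_space_iff by unfold_locales
  have Atc: "At \<subseteq> carrier D" using D.star_subalgD(1)[OF At_star] by blast
  have "selfless_inclusion (D\<lparr>carrier := carrier D\<rparr>) At"
  proof (rule complexification_selfless[OF D.cstar_subalgebra_carrier Atc])
    show "cstar_prob_space (D\<lparr>carrier := carrier D\<rparr>)" unfolding D by (rule ps)
    show "\<exists>y\<in>carrier D \<inter> L.D0. D.nn (x \<ominus> y) < e" if "x \<in> carrier D" "e > 0" for x e
      using D0_dense[OF that] L.Sp_closed by blast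
  qed
  thus "selfless_inclusion D At" unfolding D .
  assume g: "gns_faithful (D\<lparr>carrier := At\<rparr>)"
  interpret T: pre_prob "D\<lparr>carrier := At\<rparr>" by (rule D.subalg_pre_prob(1)[OF At_star])
  have f: "cstar_prob_space (D\<lparr>carrier := At\<rparr>)"
    unfolding cstar_prob_space_def using D.subalg_cstar_algebra[OF D.cstar_algebra_axioms At_sub] T.state_is_state g by blast
  have "selfless_inclusion (D\<lparr>carrier := At\<rparr>) At"
    by (rule complexification_selfless[OF At_sub order_refl f At_dense])
  thus "selfless (D\<lparr>carrier := At\<rparr>)" by (simp add: selfless_def)
qed

end

theorem theorem4p1:
  fixes A :: "'a cstar_prob" and S :: "'a set" and a b c :: 'a
    and D :: "'d cstar_prob" and \<iota> :: "'a \<Rightarrow> 'd" and \<kappa> :: "(complex \<Rightarrow> complex) \<Rightarrow> 'd"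
  assumes "cstar_prob_space A"
    and "S \<subseteq> carrier A" and "cstar_generated A S = carrier A"
    and "a \<in> unitaries A" and "a \<in> proj_right A S" and "a \<in> centralizer A"
    and "b \<in> unitaries A" and "b \<in> proj_left A S" and "b \<in> centralizer A"
    and "c \<in> unitaries A" and "c \<in> proj_left A S" and "c \<in> centralizer A"
    and "state A a = 0" and "state A b = 0" and "state A c = 0"
    and "state A (inv\<^bsub>A\<^esub> c \<otimes>\<^bsub>A\<^esub> a) = 0" and "state A (inv\<^bsub>A\<^esub> c \<otimes>\<^bsub>A\<^esub> b) = 0"
    and "reduced_free_product D A circle_space \<iota> \<kappa>"
  shows "let Acompl = free_complexification D \<iota> \<kappa> S in
           selfless_inclusion D Acompl \<and>
           (gns_faithful (D\<lparr>carrier := Acompl\<rparr>) \<longrightarrow> selfless (D\<lparr>carrier := Acompl\<rparr>))"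
proof -
  have "faithful_prob A" using assms(1) by (simp add: cstar_prob_space_iff)
  moreover have "faithful_prob D" using assms(18) by (simp add: reduced_free_product_def cstar_prob_space_iff)
  ultimately interpret complexification A D S a b c \<iota> \<kappa>
    using assms by (intro complexification.intro complexification_axioms.intro)
  show ?thesis using complexification_cases unfolding Let_def At_def by blast
qed

end
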